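(* Let $k$ be an algebraically closed field of characteristic zero, $n$ a positive integer with $4\mid n$, $q\in k$ a primitive $n^2$-th root of unity, and $A=\mathrm{Qu}_q(\mathfrak{sl}_2)$, with the left $A$-modules $P_{2i,j},S_{2i,j}$ defined in the context. For $1\le i_1,i_2\le\frac{n^2}{2}$ and $0\le j_1,j_2\le1$ we have: (a) If $2i_1-1\ge n^2-2i_2+1$ and $i_1\le i_2$, then $$S_{2i_1,j_1}\otimes S_{2i_2,j_2}\cong\bigoplus_{l=0}^{n^2-2i_2}S_{n^2+2i_1-2i_2-2l,\overline{j_1+j_2+l}}.$$ (b) If $2i_1-1\ge n^2-2i_2+1$ and $i_1>i_2$, then $$S_{2i_1,j_1}\otimes S_{2i_2,j_2}\cong\bigoplus_{l=0}^{n^2-2i_1}S_{n^2-2i_1+2i_2-2l,\overline{j_1+j_2+l}}.$$ (c) If $2i_1-1<n^2-2i_2+1$ and $i_1\le i_2$, then $$S_{2i_1,j_1}\otimes S_{2i_2,j_2}\cong\bigoplus_{l=0}^{2i_1-2}S_{n^2+2i_1-2i_2-2l,\overline{j_1+j_2+l}}\oplus\bigoplus_{l=0}^{\frac{n^2}{2}-i_1-i_2}P_{n^2-2i_1-2i_2+2-2l,\overline{j_1+j_2+l-1}}.$$ (d) If $2i_1-1<n^2-2i_2+1$ and $i_1>i_2$, then $$S_{2i_1,j_1}\otimes S_{2i_2,j_2}\cong\bigoplus_{l=0}^{2i_2-2}S_{n^2-2i_1+2i_2-2l,\overline{j_1+j_2+l}}\oplus\bigoplus_{l=0}^{\frac{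n^2}{2}-i_1-i_2}P_{n^2-2i_1-2i_2+2-2l,\overline{j_1+j_2+l-1}}.$$
   Context: Here $\overline r\in\{0,1\}$ denotes the least non-negative residue of the integer $r$ modulo $2$. Let $\mathfrak q:=q^n$. The associative unital $k$-algebra $A=\mathrm{Qu}_q(\mathfrak{sl}_2)$ is generated by $\kappa,\hat\kappa,E,F$ with relations $\kappa^n=1$, $\hat\kappa^n=\kappa^{-2}$, $\kappa\hat\kappa=\hat\kappa\kappa$, $\kappa E\kappa^{-1}=\mathfrak qE$, $\kappa F\kappa^{-1}=\mathfrak q^{-1}F$, $\hat\kappa E\hat\kappa^{-1}=\mathfrak q q^{-2}E$, $\hat\kappa F\hat\kappa^{-1}=\mathfrak q^{-1}q^2F$, $E^{n^2}=F^{n^2}=0$, $FE-q^{-1}EF=1-\kappa^{-1}\hat\kappa$. Put $1_i=\frac1n\sum_{r=0}^{n-1}(\mathfrak q^{n-i})^r\kappa^r$ and $\flat=\sum_{i=0}^{n-1}q^{-i}1_i$. $A$ is a quasi-Hopf algebra with reassociator $\sum_{i,j,r=0}^{n-1}\mathfrak q^{-i[\frac{j+r}{n}]}1_i\otimes1_j\otimes1_r$ ($[\cdot]$ the integer part), comultiplication $\Delta(\kappa)=\kappa\otimes\kappa$, $\Delta(\hat\kappa)=\hat\kappa\otimes\hat\kappa$, $\Delta(E)=E\otimes\flat^{-1}+\kappa^{-1}\otimes1_0E+1\otimes\sum_{i=1}^{n-1}1_iE$, $\Delta(F)=F\otimes\flat+\kappa^{-1}\hat\kappa\otimes F\sum_{i=1}^{n-1}1_i+\hat\kappa\otimes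 F1_0$, and counit $\varepsilon(\kappa)=\varepsilon(\hat\kappa)=1$, $\varepsilon(E)=\varepsilon(F)=0$. For left $A$-modules $M,N$, the module $M\otimes N$ is $M\otimes_kN$ with $A$ acting through $\Delta$. Let $\mathbf u^0$ be the subalgebra generated by $\kappa,\hat\kappa$; one has $A=\bigoplus_{0\le a,b\le n^2-1}F^a\mathbf u^0E^b$. With $m=n/2$, put $\varphi_{2i}=\frac{1}{mn}\sum_{r=0}^{mn-1}q^{-2ir}(\kappa^{-1}\hat\kappa)^r$, $\mathbf 1_0=\frac12(1+\kappa\hat\kappa^{n/2})$, $\mathbf 1_1=\frac12(1-\kappa\hat\kappa^{n/2})$ (boldface, distinct from the $1_i$ above), $e_{2i,j}=\varphi_{2i}\mathbf 1_j$. For $1\le i\le\frac{n^2}{2}$, $j\in\{0,1\}$, put $\alpha_{2i,j}=F^{n^2-1}e_{2i,j}$, $\beta_{2i,j}=E^{2i-2}\alpha_{2i,j}$, $\widetilde\alpha_{2i,j}=E^{2i-1}\alpha_{2i,j}$, and let $\gamma_{2i,j}$ be the unique element of $\bigoplus_{0\le a\le n^2-2,\ 0\le b\le n^2-1}F^a\mathbf u^0E^b$ with $F\gamma_{2i,j}=\beta_{2i,j}$. Define $P_{2i,j}:=A\gamma_{2i,j}$ and $S_{2i,j}:=\mathrm{Soc}(P_{2i,j})$ (spanned by $E^l\widetilde\alpha_{2i,j}$, $0\le l\le n^2-2i$). *)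

theory Defs
  imports
    "HOL-Algebra.Algebra"
    "HOL-Algebra.Algebraic_Closure_Type"
    "HOL-Library.Poly_Mapping"
    "HOL-Library.Product_Plus"
    "HOL-Library.FuncSet"
begin

section \<open>Left modules over a not necessarily commutative ring\<close>

text \<open>
  Left modules are carried by the record \<^type>\<open>module\<close> of HOL-Algebra. Its fields \<open>mult\<close> and
  \<open>one\<close> play no role for modules. The library locales \<^locale>\<open>submodule\<close> and \<^locale>\<open>ideal\<close> do
  not assume commutativity of the ring (ideals are two-sided).
\<close>

definition left_regular :: "('a, 'c) ring_scheme \<Rightarrow> ('a, 'a) module" where
  "left_regular R = \<lparr>carrier = carrier R, monoid.mult = monoid.mult R, one = one R,
     ring.zero = ring.zero R, ring.add = ring.add R, module.smult = monoid.mult R\<rparr>"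

definition submodule_gen ::
  "('a, 'c) ring_scheme \<Rightarrow> ('a, 'm, 'd) module_scheme \<Rightarrow> 'm set \<Rightarrow> 'm set" where
  "submodule_gen R M B = \<Inter>{H. submodule H R M \<and> B \<subseteq> H}"

definition simple_submodule ::
  "'m set \<Rightarrow> ('a, 'c) ring_scheme \<Rightarrow> ('a, 'm, 'd) module_scheme \<Rightarrow> bool" where
  "simple_submodule N R M \<longleftrightarrow> submodule N R M \<and> N \<noteq> {\<zero>\<^bsub>M\<^esub>} \<and>
     (\<forall>L. submodule L R M \<and> L \<subseteq> N \<longrightarrow> L = {\<zero>\<^bsub>M\<^esub>} \<or> L = N)"

text \<open>The socle, i.e. the sum of all simple submodules.\<close>

definition Soc :: "('a, 'c) ring_scheme \<Rightarrow> ('a, 'm, 'd) module_scheme \<Rightarrow> 'm set" where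
  "Soc R M = submodule_gen R M (\<Union>{N. simple_submodule N R M})"

definition lmod_iso ::
  "('a, 'c) ring_scheme \<Rightarrow> ('a, 'm, 'd) module_scheme \<Rightarrow> ('a, 'p, 'e) module_scheme \<Rightarrow> bool" where
  "lmod_iso R M N \<longleftrightarrow> (\<exists>f \<in> iso (add_monoid M) (add_monoid N).
     \<forall>a \<in> carrier R. \<forall>x \<in> carrier M. f (a \<odot>\<^bsub>M\<^esub> x) = a \<odot>\<^bsub>N\<^esub> f x)"

definition dir_sum :: "'i set \<Rightarrow> ('i \<Rightarrow> ('a, 'm) module) \<Rightarrow> ('a, 'i \<Rightarrow> 'm) module" where
  "dir_sum I M = \<lparr>
     carrier = {f \<in> \<Pi>\<^sub>E i\<in>I. carrier (M i). finite {i \<in> I. f i \<noteq> \<zero>\<^bsub>M i\<^esub>}},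
     monoid.mult = undefined, one = undefined,
     ring.zero = (\<lambda>i\<in>I. \<zero>\<^bsub>M i\<^esub>),
     ring.add = (\<lambda>f g. \<lambda>i\<in>I. f i \<oplus>\<^bsub>M i\<^esub> g i),
     module.smult = (\<lambda>a f. \<lambda>i\<in>I. a \<odot>\<^bsub>M i\<^esub> f i)\<rparr>"

definition dir_sum2 :: "('a, 'm) module \<Rightarrow> ('a, 'p) module \<Rightarrow> ('a, 'm \<times> 'p) module" where
  "dir_sum2 M N = \<lparr>
     carrier = carrier M \<times> carrier N,
     monoid.mult = undefined, one = undefined,
     ring.zero = (\<zero>\<^bsub>M\<^esub>, \<zero>\<^bsub>N\<^esub>),
     ring.add = (\<lambda>(x, y) (x', y'). (x \<oplus>\<^bsub>M\<^esub> x', y \<oplus>\<^bsub>N\<^esub> y')),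
     module.smult = (\<lambda>a (x, y). (a \<odot>\<^bsub>M\<^esub> x, a \<odot>\<^bsub>N\<^esub> y))\<rparr>"


section \<open>The free algebra on four generators and its tensor square\<close>

datatype letter = L_kap | L_hat | L_E | L_F

datatype word = Word (letters: "letter list")

instantiation word :: monoid_add
begin

definition zero_word :: word where "0 = Word []"

definition plus_word :: "word \<Rightarrow> word \<Rightarrow> word" where "u + v = Word (letters u @ letters v)"

instance
  by standard (auto simp: zero_word_def plus_word_def)

end

text \<open>
  The monoid algebra of words is the free algebra. The monoid algebra of pairs of words, with
  componentwise concatenation, is the tensor square of the free algebra over the ground field,
  the pair of words \<open>(u, v)\<close> standing for the pure tensor of \<open>u\<close> and \<open>v\<close>.
\<close>

type_synonym 'k falg = "word \<Rightarrow>\<^sub>0 'k"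
type_synonym 'k falg2 = "(word \<times> word) \<Rightarrow>\<^sub>0 'k"

definition const :: "'k \<Rightarrow> ('w::monoid_add \<Rightarrow>\<^sub>0 'k::field)" where
  "const c = Poly_Mapping.single 0 c"

definition gen :: "letter \<Rightarrow> 'k::field falg" where
  "gen g = Poly_Mapping.single (Word [g]) 1"

definition tens :: "'k falg \<Rightarrow> 'k falg \<Rightarrow> 'k::field falg2" (infixl \<open>\<otimes>\<^sub>k\<close> 72) where
  "x \<otimes>\<^sub>k y = (\<Sum>u\<in>Poly_Mapping.keys x. \<Sum>v\<in>Poly_Mapping.keys y.
     Poly_Mapping.single (u, v) (Poly_Mapping.lookup x u * Poly_Mapping.lookup y v))"

abbreviation kap :: "'k::field falg" where "kap \<equiv> gen L_kap"
abbreviation hat :: "'k::field falg" where "hat \<equiv> gen L_hat"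
abbreviation gE :: "'k::field falg" where "gE \<equiv> gen L_E"
abbreviation gF :: "'k::field falg" where "gF \<equiv> gen L_F"

text \<open>
  Elements of the algebra are written through representatives in the free algebra. The relations
  \<open>kap ^ n = 1\<close> and \<open>hat ^ n = kap ^ -2\<close> give the following representatives of the inverses of the
  first two generators.
\<close>

definition kap_inv :: "nat \<Rightarrow> 'k::field falg" where
  "kap_inv n = kap ^ (n - 1)"

definition hat_inv :: "nat \<Rightarrow> 'k::field falg" where
  "hat_inv n = hat ^ (n - 1) * kap ^ 2"


section \<open>The quasi-Hopf algebra\<close>

text \<open>Below \<open>q ^ n\<close> is the scalar written as a Fraktur q in the literature.\<close>

definition Qu_rels :: "nat \<Rightarrow> 'k::field \<Rightarrow> 'k falg set" where
  "Qu_rels n q = {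
     kap ^ n - 1,
     hat ^ n - kap_inv n ^ 2,
     kap * hat - hat * kap,
     kap * gE * kap_inv n - const (q ^ n) * gE,
     kap * gF * kap_inv n - const (inverse (q ^ n)) * gF,
     hat * gE * hat_inv n - const (q ^ n * inverse (q ^ 2)) * gE,
     hat * gF * hat_inv n - const (inverse (q ^ n) * q ^ 2) * gF,
     gE ^ (n ^ 2),
     gF ^ (n ^ 2),
     gF * gE - const (inverse q) * gE * gF - (1 - kap_inv n * hat)}"

definition Qu_ideal :: "nat \<Rightarrow> 'k::field \<Rightarrow> 'k falg set" where
  "Qu_ideal n q = Idl\<^bsub>ring_of_type_algebra\<^esub> (Qu_rels n q)"

definition Qu :: "nat \<Rightarrow> 'k::field \<Rightarrow> 'k falg set ring" where
  "Qu n q = ring_of_type_algebra Quot Qu_ideal n q"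

definition Qu_cls :: "nat \<Rightarrow> 'k::field \<Rightarrow> 'k falg \<Rightarrow> 'k falg set" where
  "Qu_cls n q x = Qu_ideal n q +>\<^bsub>ring_of_type_algebra\<^esub> x"

text \<open>The tensor square of \<^const>\<open>Qu\<close>, as a quotient of the tensor square of the free algebra.\<close>

definition Qu2_ideal :: "nat \<Rightarrow> 'k::field \<Rightarrow> 'k falg2 set" where
  "Qu2_ideal n q = Idl\<^bsub>ring_of_type_algebra\<^esub>
     ((\<lambda>x. x \<otimes>\<^sub>k 1) ` Qu_ideal n q \<union> (\<lambda>x. 1 \<otimes>\<^sub>k x) ` Qu_ideal n q)"

definition Qu2 :: "nat \<Rightarrow> 'k::field \<Rightarrow> 'k falg2 set ring" where
  "Qu2 n q = ring_of_type_algebra Quot Qu2_ideal n q"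

definition idem1 :: "nat \<Rightarrow> 'k::field \<Rightarrow> nat \<Rightarrow> 'k falg" where
  "idem1 n q i = const (1 / of_nat n) * (\<Sum>r = 0..n - 1. const (((q ^ n) ^ (n - i)) ^ r) * kap ^ r)"

definition flat :: "nat \<Rightarrow> 'k::field \<Rightarrow> 'k falg" where
  "flat n q = (\<Sum>i = 0..n - 1. const (inverse (q ^ i)) * idem1 n q i)"

text \<open>
  The classes of the elements \<^const>\<open>idem1\<close> in \<^const>\<open>Qu\<close> are orthogonal idempotents with sum 1, so
  the following represents the inverse of the class of \<^const>\<open>flat\<close>; see \<open>Qu_flat_inv\<close> below.
\<close>

definition flat_inv :: "nat \<Rightarrow> 'k::field \<Rightarrow> 'k falg" where
  "flat_inv n q = (\<Sum>i = 0..n - 1. const (q ^ i) * idem1 n q i)"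

lemma ring_ring_of_type_algebra: "ring (ring_of_type_algebra :: 'a::ring_1 ring)"
proof -
  have "\<exists>y. x + y = 0" for x :: 'a
    using add.right_inverse by blast
  then show ?thesis
    unfolding ring_of_type_algebra_def
    by unfold_locales (auto simp: algebra_simps Units_def)
qed

lemma const_simps:
  "const (a * b) = const a * const b" "const 1 = 1" "const 0 = 0"
  "const (a + b) = const a + const b"
  by (simp_all add: const_def mult_single single_add)

lemma const_sum: "const (sum f S) = (\<Sum>i\<in>S. const (f i))"
  by (induction S rule: infinite_finite_induct) (simp_all add: const_simps)

lemma const_kap_pow: "kap ^ r * const c = const c * kap ^ r"
proof -
  have "kap * const c = const c * kap"
    by (simp add: const_def gen_def mult_single)
  then show ?thesis by (metis power_commuting_commutes)
qed

lemma ideal_Qu_ideal: "ideal (Qu_ideal n q) ring_of_type_algebra"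
  unfolding Qu_ideal_def by (intro ring.genideal_ideal ring_ring_of_type_algebra)
     (simp add: ring_of_type_algebra_def)

lemma Qu_rels_subset: "Qu_rels n q \<subseteq> Qu_ideal n q"
  unfolding Qu_ideal_def genideal_def by blast

lemma Qu_ideal_closed:
  "0 \<in> Qu_ideal n q"
  "x \<in> Qu_ideal n q \<Longrightarrow> y \<in> Qu_ideal n q \<Longrightarrow> x + y \<in> Qu_ideal n q"
  "x \<in> Qu_ideal n q \<Longrightarrow> y * x \<in> Qu_ideal n q"
  "x \<in> Qu_ideal n q \<Longrightarrow> x * y \<in> Qu_ideal n q"
proof -
  interpret ideal "Qu_ideal n q" ring_of_type_algebra by (rule ideal_Qu_ideal)
  show "0 \<in> Qu_ideal n q"
    using additive_subgroup.zero_closed[OF is_additive_subgroup]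
    by (simp add: ring_of_type_algebra_def)
  show "x + y \<in> Qu_ideal n q" if "x \<in> Qu_ideal n q" "y \<in> Qu_ideal n q"
    using additive_subgroup.a_closed[OF is_additive_subgroup that]
    by (simp add: ring_of_type_algebra_def)
  show "y * x \<in> Qu_ideal n q" "x * y \<in> Qu_ideal n q" if "x \<in> Qu_ideal n q"
    using I_l_closed[OF that, of y] I_r_closed[OF that, of y]
    by (simp_all add: ring_of_type_algebra_def)
qed

lemma Qu_cls_hom: "Qu_cls n q (x * y) = Qu_cls n q x \<otimes>\<^bsub>Qu n q\<^esub> Qu_cls n q y"
  using ring_hom_mult[OF ideal.rcos_ring_hom[OF ideal_Qu_ideal], of x y n q]
  by (simp add: Qu_cls_def Qu_def ring_of_type_algebra_def)

lemma Qu_cls_1: "Qu_cls n q 1 = \<one>\<^bsub>Qu n q\<^esub>"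
  by (simp add: Qu_cls_def Qu_def ring_of_type_algebra_def FactRing_def)

lemma Qu_cls_eqI: "Qu_cls n q x = Qu_cls n q y" if "x - y \<in> Qu_ideal n q"
proof -
  interpret ring "ring_of_type_algebra :: 'a falg ring" by (rule ring_ring_of_type_algebra)
  have "\<ominus>\<^bsub>ring_of_type_algebra\<^esub> y = - y"
    by (rule minus_equality) (simp_all add: ring_of_type_algebra_def)
  then have "x \<ominus>\<^bsub>ring_of_type_algebra\<^esub> y = x - y"
    by (simp add: a_minus_def) (simp add: ring_of_type_algebra_def)
  then show ?thesis
    using quotient_eq_iff_same_a_r_cos[OF ideal_Qu_ideal, of x y n q] that
    by (simp add: Qu_cls_def) (simp add: ring_of_type_algebra_def)
qed

text \<open>\<^const>\<open>kap_inv\<close>, \<^const>\<open>hat_inv\<close> and \<^const>\<open>flat_inv\<close> represent inverses.\<close>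

lemma Qu_kap_inv:
  assumes "n > 0"
  shows "Qu_cls n q kap \<otimes>\<^bsub>Qu n q\<^esub> Qu_cls n q (kap_inv n) = \<one>\<^bsub>Qu n q\<^esub>"
    and "Qu_cls n q (kap_inv n) \<otimes>\<^bsub>Qu n q\<^esub> Qu_cls n q kap = \<one>\<^bsub>Qu n q\<^esub>"
proof -
  have *: "kap ^ n - 1 \<in> Qu_ideal n q"
    using Qu_rels_subset[of n q] by (auto simp: Qu_rels_def)
  have "kap * kap_inv n = (kap ^ n :: 'a falg)" "kap_inv n * kap = (kap ^ n :: 'a falg)"
    using assms by (cases n; simp add: kap_inv_def power_commutes)+
  then show "Qu_cls n q kap \<otimes>\<^bsub>Qu n q\<^esub> Qu_cls n q (kap_inv n) = \<one>\<^bsub>Qu n q\<^esub>"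
    "Qu_cls n q (kap_inv n) \<otimes>\<^bsub>Qu n q\<^esub> Qu_cls n q kap = \<one>\<^bsub>Qu n q\<^esub>"
    using Qu_cls_eqI[OF *] by (simp_all flip: Qu_cls_hom add: Qu_cls_1)
qed

lemma Qu_hat_inv:
  assumes "n > 0"
  shows "Qu_cls n q hat \<otimes>\<^bsub>Qu n q\<^esub> Qu_cls n q (hat_inv n) = \<one>\<^bsub>Qu n q\<^esub>"
    and "Qu_cls n q (hat_inv n) \<otimes>\<^bsub>Qu n q\<^esub> Qu_cls n q hat = \<one>\<^bsub>Qu n q\<^esub>"
proof -
  let ?I = "Qu_ideal n q"
  interpret A: ring "Qu n q"
    unfolding Qu_def by (rule ideal.quotient_is_ring[OF ideal_Qu_ideal])
  have carr: "Qu_cls n q x \<in> carrier (Qu n q)" for x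
    using ring_hom_closed[OF ideal.rcos_ring_hom[OF ideal_Qu_ideal], of x n q]
    by (simp add: Qu_cls_def Qu_def ring_of_type_algebra_def)
  have k: "Qu_cls n q (kap ^ n) = Qu_cls n q 1"
    and h: "Qu_cls n q (hat ^ n) = Qu_cls n q (kap_inv n ^ 2)"
    and c: "Qu_cls n q (kap * hat) = Qu_cls n q (hat * kap)"
    by (rule Qu_cls_eqI, rule subsetD[OF Qu_rels_subset], simp add: Qu_rels_def)+
  have i2: "Qu_cls n q (kap_inv n ^ 2 * kap ^ 2) = \<one>\<^bsub>Qu n q\<^esub>"
  proof -
    have "(n - 1) * 2 + 2 = n + n"
      using assms by simp
    then have "kap_inv n ^ 2 * kap ^ 2 = (kap ^ n * kap ^ n :: 'a falg)"
      unfolding kap_inv_def power_add[symmetric] power_mult[symmetric] by simp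
    then show ?thesis by (simp add: Qu_cls_hom k Qu_cls_1)
  qed
  have "hat * hat_inv n = (hat ^ n * kap ^ 2 :: 'a falg)"
    using assms by (cases n) (simp_all add: hat_inv_def mult.assoc)
  then show r: "Qu_cls n q hat \<otimes>\<^bsub>Qu n q\<^esub> Qu_cls n q (hat_inv n) = \<one>\<^bsub>Qu n q\<^esub>"
    using i2 by (simp flip: Qu_cls_hom) (simp add: Qu_cls_hom h)
  have "hat_inv n * hat = (hat ^ (n - 1) * (kap * (kap * hat)) :: 'a falg)"
    by (simp add: hat_inv_def power2_eq_square mult.assoc)
  then have "Qu_cls n q (hat_inv n * hat) = Qu_cls n q (hat ^ (n - 1) * (kap * (hat * kap)))"
    by (simp add: Qu_cls_hom c[unfolded Qu_cls_hom])
  also have "\<dots> = Qu_cls n q (hat ^ (n - 1) * (kap * hat * kap))"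
    by (simp add: mult.assoc)
  also have "\<dots> = Qu_cls n q (hat ^ (n - 1) * (hat * kap * kap))"
    by (simp add: Qu_cls_hom c[unfolded Qu_cls_hom])
  also have "hat ^ (n - 1) * (hat * kap * kap) = (hat ^ n * kap ^ 2 :: 'a falg)"
    using assms by (cases n) (simp_all add: power2_eq_square power_commutes flip: mult.assoc)
  finally show "Qu_cls n q (hat_inv n) \<otimes>\<^bsub>Qu n q\<^esub> Qu_cls n q hat = \<one>\<^bsub>Qu n q\<^esub>"
    using i2 by (simp flip: Qu_cls_hom) (simp add: Qu_cls_hom h)
qed

lemma Qu_flat_inv:
  fixes q :: "'k :: {field, ring_char_0}"
  assumes n: "n > 0" and q: "q ^ (n ^ 2) = 1" "\<And>d. 0 < d \<Longrightarrow> d < n ^ 2 \<Longrightarrow> q ^ d \<noteq> 1"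
  shows "Qu_cls n q (flat n q) \<otimes>\<^bsub>Qu n q\<^esub> Qu_cls n q (flat_inv n q) = \<one>\<^bsub>Qu n q\<^esub>"
    and "Qu_cls n q (flat_inv n q) \<otimes>\<^bsub>Qu n q\<^esub> Qu_cls n q (flat n q) = \<one>\<^bsub>Qu n q\<^esub>"
proof -
  define Q where "Q = q ^ n"
  define T where "T = idem1 n q"
  define R where "R x y \<longleftrightarrow> x - y \<in> Qu_ideal n q" for x y
  have R_refl: "R x x" for x
    by (simp add: R_def Qu_ideal_closed)
  have R_trans [trans]: "R x z" if "R x y" "R y z" for x y z
    using Qu_ideal_closed(2)[of "x - y" n q "y - z"] that by (simp add: R_def)
  have R_add: "R (x + x') (y + y')" if "R x y" "R x' y'" for x x' y y'
    using Qu_ideal_closed(2)[of "x - y" n q "x' - y'"] that by (simp add: R_def algebra_simps)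
  have R_mult: "R (z * x) (z * y)" if "R x y" for x y z
    using Qu_ideal_closed(3)[of "x - y" n q z] that by (simp add: R_def algebra_simps)
  have R_sum: "R (sum f I) (sum g I)" if "\<And>i. i \<in> I \<Longrightarrow> R (f i) (g i)"
    for f g :: "nat \<Rightarrow> 'k falg" and I
    using that by (induction I rule: infinite_finite_induct) (auto intro: R_refl R_add)
  have ivl: "{0..n - Suc 0} = {..<n}"
    using n by auto
  have Q1: "Q ^ n = 1"
    using q(1) by (simp add: Q_def power2_eq_square power_mult)
  have Qne: "Q ^ d \<noteq> 1" if "0 < d" "d < n" for d
    using q(2)[of "n * d"] that by (simp add: Q_def power2_eq_square flip: power_mult)
  have Q0: "Q \<noteq> 0" and q0: "q \<noteq> 0"
    using Q1 q(1) n by (auto simp: power_0_left)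
  have kc: "kap * (const c * y) = const c * (kap * y)" for c y
    using const_kap_pow[of 1 c] by (simp flip: mult.assoc)
  have T_def': "T i = const (1 / of_nat n) * (\<Sum>r<n. const ((Q ^ (n - i)) ^ r) * kap ^ r)" for i
    by (simp add: T_def idem1_def Q_def ivl)
  have kT: "R (kap * T i) (const (Q ^ i) * T i)" if "i < n" for i
  proof -
    define z where "z = Q ^ (n - i)"
    have z: "z ^ n = 1" "Q ^ i * z = 1"
      using that Q1 by (simp_all add: z_def flip: power_add power_mult)
        (simp add: mult.commute[of _ n] power_mult)
    define x :: "'k falg" where "x = const z * kap"
    have xr: "x ^ r = const (z ^ r) * kap ^ r" for r
    proof (induction r)
      case (Suc r)
      have "x ^ Suc r = const z * (kap * const (z ^ r)) * kap ^ r"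
        by (simp add: Suc) (simp add: x_def mult.assoc)
      also have "\<dots> = const (z ^ Suc r) * kap ^ Suc r"
        using const_kap_pow[of 1 "z ^ r"] by (simp add: const_simps mult.assoc)
      finally show ?case .
    qed (simp add: const_simps)
    have tel: "x * (\<Sum>r<m. x ^ r) - (\<Sum>r<m. x ^ r) = x ^ m - 1" for m
      by (induction m) (simp_all add: algebra_simps)
    have "x ^ n - 1 \<in> Qu_ideal n q"
      using Qu_rels_subset[of n q] by (simp add: xr z const_simps Qu_rels_def)
    then have *: "R (x * (\<Sum>r<n. x ^ r)) (\<Sum>r<n. x ^ r)"
      by (simp add: R_def tel)
    have T: "T i = const (1 / of_nat n) * (\<Sum>r<n. x ^ r)"
      by (simp add: T_def' xr z_def)
    have "kap * T i = const (Q ^ i * z) * (kap * const (1 / of_nat n)) * (\<Sum>r<n. x ^ r)"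
      by (simp add: z T const_simps mult.assoc)
    also have "\<dots> = const (Q ^ i) * const z * const (1 / of_nat n) * kap * (\<Sum>r<n. x ^ r)"
      by (simp add: const_simps mult.assoc kc)
    also have "const (Q ^ i) * const z * const (1 / of_nat n) =
        const (Q ^ i) * const (1 / of_nat n) * const z"
      by (simp flip: const_simps add: mult_ac)
    also have "\<dots> * kap * (\<Sum>r<n. x ^ r) =
        (const (Q ^ i) * const (1 / of_nat n)) * (x * (\<Sum>r<n. x ^ r))"
      by (simp add: x_def mult.assoc)
    finally show ?thesis
      using R_mult[OF *, of "const (Q ^ i) * const (1 / of_nat n)"] by (simp add: T mult.assoc)
  qed
  have kT_pow: "R (kap ^ r * T i) (const ((Q ^ i) ^ r) * T i)" if "i < n" for i r
  proof (induction r)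
    case 0
    show ?case by (simp add: const_simps R_refl)
  next
    case (Suc r)
    have "R (kap ^ Suc r * T i) (kap * (const ((Q ^ i) ^ r) * T i))"
      using R_mult[OF Suc, of kap] by (simp add: mult.assoc)
    also have "kap * (const ((Q ^ i) ^ r) * T i) = const ((Q ^ i) ^ r) * (kap * T i)"
      using const_kap_pow[of 1 "(Q ^ i) ^ r"] by (simp flip: mult.assoc)
    finally have "R (kap ^ Suc r * T i) (const ((Q ^ i) ^ r) * (const (Q ^ i) * T i))"
      using R_mult[OF kT[OF that], of "const ((Q ^ i) ^ r)"] by (blast intro: R_trans)
    then show ?case by (simp flip: const_simps mult.assoc add: mult_ac(2))
  qed
  have geom: "(\<Sum>r<n. w ^ r) = (if w = 1 then of_nat n else 0)" if "w ^ n = 1" for w :: 'k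
    using that by (simp add: geometric_sum)
  have TT: "R (T i * T j) (if i = j then T i else 0)" if ij: "i < n" "j < n" for i j
  proof -
    have "T i * T j = const (1 / of_nat n) * (\<Sum>r<n. const ((Q ^ (n - i)) ^ r) * (kap ^ r * T j))"
      by (simp add: T_def'[of i] mult.assoc sum_distrib_right)
    also have "R \<dots> (const (1 / of_nat n) *
        (\<Sum>r<n. const ((Q ^ (n - i)) ^ r) * (const ((Q ^ j) ^ r) * T j)))"
      by (intro R_mult R_sum kT_pow ij)
    also have "(\<Sum>r<n. const ((Q ^ (n - i)) ^ r) * (const ((Q ^ j) ^ r) * T j)) =
        const (\<Sum>r<n. (Q ^ (n - i) * Q ^ j) ^ r) * T j"
      by (simp add: const_sum sum_distrib_right power_mult_distrib const_simps mult.assoc)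
    also have "(\<Sum>r<n. (Q ^ (n - i) * Q ^ j) ^ r) = (if i = j then of_nat n else 0)"
    proof -
      have "(Q ^ (n - i) * Q ^ j) ^ n = 1"
        using Q1 by (simp add: power_mult_distrib flip: power_mult)
          (simp add: mult.commute[of _ n] power_mult)
      moreover have "Q ^ (n - i) * Q ^ j = 1 \<longleftrightarrow> i = j"
      proof (cases i j rule: linorder_cases)
        case less
        then have "Q ^ (n - i) * Q ^ j = Q ^ n * Q ^ (j - i)"
          using ij by (simp flip: power_add)
        then show ?thesis using less Qne[of "j - i"] ij Q1 by auto
      next
        case equal
        then show ?thesis using ij Q1 by (simp flip: power_add)
      next
        case greater
        then show ?thesis using ij Qne[of "n - i + j"] by (auto simp flip: power_add)
      qed
      ultimately show ?thesis by (simp add: geom)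
    qed
    finally show ?thesis
      using n by (auto simp: const_simps simp flip: mult.assoc const_simps(1) split: if_splits)
  qed
  have T_const: "T i * const c = const c * T i" for i c
  proof -
    have "T i * const c = const (1 / of_nat n) *
        (\<Sum>r<n. const ((Q ^ (n - i)) ^ r) * (const c * kap ^ r))"
      by (simp add: T_def' sum_distrib_right mult.assoc const_kap_pow)
    also have "\<dots> = const (1 / of_nat n) * (const c * (\<Sum>r<n. const ((Q ^ (n - i)) ^ r) * kap ^ r))"
      by (simp add: sum_distrib_left mult_ac(2) flip: mult.assoc const_simps(1))
    also have "\<dots> = const c * T i"
      by (simp add: T_def' flip: mult.assoc const_simps(1))
    finally show ?thesis .
  qed
  have sumT: "(\<Sum>i<n. T i) = 1"
  proof -
    have "(\<Sum>i<n. T i) = const (1 / of_nat n) * (\<Sum>r<n. const (\<Sum>i<n. (Q ^ (n - i)) ^ r) * kap ^ r)"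
      unfolding T_def' sum_distrib_left[symmetric] const_sum sum_distrib_right
      by (subst sum.swap) simp
    also have "(\<Sum>r<n. const (\<Sum>i<n. (Q ^ (n - i)) ^ r) * kap ^ r) =
        (\<Sum>r<n. if r = 0 then const (of_nat n) else (0 :: 'k falg))"
    proof (intro sum.cong refl)
      fix r assume r: "r \<in> {..<n}"
      have "(\<Sum>i<n. (Q ^ (n - i)) ^ r) = (\<Sum>i<n. inverse (Q ^ r) ^ i)"
      proof (intro sum.cong refl)
        fix i assume "i \<in> {..<n}"
        then have "(Q ^ (n - i)) ^ r * (Q ^ r) ^ i = (Q ^ n) ^ r"
          by (simp flip: power_mult power_add)
             (metis add_mult_distrib le_add_diff_inverse2 less_imp_le mult.commute)
        then show "(Q ^ (n - i)) ^ r = inverse (Q ^ r) ^ i"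
          using Q0 Q1 by (simp add: power_inverse field_simps)
      qed
      also have "\<dots> = (if r = 0 then of_nat n else 0)"
      proof -
        have "inverse (Q ^ r) ^ n = 1"
          using Q1 by (simp add: power_inverse flip: power_mult)
            (simp add: mult.commute[of _ n] power_mult)
        moreover have "inverse (Q ^ r) = 1 \<longleftrightarrow> r = 0"
          using Qne[of r] r by auto
        ultimately show ?thesis by (simp add: geom)
      qed
      finally show "const (\<Sum>i<n. (Q ^ (n - i)) ^ r) * kap ^ r =
          (if r = 0 then const (of_nat n) else (0 :: 'k falg))"
        by (simp add: const_simps)
    qed
    finally show ?thesis
      using n by (simp flip: const_simps(1)) (simp add: const_simps)
  qed
  have main: "R ((\<Sum>i<n. const (f i) * T i) * (\<Sum>j<n. const (g j) * T j)) 1"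
    if fg: "\<And>i. i < n \<Longrightarrow> f i * g i = 1" for f g
  proof -
    have "(const (f i) * T i) * (const (g j) * T j) = const (f i) * (T i * const (g j)) * T j" for i j
      by (simp only: mult.assoc)
    then have "(const (f i) * T i) * (const (g j) * T j) = const (f i * g j) * (T i * T j)" for i j
      by (simp only: T_const const_simps mult.assoc)
    then have "(\<Sum>i<n. const (f i) * T i) * (\<Sum>j<n. const (g j) * T j) =
        (\<Sum>i<n. \<Sum>j<n. const (f i * g j) * (T i * T j))"
      by (simp add: sum_product)
    also have "R \<dots> (\<Sum>i<n. \<Sum>j<n. const (f i * g j) * (if i = j then T i else 0))"
      by (intro R_sum R_mult TT) auto
    also have "(\<Sum>i<n. \<Sum>j<n. const (f i * g j) * (if i = j then T i else 0)) = (\<Sum>i<n. T i)"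
      by (intro sum.cong refl) (simp add: if_distrib[of "(*) _"] fg const_simps(2) cong: if_cong)
    finally show ?thesis by (simp add: sumT)
  qed
  have "flat n q = (\<Sum>i<n. const (inverse (q ^ i)) * T i)"
    "flat_inv n q = (\<Sum>i<n. const (q ^ i) * T i)"
    by (simp_all add: flat_def flat_inv_def T_def ivl)
  then have "R (flat n q * flat_inv n q) 1" "R (flat_inv n q * flat n q) 1"
    using main[of "\<lambda>i. inverse (q ^ i)" "\<lambda>i. q ^ i"] main[of "\<lambda>i. q ^ i" "\<lambda>i. inverse (q ^ i)"] q0
    by simp_all
  then show "Qu_cls n q (flat n q) \<otimes>\<^bsub>Qu n q\<^esub> Qu_cls n q (flat_inv n q) = \<one>\<^bsub>Qu n q\<^esub>"
    "Qu_cls n q (flat_inv n q) \<otimes>\<^bsub>Qu n q\<^esub> Qu_cls n q (flat n q) = \<one>\<^bsub>Qu n q\<^esub>"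
    by (simp_all add: R_def Qu_cls_eqI flip: Qu_cls_hom Qu_cls_1)
qed

fun comult_gen :: "nat \<Rightarrow> 'k::field \<Rightarrow> letter \<Rightarrow> 'k falg2" where
  "comult_gen n q L_kap = kap \<otimes>\<^sub>k kap"
| "comult_gen n q L_hat = hat \<otimes>\<^sub>k hat"
| "comult_gen n q L_E = gE \<otimes>\<^sub>k flat_inv n q + kap_inv n \<otimes>\<^sub>k (idem1 n q 0 * gE)
     + 1 \<otimes>\<^sub>k (\<Sum>i = 1..n - 1. idem1 n q i * gE)"
| "comult_gen n q L_F = gF \<otimes>\<^sub>k flat n q + (kap_inv n * hat) \<otimes>\<^sub>k (gF * (\<Sum>i = 1..n - 1. idem1 n q i))
     + hat \<otimes>\<^sub>k (gF * idem1 n q 0)"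

text \<open>
  The unique algebra homomorphism on the free algebra with the values \<^const>\<open>comult_gen\<close>, and the
  map \<open>Qu n q \<rightarrow> Qu2 n q\<close> it induces on cosets (in the style of \<^const>\<open>rcoset_mult\<close>).
\<close>

definition comult_free :: "nat \<Rightarrow> 'k::field \<Rightarrow> 'k falg \<Rightarrow> 'k falg2" where
  "comult_free n q x = (\<Sum>w\<in>Poly_Mapping.keys x.
     const (Poly_Mapping.lookup x w) * prod_list (map (comult_gen n q) (letters w)))"

definition Qu_comult :: "nat \<Rightarrow> 'k::field \<Rightarrow> 'k falg set \<Rightarrow> 'k falg2 set" where
  "Qu_comult n q a = (\<Union>x\<in>a. Qu2_ideal n q +>\<^bsub>ring_of_type_algebra\<^esub> comult_free n q x)"


section \<open>Tensor products of modules\<close>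

text \<open>The vector space with basis \<open>B\<close> over the ground field.\<close>

definition free_space :: "'x set \<Rightarrow> ('k::field, 'x \<Rightarrow>\<^sub>0 'k) module" where
  "free_space B = \<lparr>carrier = {t. Poly_Mapping.keys t \<subseteq> B},
     monoid.mult = undefined, one = undefined,
     ring.zero = 0, ring.add = (+), module.smult = (\<lambda>c. Poly_Mapping.map ((*) c))\<rparr>"

text \<open>A scalar \<open>c\<close> acts on a module over \<^const>\<open>Qu\<close> through the class of \<open>const c\<close>.\<close>

definition bilin_rels :: "nat \<Rightarrow> 'k::field \<Rightarrow>
    ('k falg set, 'm) module \<Rightarrow> ('k falg set, 'p) module \<Rightarrow> (('m \<times> 'p) \<Rightarrow>\<^sub>0 'k) set" where
  "bilin_rels n q M N =
     {Poly_Mapping.single (x \<oplus>\<^bsub>M\<^esub> x', y) 1 - Poly_Mapping.single (x, y) 1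
        - Poly_Mapping.single (x', y) 1 | x x' y.
        x \<in> carrier M \<and> x' \<in> carrier M \<and> y \<in> carrier N}
   \<union> {Poly_Mapping.single (x, y \<oplus>\<^bsub>N\<^esub> y') 1 - Poly_Mapping.single (x, y) 1
        - Poly_Mapping.single (x, y') 1 | x y y'.
        x \<in> carrier M \<and> y \<in> carrier N \<and> y' \<in> carrier N}
   \<union> {Poly_Mapping.single (Qu_cls n q (const c) \<odot>\<^bsub>M\<^esub> x, y) 1 - Poly_Mapping.single (x, y) c
        | c x y. x \<in> carrier M \<and> y \<in> carrier N}
   \<union> {Poly_Mapping.single (x, Qu_cls n q (const c) \<odot>\<^bsub>N\<^esub> y) 1 - Poly_Mapping.single (x, y) c
        | c x y. x \<in> carrier M \<and> y \<in> carrier N}"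

definition tens_null :: "nat \<Rightarrow> 'k::field \<Rightarrow>
    ('k falg set, 'm) module \<Rightarrow> ('k falg set, 'p) module \<Rightarrow> (('m \<times> 'p) \<Rightarrow>\<^sub>0 'k) set" where
  "tens_null n q M N = submodule_gen (ring_of_type_algebra :: 'k ring)
     (free_space (carrier M \<times> carrier N)) (bilin_rels n q M N)"

text \<open>The bilinear extension of \<open>(u \<otimes> v) (x \<otimes> y) = u x \<otimes> v y\<close>.\<close>

definition act2 :: "nat \<Rightarrow> 'k::field \<Rightarrow> ('k falg set, 'm) module \<Rightarrow> ('k falg set, 'p) module
    \<Rightarrow> 'k falg2 \<Rightarrow> (('m \<times> 'p) \<Rightarrow>\<^sub>0 'k) \<Rightarrow> (('m \<times> 'p) \<Rightarrow>\<^sub>0 'k)" where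
  "act2 n q M N d t = (\<Sum>(u, v)\<in>Poly_Mapping.keys d. \<Sum>(x, y)\<in>Poly_Mapping.keys t.
     Poly_Mapping.single
       (Qu_cls n q (Poly_Mapping.single u 1) \<odot>\<^bsub>M\<^esub> x, Qu_cls n q (Poly_Mapping.single v 1) \<odot>\<^bsub>N\<^esub> y)
       (Poly_Mapping.lookup d (u, v) * Poly_Mapping.lookup t (x, y)))"

text \<open>
  The tensor product over the ground field: the free vector space on pairs modulo the bilinearity
  relations, an element \<open>a\<close> acting through \<open>Qu_comult n q a\<close>.
\<close>

definition Qu_tensor :: "nat \<Rightarrow> 'k::field \<Rightarrow> ('k falg set, 'm) module \<Rightarrow> ('k falg set, 'p) module
    \<Rightarrow> ('k falg set, (('m \<times> 'p) \<Rightarrow>\<^sub>0 'k) set) module" where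
  "Qu_tensor n q M N =
     (let V = (free_space (carrier M \<times> carrier N) :: ('k, ('m \<times> 'p) \<Rightarrow>\<^sub>0 'k) module);
          H = tens_null n q M N
      in \<lparr>carrier = a_rcosets\<^bsub>V\<^esub> H, monoid.mult = undefined, one = undefined,
          ring.zero = H, ring.add = set_add V,
          module.smult = (\<lambda>a T. \<Union>d\<in>Qu_comult n q a. \<Union>t\<in>T. H +>\<^bsub>V\<^esub> act2 n q M N d t)\<rparr>)"


section \<open>The modules P and S\<close>

text \<open>
  The first index \<open>s\<close> of the following notions stands for the (even) subscript \<open>2i\<close>; the second
  index \<open>j\<close> is 0 or 1.
\<close>

definition Qu_u0 :: "nat \<Rightarrow> 'k::field \<Rightarrow> 'k falg set set" where
  "Qu_u0 n q = generate_ring (Qu n q)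
     (range (\<lambda>c. Qu_cls n q (const c)) \<union> {Qu_cls n q kap, Qu_cls n q hat})"

definition phi :: "nat \<Rightarrow> 'k::field \<Rightarrow> nat \<Rightarrow> 'k falg" where
  "phi n q s = const (1 / of_nat (n div 2 * n)) *
     (\<Sum>r = 0..n div 2 * n - 1. const (inverse (q ^ (s * r))) * (kap_inv n * hat) ^ r)"

definition bold1 :: "nat \<Rightarrow> nat \<Rightarrow> 'k::field falg" where
  "bold1 n j = (if j = 0 then const (1/2) * (1 + kap * hat ^ (n div 2))
                else const (1/2) * (1 - kap * hat ^ (n div 2)))"

definition alpha :: "nat \<Rightarrow> 'k::field \<Rightarrow> nat \<Rightarrow> nat \<Rightarrow> 'k falg" where
  "alpha n q s j = gF ^ (n ^ 2 - 1) * (phi n q s * bold1 n j)"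

definition beta :: "nat \<Rightarrow> 'k::field \<Rightarrow> nat \<Rightarrow> nat \<Rightarrow> 'k falg" where
  "beta n q s j = gE ^ (s - 2) * alpha n q s j"

definition gamma_space :: "nat \<Rightarrow> 'k::field \<Rightarrow> 'k falg set set" where
  "gamma_space n q =
     {(\<Oplus>\<^bsub>Qu n q\<^esub>a \<in> {0..n ^ 2 - 2}. \<Oplus>\<^bsub>Qu n q\<^esub>b \<in> {0..n ^ 2 - 1}.
         Qu_cls n q (gF ^ a) \<otimes>\<^bsub>Qu n q\<^esub> u a b \<otimes>\<^bsub>Qu n q\<^esub> Qu_cls n q (gE ^ b)) | u.
       \<forall>a b. u a b \<in> Qu_u0 n q}"

definition gamma :: "nat \<Rightarrow> 'k::field \<Rightarrow> nat \<Rightarrow> nat \<Rightarrow> 'k falg set" where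
  "gamma n q s j = (THE x. x \<in> gamma_space n q \<and>
     Qu_cls n q gF \<otimes>\<^bsub>Qu n q\<^esub> x = Qu_cls n q (beta n q s j))"

definition Qu_P :: "nat \<Rightarrow> 'k::field \<Rightarrow> nat \<Rightarrow> nat \<Rightarrow> ('k falg set, 'k falg set) module" where
  "Qu_P n q s j = (left_regular (Qu n q))
     \<lparr>carrier := {a \<otimes>\<^bsub>Qu n q\<^esub> gamma n q s j | a. a \<in> carrier (Qu n q)}\<rparr>"

definition Qu_S :: "nat \<Rightarrow> 'k::field \<Rightarrow> nat \<Rightarrow> nat \<Rightarrow> ('k falg set, 'k falg set) module" where
  "Qu_S n q s j = (Qu_P n q s j)\<lparr>carrier := Soc (Qu n q) (Qu_P n q s j)\<rparr>"

definition res2 :: "int \<Rightarrow> nat" where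
  "res2 r = nat (r mod 2)"

end

theory Submission
  imports Defs "HOL-Library.Function_Algebras"
begin

text \<open>
  Every module is replaced by an explicit space of coordinate functions on which the four generators
  act by matrices: \<open>S\<close> becomes a single string of \<open>E\<close>-powers of a vector killed by \<open>F\<close>, and \<open>P\<close> becomes
  two strings of length \<open>n\<^sup>2\<close> through \<open>\<gamma>\<close> and \<open>\<alpha>\<close> with \<open>F \<gamma> = E\<^sup>2\<^sup>i\<^sup>-\<^sup>2 \<alpha>\<close>. In the tensor product of two strings
  of lengths \<open>d\<^sub>1\<close> and \<open>d\<^sub>2\<close>, graded by the sum of the exponents, \<open>F\<close> is surjective onto each low level, so
  each level below \<open>min d\<^sub>1 d\<^sub>2\<close> contains a vector killed by \<open>F\<close>, and \<open>F\<close> is injective on the high levels,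
  which makes the strings through these vectors end where they should. Each such vector generates a copy
  of \<open>S\<close>, or, together with a solution \<open>y\<close> of \<open>F y = E\<^sup>2\<^sup>i\<^sup>-\<^sup>2 x\<close>, a copy of \<open>P\<close>. As \<open>F\<close> is nilpotent, the
  sum of the resulting homomorphisms is injective as soon as it is so on the kernel of \<open>F\<close>, which is
  spanned by vectors of pairwise distinct levels; a dimension count then gives bijectivity. The same
  map shows that the ideal of relations acts as zero on the tensor product.
\<close>

section \<open>Coordinate spaces and actions of words\<close>

text \<open>Write p = n^2 and K = \<open>kap_inv n * hat\<close>. Everything rests on one number: on
  a vector v killed by F on which K acts as q^(d-1), F E^l v is (1 - q^(d-l)) times a q-number times
  E^(l-1) v, and for 0 < l < p this vanishes only at l = d. In P this happens for \<gamma> (modulo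
  the string of \<alpha>) at d = p - 2i + 1 and for \<alpha> at r = 2i - 1; d + r = p governs the
  length d of S, the shape of P and its socle generated by E^r \<alpha>. Two obstacles shape the
  proof. \<gamma> is a definite description, so F must be injective on the span of the F^a u E^b
  with a \<le> p - 2; this is seen by evaluating such sums on modules induced from suitable weights.
  And that \<Delta> respects the relations is not established in advance: on the tensor product only
  weights and the relation between E and F are computed, which suffices to construct the
  homomorphisms, and their surjectivity yields the other relations. Divisibility of n by 4 enters in
  (1 + n/2)^2 = 1 modulo n, by which the eigenvalue of \<kappa> on an idempotent is recovered from
  those of K and \<open>kap * hat ^ (n div 2)\<close>.\<close>

definition fscale :: "'k::times \<Rightarrow> ('b \<Rightarrow> 'k) \<Rightarrow> 'b \<Rightarrow> 'k" (infixr \<open>*\<^sub>f\<close> 75)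
  where "c *\<^sub>f f = (\<lambda>b. c * f b)"

text \<open>Vanishing off \<open>B\<close>, rather than being undefined there, keeps zero and
  addition those of the function type, so modules of all dimensions share the same
  operations.\<close>

definition funs_on :: "'b set \<Rightarrow> ('b \<Rightarrow> 'k::zero) set"
  where "funs_on B = {f. \<forall>b. b \<notin> B \<longrightarrow> f b = 0}"

definition delta :: "'b \<Rightarrow> 'b \<Rightarrow> 'k::zero_neq_one"
  where "delta a = (\<lambda>b. if b = a then 1 else 0)"

text \<open>Linearity is asked for on all functions and not only on those supported on a basis;
  sums, composites and powers of operators then carry no side condition on supports.\<close>

definition lin :: "(('b \<Rightarrow> 'k::comm_ring_1) \<Rightarrow> 'c \<Rightarrow> 'k) \<Rightarrow> bool"
  where "lin T \<longleftrightarrow> (\<forall>f g. T (f + g) = T f + T g) \<and> (\<forall>c f. T (c *\<^sub>f f) = c *\<^sub>f T f)"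

declare plus_fun_apply [simp del] zero_fun_apply [simp del] minus_apply [simp del] uminus_apply [simp del]

lemma fscale_apply: "(c *\<^sub>f f) b = c * f b"
  by (simp add: fscale_def)

lemma fscale_simps [simp]:
  fixes f :: "'b \<Rightarrow> 'k::comm_ring_1"
  shows "1 *\<^sub>f f = f" "0 *\<^sub>f f = 0" "c *\<^sub>f 0 = (0 :: 'b \<Rightarrow> 'k)" "c *\<^sub>f d *\<^sub>f f = (c * d) *\<^sub>f f"
  by (auto simp: fun_eq_iff plus_fun_apply zero_fun_apply minus_apply uminus_apply fscale_apply mult.assoc)

lemma fscale_add:
  fixes f :: "'b \<Rightarrow> 'k::comm_ring_1"
  shows "c *\<^sub>f (f + g) = c *\<^sub>f f + c *\<^sub>f g" "(c + d) *\<^sub>f f = c *\<^sub>f f + d *\<^sub>f f"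
    "c *\<^sub>f (f - g) = c *\<^sub>f f - c *\<^sub>f g" "(c - d) *\<^sub>f f = c *\<^sub>f f - d *\<^sub>f f"
    "c *\<^sub>f (- f) = - (c *\<^sub>f f)"
  by (auto simp: fun_eq_iff plus_fun_apply zero_fun_apply minus_apply uminus_apply fscale_apply algebra_simps)

lemma sum_fun_apply: "(\<Sum>i\<in>I. F i) b = (\<Sum>i\<in>I. F i b)"
  for F :: "'i \<Rightarrow> 'b \<Rightarrow> 'k::comm_monoid_add"
  by (induction I rule: infinite_finite_induct) (auto simp: plus_fun_apply zero_fun_apply)

lemmas fun_apply = plus_fun_apply zero_fun_apply minus_apply uminus_apply fscale_apply sum_fun_apply

lemma fscale_sum: "c *\<^sub>f (\<Sum>i\<in>I. F i) = (\<Sum>i\<in>I. c *\<^sub>f F i)"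
  for F :: "'i \<Rightarrow> 'b \<Rightarrow> 'k::comm_ring_1"
  by (simp add: fun_eq_iff fun_apply sum_distrib_left)

lemma funs_onI: "(\<And>b. b \<notin> B \<Longrightarrow> f b = 0) \<Longrightarrow> f \<in> funs_on B"
  by (auto simp: funs_on_def fun_apply)

lemma funs_onD: "f \<in> funs_on B \<Longrightarrow> b \<notin> B \<Longrightarrow> f b = 0"
  by (auto simp: funs_on_def fun_apply)

lemma funs_on_simps [simp]:
  fixes f :: "'b \<Rightarrow> 'k::comm_ring_1"
  shows "0 \<in> (funs_on B :: ('b \<Rightarrow> 'k) set)"
    "f \<in> funs_on B \<Longrightarrow> g \<in> funs_on B \<Longrightarrow> f + g \<in> funs_on B"
    "f \<in> funs_on B \<Longrightarrow> g \<in> funs_on B \<Longrightarrow> f - g \<in> funs_on B"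
    "f \<in> funs_on B \<Longrightarrow> - f \<in> funs_on B"
    "f \<in> funs_on B \<Longrightarrow> c *\<^sub>f f \<in> funs_on B"
    "funs_on UNIV = (UNIV :: ('b \<Rightarrow> 'k) set)"
  by (auto simp: funs_on_def fun_apply)

lemma funs_on_sum: "(\<And>i. i \<in> I \<Longrightarrow> F i \<in> funs_on B) \<Longrightarrow> (\<Sum>i\<in>I. F i) \<in> funs_on B"
  for F :: "'i \<Rightarrow> 'b \<Rightarrow> 'k::comm_ring_1"
  by (induction I rule: infinite_finite_induct) auto

lemma delta_funs_on [simp]: "delta a \<in> funs_on B \<longleftrightarrow> a \<in> B"
  by (auto simp: funs_on_def delta_def fun_apply split: if_splits)

lemma delta_expansion:
  fixes f :: "'b \<Rightarrow> 'k::comm_ring_1"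
  assumes "finite B" "f \<in> funs_on B"
  shows "f = (\<Sum>b\<in>B. f b *\<^sub>f delta b)"
proof
  fix x show "f x = (\<Sum>b\<in>B. f b *\<^sub>f delta b) x"
    using assms funs_onD[of f B x] by (cases "x \<in> B") (auto simp: fun_apply delta_def if_distrib cong: if_cong)
qed

lemma linI: "(\<And>f g. T (f + g) = T f + T g) \<Longrightarrow> (\<And>c f. T (c *\<^sub>f f) = c *\<^sub>f T f) \<Longrightarrow> lin T"
  by (auto simp: lin_def)

lemma lin_add: "lin T \<Longrightarrow> T (f + g) = T f + T g"
  and lin_scale: "lin T \<Longrightarrow> T (c *\<^sub>f f) = c *\<^sub>f T f"
  by (auto simp: lin_def)

lemma lin_0: "lin T \<Longrightarrow> T 0 = 0"
  using lin_scale[of T 0 0] by simp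

lemma lin_minus: "lin T \<Longrightarrow> T (- f) = - T f"
  using lin_scale[of T "-1" f] by (simp add: fun_eq_iff fscale_def fun_Compl_def)

lemma lin_diff: "lin T \<Longrightarrow> T (f - g) = T f - T g"
  using lin_add[of T f "- g"] lin_minus[of T g] by simp

lemma lin_sum:
  assumes "lin T" shows "T (\<Sum>i\<in>I. F i) = (\<Sum>i\<in>I. T (F i))"
proof (induction I rule: infinite_finite_induct)
  case (insert i I)
  show ?case using insert.IH by (simp only: sum.insert[OF insert.hyps] lin_add[OF assms])
qed (simp_all add: lin_0[OF assms])

lemma lin_comp: "lin S \<Longrightarrow> lin T \<Longrightarrow> lin (S \<circ> T)"
  by (simp add: lin_def)

lemma lin_id: "lin id" "lin (\<lambda>f. f)"
  by (simp_all add: lin_def)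

lemma lin_funpow:
  fixes T :: "('b \<Rightarrow> 'k::comm_ring_1) \<Rightarrow> 'b \<Rightarrow> 'k"
  assumes "lin T" shows "lin (T ^^ l)"
proof (induction l)
  case (Suc l)
  then show ?case unfolding funpow.simps by (rule lin_comp[OF assms])
qed (simp add: lin_id)

lemma lin_eqI:
  fixes S T :: "('b \<Rightarrow> 'k::comm_ring_1) \<Rightarrow> 'c \<Rightarrow> 'k"
  assumes "finite B" "lin S" "lin T" "\<And>b. b \<in> B \<Longrightarrow> S (delta b) = T (delta b)" "f \<in> funs_on B"
  shows "S f = T f"
proof -
  have "f = (\<Sum>b\<in>B. f b *\<^sub>f delta b)"
    by (rule delta_expansion) fact+
  moreover have "S (\<Sum>b\<in>B. f b *\<^sub>f delta b) = T (\<Sum>b\<in>B. f b *\<^sub>f delta b)"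
    using assms(4) by (simp add: lin_sum[OF assms(2)] lin_sum[OF assms(3)]
        lin_scale[OF assms(2)] lin_scale[OF assms(3)])
  ultimately show ?thesis by simp
qed

section \<open>Linear extension of monoid actions to the monoid algebra\<close>

lemma poly_mapping_add_induct [case_names zero single add]:
  fixes x :: "'w \<Rightarrow>\<^sub>0 'k::comm_monoid_add"
  assumes "P 0" "\<And>w c. P (Poly_Mapping.single w c)" "\<And>x y. P x \<Longrightarrow> P y \<Longrightarrow> P (x + y)"
  shows "P x"
proof (induction x rule: update_induct)
  case const
  show ?case by fact
next
  case (update f a b)
  have "Poly_Mapping.update a b f = f + Poly_Mapping.single a b"
    using update(1)
    by (intro poly_mapping_eqI) (auto simp: lookup_update lookup_add lookup_single when_def in_keys_iff)
  then show ?case using update assms by simp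
qed

text \<open>One linear extension for three index sets: words acting on coordinates, pairs of words
  acting on a tensor product, and pairs of module elements in \<open>tval\<close>, where the
  operators ignore their argument.\<close>

definition rep :: "('w \<Rightarrow> ('b \<Rightarrow> 'k) \<Rightarrow> 'b \<Rightarrow> 'k) \<Rightarrow> ('w \<Rightarrow>\<^sub>0 'k) \<Rightarrow> ('b \<Rightarrow> 'k::comm_ring_1) \<Rightarrow> 'b \<Rightarrow> 'k"
  where "rep m x f = (\<Sum>w\<in>Poly_Mapping.keys x. Poly_Mapping.lookup x w *\<^sub>f m w f)"

definition monoid_rep :: "('w::monoid_add \<Rightarrow> ('b \<Rightarrow> 'k::comm_ring_1) \<Rightarrow> 'b \<Rightarrow> 'k) \<Rightarrow> bool"
  where "monoid_rep m \<longleftrightarrow> (\<forall>w. lin (m w)) \<and> m 0 = id \<and> (\<forall>u v. m (u + v) = m u \<circ> m v)"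

lemma rep_superset:
  "finite S \<Longrightarrow> Poly_Mapping.keys x \<subseteq> S \<Longrightarrow> rep m x f = (\<Sum>w\<in>S. Poly_Mapping.lookup x w *\<^sub>f m w f)"
  unfolding rep_def by (rule sum.mono_neutral_left) (auto simp: in_keys_iff)

lemma rep_0 [simp]: "rep m 0 f = 0"
  by (simp add: rep_def)

lemma rep_single [simp]: "rep m (Poly_Mapping.single w c) f = c *\<^sub>f m w f"
  by (cases "c = 0") (simp_all add: rep_def)

lemma rep_add: "rep m (x + y) f = rep m x f + rep m y f"
proof -
  let ?S = "Poly_Mapping.keys x \<union> Poly_Mapping.keys y"
  have "rep m (x + y) f = (\<Sum>w\<in>?S. Poly_Mapping.lookup (x + y) w *\<^sub>f m w f)"
    by (rule rep_superset) (auto simp: keys_add)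
  moreover have "rep m x f = (\<Sum>w\<in>?S. Poly_Mapping.lookup x w *\<^sub>f m w f)"
    by (rule rep_superset) auto
  moreover have "rep m y f = (\<Sum>w\<in>?S. Poly_Mapping.lookup y w *\<^sub>f m w f)"
    by (rule rep_superset) auto
  ultimately show ?thesis
    by (simp add: lookup_add fscale_add sum.distrib)
qed

lemma rep_minus: "rep m (- x) f = - rep m x f"
proof -
  have "rep m x f + rep m (- x) f = 0"
    by (simp flip: rep_add)
  then show ?thesis by (simp add: eq_neg_iff_add_eq_0 add.commute)
qed

lemma rep_diff: "rep m (x - y) f = rep m x f - rep m y f"
  using rep_add[of m x "- y" f] by (simp add: rep_minus)

lemma rep_sum: "rep m (\<Sum>i\<in>I. x i) f = (\<Sum>i\<in>I. rep m (x i) f)"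
  by (induction I rule: infinite_finite_induct) (auto simp: rep_add)

lemma lin_rep:
  assumes "\<And>w. lin (m w)" shows "lin (rep m x)"
  by (rule linI) (simp_all add: rep_def lin_add[OF assms] lin_scale[OF assms] fscale_add
      sum.distrib fscale_sum mult.commute)

lemma rep_mult:
  assumes "monoid_rep m"
  shows "rep m (x * y) f = rep m x (rep m y f)"
proof -
  have m: "lin (m w)" "m (u + v) g = m u (m v g)" for u v w g
    using assms by (auto simp: monoid_rep_def)
  show ?thesis
  proof (induction x rule: poly_mapping_add_induct)
    case (single w c)
    show ?case
    proof (induction y rule: poly_mapping_add_induct)
      case (single v d)
      then show ?case
        by (simp only: mult_single rep_single m(2) lin_scale[OF m(1)] fscale_simps)
    next
      case (add x y)
      then show ?case
        by (simp only: distrib_left rep_add rep_single lin_add[OF m(1)] fscale_add)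
    qed (use lin_0[OF m(1)] in simp)
  next
    case (add x x')
    then show ?case by (simp add: distrib_right rep_add)
  qed simp
qed

lemma rep_one: "monoid_rep m \<Longrightarrow> rep m 1 f = f"
  by (simp add: monoid_rep_def flip: single_one)

lemma rep_const: "monoid_rep m \<Longrightarrow> rep m (const c) f = c *\<^sub>f f"
  by (simp add: monoid_rep_def const_def)

lemma rep_power: "monoid_rep m \<Longrightarrow> rep m (x ^ l) f = (rep m x ^^ l) f"
  by (induction l) (simp_all add: rep_one rep_mult)

lemma rep_prod_list:
  "monoid_rep m \<Longrightarrow> rep m (prod_list (map c gs)) f = foldr (\<lambda>g. rep m (c g)) gs f"
  by (induction gs) (simp_all add: rep_one rep_mult)

definition word_act :: "(letter \<Rightarrow> ('b \<Rightarrow> 'k) \<Rightarrow> 'b \<Rightarrow> 'k) \<Rightarrow> word \<Rightarrow> ('b \<Rightarrow> 'k) \<Rightarrow> 'b \<Rightarrow> 'k"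
  where "word_act T w = foldr T (letters w)"

abbreviation frep :: "(letter \<Rightarrow> ('b \<Rightarrow> 'k) \<Rightarrow> 'b \<Rightarrow> 'k) \<Rightarrow> 'k falg \<Rightarrow> ('b \<Rightarrow> 'k::comm_ring_1) \<Rightarrow> 'b \<Rightarrow> 'k"
  where "frep T \<equiv> rep (word_act T)"

lemma lin_foldr: "(\<And>g. lin (T g)) \<Longrightarrow> lin (foldr T gs)"
  by (induction gs) (auto intro: lin_comp simp: lin_id)

lemma monoid_rep_word_act: "(\<And>g. lin (T g)) \<Longrightarrow> monoid_rep (word_act T)"
  by (auto simp: monoid_rep_def word_act_def zero_word_def plus_word_def fun_eq_iff lin_foldr lin_id)

lemma frep_gen: "frep T (gen g) f = T g f"
  by (simp add: gen_def word_act_def)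

lemma foldr_funs_on:
  "(\<And>g f. f \<in> F \<Longrightarrow> T g f \<in> F) \<Longrightarrow> f \<in> F \<Longrightarrow> foldr T gs f \<in> F"
  by (induction gs) auto

lemma frep_funs_on:
  "(\<And>g f. f \<in> funs_on B \<Longrightarrow> T g f \<in> funs_on B) \<Longrightarrow> f \<in> funs_on B \<Longrightarrow> frep T x f \<in> funs_on B"
  unfolding rep_def word_act_def
  by (intro funs_on_sum funs_on_simps(5) foldr_funs_on[where F = "funs_on B"])

text \<open>By induction over the letters of a word, equivariance for the four generators extends to
  the free algebra. The stable set \<open>F\<close> is there because the generators are in general
  known to intertwine only on the span of a basis.\<close>

lemma frep_intertwine:
  fixes \<psi> :: "('b \<Rightarrow> 'k::comm_ring_1) \<Rightarrow> 'c \<Rightarrow> 'k"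
  assumes \<psi>: "lin \<psi>"
    and T: "\<And>g f. f \<in> F \<Longrightarrow> T g f \<in> F" and I: "\<And>g f. f \<in> F \<Longrightarrow> \<psi> (T g f) = T' g (\<psi> f)"
    and f: "f \<in> F"
  shows "\<psi> (frep T x f) = frep T' x (\<psi> f)"
proof -
  have "\<psi> (foldr T gs f) = foldr T' gs (\<psi> f)" for gs
    by (induction gs) (auto simp: I foldr_funs_on[of F, OF T] f)
  then show ?thesis
    by (simp add: rep_def lin_sum[OF \<psi>] lin_scale[OF \<psi>] word_act_def)
qed

section \<open>Coordinates on modules\<close>

text \<open>A module given by four matrices. No clause mentions the relations of the algebra: as the
  last one refers to the class of x only, they are forced, see
  \<open>coords_kills_ideal\<close>.\<close>

definition coords :: "nat \<Rightarrow> 'k::field \<Rightarrow> ('k falg set, 'm) module \<Rightarrow> 'b set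
    \<Rightarrow> (letter \<Rightarrow> ('b \<Rightarrow> 'k) \<Rightarrow> 'b \<Rightarrow> 'k) \<Rightarrow> (('b \<Rightarrow> 'k) \<Rightarrow> 'm) \<Rightarrow> bool" where
  "coords n q M B T \<Phi> \<longleftrightarrow> (\<forall>g. lin (T g)) \<and> (\<forall>g. \<forall>f\<in>funs_on B. T g f \<in> funs_on B) \<and>
     bij_betw \<Phi> (funs_on B) (carrier M) \<and> \<Phi> 0 = \<zero>\<^bsub>M\<^esub> \<and>
     (\<forall>f\<in>funs_on B. \<forall>g\<in>funs_on B. \<Phi> (f + g) = \<Phi> f \<oplus>\<^bsub>M\<^esub> \<Phi> g) \<and>
     (\<forall>x. \<forall>f\<in>funs_on B. \<Phi> (frep T x f) = Qu_cls n q x \<odot>\<^bsub>M\<^esub> \<Phi> f)"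

lemma coordsD:
  assumes "coords n q M B T \<Phi>"
  shows "lin (T g)" "f \<in> funs_on B \<Longrightarrow> T g f \<in> funs_on B"
    "bij_betw \<Phi> (funs_on B) (carrier M)" "\<Phi> 0 = \<zero>\<^bsub>M\<^esub>"
    "f \<in> funs_on B \<Longrightarrow> h \<in> funs_on B \<Longrightarrow> \<Phi> (f + h) = \<Phi> f \<oplus>\<^bsub>M\<^esub> \<Phi> h"
    "f \<in> funs_on B \<Longrightarrow> \<Phi> (frep T x f) = Qu_cls n q x \<odot>\<^bsub>M\<^esub> \<Phi> f"
    "f \<in> funs_on B \<Longrightarrow> \<Phi> f \<in> carrier M"
    "f \<in> funs_on B \<Longrightarrow> frep T x f \<in> funs_on B"
    "monoid_rep (word_act T)"
proof -
  note a = assms[unfolded coords_def]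
  show "lin (T g)" "f \<in> funs_on B \<Longrightarrow> T g f \<in> funs_on B"
    "bij_betw \<Phi> (funs_on B) (carrier M)" "\<Phi> 0 = \<zero>\<^bsub>M\<^esub>"
    "f \<in> funs_on B \<Longrightarrow> h \<in> funs_on B \<Longrightarrow> \<Phi> (f + h) = \<Phi> f \<oplus>\<^bsub>M\<^esub> \<Phi> h"
    "f \<in> funs_on B \<Longrightarrow> \<Phi> (frep T x f) = Qu_cls n q x \<odot>\<^bsub>M\<^esub> \<Phi> f" for f
    using a by blast+
  show "f \<in> funs_on B \<Longrightarrow> \<Phi> f \<in> carrier M"
    by (rule bij_betw_apply[of \<Phi> "funs_on B"]) (use a in blast)+
  show "f \<in> funs_on B \<Longrightarrow> frep T x f \<in> funs_on B"
    by (rule frep_funs_on) (use a in blast)+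
  show "monoid_rep (word_act T)"
    by (rule monoid_rep_word_act) (use a in blast)
qed

lemma coords_scale:
  assumes "coords n q M B T \<Phi>" "f \<in> funs_on B"
  shows "\<Phi> (c *\<^sub>f f) = Qu_cls n q (const c) \<odot>\<^bsub>M\<^esub> \<Phi> f"
  using coordsD(6)[OF assms, of "const c"] by (simp add: rep_const coordsD(9)[OF assms(1)])

lemma Qu_cls_self: "x \<in> Qu_cls n q x"
  using Qu_ideal_closed(1)[of n q]
  by (auto simp: Qu_cls_def a_r_coset_def' ring_of_type_algebra_def)

lemma Qu_cls_eq_iff: "Qu_cls n q x = Qu_cls n q y \<longleftrightarrow> x - y \<in> Qu_ideal n q"
proof
  assume "Qu_cls n q x = Qu_cls n q y"
  then have "x \<in> Qu_cls n q y" using Qu_cls_self by blast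
  then obtain h where "h \<in> Qu_ideal n q" "x = h + y"
    by (auto simp: Qu_cls_def a_r_coset_def' ring_of_type_algebra_def)
  then show "x - y \<in> Qu_ideal n q" by simp
qed (rule Qu_cls_eqI)

lemma carrier_Qu: "carrier (Qu n q) = range (Qu_cls n q)"
  by (auto simp: Qu_def FactRing_def A_RCOSETS_def' Qu_cls_def ring_of_type_algebra_def)

lemma Qu_add: "Qu_cls n q x \<oplus>\<^bsub>Qu n q\<^esub> Qu_cls n q y = Qu_cls n q (x + y)"
  using ring_hom_add[OF ideal.rcos_ring_hom[OF ideal_Qu_ideal], of x y n q]
  by (simp add: Qu_cls_def Qu_def ring_of_type_algebra_def)

lemma Qu_zero: "\<zero>\<^bsub>Qu n q\<^esub> = Qu_cls n q 0"
  using Qu_ideal_closed(1)[of n q]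
  by (simp add: Qu_def FactRing_def Qu_cls_def a_r_coset_def' ring_of_type_algebra_def)

lemma ring_Qu: "ring (Qu n q)"
  unfolding Qu_def by (rule ideal.quotient_is_ring[OF ideal_Qu_ideal])

text \<open>An element of the ideal has the class of 0, so x and 0 act alike on the module, and
  \<open>\<Phi>\<close> is injective.\<close>

lemma coords_kills_ideal:
  assumes c: "coords n q M B T \<Phi>" and x: "x \<in> Qu_ideal n q" and f: "f \<in> funs_on B"
  shows "frep T x f = 0"
proof -
  have "Qu_cls n q x = Qu_cls n q 0" using x by (simp add: Qu_cls_eq_iff)
  then have "\<Phi> (frep T x f) = \<Phi> (frep T 0 f)"
    using coordsD(6)[OF c f] by metis
  moreover have "frep T x f \<in> funs_on B" "frep T 0 f \<in> funs_on B" using coordsD(8)[OF c f] by blast+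
  ultimately show ?thesis
    using bij_betw_imp_inj_on[OF coordsD(3)[OF c]] inj_onD by fastforce
qed

text \<open>A homomorphism is easily written down from the direct sum to the tensor product, while
  the isomorphism wanted starts at the tensor product. Hence \<open>\<psi>\<close> runs from the
  coordinates of \<open>M\<close> to those of \<open>N\<close> and is inverted in the proof.\<close>

lemma lmod_iso_by_coords:
  assumes M: "coords n q M B T \<Phi>" and N: "coords n q N B' T' \<Phi>'"
    and \<psi>: "lin \<psi>" and b: "bij_betw \<psi> (funs_on B) (funs_on B')"
    and I: "\<And>g f. f \<in> funs_on B \<Longrightarrow> \<psi> (T g f) = T' g (\<psi> f)"
  shows "lmod_iso (Qu n q) N M"
proof -
  let ?F = "funs_on B" and ?F' = "funs_on B'"
  define \<Psi> where "\<Psi> = inv_into ?F' \<Phi>'"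
  define \<theta> where "\<theta> = inv_into ?F \<psi>"
  have \<Psi>: "bij_betw \<Psi> (carrier N) ?F'"
    unfolding \<Psi>_def by (intro bij_betw_inv_into coordsD(3)[OF N])
  have \<theta>: "bij_betw \<theta> ?F' ?F"
    unfolding \<theta>_def by (rule bij_betw_inv_into[OF b])
  have \<psi>\<theta>: "\<psi> (\<theta> w) = w" if "w \<in> ?F'" for w
    unfolding \<theta>_def using b that bij_betw_inv_into_right by metis
  have \<theta>\<psi>: "\<theta> (\<psi> f) = f" if "f \<in> ?F" for f
    unfolding \<theta>_def using b that by (simp add: bij_betw_inv_into_left)
  have \<theta>in: "\<theta> w \<in> ?F" if "w \<in> ?F'" for w
    using \<theta> that bij_betw_apply by metis
  have \<Psi>in: "\<Psi> w \<in> ?F'" if "w \<in> carrier N" for w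
    using \<Psi> that bij_betw_apply by metis
  have \<Phi>\<Psi>: "\<Phi>' (\<Psi> x) = x" if "x \<in> carrier N" for x
    unfolding \<Psi>_def using coordsD(3)[OF N] that bij_betw_inv_into_right by metis
  have \<Psi>\<Phi>: "\<Psi> (\<Phi>' f) = f" if "f \<in> ?F'" for f
    unfolding \<Psi>_def using coordsD(3)[OF N] that by (simp add: bij_betw_inv_into_left)
  define h where "h = (\<lambda>x. \<Phi> (\<theta> (\<Psi> x)))"
  have "bij_betw (\<Phi> \<circ> \<theta> \<circ> \<Psi>) (carrier N) (carrier M)"
    by (intro bij_betw_trans[OF \<Psi>] bij_betw_trans[OF \<theta>] coordsD(3)[OF M])
  then have hb: "bij_betw h (carrier N) (carrier M)" by (simp add: h_def comp_def)
  have add: "h (x \<oplus>\<^bsub>N\<^esub> y) = h x \<oplus>\<^bsub>M\<^esub> h y" if "x \<in> carrier N" "y \<in> carrier N" for x y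
  proof -
    note i = \<Psi>in[OF that(1)] \<Psi>in[OF that(2)]
    have "x \<oplus>\<^bsub>N\<^esub> y = \<Phi>' (\<Psi> x + \<Psi> y)"
      using coordsD(5)[OF N i] that by (simp add: \<Phi>\<Psi>)
    then have "\<Psi> (x \<oplus>\<^bsub>N\<^esub> y) = \<Psi> x + \<Psi> y" using i by (simp add: \<Psi>\<Phi>)
    moreover have "\<theta> (\<Psi> x + \<Psi> y) = \<theta> (\<Psi> x) + \<theta> (\<Psi> y)"
    proof -
      have "\<Psi> x + \<Psi> y = \<psi> (\<theta> (\<Psi> x) + \<theta> (\<Psi> y))"
        using i by (simp add: lin_add[OF \<psi>] \<psi>\<theta>)
      then show ?thesis using i \<theta>in by (simp add: \<theta>\<psi>)
    qed
    ultimately show ?thesis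
      unfolding h_def using coordsD(5)[OF M] i \<theta>in by simp
  qed
  have sm: "h (a \<odot>\<^bsub>N\<^esub> x) = a \<odot>\<^bsub>M\<^esub> h x" if a: "a \<in> carrier (Qu n q)" and x: "x \<in> carrier N" for a x
  proof -
    obtain u where u: "a = Qu_cls n q u" using a by (auto simp: carrier_Qu)
    note i = \<Psi>in[OF x]
    have "a \<odot>\<^bsub>N\<^esub> x = \<Phi>' (frep T' u (\<Psi> x))"
      using coordsD(6)[OF N i] x by (simp add: \<Phi>\<Psi> u)
    then have 1: "\<Psi> (a \<odot>\<^bsub>N\<^esub> x) = frep T' u (\<Psi> x)" using i coordsD(8)[OF N] by (simp add: \<Psi>\<Phi>)
    have "\<psi> (frep T u (\<theta> (\<Psi> x))) = frep T' u (\<psi> (\<theta> (\<Psi> x)))"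
      by (rule frep_intertwine[where F = ?F]) (use \<psi> coordsD(2)[OF M] I \<theta>in i in auto)
    then have "\<theta> (frep T' u (\<Psi> x)) = frep T u (\<theta> (\<Psi> x))"
      using \<theta>\<psi>[OF coordsD(8)[OF M \<theta>in[OF i]], of u] i by (simp add: \<psi>\<theta>)
    then show ?thesis
      unfolding h_def using 1 coordsD(6)[OF M \<theta>in[OF i]] u by simp
  qed
  have "h \<in> iso (add_monoid N) (add_monoid M)"
    using hb add by (auto simp: iso_def hom_def bij_betw_def)
  then show ?thesis unfolding lmod_iso_def using sm by blast
qed

section \<open>Coordinates on direct sums\<close>

definition dir_sum_ops :: "'i set \<Rightarrow> ('i \<Rightarrow> letter \<Rightarrow> ('b \<Rightarrow> 'k) \<Rightarrow> 'b \<Rightarrow> 'k)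
    \<Rightarrow> letter \<Rightarrow> ('i \<times> 'b \<Rightarrow> 'k::comm_ring_1) \<Rightarrow> 'i \<times> 'b \<Rightarrow> 'k" where
  "dir_sum_ops I T g f = (\<lambda>(l, b). if l \<in> I then T l g (\<lambda>b. f (l, b)) b else 0)"

text \<open>The basis is the disjoint union of the bases. Finiteness of \<open>I\<close> makes the
  finite support condition in \<open>dir_sum\<close> automatic.\<close>

lemma coords_dir_sum:
  assumes fin: "finite I" and c: "\<And>l. l \<in> I \<Longrightarrow> coords n q (M l) (B l) (T l) (\<Phi> l)"
  shows "coords n q (dir_sum I M) (Sigma I B) (dir_sum_ops I T)
           (\<lambda>f. \<lambda>l\<in>I. \<Phi> l (\<lambda>b. f (l, b)))"
  unfolding coords_def
proof (intro conjI allI ballI)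
  fix g
  show "lin (dir_sum_ops I T g)"
  proof (rule linI)
    fix f h :: "'a \<times> 'd \<Rightarrow> 'b"
    have "(\<lambda>b. (f + h) (l, b)) = (\<lambda>b. f (l, b)) + (\<lambda>b. h (l, b))" for l
      by (simp add: plus_fun_def)
    then have "T l g (\<lambda>b. (f + h) (l, b)) = T l g (\<lambda>b. f (l, b)) + T l g (\<lambda>b. h (l, b))" if "l \<in> I" for l
      using lin_add[OF coordsD(1)[OF c[OF that]]] by metis
    then show "dir_sum_ops I T g (f + h) = dir_sum_ops I T g f + dir_sum_ops I T g h"
      by (intro ext) (simp add: dir_sum_ops_def fun_apply split: prod.split)
  next
    fix k and f :: "'a \<times> 'd \<Rightarrow> 'b"
    have "(\<lambda>b. (k *\<^sub>f f) (l, b)) = k *\<^sub>f (\<lambda>b. f (l, b))" for l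
      by (simp add: fscale_def)
    then have "T l g (\<lambda>b. (k *\<^sub>f f) (l, b)) = k *\<^sub>f T l g (\<lambda>b. f (l, b))" if "l \<in> I" for l
      using lin_scale[OF coordsD(1)[OF c[OF that]]] by metis
    then show "dir_sum_ops I T g (k *\<^sub>f f) = k *\<^sub>f dir_sum_ops I T g f"
      by (intro ext) (simp add: dir_sum_ops_def fun_apply split: prod.split)
  qed
next
  fix g and f :: "'a \<times> 'd \<Rightarrow> 'b" assume f: "f \<in> funs_on (Sigma I B)"
  have sl: "(\<lambda>b. f (l, b)) \<in> funs_on (B l)" if "l \<in> I" for l
    using f that by (auto simp: funs_on_def)
  show "dir_sum_ops I T g f \<in> funs_on (Sigma I B)"
  proof (rule funs_onI)
    fix x assume x: "x \<notin> Sigma I B"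
    obtain l b where lb: "x = (l, b)" by (cases x)
    show "dir_sum_ops I T g f x = 0"
    proof (cases "l \<in> I")
      case True
      then have "b \<notin> B l" using x lb by simp
      then show ?thesis using True lb funs_onD[OF coordsD(2)[OF c[OF True] sl[OF True]]]
        by (simp add: dir_sum_ops_def)
    qed (simp add: dir_sum_ops_def lb)
  qed
next
  let ?\<Phi> = "\<lambda>f. \<lambda>l\<in>I. \<Phi> l (\<lambda>b. f (l, b))"
  let ?V = "funs_on (Sigma I B) :: ('a \<times> 'd \<Rightarrow> 'b) set"
  have sl: "(\<lambda>b. f (l, b)) \<in> funs_on (B l)" if "l \<in> I" "f \<in> ?V" for l f
    using that by (auto simp: funs_on_def)
  show "bij_betw ?\<Phi> ?V (carrier (dir_sum I M))"
    unfolding bij_betw_def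
  proof
    show "inj_on ?\<Phi> ?V"
    proof (rule inj_onI)
      fix f h assume f: "f \<in> ?V" "h \<in> ?V" "?\<Phi> f = ?\<Phi> h"
      show "f = h"
      proof
        fix x :: "'a \<times> 'd" obtain l b where x: "x = (l, b)" by (cases x)
        show "f x = h x"
        proof (cases "l \<in> I")
          case True
          then have "\<Phi> l (\<lambda>b. f (l, b)) = \<Phi> l (\<lambda>b. h (l, b))"
            using fun_cong[OF f(3), of l] by simp
          then have "(\<lambda>b. f (l, b)) = (\<lambda>b. h (l, b))"
            using bij_betw_imp_inj_on[OF coordsD(3)[OF c[OF True]]] sl[OF True] f by (meson inj_onD)
          then show ?thesis using x by metis
        next
          case False
          then show ?thesis using f x by (auto simp: funs_on_def)
        qed
      qed
    qed
    show "?\<Phi> ` ?V = carrier (dir_sum I M)"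
    proof (intro equalityI subsetI)
      fix y assume "y \<in> ?\<Phi> ` ?V"
      then show "y \<in> carrier (dir_sum I M)"
        using fin by (auto simp: dir_sum_def intro!: coordsD(7)[OF c] sl)
    next
      fix y assume y: "y \<in> carrier (dir_sum I M)"
      define f where "f = (\<lambda>(l, b). if l \<in> I then inv_into (funs_on (B l)) (\<Phi> l) (y l) b else 0)"
      have yl: "y l \<in> \<Phi> l ` funs_on (B l)" if "l \<in> I" for l
        using y coordsD(3)[OF c[OF that]] that by (auto simp: dir_sum_def bij_betw_def)
      have i: "inv_into (funs_on (B l)) (\<Phi> l) (y l) \<in> funs_on (B l)" if "l \<in> I" for l
        by (rule inv_into_into[OF yl[OF that]])
      have e: "(\<lambda>b. f (l, b)) = inv_into (funs_on (B l)) (\<Phi> l) (y l)" if "l \<in> I" for l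
        using that by (simp add: f_def)
      have "f x = 0" if "x \<notin> Sigma I B" for x
        using that i[of "fst x"] by (auto simp: f_def funs_on_def split: prod.splits)
      then have "f \<in> ?V" by (rule funs_onI)
      moreover have "?\<Phi> f = y"
      proof
        fix l
        show "?\<Phi> f l = y l"
          using y f_inv_into_f[OF yl, of l] e
          by (cases "l \<in> I") (auto simp: dir_sum_def)
      qed
      ultimately show "y \<in> ?\<Phi> ` ?V" by blast
    qed
  qed
next
  show "(\<lambda>l\<in>I. \<Phi> l (\<lambda>b. (0 :: 'a \<times> 'd \<Rightarrow> 'b) (l, b))) = \<zero>\<^bsub>dir_sum I M\<^esub>"
  proof -
    have "(\<lambda>b. (0 :: 'a \<times> 'd \<Rightarrow> 'b) (l, b)) = 0" for l by (auto simp: fun_eq_iff fun_apply)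
    then show ?thesis using coordsD(4)[OF c] by (auto simp: dir_sum_def)
  qed
next
  fix f h :: "'a \<times> 'd \<Rightarrow> 'b" assume f: "f \<in> funs_on (Sigma I B)" "h \<in> funs_on (Sigma I B)"
  have sl: "(\<lambda>b. f (l, b)) \<in> funs_on (B l)" "(\<lambda>b. h (l, b)) \<in> funs_on (B l)" if "l \<in> I" for l
    using that f by (auto simp: funs_on_def)
  have "(\<lambda>b. (f + h) (l, b)) = (\<lambda>b. f (l, b)) + (\<lambda>b. h (l, b))" for l
    by (auto simp: fun_eq_iff fun_apply)
  then show "(\<lambda>l\<in>I. \<Phi> l (\<lambda>b. (f + h) (l, b))) =
      (\<lambda>l\<in>I. \<Phi> l (\<lambda>b. f (l, b))) \<oplus>\<^bsub>dir_sum I M\<^esub> (\<lambda>l\<in>I. \<Phi> l (\<lambda>b. h (l, b)))"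
    using coordsD(5)[OF c sl] by (auto simp: dir_sum_def intro!: restrict_ext)
next
  fix x and f :: "'a \<times> 'd \<Rightarrow> 'b" assume f: "f \<in> funs_on (Sigma I B)"
  have sl: "(\<lambda>b. f (l, b)) \<in> funs_on (B l)" if "l \<in> I" for l
    using that f by (auto simp: funs_on_def)
  have w: "(\<lambda>b. foldr (dir_sum_ops I T) gs f (l, b)) = foldr (T l) gs (\<lambda>b. f (l, b))" if "l \<in> I" for l gs
    using that by (induction gs) (auto simp: dir_sum_ops_def)
  have "(\<lambda>b. frep (dir_sum_ops I T) x f (l, b)) = frep (T l) x (\<lambda>b. f (l, b))" if "l \<in> I" for l
    using w[OF that] by (auto simp: rep_def word_act_def fun_eq_iff fun_apply)
  then show "(\<lambda>l\<in>I. \<Phi> l (\<lambda>b. frep (dir_sum_ops I T) x f (l, b))) =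
      Qu_cls n q x \<odot>\<^bsub>dir_sum I M\<^esub> (\<lambda>l\<in>I. \<Phi> l (\<lambda>b. f (l, b)))"
    using coordsD(6)[OF c sl] by (auto simp: dir_sum_def intro!: restrict_ext)
qed

definition dir_sum2_ops :: "(letter \<Rightarrow> ('b \<Rightarrow> 'k) \<Rightarrow> 'b \<Rightarrow> 'k) \<Rightarrow> (letter \<Rightarrow> ('c \<Rightarrow> 'k) \<Rightarrow> 'c \<Rightarrow> 'k)
    \<Rightarrow> letter \<Rightarrow> ('b + 'c \<Rightarrow> 'k::comm_ring_1) \<Rightarrow> 'b + 'c \<Rightarrow> 'k" where
  "dir_sum2_ops T T' g f = case_sum (T g (\<lambda>b. f (Inl b))) (T' g (\<lambda>b. f (Inr b)))"

lemma case_sum_fun_simps: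
  fixes f :: "'b + 'c \<Rightarrow> 'k::comm_ring_1"
  shows "(\<lambda>b. (f + h) (Inl b)) = (\<lambda>b. f (Inl b)) + (\<lambda>b. h (Inl b))"
    "(\<lambda>b. (f + h) (Inr b)) = (\<lambda>b. f (Inr b)) + (\<lambda>b. h (Inr b))"
    "(\<lambda>b. (k *\<^sub>f f) (Inl b)) = k *\<^sub>f (\<lambda>b. f (Inl b))"
    "(\<lambda>b. (k *\<^sub>f f) (Inr b)) = k *\<^sub>f (\<lambda>b. f (Inr b))"
    "(\<lambda>b. (0 :: 'b + 'c \<Rightarrow> 'k) (Inl b)) = 0"
    "(\<lambda>b. (0 :: 'b + 'c \<Rightarrow> 'k) (Inr b)) = 0"
  by (auto simp: fun_eq_iff fun_apply)

lemma coords_dir_sum2: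
  fixes T :: "letter \<Rightarrow> ('b \<Rightarrow> 'k::field) \<Rightarrow> 'b \<Rightarrow> 'k" and T' :: "letter \<Rightarrow> ('c \<Rightarrow> 'k) \<Rightarrow> 'c \<Rightarrow> 'k"
  assumes M: "coords n q M B T \<Phi>" and N: "coords n q N B' T' \<Phi>'"
  shows "coords n q (dir_sum2 M N) (B <+> B') (dir_sum2_ops T T')
           (\<lambda>f. (\<Phi> (\<lambda>b. f (Inl b)), \<Phi>' (\<lambda>b. f (Inr b))))"
proof -
  let ?\<Phi> = "\<lambda>f. (\<Phi> (\<lambda>b. f (Inl b)), \<Phi>' (\<lambda>b. f (Inr b)))"
  let ?V = "funs_on (B <+> B') :: ('b + 'c \<Rightarrow> 'k) set"
  have sl: "(\<lambda>b. f (Inl b)) \<in> funs_on B" "(\<lambda>b. f (Inr b)) \<in> funs_on B'" if "f \<in> ?V" for f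
    using that by (auto simp: funs_on_def)
  have cs: "case_sum f h \<in> ?V" if "f \<in> funs_on B" "h \<in> funs_on B'" for f h
    using that by (auto simp: funs_on_def split: sum.split)
  have ext_sum: "f = h \<longleftrightarrow> (\<lambda>b. f (Inl b)) = (\<lambda>b. h (Inl b)) \<and> (\<lambda>b. f (Inr b)) = (\<lambda>b. h (Inr b))"
    for f h :: "'b + 'c \<Rightarrow> 'k"
    unfolding fun_eq_iff by (metis old.sum.exhaust)
  have 1: "lin (dir_sum2_ops T T' g)" for g
    by (intro linI ext, simp_all only: dir_sum2_ops_def case_sum_fun_simps
        lin_add[OF coordsD(1)[OF M]] lin_add[OF coordsD(1)[OF N]]
        lin_scale[OF coordsD(1)[OF M]] lin_scale[OF coordsD(1)[OF N]])
      (simp_all add: fun_apply split: sum.split)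
  have 2: "dir_sum2_ops T T' g f \<in> ?V" if "f \<in> ?V" for g f
    unfolding dir_sum2_ops_def by (intro cs coordsD(2)[OF M] coordsD(2)[OF N] sl that)
  have 3: "bij_betw ?\<Phi> ?V (carrier (dir_sum2 M N))"
    unfolding bij_betw_def
  proof
    show "inj_on ?\<Phi> ?V"
    proof (rule inj_onI)
      fix f h assume f: "f \<in> ?V" "h \<in> ?V" "?\<Phi> f = ?\<Phi> h"
      then show "f = h"
        unfolding ext_sum using bij_betw_imp_inj_on[OF coordsD(3)[OF M]]
          bij_betw_imp_inj_on[OF coordsD(3)[OF N]] sl by (auto dest!: inj_onD)
    qed
    show "?\<Phi> ` ?V = carrier (dir_sum2 M N)"
    proof (intro equalityI subsetI)
      fix y assume "y \<in> ?\<Phi> ` ?V"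
      then show "y \<in> carrier (dir_sum2 M N)"
        using coordsD(7)[OF M] coordsD(7)[OF N] sl by (auto simp: dir_sum2_def)
    next
      fix y assume "y \<in> carrier (dir_sum2 M N)"
      then have "fst y \<in> \<Phi> ` funs_on B" "snd y \<in> \<Phi>' ` funs_on B'"
        using coordsD(3)[OF M] coordsD(3)[OF N] by (auto simp: dir_sum2_def bij_betw_def)
      then obtain f h where "f \<in> funs_on B" "h \<in> funs_on B'" "y = (\<Phi> f, \<Phi>' h)"
        by (metis imageE prod.collapse)
      then show "y \<in> ?\<Phi> ` ?V"
        using cs by (intro image_eqI[of _ _ "case_sum f h"]) auto
    qed
  qed
  have w: "(\<lambda>b. foldr (dir_sum2_ops T T') gs f (Inl b)) = foldr T gs (\<lambda>b. f (Inl b))"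
    "(\<lambda>b. foldr (dir_sum2_ops T T') gs f (Inr b)) = foldr T' gs (\<lambda>b. f (Inr b))" for gs f
    by (induction gs) (auto simp: dir_sum2_ops_def)
  have "(\<lambda>b. frep (dir_sum2_ops T T') x f (Inl b)) = frep T x (\<lambda>b. f (Inl b))"
    "(\<lambda>b. frep (dir_sum2_ops T T') x f (Inr b)) = frep T' x (\<lambda>b. f (Inr b))" for x f
    using w by (auto simp: rep_def word_act_def fun_eq_iff fun_apply)
  then show ?thesis
    unfolding coords_def using 1 2 3 sl
    by (auto simp: case_sum_fun_simps coordsD(4)[OF M] coordsD(4)[OF N] dir_sum2_def
        coordsD(5)[OF M] coordsD(5)[OF N] coordsD(6)[OF M] coordsD(6)[OF N])
qed

section \<open>Injective linear maps between coordinate spaces\<close>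

text \<open>The images of the basis vectors are independent by injectivity, and there are as many of
  them as basis vectors of the target, so they span it.\<close>

lemma inj_imp_bij_funs_on:
  fixes \<psi> :: "('b \<Rightarrow> 'k::field) \<Rightarrow> 'c \<Rightarrow> 'k"
  assumes fin: "finite B" "finite C" and card: "card B = card C" and \<psi>: "lin \<psi>"
    and maps: "\<And>f. f \<in> funs_on B \<Longrightarrow> \<psi> f \<in> funs_on C"
    and inj: "\<And>f. f \<in> funs_on B \<Longrightarrow> \<psi> f = 0 \<Longrightarrow> f = 0"
  shows "bij_betw \<psi> (funs_on B) (funs_on C)"
proof -
  interpret V: vector_space "(*\<^sub>f) :: 'k \<Rightarrow> ('c \<Rightarrow> 'k) \<Rightarrow> 'c \<Rightarrow> 'k"
    by unfold_locales (auto simp: fscale_add)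
  have injon: "inj_on \<psi> (funs_on B)"
  proof (rule inj_onI)
    fix f h assume "f \<in> funs_on B" "h \<in> funs_on B" "\<psi> f = \<psi> h"
    then show "f = h" using inj[of "f - h"] lin_diff[OF \<psi>] by simp
  qed
  have dinj: "inj_on (\<lambda>b. \<psi> (delta b)) B"
  proof (rule inj_onI)
    fix b b' assume "b \<in> B" "b' \<in> B" "\<psi> (delta b) = \<psi> (delta b')"
    then have "(delta b :: 'b \<Rightarrow> 'k) = delta b'" using inj_onD[OF injon] by simp
    then show "b = b'" by (metis delta_def zero_neq_one)
  qed
  define S where "S = (\<lambda>b. \<psi> (delta b)) ` B"
  define T where "T = (delta ` C :: ('c \<Rightarrow> 'k) set)"
  have ind: "V.independent S"
  proof (rule V.independent_if_scalars_zero)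
    show "finite S" using fin by (simp add: S_def)
    fix u x assume u: "(\<Sum>x\<in>S. u x *\<^sub>f x) = 0" and x: "x \<in> S"
    define f where "f = (\<lambda>b. if b \<in> B then u (\<psi> (delta b)) else 0)"
    have f: "f \<in> funs_on B" by (auto simp: f_def funs_on_def)
    have "\<psi> f = \<psi> (\<Sum>b\<in>B. f b *\<^sub>f delta b)" using delta_expansion[OF fin(1) f] by simp
    also have "\<dots> = (\<Sum>b\<in>B. u (\<psi> (delta b)) *\<^sub>f \<psi> (delta b))"
      by (simp add: lin_sum[OF \<psi>] lin_scale[OF \<psi>] f_def)
    also have "\<dots> = (\<Sum>x\<in>S. u x *\<^sub>f x)"
      unfolding S_def by (simp add: sum.reindex[OF dinj])
    finally have "f = 0" using u inj[OF f] by simp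
    moreover obtain b where "b \<in> B" "x = \<psi> (delta b)" using x by (auto simp: S_def)
    moreover have "f b = u (\<psi> (delta b))" if "b \<in> B" for b using that by (simp add: f_def)
    ultimately show "u x = 0" by (metis zero_fun_apply)
  qed
  have spanT: "V.span T = funs_on C"
  proof
    have "V.subspace (funs_on C)" by (auto simp: V.subspace_def)
    moreover have "T \<subseteq> funs_on C" by (auto simp: T_def)
    ultimately show "V.span T \<subseteq> funs_on C" by (rule V.span_minimal[rotated])
    show "funs_on C \<subseteq> V.span T"
    proof
      fix f :: "'c \<Rightarrow> 'k" assume "f \<in> funs_on C"
      from delta_expansion[OF fin(2) this]
      show "f \<in> V.span T"
        by (metis (no_types, lifting) T_def V.span_base V.span_scale V.span_sum imageI)
    qed
  qed
  have "card S = card C" using card dinj by (simp add: S_def card_image)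
  moreover have "inj_on (delta :: 'c \<Rightarrow> 'c \<Rightarrow> 'k) C"
    by (rule inj_onI) (metis delta_def zero_neq_one)
  then have "card T = card C" by (simp add: T_def card_image)
  moreover have "S \<subseteq> V.span T" using maps by (auto simp: spanT S_def)
  moreover have "finite T" using fin by (simp add: T_def)
  ultimately obtain t' where t: "card t' = card S" "finite t'" "S \<subseteq> t'" "t' \<subseteq> S \<union> T" "S \<subseteq> V.span t'"
    using V.exchange_lemma[of T S] ind by metis
  have finS: "finite S" using fin by (simp add: S_def)
  \<comment> \<open>A unit vector outside the span of \<open>S\<close> could be added to
    \<open>S\<close>, giving an independent set with more elements than the spanning set
    \<open>T\<close>.\<close>
  have "T \<subseteq> V.span S"
  proof
    fix x assume x: "x \<in> T"
    show "x \<in> V.span S"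
    proof (rule ccontr)
      assume nx: "x \<notin> V.span S"
      have "V.independent (insert x S)" using nx ind V.independent_insertI by blast
      moreover have "insert x S \<subseteq> V.span T"
        using x \<open>S \<subseteq> V.span T\<close> V.span_base by auto
      ultimately have "card (insert x S) \<le> card T"
        using V.independent_span_bound[OF \<open>finite T\<close>] by blast
      moreover have "x \<notin> S" using nx V.span_base by blast
      ultimately show False
        using finS \<open>card S = card C\<close> \<open>card T = card C\<close> by simp
    qed
  qed
  have "V.subspace (\<psi> ` funs_on B)"
  proof (rule V.subspaceI)
    show "0 \<in> \<psi> ` funs_on B" using lin_0[OF \<psi>] by (intro image_eqI[of _ _ 0]) auto
  next
    fix x y assume "x \<in> \<psi> ` funs_on B" "y \<in> \<psi> ` funs_on B"
    then obtain f h where "f \<in> funs_on B" "h \<in> funs_on B" "x = \<psi> f" "y = \<psi> h" by auto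
    then show "x + y \<in> \<psi> ` funs_on B"
      by (intro image_eqI[of _ _ "f + h"]) (auto simp: lin_add[OF \<psi>])
  next
    fix c x assume "x \<in> \<psi> ` funs_on B"
    then obtain f where "f \<in> funs_on B" "x = \<psi> f" by auto
    then show "c *\<^sub>f x \<in> \<psi> ` funs_on B"
      by (intro image_eqI[of _ _ "c *\<^sub>f f"]) (auto simp: lin_scale[OF \<psi>])
  qed
  moreover have "S \<subseteq> \<psi> ` funs_on B" by (auto simp: S_def)
  ultimately have "V.span S \<subseteq> \<psi> ` funs_on B" by (rule V.span_minimal[rotated])
  moreover have "V.span T \<subseteq> V.span S"
    using \<open>T \<subseteq> V.span S\<close> V.span_minimal V.subspace_span by blast
  ultimately have "\<psi> ` funs_on B = funs_on C" using spanT maps by blast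
  with injon show ?thesis by (simp add: bij_betw_def)
qed

text \<open>Along f, F f, F^2 f, ... the last non-zero vector would lie in the kernels of F and of
  \<open>\<psi>\<close>, against \<open>ker\<close>. The induction runs this backwards, removing one
  F at a time from F^N f = 0.\<close>

lemma inj_on_ker_imp_inj:
  fixes \<psi> :: "('b \<Rightarrow> 'k::comm_ring_1) \<Rightarrow> 'c \<Rightarrow> 'k"
  assumes \<psi>: "lin \<psi>" and F': "lin F'"
    and F: "\<And>f. f \<in> V \<Longrightarrow> F f \<in> V" "\<And>f. f \<in> V \<Longrightarrow> \<psi> (F f) = F' (\<psi> f)"
    and nil: "\<And>f. f \<in> V \<Longrightarrow> (F ^^ N) f = 0"
    and ker: "\<And>f. f \<in> V \<Longrightarrow> F f = 0 \<Longrightarrow> \<psi> f = 0 \<Longrightarrow> f = 0"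
    and f: "f \<in> V" "\<psi> f = 0"
  shows "f = 0"
proof -
  have V: "(F ^^ l) f \<in> V" for l by (induction l) (auto simp: F f)
  have z: "\<psi> ((F ^^ l) f) = 0" for l
    by (induction l) (auto simp: F V f lin_0[OF F'])
  have "l \<le> N \<Longrightarrow> (F ^^ (N - l)) f = 0" for l
  proof (induction l)
    case (Suc l)
    then have "F ((F ^^ (N - Suc l)) f) = 0"
      by (metis Suc_diff_Suc Suc_le_lessD Suc_leD funpow.simps(2) o_apply)
    then show ?case using ker[OF V _ z] by blast
  qed (simp add: nil f)
  from this[of N] show ?thesis by simp
qed

section \<open>Coordinates on tensor products\<close>

text \<open>The annihilator of \<open>V\<close> is a two-sided ideal, closure under right
  multiplication being the stability of \<open>V\<close>; so it is enough that the generators of the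
  ideal annihilate \<open>V\<close>.\<close>

lemma genideal_rep_zero:
  fixes m :: "'w::monoid_add \<Rightarrow> ('b \<Rightarrow> 'k::field) \<Rightarrow> 'b \<Rightarrow> 'k"
  assumes m: "monoid_rep m" and V: "\<And>x f. f \<in> V \<Longrightarrow> rep m x f \<in> V"
    and S: "\<And>x f. x \<in> S \<Longrightarrow> f \<in> V \<Longrightarrow> rep m x f = 0"
    and y: "y \<in> Idl\<^bsub>ring_of_type_algebra\<^esub> S" and f: "f \<in> V"
  shows "rep m y f = 0"
proof -
  let ?R = "ring_of_type_algebra :: ('w \<Rightarrow>\<^sub>0 'k) ring"
  define I where "I = {x. \<forall>f\<in>V. rep m x f = 0}"
  interpret ring ?R by (rule ring_ring_of_type_algebra)
  have neg: "\<ominus>\<^bsub>?R\<^esub> x = - x" for x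
    by (rule minus_equality) (simp_all add: ring_of_type_algebra_def)
  have neg: "m_inv \<lparr>carrier = UNIV, monoid.mult = (+), one = (0 :: 'w \<Rightarrow>\<^sub>0 'k)\<rparr> x = - x" for x
    using neg[of x] by (simp add: a_inv_def ring_of_type_algebra_def)
  have "rep m x 0 = 0" for x
    by (rule lin_0, rule lin_rep) (use m in \<open>simp add: monoid_rep_def\<close>)
  then have "ideal I ?R"
    using V by (intro idealI ring_ring_of_type_algebra subgroup.intro)
      (auto simp: I_def ring_of_type_algebra_def rep_add rep_minus rep_mult[OF m] neg)
  moreover have "S \<subseteq> I" using S by (auto simp: I_def)
  ultimately have "y \<in> I" using y by (auto simp: genideal_def)
  then show ?thesis using f by (simp add: I_def)
qed

text \<open>In coordinates this is S \<otimes> id: a function on a product basis is a matrix, and S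
  acts on each of its columns. Likewise \<open>act_snd\<close> is id \<otimes> S, and
  \<open>outer\<close> gives the pure tensors.\<close>

definition act_fst :: "(('b \<Rightarrow> 'k) \<Rightarrow> 'b \<Rightarrow> 'k) \<Rightarrow> ('b \<times> 'c \<Rightarrow> 'k) \<Rightarrow> 'b \<times> 'c \<Rightarrow> 'k"
  where "act_fst S f = (\<lambda>(a, b). S (\<lambda>a. f (a, b)) a)"

definition act_snd :: "(('c \<Rightarrow> 'k) \<Rightarrow> 'c \<Rightarrow> 'k) \<Rightarrow> ('b \<times> 'c \<Rightarrow> 'k) \<Rightarrow> 'b \<times> 'c \<Rightarrow> 'k"
  where "act_snd S f = (\<lambda>(a, b). S (\<lambda>b. f (a, b)) b)"

definition outer :: "('b \<Rightarrow> 'k::times) \<Rightarrow> ('c \<Rightarrow> 'k) \<Rightarrow> 'b \<times> 'c \<Rightarrow> 'k"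
  where "outer f g = (\<lambda>(a, b). f a * g b)"

definition pair_act :: "(letter \<Rightarrow> ('b \<Rightarrow> 'k) \<Rightarrow> 'b \<Rightarrow> 'k) \<Rightarrow> (letter \<Rightarrow> ('c \<Rightarrow> 'k) \<Rightarrow> 'c \<Rightarrow> 'k)
    \<Rightarrow> word \<times> word \<Rightarrow> ('b \<times> 'c \<Rightarrow> 'k) \<Rightarrow> 'b \<times> 'c \<Rightarrow> 'k"
  where "pair_act T1 T2 uv = act_fst (word_act T1 (fst uv)) \<circ> act_snd (word_act T2 (snd uv))"

definition tensor_ops :: "nat \<Rightarrow> 'k::field \<Rightarrow> (letter \<Rightarrow> ('b \<Rightarrow> 'k) \<Rightarrow> 'b \<Rightarrow> 'k)
    \<Rightarrow> (letter \<Rightarrow> ('c \<Rightarrow> 'k) \<Rightarrow> 'c \<Rightarrow> 'k) \<Rightarrow> letter \<Rightarrow> ('b \<times> 'c \<Rightarrow> 'k) \<Rightarrow> 'b \<times> 'c \<Rightarrow> 'k"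
  where "tensor_ops n q T1 T2 g = rep (pair_act T1 T2) (comult_gen n q g)"

lemma slice_simps:
  fixes f :: "'b \<times> 'c \<Rightarrow> 'k::comm_ring_1"
  shows "(\<lambda>a. (f + h) (a, b)) = (\<lambda>a. f (a, b)) + (\<lambda>a. h (a, b))"
    "(\<lambda>b. (f + h) (a, b)) = (\<lambda>b. f (a, b)) + (\<lambda>b. h (a, b))"
    "(\<lambda>a. (k *\<^sub>f f) (a, b)) = k *\<^sub>f (\<lambda>a. f (a, b))"
    "(\<lambda>b. (k *\<^sub>f f) (a, b)) = k *\<^sub>f (\<lambda>b. f (a, b))"
    "(\<lambda>a. (\<Sum>i\<in>I. F i) (a, b)) = (\<Sum>i\<in>I. (\<lambda>a. F i (a, b)))"
    "(\<lambda>b. (\<Sum>i\<in>I. F i) (a, b)) = (\<Sum>i\<in>I. (\<lambda>b. F i (a, b)))"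
  by (simp_all add: fun_eq_iff fun_apply)

lemma lin_act_fst:
  assumes "lin S" shows "lin (act_fst S)"
  by (intro linI ext, unfold act_fst_def case_prod_unfold slice_simps lin_add[OF assms] lin_scale[OF assms])
    (simp_all add: fun_apply)

lemma lin_act_snd:
  assumes "lin S" shows "lin (act_snd S)"
  by (intro linI ext, unfold act_snd_def case_prod_unfold slice_simps lin_add[OF assms] lin_scale[OF assms])
    (simp_all add: fun_apply)

lemma act_comp:
  "act_fst (S \<circ> S') f = act_fst S (act_fst S' f)" "act_snd (R \<circ> R') f = act_snd R (act_snd R' f)"
  "act_fst id f = f" "act_snd id f = f"
  by (auto simp: act_fst_def act_snd_def)

lemma act_fst_outer: assumes "lin S" shows "act_fst S (outer f g) = outer (S f) g"
proof -
  have "(\<lambda>a. outer f g (a, b)) = g b *\<^sub>f f" for b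
    by (simp add: outer_def fscale_def mult.commute)
  then show ?thesis
    by (simp add: act_fst_def lin_scale[OF assms] fscale_apply outer_def mult.commute)
qed

lemma act_snd_outer: assumes "lin R" shows "act_snd R (outer f g) = outer f (R g)"
proof -
  have "(\<lambda>b. outer f g (a, b)) = f a *\<^sub>f g" for a
    by (simp add: outer_def fscale_def)
  then show ?thesis
    by (simp add: act_snd_def lin_scale[OF assms] fscale_apply outer_def)
qed

lemma funs_on_slice:
  "f \<in> funs_on (B \<times> C) \<Longrightarrow> (\<lambda>a. f (a, b)) \<in> funs_on B"
  "f \<in> funs_on (B \<times> C) \<Longrightarrow> (\<lambda>b. f (a, b)) \<in> funs_on C"
  "f \<in> funs_on (B \<times> C) \<Longrightarrow> b \<notin> C \<Longrightarrow> (\<lambda>a. f (a, b)) = (\<lambda>a. 0)"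
  "f \<in> funs_on (B \<times> C) \<Longrightarrow> a \<notin> B \<Longrightarrow> (\<lambda>b. f (a, b)) = (\<lambda>b. 0)"
  by (auto simp: funs_on_def)

lemma lookup_map_scale: "Poly_Mapping.lookup (Poly_Mapping.map ((*) c) t) k = c * Poly_Mapping.lookup t k"
  for c :: "'k::field"
  by (simp add: map.rep_eq when_def)

lemma map_scale:
  fixes c :: "'k::field"
  shows "Poly_Mapping.map ((*) c) (t + t') = Poly_Mapping.map ((*) c) t + Poly_Mapping.map ((*) c) t'"
    "Poly_Mapping.map ((*) c) (t - t') = Poly_Mapping.map ((*) c) t - Poly_Mapping.map ((*) c) t'"
    "Poly_Mapping.map ((*) (- 1)) u = - (u :: 'w \<Rightarrow>\<^sub>0 'k)"
  by (rule poly_mapping_eqI, simp add: lookup_map_scale lookup_add lookup_minus algebra_simps)+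

text \<open>That the two actions commute is assumed because S \<otimes> id and id \<otimes> R,
  defined by slices, need not commute for linear maps that are sensitive to infinite supports. For
  explicit matrices it is a computation, see \<open>S_ops_commute\<close>.\<close>

locale tensor_coords =
  fixes n :: nat and q :: "'k::field"
    and M :: "('k falg set, 'm) module" and N :: "('k falg set, 'p) module"
    and B :: "'b set" and C :: "'c set" and T1 T2 \<Phi>1 \<Phi>2
  assumes M: "coords n q M B T1 \<Phi>1" and N: "coords n q N C T2 \<Phi>2"
    and fin: "finite B" "finite C"
    and commute: "\<And>g h (f :: 'b \<times> 'c \<Rightarrow> 'k).
        act_fst (T1 g) (act_snd (T2 h) f) = act_snd (T2 h) (act_fst (T1 g) f)"
begin

abbreviation "V \<equiv> funs_on (B \<times> C) :: ('b \<times> 'c \<Rightarrow> 'k) set"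
abbreviation "rep2 \<equiv> rep (pair_act T1 T2)"
abbreviation "TW \<equiv> tensor_ops n q T1 T2"

lemma lin_words: "lin (word_act T1 u)" "lin (word_act T2 u)"
  unfolding word_act_def using coordsD(1)[OF M] coordsD(1)[OF N] by (auto intro: lin_foldr)

lemma commute_words:
  "act_fst (foldr T1 gs) (act_snd (foldr T2 hs) f) = act_snd (foldr T2 hs) (act_fst (foldr T1 gs) f)"
proof (induction gs arbitrary: f)
  case (Cons g gs)
  have *: "act_fst (T1 g) (act_snd (foldr T2 hs) f) = act_snd (foldr T2 hs) (act_fst (T1 g) f)" for f
  proof (induction hs arbitrary: f)
    case (Cons h hs)
    show ?case unfolding foldr.simps act_comp commute Cons ..
  qed (simp add: act_comp)
  show ?case unfolding foldr.simps act_comp Cons * ..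
qed (simp add: act_comp)

lemma monoid_rep_pair_act: "monoid_rep (pair_act T1 T2)"
  unfolding monoid_rep_def
proof (intro conjI allI)
  show "lin (pair_act T1 T2 uv)" for uv
    unfolding pair_act_def by (intro lin_comp lin_act_fst lin_act_snd lin_words)
  show "pair_act T1 T2 0 = id"
    by (auto simp: pair_act_def word_act_def zero_word_def act_comp)
  show "pair_act T1 T2 (u + v) = pair_act T1 T2 u \<circ> pair_act T1 T2 v" for u v
  proof
    fix f
    have 1: "foldr T1 (gs @ hs) = foldr T1 gs \<circ> foldr T1 hs"
      "foldr T2 (gs @ hs) = foldr T2 gs \<circ> foldr T2 hs" for gs hs
      by (simp_all add: fun_eq_iff)
    show "pair_act T1 T2 (u + v) f = (pair_act T1 T2 u \<circ> pair_act T1 T2 v) f"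
      unfolding pair_act_def word_act_def plus_word_def o_apply fst_add snd_add word.sel
      by (simp only: 1 act_comp commute_words)
  qed
qed

lemma rep2_tens: "rep2 (x \<otimes>\<^sub>k y) f = act_fst (frep T1 x) (act_snd (frep T2 y) f)"
proof
  fix ab :: "'b \<times> 'c" obtain a b where ab: "ab = (a, b)" by (cases ab)
  have "rep2 (x \<otimes>\<^sub>k y) f = (\<Sum>u\<in>Poly_Mapping.keys x. \<Sum>v\<in>Poly_Mapping.keys y.
      (Poly_Mapping.lookup x u * Poly_Mapping.lookup y v) *\<^sub>f act_fst (word_act T1 u) (act_snd (word_act T2 v) f))"
    by (simp add: tens_def rep_sum pair_act_def)
  also have "\<dots> = (\<Sum>u\<in>Poly_Mapping.keys x. Poly_Mapping.lookup x u *\<^sub>f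
      act_fst (word_act T1 u) (\<Sum>v\<in>Poly_Mapping.keys y. Poly_Mapping.lookup y v *\<^sub>f act_snd (word_act T2 v) f))"
    by (simp add: lin_sum[OF lin_act_fst[OF lin_words(1)]] lin_scale[OF lin_act_fst[OF lin_words(1)]] fscale_sum)
  also have "(\<Sum>v\<in>Poly_Mapping.keys y. Poly_Mapping.lookup y v *\<^sub>f act_snd (word_act T2 v) f) = act_snd (frep T2 y) f"
    by (simp add: fun_eq_iff fun_apply act_snd_def rep_def)
  finally have e: "rep2 (x \<otimes>\<^sub>k y) f = (\<Sum>u\<in>Poly_Mapping.keys x. Poly_Mapping.lookup x u *\<^sub>f
      act_fst (word_act T1 u) (act_snd (frep T2 y) f))" .
  show "rep2 (x \<otimes>\<^sub>k y) f ab = act_fst (frep T1 x) (act_snd (frep T2 y) f) ab"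
    unfolding e by (simp add: ab fun_apply act_fst_def rep_def)
qed

text \<open>Both sides are multiplicative in words and agree on letters, \<open>tensor_ops\<close>
  being the action through the values of \<Delta> on the generators.\<close>

lemma rep2_comult: "rep2 (comult_free n q x) f = frep TW x f"
proof -
  have "rep2 (comult_free n q x) f = (\<Sum>w\<in>Poly_Mapping.keys x. Poly_Mapping.lookup x w *\<^sub>f
      foldr (\<lambda>g. rep2 (comult_gen n q g)) (letters w) f)"
    by (simp add: comult_free_def rep_sum rep_mult[OF monoid_rep_pair_act]
        rep_const[OF monoid_rep_pair_act] rep_prod_list[OF monoid_rep_pair_act])
  then show ?thesis by (simp add: rep_def word_act_def tensor_ops_def[abs_def])
qed

lemma act_fst_V: "f \<in> V \<Longrightarrow> act_fst (frep T1 x) f \<in> V"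
  and act_snd_V: "f \<in> V \<Longrightarrow> act_snd (frep T2 x) f \<in> V"
proof -
  have z: "frep T1 x (\<lambda>a. 0) = (\<lambda>a. 0)" "frep T2 x (\<lambda>a. 0) = (\<lambda>a. 0)" for x
    using lin_0[OF lin_rep[of "word_act T1" x, OF lin_words(1)]]
      lin_0[OF lin_rep[of "word_act T2" x, OF lin_words(2)]] by (simp_all add: zero_fun_def)
  show "act_fst (frep T1 x) f \<in> V" if f: "f \<in> V"
  proof (rule funs_onI)
    fix ab assume "ab \<notin> B \<times> C"
    then consider "fst ab \<notin> B" | "snd ab \<notin> C" by (metis SigmaI prod.collapse)
    then show "act_fst (frep T1 x) f ab = 0"
      using funs_onD[OF coordsD(8)[OF M funs_on_slice(1)[OF f]]] funs_on_slice(3)[OF f]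
      by cases (simp_all add: act_fst_def z case_prod_unfold)
  qed
  show "act_snd (frep T2 x) f \<in> V" if f: "f \<in> V"
  proof (rule funs_onI)
    fix ab assume "ab \<notin> B \<times> C"
    then consider "fst ab \<notin> B" | "snd ab \<notin> C" by (metis SigmaI prod.collapse)
    then show "act_snd (frep T2 x) f ab = 0"
      using funs_onD[OF coordsD(8)[OF N funs_on_slice(2)[OF f]]] funs_on_slice(4)[OF f]
      by cases (simp_all add: act_snd_def z case_prod_unfold)
  qed
qed

lemma rep2_V: assumes f: "f \<in> V" shows "rep2 d f \<in> V"
proof -
  have 1: "word_act T1 u = frep T1 (Poly_Mapping.single u 1)"
    "word_act T2 u = frep T2 (Poly_Mapping.single u 1)" for u
    by (simp_all add: fun_eq_iff)
  have "act_fst (word_act T1 u) h \<in> V" "act_snd (word_act T2 u) h \<in> V" if "h \<in> V" for u h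
    using act_fst_V[OF that, of "Poly_Mapping.single u 1"] act_snd_V[OF that, of "Poly_Mapping.single u 1"]
    by (simp_all only: 1[symmetric])
  then have "pair_act T1 T2 uv f \<in> V" for uv
    using f by (simp add: pair_act_def)
  then show ?thesis unfolding rep_def by (intro funs_on_sum funs_on_simps)
qed

text \<open>The generators y \<otimes> 1 and 1 \<otimes> y of the ideal act through one factor,
  where y acts as zero because the factor is a module over \<open>Qu\<close>.\<close>

lemma rep2_ideal:
  assumes d: "d \<in> Qu2_ideal n q" and f: "f \<in> V"
  shows "rep2 d f = 0"
proof (rule genideal_rep_zero[OF monoid_rep_pair_act rep2_V _ d[unfolded Qu2_ideal_def] f])
  fix x f assume x: "x \<in> (\<lambda>x. x \<otimes>\<^sub>k 1) ` Qu_ideal n q \<union> (\<lambda>x. 1 \<otimes>\<^sub>k x) ` Qu_ideal n q"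
    and f: "f \<in> V"
  from x show "rep2 x f = 0"
  proof
    assume "x \<in> (\<lambda>x. x \<otimes>\<^sub>k 1) ` Qu_ideal n q"
    then obtain y where y: "x = y \<otimes>\<^sub>k 1" "y \<in> Qu_ideal n q" by blast
    have "frep T1 y (\<lambda>a. g (a, b)) = 0" if "g \<in> V" for g :: "'b \<times> 'c \<Rightarrow> 'k" and b
      by (rule coords_kills_ideal[OF M y(2) funs_on_slice(1)[OF that]])
    then show ?thesis
      using act_snd_V[OF f, of 1] by (auto simp: y rep2_tens act_fst_def fun_apply fun_eq_iff)
  next
    assume "x \<in> (\<lambda>x. 1 \<otimes>\<^sub>k x) ` Qu_ideal n q"
    then obtain y where y: "x = 1 \<otimes>\<^sub>k y" "y \<in> Qu_ideal n q" by blast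
    have "frep T2 y (\<lambda>b. f (a, b)) = 0" for a
      by (rule coords_kills_ideal[OF N y(2) funs_on_slice(2)[OF f]])
    then have "act_snd (frep T2 y) f = 0" by (simp add: act_snd_def fun_apply fun_eq_iff)
    moreover have "frep T1 1 = id"
      using rep_one[OF coordsD(9)[OF M]] by (simp add: fun_eq_iff)
    ultimately show ?thesis by (simp add: y rep2_tens act_comp)
  qed
qed

section \<open>Evaluation of formal sums of pairs, and the null space of the bilinearity
  relations\<close>

abbreviation "W \<equiv> free_space (carrier M \<times> carrier N) :: ('k, ('m \<times> 'p) \<Rightarrow>\<^sub>0 'k) module"
definition "\<Psi>1 = inv_into (funs_on B) \<Phi>1"
definition "\<Psi>2 = inv_into (funs_on C) \<Phi>2"

text \<open>The canonical map from formal sums of pairs to the tensor product, read in coordinates: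
  (x, y) goes to the matrix of the pure tensor x \<otimes> y.\<close>

definition tval :: "(('m \<times> 'p) \<Rightarrow>\<^sub>0 'k) \<Rightarrow> 'b \<times> 'c \<Rightarrow> 'k" where
  "tval t = rep (\<lambda>xy _. outer (\<Psi>1 (fst xy)) (\<Psi>2 (snd xy))) t 0"

lemma tval_simps:
  "tval (t + t') = tval t + tval t'" "tval (t - t') = tval t - tval t'" "tval (- t) = - tval t"
  "tval 0 = 0" "tval (Poly_Mapping.single (x, y) c) = c *\<^sub>f outer (\<Psi>1 x) (\<Psi>2 y)"
  "tval (\<Sum>i\<in>I. F i) = (\<Sum>i\<in>I. tval (F i))"
  by (simp_all add: tval_def rep_add rep_diff rep_minus rep_sum)

lemma tval_scale: "tval (Poly_Mapping.map ((*) c) t) = c *\<^sub>f tval t"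
proof (induction t rule: poly_mapping_add_induct)
  case (single w d)
  then show ?case by (cases w) (simp add: tval_simps map_single)
next
  case (add x y)
  then show ?case by (simp add: map_scale tval_simps fscale_add)
next
  case zero
  have "Poly_Mapping.map ((*) c) 0 = (0 :: ('m \<times> 'p) \<Rightarrow>\<^sub>0 'k)"
    by (rule poly_mapping_eqI) (simp add: lookup_map_scale)
  then show ?case by (simp add: tval_simps)
qed

lemma \<Psi>\<Phi>: "f \<in> funs_on B \<Longrightarrow> \<Psi>1 (\<Phi>1 f) = f" "g \<in> funs_on C \<Longrightarrow> \<Psi>2 (\<Phi>2 g) = g"
  unfolding \<Psi>1_def \<Psi>2_def using coordsD(3)[OF M] coordsD(3)[OF N]
  by (simp_all add: bij_betw_inv_into_left)

lemma coords_cases: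
  assumes "x \<in> carrier M" obtains f where "f \<in> funs_on B" "x = \<Phi>1 f" "\<Psi>1 x = f"
proof -
  have "x \<in> \<Phi>1 ` funs_on B" using coordsD(3)[OF M] assms by (simp add: bij_betw_def)
  then show ?thesis using that \<Psi>\<Phi>(1) by (elim imageE) simp
qed

lemma coords_cases2:
  assumes "x \<in> carrier N" obtains f where "f \<in> funs_on C" "x = \<Phi>2 f" "\<Psi>2 x = f"
proof -
  have "x \<in> \<Phi>2 ` funs_on C" using coordsD(3)[OF N] assms by (simp add: bij_betw_def)
  then show ?thesis using that \<Psi>\<Phi>(2) by (elim imageE) simp
qed

lemma outer_V: "f \<in> funs_on B \<Longrightarrow> g \<in> funs_on C \<Longrightarrow> outer f g \<in> V"
  by (auto simp: funs_on_def outer_def)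

lemma outer_add:
  "outer (f + f') g = outer f g + outer f' g" "outer f (g + g') = outer f g + outer f g'"
  "outer (c *\<^sub>f f) g = c *\<^sub>f outer f g" "outer f (c *\<^sub>f g) = c *\<^sub>f outer f g"
  for f f' :: "'b \<Rightarrow> 'k" and g g' :: "'c \<Rightarrow> 'k"
  by (auto simp: outer_def fun_eq_iff fun_apply algebra_simps)

lemma tval_V: "Poly_Mapping.keys t \<subseteq> carrier M \<times> carrier N \<Longrightarrow> tval t \<in> V"
  unfolding tval_def rep_def
  by (intro funs_on_sum funs_on_simps outer_V) (auto elim!: coords_cases coords_cases2)

lemma W_simps:
  "t \<in> carrier W \<longleftrightarrow> Poly_Mapping.keys t \<subseteq> carrier M \<times> carrier N"
  "t \<oplus>\<^bsub>W\<^esub> t' = t + t'" "\<zero>\<^bsub>W\<^esub> = 0" "c \<odot>\<^bsub>W\<^esub> t = Poly_Mapping.map ((*) c) t"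
  by (simp_all add: free_space_def)

lemma carrier_W:
  "0 \<in> carrier W" "t \<in> carrier W \<Longrightarrow> t' \<in> carrier W \<Longrightarrow> t + t' \<in> carrier W"
  "t \<in> carrier W \<Longrightarrow> - t \<in> carrier W"
  "t \<in> carrier W \<Longrightarrow> t' \<in> carrier W \<Longrightarrow> t - t' \<in> carrier W"
  "t \<in> carrier W \<Longrightarrow> Poly_Mapping.map ((*) c) t \<in> carrier W"
  "x \<in> carrier M \<Longrightarrow> y \<in> carrier N \<Longrightarrow> Poly_Mapping.single (x, y) c \<in> carrier W"
proof -
  show add: "t \<in> carrier W \<Longrightarrow> t' \<in> carrier W \<Longrightarrow> t + t' \<in> carrier W" for t t'
    using keys_add[of t t'] by (auto simp: W_simps)
  show neg: "t \<in> carrier W \<Longrightarrow> - t \<in> carrier W" for t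
    by (auto simp: W_simps in_keys_iff subset_iff)
  show "t \<in> carrier W \<Longrightarrow> t' \<in> carrier W \<Longrightarrow> t - t' \<in> carrier W"
    using add[of t "- t'"] neg[of t'] by simp
  show "t \<in> carrier W \<Longrightarrow> Poly_Mapping.map ((*) c) t \<in> carrier W"
    by (auto simp: W_simps in_keys_iff subset_iff map.rep_eq when_def split: if_splits)
qed (auto simp: W_simps)

lemma carrier_W_sum: "(\<And>i. i \<in> I \<Longrightarrow> F i \<in> carrier W) \<Longrightarrow> (\<Sum>i\<in>I. F i) \<in> carrier W"
  by (induction I rule: infinite_finite_induct) (auto intro: carrier_W)

text \<open>A section of \<open>tval\<close> that uses pairs of basis vectors only. Modulo the
  bilinearity relations it is a normal form, and this identifies their span in
  \<open>tens_null_eq\<close>.\<close>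

definition "basis_expansion f = (\<Sum>a\<in>B. \<Sum>b\<in>C. Poly_Mapping.single (\<Phi>1 (delta a), \<Phi>2 (delta b)) (f (a, b)))"

lemma basis_expansion_W: "basis_expansion f \<in> carrier W"
  unfolding basis_expansion_def
  by (intro carrier_W_sum carrier_W coordsD(7)[OF M] coordsD(7)[OF N]) auto

lemma tval_basis_expansion: assumes f: "f \<in> V" shows "tval (basis_expansion f) = f"
proof
  fix ab :: "'b \<times> 'c" obtain a b where ab: "ab = (a, b)" by (cases ab)
  have "tval (basis_expansion f) ab = (\<Sum>a'\<in>B. \<Sum>b'\<in>C. f (a', b') * (delta a' a * delta b' b))"
    by (simp add: basis_expansion_def tval_simps \<Psi>\<Phi> fun_apply ab outer_def)
  also have "\<dots> = (\<Sum>a'\<in>B. if a = a' then \<Sum>b'\<in>C. if b = b' then f (a', b') else 0 else 0)"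
    by (intro sum.cong refl) (auto simp: delta_def intro!: sum.cong)
  also have "\<dots> = (if a \<in> B \<and> b \<in> C then f (a, b) else 0)"
    using fin by simp
  also have "\<dots> = f ab" using f ab by (auto simp: funs_on_def)
  finally show "tval (basis_expansion f) ab = f ab" .
qed

lemma bilin_rels_tval: "t \<in> bilin_rels n q M N \<Longrightarrow> t \<in> carrier W \<and> tval t = 0"
  unfolding bilin_rels_def
proof (elim UnE CollectE exE conjE)
  fix x x' y assume t: "t = Poly_Mapping.single (x \<oplus>\<^bsub>M\<^esub> x', y) 1 - Poly_Mapping.single (x, y) 1 -
      Poly_Mapping.single (x', y) 1" and "x \<in> carrier M" "x' \<in> carrier M" and y: "y \<in> carrier N"
  then obtain f f' where f: "f \<in> funs_on B" "x = \<Phi>1 f" "\<Psi>1 x = f" "f' \<in> funs_on B" "x' = \<Phi>1 f'" "\<Psi>1 x' = f'"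
    by (metis coords_cases)
  then have e: "x \<oplus>\<^bsub>M\<^esub> x' = \<Phi>1 (f + f')" using coordsD(5)[OF M] by simp
  show ?thesis unfolding t e using f y
    by (auto intro!: carrier_W coordsD(7)[OF M] simp: tval_simps \<Psi>\<Phi> outer_add)
next
  fix x y y' assume t: "t = Poly_Mapping.single (x, y \<oplus>\<^bsub>N\<^esub> y') 1 - Poly_Mapping.single (x, y) 1 -
      Poly_Mapping.single (x, y') 1" and "y \<in> carrier N" "y' \<in> carrier N" and x: "x \<in> carrier M"
  then obtain f f' where f: "f \<in> funs_on C" "y = \<Phi>2 f" "\<Psi>2 y = f" "f' \<in> funs_on C" "y' = \<Phi>2 f'" "\<Psi>2 y' = f'"
    by (metis coords_cases2)
  then have e: "y \<oplus>\<^bsub>N\<^esub> y' = \<Phi>2 (f + f')" using coordsD(5)[OF N] by simp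
  show ?thesis unfolding t e using f x
    by (auto intro!: carrier_W coordsD(7)[OF N] simp: tval_simps \<Psi>\<Phi> outer_add)
next
  fix c x y assume t: "t = Poly_Mapping.single (Qu_cls n q (const c) \<odot>\<^bsub>M\<^esub> x, y) 1 - Poly_Mapping.single (x, y) c"
    and "x \<in> carrier M" and y: "y \<in> carrier N"
  then obtain f where f: "f \<in> funs_on B" "x = \<Phi>1 f" "\<Psi>1 x = f" by (metis coords_cases)
  then have e: "Qu_cls n q (const c) \<odot>\<^bsub>M\<^esub> x = \<Phi>1 (c *\<^sub>f f)" using coords_scale[OF M] by simp
  show ?thesis unfolding t e using f y
    by (auto intro!: carrier_W coordsD(7)[OF M] simp: tval_simps \<Psi>\<Phi> outer_add)
next
  fix c x y assume t: "t = Poly_Mapping.single (x, Qu_cls n q (const c) \<odot>\<^bsub>N\<^esub> y) 1 - Poly_Mapping.single (x, y) c"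
    and "y \<in> carrier N" and x: "x \<in> carrier M"
  then obtain f where f: "f \<in> funs_on C" "y = \<Phi>2 f" "\<Psi>2 y = f" by (metis coords_cases2)
  then have e: "Qu_cls n q (const c) \<odot>\<^bsub>N\<^esub> y = \<Phi>2 (c *\<^sub>f f)" using coords_scale[OF N] by simp
  show ?thesis unfolding t e using f x
    by (auto intro!: carrier_W coordsD(7)[OF N] simp: tval_simps \<Psi>\<Phi> outer_add)
qed

lemma inv_W: "t \<in> carrier W \<Longrightarrow> inv\<^bsub>add_monoid W\<^esub> t = - t"
  unfolding m_inv_def
proof (rule the_equality)
  assume t: "t \<in> carrier W"
  then show "- t \<in> carrier (add_monoid W) \<and>
      t \<otimes>\<^bsub>add_monoid W\<^esub> - t = \<one>\<^bsub>add_monoid W\<^esub> \<and> - t \<otimes>\<^bsub>add_monoid W\<^esub> t = \<one>\<^bsub>add_monoid W\<^esub>"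
    using carrier_W(3) by (simp add: free_space_def)
  fix y assume "y \<in> carrier (add_monoid W) \<and> t \<otimes>\<^bsub>add_monoid W\<^esub> y = \<one>\<^bsub>add_monoid W\<^esub> \<and>
      y \<otimes>\<^bsub>add_monoid W\<^esub> t = \<one>\<^bsub>add_monoid W\<^esub>"
  then show "y = - t" by (simp add: free_space_def eq_neg_iff_add_eq_0)
qed

text \<open>The kernel of \<open>tval\<close> is a submodule containing the relations. Conversely,
  modulo any submodule with the relations each t is congruent to
  \<open>basis_expansion (tval t)\<close>, which is 0 if \<open>tval t = 0\<close>.\<close>

lemma tens_null_eq: "tens_null n q M N = {t \<in> carrier W. tval t = 0}"
proof (intro equalityI subsetI)
  fix t assume t: "t \<in> tens_null n q M N"
  let ?H = "{t \<in> carrier W. tval t = 0}"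
  have "subgroup ?H (add_monoid W)"
  proof (rule subgroup.intro)
    fix x assume "x \<in> ?H"
    then show "inv\<^bsub>add_monoid W\<^esub> x \<in> ?H" using carrier_W(3)[of x] by (simp add: inv_W tval_simps)
  qed (use carrier_W in \<open>auto simp: W_simps(2,3) tval_simps\<close>)
  then have "submodule ?H (ring_of_type_algebra :: 'k ring) W"
    unfolding submodule_def submodule_axioms_def
    by (auto simp: W_simps(4) tval_scale intro: carrier_W)
  moreover have "bilin_rels n q M N \<subseteq> ?H" using bilin_rels_tval by auto
  ultimately show "t \<in> ?H"
    using t unfolding tens_null_def submodule_gen_def by blast
next
  fix t assume t: "t \<in> {t \<in> carrier W. tval t = 0}"
  show "t \<in> tens_null n q M N"
    unfolding tens_null_def submodule_gen_def
  proof (rule InterI, elim CollectE conjE)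
    fix H assume H: "submodule H (ring_of_type_algebra :: 'k ring) W" "bilin_rels n q M N \<subseteq> H"
    interpret submodule H "ring_of_type_algebra :: 'k ring" W by fact
    have H0: "0 \<in> H" using one_closed by (simp add: W_simps)
    have Hadd: "u + v \<in> H" if "u \<in> H" "v \<in> H" for u v
      using m_closed[OF that] by (simp add: W_simps)
    have Hsc: "Poly_Mapping.map ((*) c) u \<in> H" if "u \<in> H" for u c
      using smult_closed[OF _ that, of c] by (simp add: W_simps ring_of_type_algebra_def)
    have Hneg: "- u \<in> H" if "u \<in> H" for u
      using Hsc[OF that, of "-1"] by (simp add: map_scale)
    have Hdiff: "u - v \<in> H" if "u \<in> H" "v \<in> H" for u v
      using Hadd[OF that(1) Hneg[OF that(2)]] by simp
    define sim where "sim u v \<longleftrightarrow> u - v \<in> H" for u v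
    have sim_refl: "sim u u" for u using H0 by (simp add: sim_def)
    have sim_trans: "sim u v \<Longrightarrow> sim v w \<Longrightarrow> sim u w" for u v w
      using Hadd[of "u - v" "v - w"] by (simp add: sim_def)
    have sim_add: "sim u v \<Longrightarrow> sim u' v' \<Longrightarrow> sim (u + u') (v + v')" for u v u' v'
      using Hadd[of "u - v" "u' - v'"] by (simp add: sim_def algebra_simps)
    have sim_sum: "(\<And>i. i \<in> I \<Longrightarrow> sim (F i) (G i)) \<Longrightarrow> sim (\<Sum>i\<in>I. F i) (\<Sum>i\<in>I. G i)"
      for I :: "'z set" and F G
      by (induction I rule: infinite_finite_induct) (auto intro: sim_add sim_refl)
    let ?s = "Poly_Mapping.single"
    have r1: "sim (?s (x \<oplus>\<^bsub>M\<^esub> x', y) c) (?s (x, y) c + ?s (x', y) c)"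
      if "x \<in> carrier M" "x' \<in> carrier M" "y \<in> carrier N" for x x' y c
    proof -
      have "?s (x \<oplus>\<^bsub>M\<^esub> x', y) 1 - ?s (x, y) 1 - ?s (x', y) 1 \<in> H"
        by (rule subsetD[OF H(2)], unfold bilin_rels_def) (use that in blast)
      from Hsc[OF this, of c] show ?thesis
        by (simp add: sim_def map_scale algebra_simps)
    qed
    have r2: "sim (?s (x, y \<oplus>\<^bsub>N\<^esub> y') c) (?s (x, y) c + ?s (x, y') c)"
      if "x \<in> carrier M" "y \<in> carrier N" "y' \<in> carrier N" for x y y' c
    proof -
      have "?s (x, y \<oplus>\<^bsub>N\<^esub> y') 1 - ?s (x, y) 1 - ?s (x, y') 1 \<in> H"
        by (rule subsetD[OF H(2)], unfold bilin_rels_def) (use that in blast)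
      from Hsc[OF this, of c] show ?thesis
        by (simp add: sim_def map_scale algebra_simps)
    qed
    have r3: "sim (?s (Qu_cls n q (const d) \<odot>\<^bsub>M\<^esub> x, y) c) (?s (x, y) (c * d))"
      if "x \<in> carrier M" "y \<in> carrier N" for x y c d
    proof -
      have "?s (Qu_cls n q (const d) \<odot>\<^bsub>M\<^esub> x, y) 1 - ?s (x, y) d \<in> H"
        by (rule subsetD[OF H(2)], unfold bilin_rels_def) (use that in blast)
      from Hsc[OF this, of c] show ?thesis
        by (simp add: sim_def map_scale)
    qed
    have r4: "sim (?s (x, Qu_cls n q (const d) \<odot>\<^bsub>N\<^esub> y) c) (?s (x, y) (c * d))"
      if "x \<in> carrier M" "y \<in> carrier N" for x y c d
    proof -
      have "?s (x, Qu_cls n q (const d) \<odot>\<^bsub>N\<^esub> y) 1 - ?s (x, y) d \<in> H"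
        by (rule subsetD[OF H(2)], unfold bilin_rels_def) (use that in blast)
      from Hsc[OF this, of c] show ?thesis
        by (simp add: sim_def map_scale)
    qed
    \<comment> \<open>The pair (0, y) is a basis vector of the free space and not its zero; it
      becomes congruent to 0 by pulling out the scalar 0. This starts the induction over the basis
      in \<open>e1\<close>.\<close>
    have z1: "sim (?s (\<Phi>1 0, y) c) 0" if y: "y \<in> carrier N" for y c
    proof -
      have "Qu_cls n q (const 0) \<odot>\<^bsub>M\<^esub> \<Phi>1 0 = \<Phi>1 0"
        using coords_scale[OF M, of 0 0] by simp
      then show ?thesis using r3[of "\<Phi>1 0" y 0 c] coordsD(7)[OF M, of 0] y by simp
    qed
    have z2: "sim (?s (x, \<Phi>2 0) c) 0" if x: "x \<in> carrier M" for x c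
    proof -
      have "Qu_cls n q (const 0) \<odot>\<^bsub>N\<^esub> \<Phi>2 0 = \<Phi>2 0"
        using coords_scale[OF N, of 0 0] by simp
      then show ?thesis using r4[of x "\<Phi>2 0" 0 c] coordsD(7)[OF N, of 0] x by simp
    qed
    have e1: "sim (?s (\<Phi>1 (\<Sum>a\<in>I. f a *\<^sub>f delta a), y) c) (\<Sum>a\<in>I. ?s (\<Phi>1 (delta a), y) (c * f a))"
      if "I \<subseteq> B" "y \<in> carrier N" for I f y c
    proof -
      have "finite I" using that fin finite_subset by blast
      then show ?thesis using that(1)
      proof (induction I)
        case empty
        then show ?case using z1 that by simp
      next
        case (insert a I)
        have d: "delta a \<in> funs_on B" "(\<Sum>a\<in>I. f a *\<^sub>f delta a) \<in> funs_on B"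
          using insert.prems by (auto intro!: funs_on_sum)
        have p: "\<Phi>1 (f a *\<^sub>f delta a + (\<Sum>a\<in>I. f a *\<^sub>f delta a)) =
            Qu_cls n q (const (f a)) \<odot>\<^bsub>M\<^esub> \<Phi>1 (delta a) \<oplus>\<^bsub>M\<^esub> \<Phi>1 (\<Sum>a\<in>I. f a *\<^sub>f delta a)"
          using d by (simp add: coordsD(5)[OF M] coords_scale[OF M])
        have k: "Qu_cls n q (const (f a)) \<odot>\<^bsub>M\<^esub> \<Phi>1 (delta a) \<in> carrier M"
          using coordsD(7)[OF M funs_on_simps(5)[OF d(1), of "f a"]] by (simp add: coords_scale[OF M d(1)])
        show ?case
          unfolding sum.insert[OF insert.hyps] p
          by (rule sim_trans[OF r1[OF k coordsD(7)[OF M d(2)] that(2)]],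
              rule sim_add[OF r3[OF coordsD(7)[OF M d(1)] that(2)] insert.IH]) (use insert.prems in simp)
      qed
    qed
    have e2: "sim (?s (x, \<Phi>2 (\<Sum>a\<in>I. f a *\<^sub>f delta a)) c) (\<Sum>a\<in>I. ?s (x, \<Phi>2 (delta a)) (c * f a))"
      if "I \<subseteq> C" "x \<in> carrier M" for I f x c
    proof -
      have "finite I" using that fin finite_subset by blast
      then show ?thesis using that(1)
      proof (induction I)
        case empty
        then show ?case using z2 that by simp
      next
        case (insert a I)
        have d: "delta a \<in> funs_on C" "(\<Sum>a\<in>I. f a *\<^sub>f delta a) \<in> funs_on C"
          using insert.prems by (auto intro!: funs_on_sum)
        have p: "\<Phi>2 (f a *\<^sub>f delta a + (\<Sum>a\<in>I. f a *\<^sub>f delta a)) =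
            Qu_cls n q (const (f a)) \<odot>\<^bsub>N\<^esub> \<Phi>2 (delta a) \<oplus>\<^bsub>N\<^esub> \<Phi>2 (\<Sum>a\<in>I. f a *\<^sub>f delta a)"
          using d by (simp add: coordsD(5)[OF N] coords_scale[OF N])
        have k: "Qu_cls n q (const (f a)) \<odot>\<^bsub>N\<^esub> \<Phi>2 (delta a) \<in> carrier N"
          using coordsD(7)[OF N funs_on_simps(5)[OF d(1), of "f a"]] by (simp add: coords_scale[OF N d(1)])
        show ?case
          unfolding sum.insert[OF insert.hyps] p
          by (rule sim_trans[OF r2[OF that(2) k coordsD(7)[OF N d(2)]]],
              rule sim_add[OF r4[OF that(2) coordsD(7)[OF N d(1)]] insert.IH]) (use insert.prems in simp)
      qed
    qed
    have e3: "sim (?s (x, y) c) (basis_expansion (tval (?s (x, y) c)))"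
      if xy: "x \<in> carrier M" "y \<in> carrier N" for x y c
    proof -
      obtain f where f: "f \<in> funs_on B" "x = \<Phi>1 f" "\<Psi>1 x = f" using xy(1) by (rule coords_cases)
      obtain g where g: "g \<in> funs_on C" "y = \<Phi>2 g" "\<Psi>2 y = g" using xy(2) by (rule coords_cases2)
      have "sim (?s (x, y) c) (\<Sum>a\<in>B. ?s (\<Phi>1 (delta a), y) (c * f a))"
        using e1[OF subset_refl xy(2), of f c] delta_expansion[OF fin(1) f(1)] f(2) by simp
      moreover have "sim (\<Sum>a\<in>B. ?s (\<Phi>1 (delta a), y) (c * f a))
          (\<Sum>a\<in>B. \<Sum>b\<in>C. ?s (\<Phi>1 (delta a), \<Phi>2 (delta b)) (c * f a * g b))"
      proof (rule sim_sum)
        fix a assume "a \<in> B"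
        then have "\<Phi>1 (delta a) \<in> carrier M" using coordsD(7)[OF M] by simp
        from e2[OF subset_refl this, of g "c * f a"]
        show "sim (?s (\<Phi>1 (delta a), y) (c * f a)) (\<Sum>b\<in>C. ?s (\<Phi>1 (delta a), \<Phi>2 (delta b)) (c * f a * g b))"
          using delta_expansion[OF fin(2) g(1)] g(2) by simp
      qed
      ultimately show ?thesis
        using sim_trans by (simp add: basis_expansion_def tval_simps f(3) g(3) fun_apply outer_def mult.assoc)
    qed
    have be_add: "basis_expansion (f + g) = basis_expansion f + basis_expansion g" for f g
      by (simp add: basis_expansion_def fun_apply single_add sum.distrib)
    have be0: "basis_expansion 0 = 0" by (simp add: basis_expansion_def fun_apply)
    have "t = (\<Sum>xy\<in>Poly_Mapping.keys t. ?s xy (Poly_Mapping.lookup t xy))"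
      by (rule poly_mapping_eqI) (simp add: lookup_sum lookup_single when_def in_keys_iff)
    moreover have "sim (\<Sum>xy\<in>K. ?s xy (Poly_Mapping.lookup t xy))
        (basis_expansion (tval (\<Sum>xy\<in>K. ?s xy (Poly_Mapping.lookup t xy))))"
      if "finite K" "K \<subseteq> carrier M \<times> carrier N" for K
      using that
    proof (induction K)
      case (insert xy K)
      obtain x y where xy: "xy = (x, y)" "x \<in> carrier M" "y \<in> carrier N"
        using insert.prems by auto
      show ?case
        unfolding sum.insert[OF insert.hyps] tval_simps(1) be_add
        by (rule sim_add) (use insert xy e3 in auto)
    qed (simp add: tval_simps be0 sim_refl)
    ultimately have "sim t (basis_expansion (tval t))"
      using t finite_keys[of t] by (metis (no_types, lifting) W_simps(1) mem_Collect_eq)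
    then show "t \<in> H" using t by (simp add: sim_def be0)
  qed
qed

text \<open>The cosets of the null space are the fibres of \<open>tval\<close>, so
  \<open>fibre\<close> is the coordinate map of the tensor product.\<close>

definition fibre :: "('b \<times> 'c \<Rightarrow> 'k) \<Rightarrow> (('m \<times> 'p) \<Rightarrow>\<^sub>0 'k) set" where
  "fibre f = {t \<in> carrier W. tval t = f}"

lemma coset_eq_fibre: "t \<in> carrier W \<Longrightarrow> tens_null n q M N +>\<^bsub>W\<^esub> t = fibre (tval t)"
proof (intro equalityI subsetI)
  fix u assume t: "t \<in> carrier W" and "u \<in> tens_null n q M N +>\<^bsub>W\<^esub> t"
  then show "u \<in> fibre (tval t)"
    by (auto simp: a_r_coset_def' tens_null_eq fibre_def W_simps(2) tval_simps intro: carrier_W)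
next
  fix u assume t: "t \<in> carrier W" and "u \<in> fibre (tval t)"
  then have "u - t \<in> tens_null n q M N" "u = (u - t) \<oplus>\<^bsub>W\<^esub> t"
    by (auto simp: tens_null_eq fibre_def W_simps(2) tval_simps intro: carrier_W)
  then show "u \<in> tens_null n q M N +>\<^bsub>W\<^esub> t" by (auto simp: a_r_coset_def')
qed

lemma fibre_ne: "f \<in> V \<Longrightarrow> basis_expansion f \<in> fibre f"
  by (simp add: fibre_def basis_expansion_W tval_basis_expansion)

lemma fibre_inj: "f \<in> V \<Longrightarrow> fibre f = fibre g \<Longrightarrow> f = g"
  by (metis (mono_tags, lifting) fibre_def fibre_ne mem_Collect_eq tval_basis_expansion)

lemma fibre_add:
  assumes "f \<in> V" "g \<in> V" shows "fibre f <+>\<^bsub>W\<^esub> fibre g = fibre (f + g)"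
proof (intro equalityI subsetI)
  fix u assume "u \<in> fibre f <+>\<^bsub>W\<^esub> fibre g"
  then show "u \<in> fibre (f + g)"
    by (auto simp: set_add_def' fibre_def W_simps(2) tval_simps intro: carrier_W)
next
  fix u assume u: "u \<in> fibre (f + g)"
  then have "u - basis_expansion g \<in> fibre f"
    using assms by (auto simp: fibre_def tval_simps tval_basis_expansion intro: carrier_W basis_expansion_W)
  then show "u \<in> fibre f <+>\<^bsub>W\<^esub> fibre g"
    using fibre_ne[OF assms(2)] unfolding set_add_def' W_simps(2)
    by (metis (mono_tags, lifting) UN_I diff_add_cancel singletonI)
qed

lemma act2_tval:
  assumes t: "t \<in> carrier W"
  shows "act2 n q M N d t \<in> carrier W" "tval (act2 n q M N d t) = rep2 d (tval t)"
proof -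
  define uv where "uv = (\<lambda>u v xy. Poly_Mapping.single
       (Qu_cls n q (Poly_Mapping.single u 1) \<odot>\<^bsub>M\<^esub> fst xy, Qu_cls n q (Poly_Mapping.single v 1) \<odot>\<^bsub>N\<^esub> snd xy)
       (Poly_Mapping.lookup d (u, v) * Poly_Mapping.lookup t xy))"
  have a: "act2 n q M N d t = (\<Sum>(u, v)\<in>Poly_Mapping.keys d. \<Sum>xy\<in>Poly_Mapping.keys t. uv u v xy)"
    unfolding act2_def uv_def by (intro sum.cong refl) (auto simp: case_prod_unfold)
  have *: "uv u v xy \<in> carrier W \<and> tval (uv u v xy) = Poly_Mapping.lookup d (u, v) *\<^sub>f
      pair_act T1 T2 (u, v) (Poly_Mapping.lookup t xy *\<^sub>f outer (\<Psi>1 (fst xy)) (\<Psi>2 (snd xy)))"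
    if "xy \<in> Poly_Mapping.keys t" for u v xy
  proof -
    have "xy \<in> carrier M \<times> carrier N" using that t unfolding W_simps(1) by (rule subsetD[rotated])
    then obtain x y where xy: "xy = (x, y)" "x \<in> carrier M" "y \<in> carrier N" by (elim SigmaE)
    obtain f where f: "f \<in> funs_on B" "x = \<Phi>1 f" "\<Psi>1 x = f" using xy(2) by (rule coords_cases)
    obtain g where g: "g \<in> funs_on C" "y = \<Phi>2 g" "\<Psi>2 y = g" using xy(3) by (rule coords_cases2)
    have "Qu_cls n q (Poly_Mapping.single u 1) \<odot>\<^bsub>M\<^esub> x = \<Phi>1 (word_act T1 u f)"
      "Qu_cls n q (Poly_Mapping.single v 1) \<odot>\<^bsub>N\<^esub> y = \<Phi>2 (word_act T2 v g)"
      using coordsD(6)[OF M f(1), of "Poly_Mapping.single u 1"]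
        coordsD(6)[OF N g(1), of "Poly_Mapping.single v 1"] f g by simp_all
    moreover have "word_act T1 u f \<in> funs_on B" "word_act T2 v g \<in> funs_on C"
      using coordsD(8)[OF M f(1), of "Poly_Mapping.single u 1"]
        coordsD(8)[OF N g(1), of "Poly_Mapping.single v 1"] by simp_all
    ultimately show ?thesis
      using f g xy by (auto simp: uv_def tval_simps \<Psi>\<Phi> pair_act_def act_fst_outer[OF lin_words(1)] act_snd_outer[OF lin_words(2)]
          lin_scale[OF lin_act_fst[OF lin_words(1)]] lin_scale[OF lin_act_snd[OF lin_words(2)]]
          intro!: carrier_W coordsD(7)[OF M] coordsD(7)[OF N])
  qed
  show "act2 n q M N d t \<in> carrier W"
    unfolding a using * by (intro carrier_W_sum) (auto intro!: carrier_W_sum)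
  have l: "lin (pair_act T1 T2 w)" for w using monoid_rep_pair_act unfolding monoid_rep_def by blast
  have "tval (act2 n q M N d t) = (\<Sum>(u, v)\<in>Poly_Mapping.keys d. \<Sum>xy\<in>Poly_Mapping.keys t. tval (uv u v xy))"
    unfolding a tval_simps by (intro sum.cong refl) (simp add: case_prod_unfold tval_simps)
  also have "\<dots> = (\<Sum>w\<in>Poly_Mapping.keys d. Poly_Mapping.lookup d w *\<^sub>f pair_act T1 T2 w (tval t))"
    using * by (intro sum.cong refl) (simp add: case_prod_unfold tval_def rep_def lin_sum[OF l] fscale_sum)
  finally show "tval (act2 n q M N d t) = rep2 d (tval t)" by (simp add: rep_def)
qed

text \<open>In \<open>Qu_tensor\<close> a class acts through \<Delta> of all its representatives at
  once. The assumption says that representatives of the same class act alike, that is, that \<Delta>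
  respects the relations as far as this module can see.\<close>

theorem coords_tensor:
  assumes K: "\<And>x f. x \<in> Qu_ideal n q \<Longrightarrow> f \<in> V \<Longrightarrow> frep TW x f = 0"
  shows "coords n q (Qu_tensor n q M N) (B \<times> C) TW fibre"
  unfolding coords_def
proof (intro conjI allI ballI)
  note T = Qu_tensor_def Let_def
  show "lin (TW g)" for g
    unfolding tensor_ops_def by (rule lin_rep) (use monoid_rep_pair_act in \<open>unfold monoid_rep_def, blast\<close>)
  show "TW g f \<in> V" if "f \<in> V" for g f
    unfolding tensor_ops_def by (rule rep2_V[OF that])
  show "bij_betw fibre V (carrier (Qu_tensor n q M N))"
    unfolding bij_betw_def
  proof
    show "inj_on fibre V" using fibre_inj by (rule inj_onI)
    show "fibre ` V = carrier (Qu_tensor n q M N)"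
    proof (intro equalityI subsetI)
      fix T assume "T \<in> fibre ` V"
      then obtain f where "f \<in> V" "T = fibre f" by auto
      then have "T = tens_null n q M N +>\<^bsub>W\<^esub> basis_expansion f"
        by (simp add: coset_eq_fibre basis_expansion_W tval_basis_expansion)
      then show "T \<in> carrier (Qu_tensor n q M N)"
        using basis_expansion_W by (auto simp: T A_RCOSETS_def')
    next
      fix T assume "T \<in> carrier (Qu_tensor n q M N)"
      then obtain t where "t \<in> carrier W" "T = tens_null n q M N +>\<^bsub>W\<^esub> t"
        by (auto simp: T A_RCOSETS_def')
      then show "T \<in> fibre ` V" using tval_V[of t] by (auto simp: coset_eq_fibre W_simps(1))
    qed
  qed
  show "fibre 0 = \<zero>\<^bsub>Qu_tensor n q M N\<^esub>" by (simp add: T fibre_def tens_null_eq)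
  show "fibre (f + g) = fibre f \<oplus>\<^bsub>Qu_tensor n q M N\<^esub> fibre g" if "f \<in> V" "g \<in> V" for f g
    using fibre_add[OF that] by (simp add: T)
  show "fibre (frep TW x f) = Qu_cls n q x \<odot>\<^bsub>Qu_tensor n q M N\<^esub> fibre f" if f: "f \<in> V" for x f
  proof -
    \<comment> \<open>\<open>d\<close> differs from \<Delta>(x) by an element of
      \<open>Qu2_ideal\<close>, which acts as zero by \<open>rep2_ideal\<close>, and by \<Delta>(h)
      with h in the ideal of relations, which does so by assumption.\<close>
    have *: "tens_null n q M N +>\<^bsub>W\<^esub> act2 n q M N d t = fibre (frep TW x f)"
      if d: "d \<in> Qu_comult n q (Qu_cls n q x)" and t: "t \<in> fibre f" for d t
    proof -
      obtain x' z where x': "x' \<in> Qu_cls n q x" and z: "z \<in> Qu2_ideal n q" "d = z + comult_free n q x'"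
        using d by (auto simp: Qu_comult_def a_r_coset_def' ring_of_type_algebra_def)
      obtain h where h: "h \<in> Qu_ideal n q" "x' = h + x"
        using x' by (auto simp: Qu_cls_def a_r_coset_def' ring_of_type_algebra_def)
      have "rep2 d f = frep TW x f"
        by (simp add: z rep_add rep2_ideal f rep2_comult h K)
      then show ?thesis using t by (simp add: fibre_def coset_eq_fibre act2_tval)
    qed
    \<comment> \<open>The union over all \<open>d\<close> equals the single coset found above only
      if some \<open>d\<close> exists; \<Delta>(x) itself is one.\<close>
    have "0 \<in> Qu2_ideal n q"
    proof -
      have "ideal (Qu2_ideal n q) (ring_of_type_algebra :: 'k falg2 ring)"
        unfolding Qu2_ideal_def by (intro ring.genideal_ideal ring_ring_of_type_algebra)
          (simp add: ring_of_type_algebra_def)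
      from additive_subgroup.zero_closed[OF ideal.axioms(1)[OF this]]
      show ?thesis by (simp add: ring_of_type_algebra_def)
    qed
    then have "comult_free n q x \<in> Qu_comult n q (Qu_cls n q x)"
      using Qu_cls_self[of x n q] by (force simp: Qu_comult_def a_r_coset_def' ring_of_type_algebra_def)
    then have "(\<Union>d\<in>Qu_comult n q (Qu_cls n q x). \<Union>t\<in>fibre f. tens_null n q M N +>\<^bsub>W\<^esub> act2 n q M N d t)
        = fibre (frep TW x f)"
      using fibre_ne[OF f] * by blast
    then show ?thesis by (simp add: T)
  qed
qed

end

section \<open>Strings in modules over the quantum group\<close>

locale root_order =
  fixes n :: nat and q :: "'k::field_char_0"
  assumes n_pos: "n > 0" and four_dvd: "4 dvd n" and q_order: "q ^ (n ^ 2) = 1"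
    and q_prim: "\<And>d. 0 < d \<Longrightarrow> d < n ^ 2 \<Longrightarrow> q ^ d \<noteq> 1"
begin

abbreviation "p \<equiv> n ^ 2"
abbreviation "qi \<equiv> inverse q"

lemma p_pos: "p > 0" and p_ge: "p \<ge> 16" and p_even: "4 dvd p"
proof -
  obtain m where m: "n = 4 * m" using four_dvd by blast
  then have "m > 0" using n_pos by simp
  then have "m * m > 0" by simp
  then show "p \<ge> 16" using m by (simp add: power2_eq_square)
  then show "p > 0" using n_pos by simp
  show "4 dvd p" using four_dvd by (simp add: power2_eq_square)
qed

lemma q_nz [simp]: "q \<noteq> 0"
  using q_order p_pos by (metis power_eq_0_iff zero_neq_one power_0_left neq0_conv)

lemma q_qi [simp]: "q * qi = 1" "qi * q = 1" "q ^ a * qi ^ a = 1" "qi ^ a * q ^ a = 1"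
  by (simp_all flip: power_mult_distrib)

lemma q_pow_mod: "q ^ d = q ^ (d mod p)"
proof -
  have "q ^ (p * (d div p) + d mod p) = q ^ (d mod p)" by (simp only: power_add power_mult q_order) simp
  then show ?thesis by simp
qed

lemma q_pow_eq_1: "q ^ d = 1 \<longleftrightarrow> p dvd d"
  using q_prim[of "d mod p"] q_pow_mod[of d] p_pos by (metis dvd_eq_mod_eq_0 mod_less_divisor neq0_conv power_0)

lemma qi_pow_eq_1: "qi ^ d = 1 \<longleftrightarrow> p dvd d"
  by (simp add: q_pow_eq_1 power_inverse)

lemma q_pow_mult_qi: "b \<le> a \<Longrightarrow> q ^ a * qi ^ b = q ^ (a - b)" "a \<le> b \<Longrightarrow> q ^ a * qi ^ b = qi ^ (b - a)"
  by (simp_all add: power_inverse power_diff field_simps flip: power_add)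

lemma q_pow_half: "q ^ (p div 2) = - 1"
proof -
  have "p div 2 * 2 = p" using p_even by presburger
  then have "(q ^ (p div 2)) ^ 2 = 1" using q_order by (metis power_mult)
  then have "q ^ (p div 2) = 1 \<or> q ^ (p div 2) = - 1" by (simp add: power2_eq_1_iff)
  moreover have "q ^ (p div 2) \<noteq> 1" using q_prim[of "p div 2"] p_ge by simp
  ultimately show ?thesis by simp
qed

definition qnum :: "nat \<Rightarrow> 'k" where "qnum l = (\<Sum>s<l. qi ^ s)"

lemma qnum_eq: "(1 - qi) * qnum l = 1 - qi ^ l"
proof (induction l)
  case (Suc l)
  have "(1 - qi) * qnum (Suc l) = (1 - qi) * qnum l + (1 - qi) * qi ^ l"
    by (simp add: qnum_def distrib_left)
  then show ?case unfolding Suc by (simp add: algebra_simps)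
qed (simp add: qnum_def)

lemma qi_neq_1: "qi \<noteq> 1"
  using q_prim[of 1] p_ge by auto

lemma qnum_eq_0: "qnum l = 0 \<longleftrightarrow> p dvd l"
  using qnum_eq[of l] qi_neq_1 qi_pow_eq_1[of l] by (metis diff_eq_diff_eq diff_self eq_iff_diff_eq_0 mult_eq_0_iff)

text \<open>The coefficient in \<open>F E\<^sup>l v = q\<^sup>-\<^sup>l E\<^sup>l F v + lowering l w \<cdot> E\<^sup>l\<^sup>-\<^sup>1 v\<close> for a vector \<open>v\<close> on which
  \<open>kap_inv n * hat\<close> acts as \<open>w\<close>.\<close>

definition lowering :: "nat \<Rightarrow> 'k \<Rightarrow> 'k" where
  "lowering l w = qnum l * (1 - w * q * qi ^ l)"

text \<open>The recursion that one more commutation of F past E produces, K acting on E^l v as w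
  q^(-2l). The sum in \<open>qnum\<close> is split once at its first and once at its last
  term.\<close>

lemma lowering_Suc: "lowering (Suc l) w = qi * lowering l w + (1 - w * qi ^ (2 * l))"
proof -
  have a: "qnum (Suc l) = qi * qnum l + 1"
    unfolding qnum_def by (subst sum.lessThan_Suc_shift) (simp add: sum_distrib_left)
  have b: "qnum (Suc l) = qnum l + qi ^ l" by (simp add: qnum_def)
  have c: "lowering (Suc l) w = qnum (Suc l) - w * qi ^ l * qnum (Suc l)"
    by (simp add: lowering_def right_diff_distrib mult_ac)
  have d: "qi * lowering l w = qi * qnum l - w * qi ^ l * qnum l"
    by (simp add: lowering_def right_diff_distrib mult_ac)
  have "w * qi ^ l * qnum (Suc l) = w * qi ^ l * qnum l + w * qi ^ (2 * l)"
    unfolding b by (simp add: distrib_left mult_2 power_add mult.assoc)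
  then show ?thesis unfolding c d by (simp add: a)
qed

lemma lowering_0 [simp]: "lowering 0 w = 0" and lowering_p: "lowering p w = 0"
  by (simp_all add: lowering_def qnum_eq_0)

definition weight :: "(letter \<Rightarrow> ('b \<Rightarrow> 'k) \<Rightarrow> 'b \<Rightarrow> 'k) \<Rightarrow> 'k \<Rightarrow> 'k \<Rightarrow> ('b \<Rightarrow> 'k) \<Rightarrow> bool" where
  "weight T k h f \<longleftrightarrow> T L_kap f = k *\<^sub>f f \<and> T L_hat f = h *\<^sub>f f"

text \<open>Only the behaviour of weight vectors under the generators is prescribed. This much can
  be verified on the tensor product before it is known to be a module over \<open>Qu\<close>, and it
  is enough for computing in strings of E-powers.\<close>

definition qrep :: "('b \<Rightarrow> 'k) set \<Rightarrow> (letter \<Rightarrow> ('b \<Rightarrow> 'k) \<Rightarrow> 'b \<Rightarrow> 'k) \<Rightarrow> bool" where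
  "qrep V T \<longleftrightarrow> (\<forall>g. lin (T g)) \<and> (\<forall>g. \<forall>f\<in>V. T g f \<in> V) \<and>
     (\<forall>f\<in>V. \<forall>k h. weight T k h f \<longrightarrow>
        T L_F (T L_E f) = qi *\<^sub>f T L_E (T L_F f) + (1 - h / k) *\<^sub>f f \<and>
        weight T (q ^ n * k) (q ^ n * qi ^ 2 * h) (T L_E f) \<and>
        weight T (qi ^ n * k) (qi ^ n * q ^ 2 * h) (T L_F f))"

lemma qrepD:
  assumes "qrep V T"
  shows "lin (T g)" "f \<in> V \<Longrightarrow> T g f \<in> V"
    "f \<in> V \<Longrightarrow> weight T k h f \<Longrightarrow> T L_F (T L_E f) = qi *\<^sub>f T L_E (T L_F f) + (1 - h / k) *\<^sub>f f"
    "f \<in> V \<Longrightarrow> weight T k h f \<Longrightarrow> weight T (q ^ n * k) (q ^ n * qi ^ 2 * h) (T L_E f)"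
    "f \<in> V \<Longrightarrow> weight T k h f \<Longrightarrow> weight T (qi ^ n * k) (qi ^ n * q ^ 2 * h) (T L_F f)"
  using assms unfolding qrep_def by blast+

lemma funpow_in: "qrep V T \<Longrightarrow> f \<in> V \<Longrightarrow> (T g ^^ l) f \<in> V"
  by (induction l) (simp_all add: qrepD(2))

lemma weight_E_pow:
  assumes T: "qrep V T" and f: "f \<in> V" "weight T k h f"
  shows "weight T ((q ^ n) ^ l * k) ((q ^ n * qi ^ 2) ^ l * h) ((T L_E ^^ l) f)"
proof (induction l)
  case (Suc l)
  then show ?case using qrepD(4)[OF T funpow_in[OF T f(1)] Suc.IH] by (simp add: mult.assoc)
qed (simp add: f)

lemma FE_pow:
  assumes T: "qrep V T" and f: "f \<in> V" "weight T k h f" and k: "k \<noteq> 0"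
  shows "T L_F ((T L_E ^^ Suc l) f) =
    qi ^ Suc l *\<^sub>f (T L_E ^^ Suc l) (T L_F f) + lowering (Suc l) (h / k) *\<^sub>f (T L_E ^^ l) f"
proof (induction l)
  case 0
  have "lowering (Suc 0) (h / k) = 1 - h / k" using lowering_Suc[of 0] by simp
  then show ?case using qrepD(3)[OF T f] by simp
next
  case (Suc l)
  let ?e = "(T L_E ^^ Suc l) f"
  have "T L_F (T L_E ?e) = qi *\<^sub>f T L_E (T L_F ?e) +
      (1 - ((q ^ n * qi ^ 2) ^ Suc l * h) / ((q ^ n) ^ Suc l * k)) *\<^sub>f ?e"
    by (rule qrepD(3)[OF T funpow_in[OF T f(1)] weight_E_pow[OF T f]])
  also have "((q ^ n * qi ^ 2) ^ Suc l * h) / ((q ^ n) ^ Suc l * k) = (h / k) * qi ^ (2 * Suc l)"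
    using k by (simp add: power_mult_distrib power_mult[of qi 2 "Suc l"] del: power_Suc mult_Suc_right)
  also have "T L_E (T L_F ?e) = qi ^ Suc l *\<^sub>f T L_E ((T L_E ^^ Suc l) (T L_F f)) + lowering (Suc l) (h / k) *\<^sub>f ?e"
    unfolding Suc lin_add[OF qrepD(1)[OF T]] lin_scale[OF qrepD(1)[OF T]] by simp
  also have "qi *\<^sub>f (qi ^ Suc l *\<^sub>f T L_E ((T L_E ^^ Suc l) (T L_F f)) + lowering (Suc l) (h / k) *\<^sub>f ?e)
      + (1 - (h / k) * qi ^ (2 * Suc l)) *\<^sub>f ?e =
      qi ^ Suc (Suc l) *\<^sub>f T L_E ((T L_E ^^ Suc l) (T L_F f)) +
      (qi * lowering (Suc l) (h / k) + (1 - (h / k) * qi ^ (2 * Suc l))) *\<^sub>f ?e"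
    by (simp add: fscale_add)
  finally show ?case by (simp only: lowering_Suc[of "Suc l"] funpow.simps o_apply)
qed

lemma FE_pow_ker:
  assumes T: "qrep V T" and f: "f \<in> V" "weight T k h f" and k: "k \<noteq> 0" and F: "T L_F f = 0"
  shows "T L_F ((T L_E ^^ Suc l) f) = lowering (Suc l) (h / k) *\<^sub>f (T L_E ^^ l) f"
  using FE_pow[OF T f k, of l] lin_0[OF lin_funpow[OF qrepD(1)[OF T]], of "Suc l" L_E]
  by (simp add: F del: funpow.simps)

section \<open>Models of the simple and of the projective modules\<close>

text \<open>The index l stands for E^l x, where x is a vector of weight (k, h) with F x = 0;
  \<open>d\<close> is the length at which the string is cut off.\<close>

definition S_ops :: "nat \<Rightarrow> 'k \<Rightarrow> 'k \<Rightarrow> letter \<Rightarrow> (nat \<Rightarrow> 'k) \<Rightarrow> nat \<Rightarrow> 'k" where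
  "S_ops d k h g f = (case g of
     L_kap \<Rightarrow> (\<lambda>l. ((q ^ n) ^ l * k) * f l)
   | L_hat \<Rightarrow> (\<lambda>l. ((q ^ n * qi ^ 2) ^ l * h) * f l)
   | L_E \<Rightarrow> (\<lambda>l. if 0 < l \<and> l < d then f (l - 1) else 0)
   | L_F \<Rightarrow> (\<lambda>l. if Suc l < d then lowering (Suc l) (h / k) * f (Suc l) else 0))"

text \<open>The index \<open>(False, l)\<close> stands for \<open>E\<^sup>l\<alpha>\<close> and \<open>(True, l)\<close> for \<open>E\<^sup>l\<gamma>\<close>; the vector
  \<open>\<gamma>\<close> has the weight \<open>(k, h)\<close>, and \<open>r = 2i - 1\<close>, so that \<open>F\<gamma> = E\<^sup>r\<^sup>-\<^sup>1\<alpha>\<close>.\<close>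

definition P_ops :: "nat \<Rightarrow> 'k \<Rightarrow> 'k \<Rightarrow> letter \<Rightarrow> (bool \<times> nat \<Rightarrow> 'k) \<Rightarrow> bool \<times> nat \<Rightarrow> 'k" where
  "P_ops r k h g f = (case g of
     L_kap \<Rightarrow> (\<lambda>(z, l). ((q ^ n) ^ l * (if z then k else (qi ^ n) ^ r * k)) * f (z, l))
   | L_hat \<Rightarrow> (\<lambda>(z, l). ((q ^ n * qi ^ 2) ^ l * (if z then h else (qi ^ n * q ^ 2) ^ r * h)) * f (z, l))
   | L_E \<Rightarrow> (\<lambda>(z, l). if 0 < l \<and> l < p then f (z, l - 1) else 0)
   | L_F \<Rightarrow> (\<lambda>(z, l).
       (if Suc l < p then lowering (Suc l) (if z then h / k else q ^ (2 * r) * (h / k)) * f (z, Suc l) else 0)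
       + (if \<not> z \<and> r - 1 \<le> l \<and> l < p then qi ^ (l + 1 - r) * f (True, l + 1 - r) else 0)))"

definition S_hom :: "nat \<Rightarrow> (letter \<Rightarrow> ('b \<Rightarrow> 'k) \<Rightarrow> 'b \<Rightarrow> 'k) \<Rightarrow> ('b \<Rightarrow> 'k) \<Rightarrow> (nat \<Rightarrow> 'k) \<Rightarrow> 'b \<Rightarrow> 'k" where
  "S_hom d T x f = (\<Sum>l<d. f l *\<^sub>f (T L_E ^^ l) x)"

text \<open>x and y are the images of \<alpha> and \<gamma>, and the image of every other vector is
  then forced.\<close>

definition P_hom :: "(letter \<Rightarrow> ('b \<Rightarrow> 'k) \<Rightarrow> 'b \<Rightarrow> 'k) \<Rightarrow> ('b \<Rightarrow> 'k) \<Rightarrow> ('b \<Rightarrow> 'k) \<Rightarrow>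
    (bool \<times> nat \<Rightarrow> 'k) \<Rightarrow> 'b \<Rightarrow> 'k" where
  "P_hom T x y f = (\<Sum>l<p. f (False, l) *\<^sub>f (T L_E ^^ l) x) + (\<Sum>l<p. f (True, l) *\<^sub>f (T L_E ^^ l) y)"

abbreviation "P_basis \<equiv> (UNIV :: bool set) \<times> {..<p}"

lemma S_ops_apply:
  "S_ops d k h L_kap f l = ((q ^ n) ^ l * k) * f l"
  "S_ops d k h L_hat f l = ((q ^ n * qi ^ 2) ^ l * h) * f l"
  "S_ops d k h L_E f l = (if 0 < l \<and> l < d then f (l - 1) else 0)"
  "S_ops d k h L_F f l = (if Suc l < d then lowering (Suc l) (h / k) * f (Suc l) else 0)"
  by (simp_all add: S_ops_def)

lemma P_ops_apply:
  "P_ops r k h L_kap f (z, l) = ((q ^ n) ^ l * (if z then k else (qi ^ n) ^ r * k)) * f (z, l)"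
  "P_ops r k h L_hat f (z, l) = ((q ^ n * qi ^ 2) ^ l * (if z then h else (qi ^ n * q ^ 2) ^ r * h)) * f (z, l)"
  "P_ops r k h L_E f (z, l) = (if 0 < l \<and> l < p then f (z, l - 1) else 0)"
  "P_ops r k h L_F f (z, l) =
     (if Suc l < p then lowering (Suc l) (if z then h / k else q ^ (2 * r) * (h / k)) * f (z, Suc l) else 0)
     + (if \<not> z \<and> r - 1 \<le> l \<and> l < p then qi ^ (l + 1 - r) * f (True, l + 1 - r) else 0)"
  by (simp_all add: P_ops_def)

lemma lin_S_ops: "lin (S_ops d k h g)"
  by (intro linI ext; cases g) (simp_all add: S_ops_def fun_apply algebra_simps)

lemma S_ops_funs_on: "f \<in> funs_on {..<d} \<Longrightarrow> S_ops d k h g f \<in> funs_on {..<d}"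
  by (cases g) (auto simp: S_ops_def funs_on_def)

lemma lin_P_ops: "lin (P_ops r k h g)"
  by (intro linI ext; cases g) (simp_all add: P_ops_def fun_apply algebra_simps split: prod.split)

lemma P_ops_funs_on: "f \<in> funs_on P_basis \<Longrightarrow> P_ops r k h g f \<in> funs_on P_basis"
  by (cases g) (auto simp: P_ops_def funs_on_def)

lemma lin_S_hom: "lin (S_hom d T x)"
  by (intro linI) (simp_all add: S_hom_def fun_apply fscale_add sum.distrib fscale_sum)

lemma lin_P_hom: "lin (P_hom T x y)"
  by (intro linI) (simp_all add: P_hom_def fun_apply fscale_add sum.distrib fscale_sum algebra_simps)

lemma S_hom_in: "qrep (funs_on B) T \<Longrightarrow> x \<in> funs_on B \<Longrightarrow> S_hom d T x f \<in> funs_on B"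
  unfolding S_hom_def by (intro funs_on_sum funs_on_simps funpow_in)

lemma P_hom_in: "qrep (funs_on B) T \<Longrightarrow> x \<in> funs_on B \<Longrightarrow> y \<in> funs_on B \<Longrightarrow> P_hom T x y f \<in> funs_on B"
  unfolding P_hom_def by (intro funs_on_sum funs_on_simps funpow_in)

lemma E_string_sum:
  assumes T: "qrep V T" and d: "d > 0" and E: "(T L_E ^^ d) x = 0"
  shows "(\<Sum>l<d. (if 0 < l \<and> l < d then c (l - 1) else 0) *\<^sub>f (T L_E ^^ l) x) =
    T L_E (\<Sum>l<d. c l *\<^sub>f (T L_E ^^ l) x)"
proof -
  obtain d' where d': "d = Suc d'" using d by (cases d) auto
  have "(\<Sum>l<d. (if 0 < l \<and> l < d then c (l - 1) else 0) *\<^sub>f (T L_E ^^ l) x) =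
      (\<Sum>l<d'. c l *\<^sub>f (T L_E ^^ Suc l) x)"
    unfolding d' by (subst sum.lessThan_Suc_shift) (simp add: d')
  also have "\<dots> = (\<Sum>l<d. c l *\<^sub>f (T L_E ^^ Suc l) x)"
    unfolding d' using E d' by simp
  finally show ?thesis
    by (simp add: lin_sum[OF qrepD(1)[OF T]] lin_scale[OF qrepD(1)[OF T]])
qed

text \<open>\<open>FE_pow\<close> applied to each term. The second sum collects what comes from F x:
  it vanishes for a vector killed by F, and for \<gamma> it is the part that falls into the string
  of \<alpha>.\<close>

lemma F_string_sum:
  assumes T: "qrep V T" and x: "x \<in> V" "weight T k h x" "k \<noteq> 0" and d: "d > 0"
  shows "T L_F (\<Sum>l<d. c l *\<^sub>f (T L_E ^^ l) x) =
    (\<Sum>l<d. (if Suc l < d then lowering (Suc l) (h / k) * c (Suc l) else 0) *\<^sub>f (T L_E ^^ l) x)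
    + (\<Sum>l<d. (qi ^ l * c l) *\<^sub>f (T L_E ^^ l) (T L_F x))"
proof -
  obtain d' where d': "d = Suc d'" using d by (cases d) auto
  have *: "T L_F ((T L_E ^^ l) x) = qi ^ l *\<^sub>f (T L_E ^^ l) (T L_F x) +
      (if l = 0 then 0 else lowering l (h / k) *\<^sub>f (T L_E ^^ (l - 1)) x)" for l
  proof (cases l)
    case (Suc m)
    show ?thesis unfolding Suc using FE_pow[OF T x, of m] by (simp del: funpow.simps)
  qed simp
  have "T L_F (\<Sum>l<d. c l *\<^sub>f (T L_E ^^ l) x) = (\<Sum>l<d. c l *\<^sub>f T L_F ((T L_E ^^ l) x))"
    by (simp add: lin_sum[OF qrepD(1)[OF T]] lin_scale[OF qrepD(1)[OF T]])
  also have "\<dots> = (\<Sum>l<d. (qi ^ l * c l) *\<^sub>f (T L_E ^^ l) (T L_F x)) +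
      (\<Sum>l<d. c l *\<^sub>f (if l = 0 then 0 else lowering l (h / k) *\<^sub>f (T L_E ^^ (l - 1)) x))"
    unfolding * by (simp add: fscale_add sum.distrib mult.commute)
  also have "(\<Sum>l<d. c l *\<^sub>f (if l = 0 then 0 else lowering l (h / k) *\<^sub>f (T L_E ^^ (l - 1)) x)) =
      (\<Sum>l<d'. (lowering (Suc l) (h / k) * c (Suc l)) *\<^sub>f (T L_E ^^ l) x)"
    unfolding d' by (subst sum.lessThan_Suc_shift) (simp add: mult.commute)
  also have "\<dots> = (\<Sum>l<d. (if Suc l < d then lowering (Suc l) (h / k) * c (Suc l) else 0) *\<^sub>f (T L_E ^^ l) x)"
    unfolding d' by simp
  finally show ?thesis by (simp add: add.commute)
qed

lemma weight_string_sum: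
  assumes T: "qrep V T" and x: "x \<in> V" "weight T k h x"
  shows "T L_kap (\<Sum>l<d. c l *\<^sub>f (T L_E ^^ l) x) = (\<Sum>l<d. ((q ^ n) ^ l * k * c l) *\<^sub>f (T L_E ^^ l) x)"
    "T L_hat (\<Sum>l<d. c l *\<^sub>f (T L_E ^^ l) x) = (\<Sum>l<d. ((q ^ n * qi ^ 2) ^ l * h * c l) *\<^sub>f (T L_E ^^ l) x)"
  using weight_E_pow[OF T x]
  by (simp_all add: lin_sum[OF qrepD(1)[OF T]] lin_scale[OF qrepD(1)[OF T]] weight_def mult.commute)

lemma S_hom_intertwine:
  assumes T: "qrep V T" and x: "x \<in> V" "weight T k h x" "k \<noteq> 0" and F: "T L_F x = 0"
    and d: "d > 0" and E: "(T L_E ^^ d) x = 0"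
  shows "S_hom d T x (S_ops d k h g f) = T g (S_hom d T x f)"
proof (cases g)
  case L_kap
  then show ?thesis using weight_string_sum[OF T x(1,2)] by (simp add: S_hom_def S_ops_def)
next
  case L_hat
  then show ?thesis using weight_string_sum[OF T x(1,2)] by (simp add: S_hom_def S_ops_def)
next
  case L_E
  then show ?thesis using E_string_sum[OF T d E, of f] by (simp add: S_hom_def S_ops_def)
next
  case L_F
  have "(T L_E ^^ l) 0 = 0" for l by (rule lin_0[OF lin_funpow[OF qrepD(1)[OF T]]])
  then show ?thesis using L_F F_string_sum[OF T x d, of f] by (simp add: S_hom_def S_ops_def F)
qed

text \<open>P is presented by \<alpha> and \<gamma> with F \<alpha> = 0, F \<gamma> = E^(r-1)
  \<alpha>, their weights, and E^p = 0 on both; any two vectors with these properties define a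
  homomorphism.\<close>

lemma P_hom_intertwine:
  assumes T: "qrep V T" and x: "x \<in> V" "weight T ((qi ^ n) ^ r * k) ((qi ^ n * q ^ 2) ^ r * h) x"
    and y: "y \<in> V" "weight T k h y" and k: "k \<noteq> 0" and r: "r > 0"
    and Fx: "T L_F x = 0" and Fy: "T L_F y = (T L_E ^^ (r - 1)) x"
    and E: "(T L_E ^^ p) x = 0" "(T L_E ^^ p) y = 0"
  shows "P_hom T x y (P_ops r k h g f) = T g (P_hom T x y f)"
proof -
  have k': "(qi ^ n) ^ r * k \<noteq> 0" using k by simp
  have add: "T g (u + v) = T g u + T g v" for g u v by (rule lin_add[OF qrepD(1)[OF T]])
  have w: "((qi ^ n * q ^ 2) ^ r * h) / ((qi ^ n) ^ r * k) = q ^ (2 * r) * (h / k)"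
    by (simp add: power_mult_distrib power_mult)
  show ?thesis
  proof (cases g)
    case L_kap
    then show ?thesis using weight_string_sum(1)[OF T x] weight_string_sum(1)[OF T y]
      by (simp add: P_hom_def P_ops_def add)
  next
    case L_hat
    then show ?thesis using weight_string_sum(2)[OF T x] weight_string_sum(2)[OF T y]
      by (simp add: P_hom_def P_ops_def add)
  next
    case L_E
    then show ?thesis
      using E_string_sum[OF T p_pos E(1), of "\<lambda>l. f (False, l)"] E_string_sum[OF T p_pos E(2), of "\<lambda>l. f (True, l)"]
      by (simp add: P_hom_def P_ops_def add)
  next
    case L_F
    let ?E = "\<lambda>l. (T L_E ^^ l)"
    have z: "?E l 0 = 0" for l by (rule lin_0[OF lin_funpow[OF qrepD(1)[OF T]]])
    have big: "?E l x = 0" if "l \<ge> p" for l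
    proof -
      have "?E ((l - p) + p) x = ?E (l - p) (?E p x)" unfolding funpow_add by simp
      then show ?thesis using that by (simp add: E z)
    qed
    \<comment> \<open>The index is shifted by r - 1, since E^l F y = E^(l+r-1) x; the terms from E^p
      x on, which the shift adds, are zero.\<close>
    have "(\<Sum>l<p. (if r - 1 \<le> l \<and> l < p then qi ^ (l + 1 - r) * f (True, l + 1 - r) else 0) *\<^sub>f ?E l x)
        = (\<Sum>l\<in>{r - 1..<p}. (qi ^ (l + 1 - r) * f (True, l + 1 - r)) *\<^sub>f ?E l x)"
      by (rule sum.mono_neutral_cong_right) auto
    also have "\<dots> = (\<Sum>l\<in>{r - 1..<p + (r - 1)}. (qi ^ (l + 1 - r) * f (True, l + 1 - r)) *\<^sub>f ?E l x)"
      by (rule sum.mono_neutral_left) (auto simp: big)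
    also have "\<dots> = (\<Sum>l<p. (qi ^ l * f (True, l)) *\<^sub>f ?E (l + (r - 1)) x)"
      using sum.shift_bounds_nat_ivl[of "\<lambda>l. (qi ^ (l + 1 - r) * f (True, l + 1 - r)) *\<^sub>f ?E l x" 0 "r - 1" p] r
      by (simp add: atLeast0LessThan)
    also have "\<dots> = (\<Sum>l<p. (qi ^ l * f (True, l)) *\<^sub>f ?E l (T L_F y))"
      by (simp add: Fy funpow_add)
    finally have 1: "(\<Sum>l<p. (qi ^ l * f (True, l)) *\<^sub>f ?E l (T L_F y)) =
      (\<Sum>l<p. (if r - 1 \<le> l \<and> l < p then qi ^ (l + 1 - r) * f (True, l + 1 - r) else 0) *\<^sub>f ?E l x)" ..
    show ?thesis
      unfolding L_F P_hom_def add
        F_string_sum[OF T x k' p_pos, of "\<lambda>l. f (False, l)"] F_string_sum[OF T y k p_pos, of "\<lambda>l. f (True, l)"] 1 w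
      by (simp add: P_ops_def Fx z fscale_add sum.distrib algebra_simps)
  qed
qed

lemma P_ops_E_delta: "P_ops r k h L_E (delta (z, l)) = (if Suc l < p then delta (z, Suc l) else 0)"
  by (auto simp: P_ops_def delta_def fun_eq_iff zero_fun_apply)

lemma funpow_E_P_ops:
  "(P_ops r k h L_E ^^ m) (delta (z, l)) = (if l + m < p then delta (z, l + m) else if m = 0 then delta (z, l) else 0)"
proof (induction m)
  case (Suc m)
  then show ?case
    using lin_0[OF lin_P_ops[of r k h L_E]] by (auto simp: P_ops_E_delta)
qed simp

text \<open>Let (False, l) have level l and (True, l) level l + r. Then F lowers levels by one, and
  all levels are below 2p because r < p.\<close>

lemma P_nilpotent:
  assumes f: "f \<in> funs_on P_basis" and r: "r < p"
  shows "(P_ops r k h L_F ^^ (2 * p)) f = 0"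
proof -
  have "2 * p \<le> l + (if z then r else 0) + N \<Longrightarrow> (P_ops r k h L_F ^^ N) f (z, l) = 0" for N z l
  proof (induction N arbitrary: z l)
    case 0
    then show ?case using r funs_onD[OF f, of "(z, l)"] by (auto split: if_splits)
  next
    case (Suc N)
    have "(P_ops r k h L_F ^^ N) f (z, Suc l) = 0"
      by (rule Suc.IH) (use Suc.prems in auto)
    moreover have "(P_ops r k h L_F ^^ N) f (True, l + 1 - r) = 0" if "\<not> z" "r - 1 \<le> l" "l < p"
      by (rule Suc.IH) (use Suc.prems that in auto)
    ultimately show ?case by (cases z) (simp_all add: P_ops_apply)
  qed
  then show ?thesis by (auto simp: fun_eq_iff zero_fun_apply)
qed

lemma S_nilpotent:
  assumes f: "f \<in> funs_on {..<d}"
  shows "d \<le> N \<Longrightarrow> (S_ops d k h L_F ^^ N) f = 0"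
proof -
  have "d \<le> l + N \<Longrightarrow> (S_ops d k h L_F ^^ N) f l = 0" for N l
  proof (induction N arbitrary: l)
    case 0
    then show ?case using funs_onD[OF f, of l] by simp
  next
    case (Suc N)
    then show ?case using Suc.IH[of "Suc l"] by (simp add: S_ops_def)
  qed
  then show "d \<le> N \<Longrightarrow> (S_ops d k h L_F ^^ N) f = 0" by (auto simp: fun_eq_iff zero_fun_apply)
qed

lemma q_pow_inj: "a < p \<Longrightarrow> b < p \<Longrightarrow> q ^ a = q ^ b \<Longrightarrow> a = b"
proof -
  have *: "a = b" if "a \<le> b" "b < p" "q ^ a = q ^ b" for a b
  proof -
    have "q ^ a * q ^ (b - a) = q ^ b" using that(1) by (simp flip: power_add)
    then have "q ^ a * q ^ (b - a) = q ^ a * 1" using that(3) by simp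
    then have "q ^ (b - a) = 1" by simp
    then have "p dvd b - a" by (simp only: q_pow_eq_1)
    then show ?thesis using that by (auto dest: dvd_imp_le)
  qed
  show "a < p \<Longrightarrow> b < p \<Longrightarrow> q ^ a = q ^ b \<Longrightarrow> a = b"
    using *[of a b] *[of b a] by (cases "a \<le> b") auto
qed

text \<open>For w = q^(d-1) the coefficient is \<open>qnum l\<close> times 1 - q^(d-l), and q has
  order p; so strictly between 0 and p the only zero is l = d.\<close>

lemma lowering_nz:
  assumes l: "0 < l" "l < p" and d: "0 < d" "d \<le> p" "l \<noteq> d"
  shows "lowering l (q ^ (d - 1)) \<noteq> 0"
proof -
  have 1: "q ^ (d - 1) * q = q ^ d" using d by (cases d) simp_all
  have "q ^ d \<noteq> q ^ l"
  proof (cases "d = p")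
    case True
    then show ?thesis using q_prim[of l] l q_order by auto
  qed (use q_pow_inj[of d l] l d in auto)
  then have "q ^ d * qi ^ l \<noteq> 1" by (auto simp: power_inverse field_simps)
  moreover have "qnum l \<noteq> 0" using l by (auto simp: qnum_eq_0 dest: dvd_imp_le)
  ultimately show ?thesis unfolding lowering_def 1 by simp
qed

lemma lowering_zero: "0 < d \<Longrightarrow> lowering d (q ^ (d - 1)) = 0"
  by (cases d) (simp_all add: lowering_def mult_ac)

lemma S_kerF:
  assumes f: "f \<in> funs_on {..<d}" and w: "h / k = q ^ (d - 1)" and d: "0 < d" "d \<le> p"
    and F: "S_ops d k h L_F f = 0"
  shows "f = f 0 *\<^sub>f delta 0"
proof
  fix l
  show "f l = (f 0 *\<^sub>f delta 0) l"
  proof (cases l)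
    case (Suc m)
    have "f (Suc m) = 0"
    proof (cases "Suc m < d")
      case True
      then show ?thesis using fun_cong[OF F, of m] lowering_nz[of "Suc m" d] d w
        by (simp add: S_ops_def zero_fun_apply)
    qed (use funs_onD[OF f] in auto)
    then show ?thesis by (simp add: Suc fscale_apply delta_def)
  qed (simp add: fscale_apply delta_def)
qed

text \<open>As d + r = p, the exponent 2r + d - 1 equals p + r - 1. So K acts on \<alpha> as
  q^(r-1), and r plays in its string the part that d plays in the string of \<gamma>.\<close>

lemma weight_alpha:
  assumes "h / k = q ^ (d - 1)" "d + r = p" "0 < d" "0 < r"
  shows "q ^ (2 * r) * (h / k) = q ^ (r - 1)"
proof -
  have "2 * r + (d - 1) = p + (r - 1)" using assms by simp
  then show ?thesis using assms(1) q_order by (metis mult_1 power_add)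
qed

text \<open>Within their own strings the coefficient of F vanishes only on \<gamma>, E^d \<gamma>,
  \<alpha> and E^r \<alpha>. The first two are excluded because F sends them to non-zero multiples
  of E^(r-1) \<alpha> and E^(p-1) \<alpha>.\<close>

lemma P_kerF:
  assumes f: "f \<in> funs_on P_basis" and w: "h / k = q ^ (d - 1)" and d: "d + r = p" "0 < d" "0 < r"
    and F: "P_ops r k h L_F f = 0"
  shows "f = f (False, 0) *\<^sub>f delta (False, 0) + f (False, r) *\<^sub>f delta (False, r)"
proof -
  have wa: "q ^ (2 * r) * h / k = q ^ (r - Suc 0)" using weight_alpha[OF w d] by simp
  have F': "P_ops r k h L_F f (z, l) = 0" for z l by (simp add: F zero_fun_apply)
  have T1: "f (True, l) = 0" if "l > 0" "l \<noteq> d" for l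
  proof (cases "l < p")
    case True
    then show ?thesis using F'[of True "l - 1"] that lowering_nz[of l d] d w by (simp add: P_ops_apply)
  qed (use funs_onD[OF f] in auto)
  \<comment> \<open>At E^(r-1) \<alpha> the contribution of E^r \<alpha> has coefficient zero, so
    that of \<gamma> stands alone.\<close>
  have "f (True, 0) = 0"
    using F'[of False "r - 1"] d by (simp add: P_ops_apply wa lowering_zero[of r, simplified] split: if_splits)
  \<comment> \<open>At the top vector E^(p-1) \<alpha> nothing comes from the string of \<alpha>,
    and p - r = d identifies the vector of the other string that is mapped there.\<close>
  moreover have "f (True, d) = 0"
  proof -
    have "p - r = d" "r - Suc 0 \<le> p - Suc 0" "r \<le> p" using d by auto
    then show ?thesis using F'[of False "p - 1"] p_pos by (simp add: P_ops_apply del: zero_less_power)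
  qed
  ultimately have T: "f (True, l) = 0" for l using T1[of l] by (cases "l = 0"; cases "l = d") auto
  have A: "f (False, l) = 0" if "l > 0" "l \<noteq> r" for l
  proof (cases "l < p")
    case True
    then show ?thesis using F'[of False "l - 1"] that lowering_nz[of l r] d
      by (simp add: P_ops_apply wa T split: if_splits)
  qed (use funs_onD[OF f] in auto)
  show ?thesis
  proof
    fix x :: "bool \<times> nat"
    obtain z l where x: "x = (z, l)" by (cases x)
    show "f x = (f (False, 0) *\<^sub>f delta (False, 0) + f (False, r) *\<^sub>f delta (False, r)) x"
      using T[of l] A[of l] d by (cases z) (auto simp: x fun_apply delta_def)
  qed
qed

text \<open>On the way down the string to \<alpha> the only zero coefficient is the one from E^r
  \<alpha> to E^(r-1) \<alpha>; the last hypothesis on l and m says that this step is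
  avoided.\<close>

lemma F_pow_delta:
  assumes w: "h / k = q ^ (d - 1)" and d: "d + r = p" "0 < d" "0 < r" and l: "l < p" "m \<le> l" "r \<le> l - m \<or> l < r"
  shows "\<exists>c. c \<noteq> 0 \<and> (P_ops r k h L_F ^^ m) (delta (False, l)) = c *\<^sub>f delta (False, l - m)"
  using l
proof (induction m)
  case 0
  show ?case by (intro exI[of _ 1]) simp
next
  case (Suc m)
  have "r \<le> l - m \<or> l < r" "m \<le> l" using Suc.prems by auto
  then obtain c where c: "c \<noteq> 0" "(P_ops r k h L_F ^^ m) (delta (False, l)) = c *\<^sub>f delta (False, l - m)"
    using Suc.IH Suc.prems(1) by blast
  have "P_ops r k h L_F (delta (False, l - m)) = lowering (l - m) (q ^ (r - 1)) *\<^sub>f delta (False, l - Suc m)"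
  proof
    fix x :: "bool \<times> nat" obtain z l' where "x = (z, l')" by (cases x)
    then show "P_ops r k h L_F (delta (False, l - m)) x =
        (lowering (l - m) (q ^ (r - 1)) *\<^sub>f delta (False, l - Suc m)) x"
      using Suc.prems weight_alpha[OF w d] by (auto simp: P_ops_apply delta_def fscale_apply)
  qed
  moreover have "lowering (l - m) (q ^ (r - 1)) \<noteq> 0"
    by (rule lowering_nz) (use Suc.prems d in auto)
  ultimately show ?case
    by (intro exI[of _ "c * lowering (l - m) (q ^ (r - 1))"])
      (simp add: c lin_scale[OF lin_P_ops])
qed

section \<open>Submodules as invariant spaces, and the socle of P\<close>

definition invariant_space :: "(letter \<Rightarrow> ('b \<Rightarrow> 'k) \<Rightarrow> 'b \<Rightarrow> 'k) \<Rightarrow> ('b \<Rightarrow> 'k) set \<Rightarrow> bool" where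
  "invariant_space T U \<longleftrightarrow> 0 \<in> U \<and> (\<forall>f\<in>U. \<forall>g\<in>U. f + g \<in> U) \<and> (\<forall>c. \<forall>f\<in>U. c *\<^sub>f f \<in> U) \<and> (\<forall>g. \<forall>f\<in>U. T g f \<in> U)"

lemma invariant_spaceD:
  assumes "invariant_space T U"
  shows "0 \<in> U" "f \<in> U \<Longrightarrow> g \<in> U \<Longrightarrow> f + g \<in> U" "f \<in> U \<Longrightarrow> c *\<^sub>f f \<in> U" "f \<in> U \<Longrightarrow> T g' f \<in> U"
    "f \<in> U \<Longrightarrow> (T g' ^^ m) f \<in> U" "c \<noteq> 0 \<Longrightarrow> c *\<^sub>f f \<in> U \<Longrightarrow> f \<in> U"
    "(\<And>i. i \<in> I \<Longrightarrow> F i \<in> U) \<Longrightarrow> (\<Sum>i\<in>I. F i) \<in> U" "f \<in> U \<Longrightarrow> frep T x f \<in> U"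
proof -
  note * = assms[unfolded invariant_space_def]
  show 1: "0 \<in> U" "f \<in> U \<Longrightarrow> g \<in> U \<Longrightarrow> f + g \<in> U" "f \<in> U \<Longrightarrow> c *\<^sub>f f \<in> U" "f \<in> U \<Longrightarrow> T g' f \<in> U"
    for f g c g' using * by blast+
  show "f \<in> U \<Longrightarrow> (T g' ^^ m) f \<in> U" by (induction m) (simp_all add: 1)
  show "c \<noteq> 0 \<Longrightarrow> c *\<^sub>f f \<in> U \<Longrightarrow> f \<in> U" using 1(3)[of "c *\<^sub>f f" "inverse c"] by simp
  show s: "(\<And>i. i \<in> I \<Longrightarrow> F i \<in> U) \<Longrightarrow> (\<Sum>i\<in>I. F i) \<in> U" for I :: "'z set" and F
    by (induction I rule: infinite_finite_induct) (simp_all add: 1)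
  show "f \<in> U \<Longrightarrow> frep T x f \<in> U"
    unfolding rep_def word_act_def by (intro s 1 foldr_funs_on[where F = U])
qed

text \<open>By nilpotency of F the space contains a non-zero vector a \<alpha> + b E^r \<alpha> of
  its kernel. If a = 0 this gives E^r \<alpha>; otherwise E^(p-1) isolates the top vector E^(p-1)
  \<alpha>, and d - 1 steps down lead to E^r \<alpha>. Powers of E do the rest.\<close>

lemma P_invariant_contains_socle:
  assumes w: "h / k = q ^ (d - 1)" and d: "d + r = p" "0 < d" "0 < r"
    and U: "invariant_space (P_ops r k h) U" "U \<subseteq> funs_on P_basis" "f \<in> U" "f \<noteq> 0"
  shows "funs_on ({False} \<times> {r..<p}) \<subseteq> U"
proof -
  let ?T = "P_ops r k h"
  have "\<exists>g\<in>U. g \<noteq> 0 \<and> ?T L_F g = 0"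
  proof (rule ccontr)
    assume no: "\<not> ?thesis"
    have "(?T L_F ^^ m) f \<noteq> 0" for m
    proof (induction m)
      case (Suc m)
      have "(?T L_F ^^ m) f \<in> U" by (rule invariant_spaceD(5)[OF U(1,3)])
      then show ?case using Suc no by auto
    qed (simp add: U)
    moreover have "r < p" "f \<in> funs_on P_basis" using U d by auto
    ultimately show False using P_nilpotent[of f r k h] by blast
  qed
  then obtain g where g: "g \<in> U" "g \<noteq> 0" "?T L_F g = 0" by blast
  define a b where "a = g (False, 0)" and "b = g (False, r)"
  have gab: "g = a *\<^sub>f delta (False, 0) + b *\<^sub>f delta (False, r)"
    unfolding a_def b_def by (rule P_kerF[OF _ w d g(3)]) (use g U in auto)
  have sm: "delta (False, r) \<in> U"
  proof (cases "a = 0")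
    case True
    then have "b \<noteq> 0" using gab g(2) by auto
    then show ?thesis using gab g(1) True invariant_spaceD(6)[OF U(1), where c = b] by simp
  next
    case False
    have l: "lin (?T L_E ^^ (p - 1))" by (intro lin_funpow lin_P_ops)
    have "(?T L_E ^^ (p - 1)) g = a *\<^sub>f delta (False, p - 1)"
      unfolding gab lin_add[OF l] lin_scale[OF l] funpow_E_P_ops using d n_pos by auto
    then have "a *\<^sub>f delta (False, p - 1) \<in> U" using invariant_spaceD(5)[OF U(1) g(1), where g' = L_E and m = "p - 1"] by simp
    then have top: "delta (False, p - 1) \<in> U" by (rule invariant_spaceD(6)[OF U(1) False])
    have "\<exists>c. c \<noteq> 0 \<and> (?T L_F ^^ (d - 1)) (delta (False, p - 1)) = c *\<^sub>f delta (False, p - 1 - (d - 1))"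
      by (rule F_pow_delta[OF w d]) (use d in auto)
    then obtain c where "c \<noteq> 0" "(?T L_F ^^ (d - 1)) (delta (False, p - 1)) = c *\<^sub>f delta (False, p - 1 - (d - 1))"
      by blast
    moreover have "p - 1 - (d - 1) = r" using d by simp
    ultimately show ?thesis
      using invariant_spaceD(5)[OF U(1) top, where g' = L_F and m = "d - 1"] invariant_spaceD(6)[OF U(1), where c = c] by auto
  qed
  have basis: "delta (False, l) \<in> U" if "r \<le> l" "l < p" for l
    using invariant_spaceD(5)[OF U(1) sm, where g' = L_E and m = "l - r"] that by (simp add: funpow_E_P_ops)
  show ?thesis
  proof
    fix f :: "bool \<times> nat \<Rightarrow> 'k" assume f: "f \<in> funs_on ({False} \<times> {r..<p})"
    have "f = (\<Sum>b\<in>{False} \<times> {r..<p}. f b *\<^sub>f delta b)"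
      by (rule delta_expansion[OF _ f]) simp
    moreover have "(\<Sum>b\<in>{False} \<times> {r..<p}. f b *\<^sub>f delta b) \<in> U"
      by (rule invariant_spaceD(7)[OF U(1)], rule invariant_spaceD(3)[OF U(1)]) (use basis in auto)
    ultimately show "f \<in> U" by simp
  qed
qed

lemma coords_inv:
  assumes M: "coords n q M B T \<Phi>" and f: "f \<in> funs_on B"
  shows "inv\<^bsub>add_monoid M\<^esub> (\<Phi> f) = \<Phi> (- f)"
  unfolding m_inv_def
proof (rule the_equality)
  have "\<Phi> f \<oplus>\<^bsub>M\<^esub> \<Phi> (- f) = \<zero>\<^bsub>M\<^esub>" "\<Phi> (- f) \<oplus>\<^bsub>M\<^esub> \<Phi> f = \<zero>\<^bsub>M\<^esub>"
    using coordsD(5)[OF M, of f "- f"] coordsD(5)[OF M, of "- f" f] f coordsD(4)[OF M] by simp_all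
  then show "\<Phi> (- f) \<in> carrier (add_monoid M) \<and> \<Phi> f \<otimes>\<^bsub>add_monoid M\<^esub> \<Phi> (- f) = \<one>\<^bsub>add_monoid M\<^esub> \<and>
      \<Phi> (- f) \<otimes>\<^bsub>add_monoid M\<^esub> \<Phi> f = \<one>\<^bsub>add_monoid M\<^esub>"
    using coordsD(7)[OF M, of "- f"] f by simp
  fix y assume y: "y \<in> carrier (add_monoid M) \<and> \<Phi> f \<otimes>\<^bsub>add_monoid M\<^esub> y = \<one>\<^bsub>add_monoid M\<^esub> \<and>
      y \<otimes>\<^bsub>add_monoid M\<^esub> \<Phi> f = \<one>\<^bsub>add_monoid M\<^esub>"
  then have "y \<in> \<Phi> ` funs_on B" using coordsD(3)[OF M] by (simp add: bij_betw_def)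
  then obtain g where g: "g \<in> funs_on B" "y = \<Phi> g" by blast
  then have "\<Phi> (f + g) = \<Phi> 0" using y f coordsD(4)[OF M] coordsD(5)[OF M f g(1)] by simp
  then have "f + g = 0" using bij_betw_imp_inj_on[OF coordsD(3)[OF M]] f g by (auto dest: inj_onD)
  then show "y = \<Phi> (- f)" using g by (simp add: minus_unique)
qed

lemma coords_submodule:
  assumes M: "coords n q M B T \<Phi>" and U: "invariant_space T U" "U \<subseteq> funs_on B"
  shows "submodule (\<Phi> ` U) (Qu n q) M"
proof (intro submodule.intro submodule_axioms.intro subgroup.intro)
  show "\<Phi> ` U \<subseteq> carrier (add_monoid M)" using U coordsD(7)[OF M] by auto
  show "x \<otimes>\<^bsub>add_monoid M\<^esub> y \<in> \<Phi> ` U" if xy: "x \<in> \<Phi> ` U" "y \<in> \<Phi> ` U" for x y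
  proof -
    obtain f g where fg: "f \<in> U" "g \<in> U" "x = \<Phi> f" "y = \<Phi> g" using xy by blast
    then have "f \<in> funs_on B" "g \<in> funs_on B" using U by blast+
    then have "x \<otimes>\<^bsub>add_monoid M\<^esub> y = \<Phi> (f + g)" using coordsD(5)[OF M] fg by simp
    then show ?thesis using invariant_spaceD(2)[OF U(1) fg(1,2)] by blast
  qed
  show "\<one>\<^bsub>add_monoid M\<^esub> \<in> \<Phi> ` U"
    using invariant_spaceD(1)[OF U(1)] coordsD(4)[OF M] by force
  show "inv\<^bsub>add_monoid M\<^esub> x \<in> \<Phi> ` U" if "x \<in> \<Phi> ` U" for x
  proof -
    obtain f where f: "f \<in> U" "x = \<Phi> f" using \<open>x \<in> \<Phi> ` U\<close> by blast
    have "- f = (- 1) *\<^sub>f f" by (simp add: fun_eq_iff fun_apply)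
    then have "- f \<in> U" using invariant_spaceD(3)[OF U(1) f(1)] by simp
    then show ?thesis using f U by (auto simp: coords_inv[OF M])
  qed
  show "a \<odot>\<^bsub>M\<^esub> x \<in> \<Phi> ` U" if ax: "a \<in> carrier (Qu n q)" "x \<in> \<Phi> ` U" for a x
  proof -
    obtain u f where uf: "a = Qu_cls n q u" "f \<in> U" "x = \<Phi> f" using ax by (auto simp: carrier_Qu)
    then have "f \<in> funs_on B" using U by blast
    then have "a \<odot>\<^bsub>M\<^esub> x = \<Phi> (frep T u f)" using coordsD(6)[OF M] uf by simp
    then show ?thesis using invariant_spaceD(8)[OF U(1) uf(2)] by blast
  qed
qed

lemma submodule_coords:
  assumes M: "coords n q M B T \<Phi>" and N: "submodule N (Qu n q) M"
  obtains U where "invariant_space T U" "U \<subseteq> funs_on B" "N = \<Phi> ` U"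
proof
  define U where "U = {f \<in> funs_on B. \<Phi> f \<in> N}"
  interpret submodule N "Qu n q" M by fact
  have sm: "\<Phi> (frep T x f) \<in> N" if "f \<in> U" for x f
    using smult_closed[of "Qu_cls n q x" "\<Phi> f"] that coordsD(6)[OF M, of f x]
    by (auto simp: U_def carrier_Qu)
  show "U \<subseteq> funs_on B" by (auto simp: U_def)
  show "invariant_space T U"
    unfolding invariant_space_def
  proof (intro conjI ballI allI)
    show "0 \<in> U" using one_closed coordsD(4)[OF M] by (simp add: U_def)
    show "f + g \<in> U" if "f \<in> U" "g \<in> U" for f g
      using m_closed[of "\<Phi> f" "\<Phi> g"] that coordsD(5)[OF M, of f g] by (simp add: U_def)
    show "c *\<^sub>f f \<in> U" if "f \<in> U" for c f
      using sm[OF that, of "const c"] that by (simp add: U_def rep_const[OF coordsD(9)[OF M]])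
    show "T g f \<in> U" if "f \<in> U" for g f
      using sm[OF that, of "gen g"] that coordsD(2)[OF M] by (simp add: U_def frep_gen)
  qed
  show "N = \<Phi> ` U"
  proof (intro equalityI subsetI)
    fix x assume x: "x \<in> N"
    then have "x \<in> \<Phi> ` funs_on B" using coordsD(3)[OF M] subset by (auto simp: bij_betw_def)
    then show "x \<in> \<Phi> ` U" using x by (auto simp: U_def)
  qed (auto simp: U_def)
qed

text \<open>The embedding of S into P: the string of length d becomes the end E^r \<alpha>, ...,
  E^(p-1) \<alpha> of the string of \<alpha>.\<close>

definition shift :: "nat \<Rightarrow> (nat \<Rightarrow> 'k) \<Rightarrow> bool \<times> nat \<Rightarrow> 'k" where
  "shift r f = (\<lambda>(z, l). if \<not> z \<and> r \<le> l then f (l - r) else 0)"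

lemma lin_shift: "lin (shift r)"
  by (intro linI ext) (auto simp: shift_def fun_apply split: prod.split)

text \<open>The weights agree since \<gamma> has the weight of E^r \<alpha>, the coefficients of F
  agree by the symmetry of \<open>lowering\<close> under d + r = p, and F E^r \<alpha> = 0 makes the
  lower end match.\<close>

lemma shift_intertwine:
  assumes w: "h / k = q ^ (d - 1)" and d: "d + r = p" "0 < d" "0 < r" and f: "f \<in> funs_on {..<d}"
  shows "shift r (S_ops d k h g f) = P_ops r k h g (shift r f)"
proof
  fix x :: "bool \<times> nat" obtain z l where x: "x = (z, l)" by (cases x)
  have wl: "lowering (Suc (l' + r)) (q ^ (2 * r) * (h / k)) = lowering (Suc l') (h / k)" for l'
  proof -
    have "q ^ r * q ^ d = 1" using d q_order by (simp flip: power_add add: add.commute)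
    then have 1: "q ^ d = qi ^ r" by (simp add: power_inverse field_simps)
    have 2: "q ^ (d - 1) * q = q ^ d" "q ^ (r - 1) * q = q ^ r" using d by (cases d; cases r; simp)+
    \<comment> \<open>Times 1 - q^(-1), both sides are the product of 1 - q^(-(l'+1+r)) and 1 -
      q^(-(l'+1)), in opposite orders, because q^d = q^(-r).\<close>
    have m: "(1 - qi) * (qnum (Suc (l' + r)) * (1 - q ^ r * qi ^ Suc (l' + r))) =
        (1 - qi) * (qnum (Suc l') * (1 - q ^ d * qi ^ Suc l'))"
      unfolding mult.assoc[symmetric] qnum_eq
    proof -
      have "q ^ r * qi ^ Suc (l' + r) = qi ^ Suc l'" by (simp add: q_pow_mult_qi)
      moreover have "q ^ d * qi ^ Suc l' = qi ^ Suc (l' + r)" by (simp add: 1 power_add)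
      ultimately show "(1 - qi ^ Suc (l' + r)) * (1 - q ^ r * qi ^ Suc (l' + r)) =
        (1 - qi ^ Suc l') * (1 - q ^ d * qi ^ Suc l')" by (simp only: mult.commute)
    qed
    then have "qnum (Suc (l' + r)) * (1 - q ^ r * qi ^ Suc (l' + r)) = qnum (Suc l') * (1 - q ^ d * qi ^ Suc l')"
      using qi_neq_1 by (metis eq_iff_diff_eq_0 mult_left_cancel)
    then show ?thesis
      unfolding lowering_def weight_alpha[OF w d] by (simp only: w 2)
  qed
  have z0: "f l = 0" if "d \<le> l" for l using funs_onD[OF f, of l] that by simp
  show "shift r (S_ops d k h g f) x = P_ops r k h g (shift r f) x"
  proof (cases "\<not> z \<and> r \<le> l")
    case True
    then obtain l' where l': "l = l' + r" by (metis add.commute le_add_diff_inverse)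
    have a: "(q ^ n) ^ (l' + r) * ((qi ^ n) ^ r * k) = (q ^ n) ^ l' * k"
      by (simp add: power_add mult_ac flip: power_mult_distrib)
    have b: "(q ^ n * qi ^ 2) ^ (l' + r) * ((qi ^ n * q ^ 2) ^ r * h) = (q ^ n * qi ^ 2) ^ l' * h"
    proof -
      have "(q ^ n * qi ^ 2) * (qi ^ n * q ^ 2) = (q ^ n * qi ^ n) * (qi ^ 2 * q ^ 2)" by (simp only: mult_ac)
      also have "\<dots> = 1" by simp
      finally have "(q ^ n * qi ^ 2) ^ r * (qi ^ n * q ^ 2) ^ r = 1" by (simp flip: power_mult_distrib)
      then show ?thesis by (simp add: power_add mult.assoc)
    qed
    show ?thesis
    proof (cases g)
      case L_E
      then show ?thesis using True d z0[of "l' - 1"] by (auto simp: x l' shift_def P_ops_apply S_ops_apply)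
    next
      case L_F
      then show ?thesis using True d wl[of l'] z0[of "Suc l'"] by (auto simp: x l' shift_def P_ops_apply S_ops_apply)
    qed (use True a b in \<open>auto simp: x l' shift_def P_ops_apply S_ops_apply\<close>)
  next
    case False
    \<comment> \<open>The only way for F to leave the range of \<open>shift\<close> is from E^r
      \<alpha> to E^(r-1) \<alpha>, and this coefficient is zero.\<close>
    have lr: "lowering r (q ^ (2 * r) * h / k) = 0"
      using weight_alpha[OF w d] lowering_zero[of r] d by simp
    show ?thesis
    proof (cases "g = L_F \<and> Suc l = r")
      case True
      then show ?thesis using lr d by (cases z) (auto simp: x shift_def P_ops_apply S_ops_apply)
    next
      case F: False
      then show ?thesis
      proof (cases "g = L_F")
        case True
        then have "\<not> z \<Longrightarrow> \<not> r \<le> Suc l" using F False by auto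
        then show ?thesis using True False by (cases z) (auto simp: x shift_def P_ops_apply S_ops_apply)
      qed (use False d in \<open>cases g; auto simp: x shift_def P_ops_apply S_ops_apply\<close>)
    qed
  qed
qed

lemma shift_bij:
  assumes d: "d + r = p"
  shows "bij_betw (shift r) (funs_on {..<d}) (funs_on ({False} \<times> {r..<p}))"
  unfolding bij_betw_def
proof
  have inv: "shift r f (False, l + r) = f l" for f l by (simp add: shift_def)
  show "inj_on (shift r) (funs_on {..<d})"
    by (rule inj_onI) (metis ext inv)
  show "shift r ` funs_on {..<d} = funs_on ({False} \<times> {r..<p})"
  proof (intro equalityI subsetI)
    fix y assume "y \<in> shift r ` funs_on {..<d}"
    then show "y \<in> funs_on ({False} \<times> {r..<p})"
      using d by (auto simp: funs_on_def shift_def)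
  next
    fix y :: "bool \<times> nat \<Rightarrow> 'k" assume y: "y \<in> funs_on ({False} \<times> {r..<p})"
    have "y = shift r (\<lambda>l. y (False, l + r))"
      using funs_onD[OF y] by (auto simp: shift_def fun_eq_iff)
    moreover have "(\<lambda>l. y (False, l + r)) \<in> funs_on {..<d}"
      using d by (intro funs_onI funs_onD[OF y]) auto
    ultimately show "y \<in> shift r ` funs_on {..<d}" by blast
  qed
qed

text \<open>The end of the string of \<alpha> is contained in every non-zero submodule; so it is
  simple and is the only simple submodule, and the sum of all of them is itself.\<close>

lemma socle_P:
  assumes M: "coords n q M P_basis (P_ops r k h) \<Phi>"
    and w: "h / k = q ^ (d - 1)" and d: "d + r = p" "0 < d" "0 < r"
  shows "Soc (Qu n q) M = \<Phi> ` funs_on ({False} \<times> {r..<p})"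
proof -
  let ?T = "P_ops r k h" and ?S = "funs_on ({False} \<times> {r..<p}) :: (bool \<times> nat \<Rightarrow> 'k) set"
  have bij: "?S = shift r ` funs_on {..<d}" using shift_bij[OF d(1)] by (simp add: bij_betw_def)
  have SU: "?S \<subseteq> funs_on P_basis" by (auto simp: funs_on_def)
  have invS: "invariant_space ?T ?S"
    unfolding invariant_space_def
  proof (intro conjI ballI allI)
    fix g f assume "f \<in> ?S"
    then obtain f' where "f' \<in> funs_on {..<d}" "f = shift r f'" using bij by blast
    then have "?T g f = shift r (S_ops d k h g f')" "S_ops d k h g f' \<in> funs_on {..<d}"
      using shift_intertwine[OF w d] S_ops_funs_on by simp_all
    then show "?T g f \<in> ?S" using bij by blast
  qed auto
  have z: "\<Phi> f = \<zero>\<^bsub>M\<^esub> \<longleftrightarrow> f = 0" if "f \<in> funs_on P_basis" for f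
    using bij_betw_imp_inj_on[OF coordsD(3)[OF M]] coordsD(4)[OF M] that
    by (metis funs_on_simps(1) inj_onD)
  have ex: "\<exists>f\<in>U. f \<noteq> 0" if "U \<subseteq> funs_on P_basis" "\<Phi> ` U \<noteq> {\<zero>\<^bsub>M\<^esub>}" "invariant_space ?T U" for U
  proof (rule ccontr)
    assume "\<not> ?thesis"
    then have "U = {0}" using invariant_spaceD(1)[OF that(3)] by blast
    then show False using that(2) coordsD(4)[OF M] by simp
  qed
  have sub: "submodule (\<Phi> ` ?S) (Qu n q) M" by (rule coords_submodule[OF M invS SU])
  have ne: "\<Phi> ` ?S \<noteq> {\<zero>\<^bsub>M\<^esub>}"
  proof
    assume e: "\<Phi> ` ?S = {\<zero>\<^bsub>M\<^esub>}"
    have in_S: "delta (False, r) \<in> ?S" using d by simp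
    then have "\<Phi> (delta (False, r)) = \<zero>\<^bsub>M\<^esub>" using e by blast
    then have "(delta (False, r) :: bool \<times> nat \<Rightarrow> 'k) = 0" using z in_S SU by blast
    from fun_cong[OF this, of "(False, r)"] show False by (simp add: delta_def zero_fun_apply)
  qed
  have "simple_submodule N (Qu n q) M \<longleftrightarrow> N = \<Phi> ` ?S" for N
  proof
    assume N: "simple_submodule N (Qu n q) M"
    then have N': "submodule N (Qu n q) M" "N \<noteq> {\<zero>\<^bsub>M\<^esub>}" by (auto simp: simple_submodule_def)
    obtain U where U: "invariant_space ?T U" "U \<subseteq> funs_on P_basis" "N = \<Phi> ` U"
      using N'(1) by (rule submodule_coords[OF M])
    then obtain f where "f \<in> U" "f \<noteq> 0" using ex[of U] N'(2) by auto
    from P_invariant_contains_socle[OF w d U(1,2) this]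
    have "\<Phi> ` ?S \<subseteq> N" using U(3) by blast
    then have "\<Phi> ` ?S = {\<zero>\<^bsub>M\<^esub>} \<or> \<Phi> ` ?S = N" using N sub unfolding simple_submodule_def by blast
    with ne show "N = \<Phi> ` ?S" by blast
  next
    assume N: "N = \<Phi> ` ?S"
    show "simple_submodule N (Qu n q) M"
      unfolding simple_submodule_def N
    proof (intro conjI allI impI sub ne)
      fix L assume L: "submodule L (Qu n q) M \<and> L \<subseteq> \<Phi> ` ?S"
      then have L': "submodule L (Qu n q) M" by simp
      obtain U where U: "invariant_space ?T U" "U \<subseteq> funs_on P_basis" "L = \<Phi> ` U"
        using L' by (rule submodule_coords[OF M])
      show "L = {\<zero>\<^bsub>M\<^esub>} \<or> L = \<Phi> ` ?S"
      proof (rule disjCI)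
        assume "L \<noteq> \<Phi> ` ?S"
        show "L = {\<zero>\<^bsub>M\<^esub>}"
        proof (rule ccontr)
          assume "L \<noteq> {\<zero>\<^bsub>M\<^esub>}"
          then obtain f where "f \<in> U" "f \<noteq> 0" using U ex[of U] by auto
          from P_invariant_contains_socle[OF w d U(1,2) this]
          show False using U(3) L \<open>L \<noteq> \<Phi> ` ?S\<close> by blast
        qed
      qed
    qed
  qed
  then have "\<Union>{N. simple_submodule N (Qu n q) M} = \<Phi> ` ?S" by simp
  then show ?thesis
    unfolding Soc_def submodule_gen_def using sub by auto
qed

lemma coords_socle:
  assumes M: "coords n q M P_basis (P_ops r k h) \<Phi>"
    and w: "h / k = q ^ (d - 1)" and d: "d + r = p" "0 < d" "0 < r"
  shows "coords n q (M\<lparr>carrier := Soc (Qu n q) M\<rparr>) {..<d} (S_ops d k h) (\<lambda>f. \<Phi> (shift r f))"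
proof -
  have SU: "funs_on ({False} \<times> {r..<p}) \<subseteq> (funs_on P_basis :: (bool \<times> nat \<Rightarrow> 'k) set)" by (auto simp: funs_on_def)
  have sh: "shift r f \<in> funs_on P_basis" if "f \<in> funs_on {..<d}" for f
    using bij_betw_apply[OF shift_bij[OF d(1)] that] SU by blast
  have "bij_betw \<Phi> (funs_on ({False} \<times> {r..<p})) (\<Phi> ` funs_on ({False} \<times> {r..<p}))"
    by (rule bij_betw_subset[OF coordsD(3)[OF M] SU refl])
  from bij_betw_trans[OF shift_bij[OF d(1)] this]
  have 1: "bij_betw (\<lambda>f. \<Phi> (shift r f)) (funs_on {..<d}) (Soc (Qu n q) M)"
    by (simp add: socle_P[OF M w d] comp_def)
  have 2: "shift r (frep (S_ops d k h) x f) = frep (P_ops r k h) x (shift r f)" if "f \<in> funs_on {..<d}" for x f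
    by (rule frep_intertwine[OF lin_shift _ _ that]) (auto intro: S_ops_funs_on shift_intertwine[OF w d])
  show ?thesis
    unfolding coords_def
    using 1 2 sh coordsD(4,5,6)[OF M] lin_S_ops S_ops_funs_on
    by (simp add: lin_0[OF lin_shift] lin_add[OF lin_shift])
qed

end

section \<open>The regular module and its submodules P\<close>

context root_order begin

abbreviation "cls \<equiv> Qu_cls n q"

text \<open>Computations in A are done with representatives in the free algebra modulo the
  relations; cosets reappear only where module structures are compared.\<close>

definition cong :: "'k falg \<Rightarrow> 'k falg \<Rightarrow> bool" (infix \<open>\<cong>\<^sub>A\<close> 50) where "x \<cong>\<^sub>A y \<longleftrightarrow> cls x = cls y"

lemma cong_refl [simp]: "x \<cong>\<^sub>A x" and cong_sym: "x \<cong>\<^sub>A y \<Longrightarrow> y \<cong>\<^sub>A x"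
  and cong_trans [trans]: "x \<cong>\<^sub>A y \<Longrightarrow> y \<cong>\<^sub>A z \<Longrightarrow> x \<cong>\<^sub>A z"
  by (simp_all add: cong_def)

lemma cong_iff: "x \<cong>\<^sub>A y \<longleftrightarrow> x - y \<in> Qu_ideal n q"
  by (simp add: cong_def Qu_cls_eq_iff)

lemma cong_mult: assumes "x \<cong>\<^sub>A x'" "y \<cong>\<^sub>A y'" shows "x * y \<cong>\<^sub>A x' * y'"
proof -
  have "x * y - x' * y' = (x - x') * y + x' * (y - y')" by (simp add: algebra_simps)
  then show ?thesis using assms unfolding cong_iff by (simp add: Qu_ideal_closed)
qed

lemma cong_multL: "y \<cong>\<^sub>A y' \<Longrightarrow> x * y \<cong>\<^sub>A x * y'" and cong_multR: "y \<cong>\<^sub>A y' \<Longrightarrow> y * x \<cong>\<^sub>A y' * x"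
  by (simp_all add: cong_mult)

lemma cong_add: assumes "x \<cong>\<^sub>A x'" "y \<cong>\<^sub>A y'" shows "x + y \<cong>\<^sub>A x' + y'"
proof -
  have "x + y - (x' + y') = (x - x') + (y - y')" by simp
  then show ?thesis using assms unfolding cong_iff by (simp only: Qu_ideal_closed)
qed

lemma cong_diff: assumes "x \<cong>\<^sub>A x'" "y \<cong>\<^sub>A y'" shows "x - y \<cong>\<^sub>A x' - y'"
  using cong_add[OF assms(1) cong_multL[OF assms(2), of "- 1"]] by simp

lemma cong_sum: "(\<And>i. i \<in> I \<Longrightarrow> f i \<cong>\<^sub>A g i) \<Longrightarrow> (\<Sum>i\<in>I. f i) \<cong>\<^sub>A (\<Sum>i\<in>I. g i)"
  by (induction I rule: infinite_finite_induct) (simp_all add: cong_add)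

lemma const_comm: "const c * (x :: 'k falg) = x * const c"
proof (induction x rule: poly_mapping_add_induct)
  case (single w d)
  then show ?case by (simp add: const_def mult_single mult.commute)
next
  case (add x y)
  then show ?case by (simp add: distrib_left distrib_right)
qed simp

lemma const_minus: "const (- c) = (- const c :: 'k falg)" "const (a - b) = (const a - const b :: 'k falg)"
  by (simp_all add: const_def single_uminus single_diff)

lemma const_mult_left: "(x :: 'k falg) * (const c * y) = const c * (x * y)"
  by (metis const_comm mult.assoc)

lemma const_mult_const: "const a * (const b * x) = const (a * b) * (x :: 'k falg)"
  by (simp add: const_simps mult.assoc)

lemma relations:
  "kap ^ n \<cong>\<^sub>A 1" "hat ^ n \<cong>\<^sub>A kap_inv n ^ 2" "kap * hat \<cong>\<^sub>A hat * kap"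
  "kap * gE * kap_inv n \<cong>\<^sub>A const (q ^ n) * gE" "kap * gF * kap_inv n \<cong>\<^sub>A const (qi ^ n) * gF"
  "hat * gE * hat_inv n \<cong>\<^sub>A const (q ^ n * qi ^ 2) * gE" "hat * gF * hat_inv n \<cong>\<^sub>A const (qi ^ n * q ^ 2) * gF"
  "gE ^ p \<cong>\<^sub>A 0" "gF ^ p \<cong>\<^sub>A 0" "gF * gE - const qi * gE * gF \<cong>\<^sub>A 1 - kap_inv n * hat"
  unfolding cong_iff using Qu_rels_subset[of n q] by (auto simp: Qu_rels_def power_inverse)

lemma inverses:
  "kap * kap_inv n \<cong>\<^sub>A 1" "kap_inv n * kap \<cong>\<^sub>A 1" "hat * hat_inv n \<cong>\<^sub>A 1" "hat_inv n * hat \<cong>\<^sub>A 1"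
  using Qu_kap_inv[OF n_pos, of q] Qu_hat_inv[OF n_pos, of q]
  by (simp_all add: cong_def Qu_cls_hom Qu_cls_1)

lemma swap_gen:
  assumes "a * g * b \<cong>\<^sub>A const c * g" "b * a \<cong>\<^sub>A 1"
  shows "a * g \<cong>\<^sub>A const c * (g * a)"
proof -
  have "a * g \<cong>\<^sub>A a * g * (b * a)" using cong_multL[OF cong_sym[OF assms(2)], of "a * g"] by simp
  also have "a * g * (b * a) = (a * g * b) * a" by (simp add: mult.assoc)
  also have "\<dots> \<cong>\<^sub>A (const c * g) * a" by (rule cong_multR[OF assms(1)])
  finally show ?thesis by (simp add: mult.assoc)
qed

lemmas kap_E = swap_gen[OF relations(4) inverses(2)]
  and kap_F = swap_gen[OF relations(5) inverses(2)]
  and hat_E = swap_gen[OF relations(6) inverses(4)]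
  and hat_F = swap_gen[OF relations(7) inverses(4)]

definition wvec :: "'k \<Rightarrow> 'k \<Rightarrow> 'k falg \<Rightarrow> bool" where
  "wvec k h z \<longleftrightarrow> kap * z \<cong>\<^sub>A const k * z \<and> hat * z \<cong>\<^sub>A const h * z"

lemma eig_shift:
  assumes "a * g \<cong>\<^sub>A const c * (g * a)" "a * z \<cong>\<^sub>A const d * z"
  shows "a * (g * z) \<cong>\<^sub>A const (c * d) * (g * z)"
proof -
  have "a * (g * z) = (a * g) * z" by (simp add: mult.assoc)
  also have "\<dots> \<cong>\<^sub>A (const c * (g * a)) * z" by (rule cong_multR[OF assms(1)])
  also have "\<dots> = const c * (g * (a * z))" by (simp add: mult.assoc)
  also have "\<dots> \<cong>\<^sub>A const c * (g * (const d * z))" by (intro cong_multL assms(2))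
  also have "\<dots> = const (c * d) * (g * z)" by (simp only: const_mult_left[of g] const_mult_const)
  finally show ?thesis .
qed

lemma wvec_EF:
  assumes "wvec k h z"
  shows "wvec (q ^ n * k) (q ^ n * qi ^ 2 * h) (gE * z)" "wvec (qi ^ n * k) (qi ^ n * q ^ 2 * h) (gF * z)"
  using assms unfolding wvec_def by (auto intro: eig_shift kap_E kap_F hat_E hat_F)

lemma wvec_EF_pow:
  assumes "wvec k h z"
  shows "wvec ((q ^ n) ^ b * k) ((q ^ n * qi ^ 2) ^ b * h) (gE ^ b * z)"
    "wvec ((qi ^ n) ^ a * k) ((qi ^ n * q ^ 2) ^ a * h) (gF ^ a * z)"
proof -
  show "wvec ((q ^ n) ^ b * k) ((q ^ n * qi ^ 2) ^ b * h) (gE ^ b * z)"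
  proof (induction b)
    case (Suc b)
    from wvec_EF(1)[OF this] show ?case by (simp add: mult.assoc)
  qed (simp add: assms)
  show "wvec ((qi ^ n) ^ a * k) ((qi ^ n * q ^ 2) ^ a * h) (gF ^ a * z)"
  proof (induction a)
    case (Suc a)
    from wvec_EF(2)[OF this] show ?case by (simp add: mult.assoc)
  qed (simp add: assms)
qed

lemma eig_power:
  assumes "a * z \<cong>\<^sub>A const d * z" shows "a ^ m * z \<cong>\<^sub>A const (d ^ m) * z"
proof (induction m)
  case (Suc m)
  have "a ^ Suc m * z = a * (a ^ m * z)" by (simp add: mult.assoc)
  also have "\<dots> \<cong>\<^sub>A a * (const (d ^ m) * z)" by (intro cong_multL Suc)
  also have "\<dots> = const (d ^ m) * (a * z)" by (rule const_mult_left)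
  also have "\<dots> \<cong>\<^sub>A const (d ^ m) * (const d * z)" by (intro cong_multL assms)
  finally show ?case by (simp add: const_mult_const mult.commute)
qed (simp add: const_simps)

lemma eig_mult:
  assumes "a * z \<cong>\<^sub>A const d * z" "b * z \<cong>\<^sub>A const c * z" shows "(a * b) * z \<cong>\<^sub>A const (d * c) * z"
proof -
  have "(a * b) * z = a * (b * z)" by (simp add: mult.assoc)
  also have "\<dots> \<cong>\<^sub>A a * (const c * z)" by (intro cong_multL assms)
  also have "\<dots> = const c * (a * z)" by (rule const_mult_left)
  also have "\<dots> \<cong>\<^sub>A const c * (const d * z)" by (intro cong_multL assms)
  finally show ?thesis by (simp add: const_mult_const mult.commute)
qed

lemma FE_cong:
  assumes z: "wvec k h z" and k: "k ^ n = 1"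
  shows "gE * (gF * z) \<cong>\<^sub>A const q * (gF * (gE * z)) - const (q * (1 - h / k)) * z"
proof -
  have k0: "k \<noteq> 0" using k n_pos by (metis power_0_left zero_neq_one neq0_conv)
  have "k ^ (n - 1) * k = 1" using k n_pos by (metis power_minus_mult)
  then have "k ^ (n - 1) = 1 / k" using k0 by (simp add: field_simps)
  then have Kz: "(kap_inv n * hat) * z \<cong>\<^sub>A const (h / k) * z"
    using eig_mult[OF eig_power[of kap z k "n - 1"], of hat h] z by (simp add: wvec_def kap_inv_def)
  have "(gF * gE - const qi * gE * gF) * z \<cong>\<^sub>A (1 - kap_inv n * hat) * z"
    by (rule cong_multR[OF relations(10)])
  then have 1: "gF * (gE * z) - const qi * (gE * (gF * z)) \<cong>\<^sub>A z - kap_inv n * hat * z"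
    by (simp add: left_diff_distrib mult.assoc)
  also have "\<dots> \<cong>\<^sub>A z - const (h / k) * z" by (intro cong_diff cong_refl Kz)
  finally have 2: "const q * (gF * (gE * z) - const qi * (gE * (gF * z))) \<cong>\<^sub>A const q * (z - const (h / k) * z)"
    by (rule cong_multL)
  have "gE * (gF * z) = const q * (gF * (gE * z)) - const q * (gF * (gE * z) - const qi * (gE * (gF * z)))"
    by (simp add: right_diff_distrib const_mult_const const_simps)
  also have "\<dots> \<cong>\<^sub>A const q * (gF * (gE * z)) - const q * (z - const (h / k) * z)"
    by (intro cong_diff cong_refl 2)
  finally show ?thesis by (simp add: right_diff_distrib const_mult_const const_minus left_diff_distrib)
qed

text \<open>The counterpart of \<open>lowering\<close> for moving E past F: E F^a z = q^a F^a E z -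
  \<open>raising a w\<close> F^(a-1) z if K acts on z as w. For a = 0 the truncated exponent a - 1
  is harmless, the coefficient being 0.\<close>

definition raising :: "nat \<Rightarrow> 'k \<Rightarrow> 'k" where
  "raising a w = (\<Sum>s<a. q ^ s) * (q - q ^ a * w)"

lemma raising_Suc: "raising (Suc a) w = q * raising a w + q * (1 - q ^ (2 * a) * w)"
proof -
  let ?s = "\<Sum>s<a. q ^ s"
  have 1: "(\<Sum>s<Suc a. q ^ s) = q * ?s + 1"
    by (subst sum.lessThan_Suc_shift) (simp add: sum_distrib_left)
  have 2: "(\<Sum>s<Suc a. q ^ s) = ?s + q ^ a" by simp
  have "raising (Suc a) w = q * (\<Sum>s<Suc a. q ^ s) - q ^ Suc a * w * (\<Sum>s<Suc a. q ^ s)"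
    unfolding raising_def by (simp only: right_diff_distrib mult_ac)
  also have "\<dots> = q * (q * ?s + 1) - q ^ Suc a * w * (?s + q ^ a)"
    by (simp only: 1[symmetric] 2[symmetric])
  also have "\<dots> = q * raising a w + q * (1 - q ^ (2 * a) * w)"
    by (simp add: raising_def algebra_simps power_add mult_2_right)
  finally show ?thesis .
qed

lemma raising_0 [simp]: "raising 0 w = 0" by (simp add: raising_def)

lemma raising_p: "raising p w = 0"
proof -
  have "(1 - q) * (\<Sum>s<p. q ^ s) = 1 - q ^ p" by (rule one_diff_power_eq[symmetric])
  moreover have "q \<noteq> 1" using q_prim[of 1] p_ge by auto
  ultimately show ?thesis by (simp add: raising_def q_order)
qed

lemma E_F_pow_cong:
  assumes z: "wvec k h z" and k: "k ^ n = 1"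
  shows "gE * (gF ^ a * z) \<cong>\<^sub>A const (q ^ a) * (gF ^ a * (gE * z)) - const (raising a (h / k)) * (gF ^ (a - 1) * z)"
proof (induction a)
  case 0
  then show ?case by (simp add: const_simps)
next
  case (Suc a)
  have k0: "k \<noteq> 0" using k n_pos by (metis power_0_left zero_neq_one neq0_conv)
  let ?u = "gF ^ a * z"
  have qn1: "((qi ^ n) ^ a) ^ n = 1"
    using q_order by (simp add: power_inverse power2_eq_square flip: power_mult)
      (metis power_mult power_one mult.commute mult.assoc)
  have "((qi ^ n) ^ a * k) ^ n = 1" by (simp add: power_mult_distrib qn1 k)
  note fe = FE_cong[OF wvec_EF_pow(2)[OF z, of a] this]
  have r: "((qi ^ n * q ^ 2) ^ a * h) / ((qi ^ n) ^ a * k) = q ^ (2 * a) * (h / k)"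
    using k0 by (simp add: power_mult_distrib power_mult)
  have "gE * (gF ^ Suc a * z) = gE * (gF * ?u)" by (simp add: mult.assoc)
  also have "\<dots> \<cong>\<^sub>A const q * (gF * (gE * ?u)) - const (q * (1 - q ^ (2 * a) * (h / k))) * ?u"
    using fe unfolding r .
  also have "\<dots> \<cong>\<^sub>A const q * (gF * (const (q ^ a) * (gF ^ a * (gE * z)) - const (raising a (h / k)) * (gF ^ (a - 1) * z)))
      - const (q * (1 - q ^ (2 * a) * (h / k))) * ?u"
    by (intro cong_diff cong_multL Suc cong_refl)
  also have "\<dots> = const (q ^ Suc a) * (gF ^ Suc a * (gE * z))
      - (const (q * raising a (h / k)) * (gF * (gF ^ (a - 1) * z)) + const (q * (1 - q ^ (2 * a) * (h / k))) * ?u)"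
    by (simp add: right_diff_distrib const_mult_left[of gF] const_mult_const mult.assoc)
  also have "const (q * raising a (h / k)) * (gF * (gF ^ (a - 1) * z)) = const (q * raising a (h / k)) * ?u"
  proof (cases a)
    case (Suc b)
    then show ?thesis by (simp add: mult.assoc)
  qed (simp add: const_simps)
  also have "\<dots> + const (q * (1 - q ^ (2 * a) * (h / k))) * ?u = const (raising (Suc a) (h / k)) * ?u"
    unfolding raising_Suc by (simp add: const_simps distrib_right)
  finally show ?case by simp
qed

section \<open>Modules induced from a weight\<close>

text \<open>The index \<open>(a, b)\<close> stands for \<open>F\<^sup>aE\<^sup>be\<close>, where \<open>e\<close> is a weight vector of weight \<open>(k, h)\<close>.\<close>

definition V_ops :: "'k \<Rightarrow> 'k \<Rightarrow> letter \<Rightarrow> (nat \<times> nat \<Rightarrow> 'k) \<Rightarrow> nat \<times> nat \<Rightarrow> 'k" where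
  "V_ops k h g f = (case g of
     L_kap \<Rightarrow> (\<lambda>(a, b). ((q ^ n) ^ b * (qi ^ n) ^ a * k) * f (a, b))
   | L_hat \<Rightarrow> (\<lambda>(a, b). ((q ^ n * qi ^ 2) ^ b * (qi ^ n * q ^ 2) ^ a * h) * f (a, b))
   | L_E \<Rightarrow> (\<lambda>(a, b). (if 0 < b \<and> b < p then q ^ a * f (a, b - 1) else 0)
        - (if Suc a < p then raising (Suc a) (qi ^ (2 * b) * (h / k)) * f (Suc a, b) else 0))
   | L_F \<Rightarrow> (\<lambda>(a, b). if 0 < a \<and> a < p then f (a - 1, b) else 0))"

lemma V_ops_apply:
  "V_ops k h L_kap f (a, b) = ((q ^ n) ^ b * (qi ^ n) ^ a * k) * f (a, b)"
  "V_ops k h L_hat f (a, b) = ((q ^ n * qi ^ 2) ^ b * (qi ^ n * q ^ 2) ^ a * h) * f (a, b)"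
  "V_ops k h L_E f (a, b) = (if 0 < b \<and> b < p then q ^ a * f (a, b - 1) else 0)
        - (if Suc a < p then raising (Suc a) (qi ^ (2 * b) * (h / k)) * f (Suc a, b) else 0)"
  "V_ops k h L_F f (a, b) = (if 0 < a \<and> a < p then f (a - 1, b) else 0)"
  by (simp_all add: V_ops_def)

abbreviation "V_basis \<equiv> {..<p} \<times> {..<p}"
abbreviation "VV \<equiv> funs_on V_basis :: (nat \<times> nat \<Rightarrow> 'k) set"

lemma lin_V_ops: "lin (V_ops k h g)"
  by (intro linI ext; cases g) (auto simp: V_ops_def fun_apply algebra_simps)

lemma V_ops_funs_on: "f \<in> VV \<Longrightarrow> V_ops k h g f \<in> VV"
  by (cases g) (auto simp: V_ops_def funs_on_def)

lemma V_weight_ops: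
  "V_ops k h L_kap (V_ops k h L_E f) = q ^ n *\<^sub>f V_ops k h L_E (V_ops k h L_kap f)"
  "V_ops k h L_hat (V_ops k h L_E f) = (q ^ n * qi ^ 2) *\<^sub>f V_ops k h L_E (V_ops k h L_hat f)"
  "V_ops k h L_kap (V_ops k h L_F f) = qi ^ n *\<^sub>f V_ops k h L_F (V_ops k h L_kap f)"
  "V_ops k h L_hat (V_ops k h L_F f) = (qi ^ n * q ^ 2) *\<^sub>f V_ops k h L_F (V_ops k h L_hat f)"
proof -
  have c: "(q ^ n * qi ^ 2) * (qi ^ n * q ^ 2) = 1"
  proof -
    have "(q ^ n * qi ^ 2) * (qi ^ n * q ^ 2) = (q ^ n * qi ^ n) * (qi ^ 2 * q ^ 2)" by (simp only: mult_ac)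
    then show ?thesis by simp
  qed
  define e1 e2 f1 f2 where d: "e1 = q ^ n" "e2 = q ^ n * qi ^ 2" "f1 = qi ^ n" "f2 = qi ^ n * q ^ 2"
  have ef: "e1 * f1 = 1" "e2 * f2 = 1" using c by (simp_all add: d)
  have ef': "e1 * (f1 * x) = x" "e2 * (f2 * x) = x" for x
    using ef by (simp_all flip: mult.assoc)
  show "V_ops k h L_kap (V_ops k h L_E f) = q ^ n *\<^sub>f V_ops k h L_E (V_ops k h L_kap f)"
  proof
    fix x :: "nat \<times> nat" obtain a b where x: "x = (a, b)" by (cases x)
    show "V_ops k h L_kap (V_ops k h L_E f) x = (q ^ n *\<^sub>f V_ops k h L_E (V_ops k h L_kap f)) x"
      unfolding x V_ops_apply fscale_apply d[symmetric]
      by (cases b) (auto simp: algebra_simps ef')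
  qed
  show "V_ops k h L_hat (V_ops k h L_E f) = (q ^ n * qi ^ 2) *\<^sub>f V_ops k h L_E (V_ops k h L_hat f)"
  proof
    fix x :: "nat \<times> nat" obtain a b where x: "x = (a, b)" by (cases x)
    show "V_ops k h L_hat (V_ops k h L_E f) x = ((q ^ n * qi ^ 2) *\<^sub>f V_ops k h L_E (V_ops k h L_hat f)) x"
      unfolding x V_ops_apply fscale_apply d[symmetric]
      by (cases b) (auto simp: algebra_simps ef')
  qed
  show "V_ops k h L_kap (V_ops k h L_F f) = qi ^ n *\<^sub>f V_ops k h L_F (V_ops k h L_kap f)"
  proof
    fix x :: "nat \<times> nat" obtain a b where x: "x = (a, b)" by (cases x)
    show "V_ops k h L_kap (V_ops k h L_F f) x = (qi ^ n *\<^sub>f V_ops k h L_F (V_ops k h L_kap f)) x"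
      unfolding x V_ops_apply fscale_apply d[symmetric]
      by (cases a) (auto simp: algebra_simps ef')
  qed
  show "V_ops k h L_hat (V_ops k h L_F f) = (qi ^ n * q ^ 2) *\<^sub>f V_ops k h L_F (V_ops k h L_hat f)"
  proof
    fix x :: "nat \<times> nat" obtain a b where x: "x = (a, b)" by (cases x)
    show "V_ops k h L_hat (V_ops k h L_F f) x = ((qi ^ n * q ^ 2) *\<^sub>f V_ops k h L_F (V_ops k h L_hat f)) x"
      unfolding x V_ops_apply fscale_apply d[symmetric]
      by (cases a) (auto simp: algebra_simps ef')
  qed
qed

lemma V_FE:
  assumes f: "f \<in> VV"
  shows "V_ops k h L_F (V_ops k h L_E f) (a, b) =
    qi * V_ops k h L_E (V_ops k h L_F f) (a, b) + (1 - q ^ (2 * a) * qi ^ (2 * b) * (h / k)) * f (a, b)"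
proof (cases "a < p \<and> b < p")
  case False
  show ?thesis
  proof (cases "a < p")
    case True
    then have "f (a', b) = 0" for a' using False funs_onD[OF f] by auto
    then show ?thesis using False True by (auto simp: V_ops_apply)
  next
    case False
    then have "f (a, b) = 0" using funs_onD[OF f] by auto
    then show ?thesis using False by (auto simp: V_ops_apply)
  qed
next
  case True
  let ?w = "qi ^ (2 * b) * (h / k)"
  have r: "qi * raising (Suc a) ?w = raising a ?w + (1 - q ^ (2 * a) * ?w)"
    unfolding raising_Suc distrib_left by (simp flip: mult.assoc)
  \<comment> \<open>At a = p - 1 the model cuts off F^p, and this changes nothing because
    \<open>raising p\<close> is 0.\<close>
  have r': "qi * (if Suc a < p then raising (Suc a) ?w * f (a, b) else 0) = qi * raising (Suc a) ?w * f (a, b)"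
  proof (cases "Suc a < p")
    case False
    then have "Suc a = p" using True by simp
    then show ?thesis using raising_p[of ?w] by simp
  qed simp
  show ?thesis
  proof (cases a)
    case 0
    have "qi * V_ops k h L_E (V_ops k h L_F f) (a, b) = - (qi * raising (Suc a) ?w * f (a, b))"
      using 0 p_ge by (simp add: V_ops_apply)
    moreover have "V_ops k h L_F (V_ops k h L_E f) (a, b) = 0" using 0 by (simp add: V_ops_apply)
    ultimately show ?thesis unfolding r using 0 by (simp add: algebra_simps)
  next
    case (Suc a')
    have *: "qi * (q ^ a * x) = q ^ a' * x" for x using Suc by simp
    have "qi * V_ops k h L_E (V_ops k h L_F f) (a, b) =
        (if 0 < b \<and> b < p then q ^ a' * f (a', b - 1) else 0) - qi * raising (Suc a) ?w * f (a, b)"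
      using True Suc r' by (auto simp: V_ops_apply right_diff_distrib *)
    moreover have "V_ops k h L_F (V_ops k h L_E f) (a, b) =
        (if 0 < b \<and> b < p then q ^ a' * f (a', b - 1) else 0) - raising a ?w * f (a, b)"
      using True Suc by (simp add: V_ops_apply)
    ultimately show ?thesis unfolding r by (simp add: distrib_right mult.assoc)
  qed
qed

lemma qrep_V: assumes k: "k \<noteq> 0" shows "qrep VV (V_ops k h)"
  unfolding qrep_def
proof (intro conjI allI ballI impI lin_V_ops)
  fix f :: "nat \<times> nat \<Rightarrow> 'k" assume f: "f \<in> VV"
  show "V_ops k h g f \<in> VV" for g by (rule V_ops_funs_on[OF f])
  fix k' h' assume w: "weight (V_ops k h) k' h' f"
  then show "weight (V_ops k h) (q ^ n * k') (q ^ n * qi ^ 2 * h') (V_ops k h L_E f)"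
    by (simp add: weight_def V_weight_ops lin_scale[OF lin_V_ops])
  from w show "weight (V_ops k h) (qi ^ n * k') (qi ^ n * q ^ 2 * h') (V_ops k h L_F f)"
    by (simp add: weight_def V_weight_ops lin_scale[OF lin_V_ops])
  show "V_ops k h L_F (V_ops k h L_E f) = qi *\<^sub>f V_ops k h L_E (V_ops k h L_F f) + (1 - h' / k') *\<^sub>f f"
  proof (rule ext, clarify)
    fix a b
    have "(1 - q ^ (2 * a) * qi ^ (2 * b) * (h / k)) * f (a, b) = (1 - h' / k') * f (a, b)"
    proof (cases "f (a, b) = 0")
      case False
      have "(q ^ n) ^ b * (qi ^ n) ^ a * k = k'"
        using False fun_cong[OF conjunct1[OF w[unfolded weight_def]], of "(a, b)"]
        by (simp add: V_ops_apply fscale_apply)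
      moreover have "(q ^ n * qi ^ 2) ^ b * (qi ^ n * q ^ 2) ^ a * h = h'"
        using False fun_cong[OF conjunct2[OF w[unfolded weight_def]], of "(a, b)"]
        by (simp add: V_ops_apply fscale_apply)
      ultimately have "h' / k' = ((q ^ n * qi ^ 2) ^ b * (qi ^ n * q ^ 2) ^ a * h) / ((q ^ n) ^ b * (qi ^ n) ^ a * k)"
        by simp
      also have "\<dots> = q ^ (2 * a) * qi ^ (2 * b) * (h / k)"
        using k by (simp add: power_mult_distrib power_mult)
      finally show ?thesis by simp
    qed simp
    then show "V_ops k h L_F (V_ops k h L_E f) (a, b) =
        (qi *\<^sub>f V_ops k h L_E (V_ops k h L_F f) + (1 - h' / k') *\<^sub>f f) (a, b)"
      unfolding V_FE[OF f] by (simp add: fun_apply)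
  qed
qed

lemma V_delta_weight:
  "weight (V_ops k h) ((q ^ n) ^ b * (qi ^ n) ^ a * k) ((q ^ n * qi ^ 2) ^ b * (qi ^ n * q ^ 2) ^ a * h) (delta (a, b))"
  by (auto simp: weight_def V_ops_def delta_def fscale_apply fun_eq_iff)

lemma V_delta:
  "b < p \<Longrightarrow> V_ops k h L_F (delta (a, b)) = (if Suc a < p then delta (Suc a, b) else 0)"
  "a < p \<Longrightarrow> V_ops k h L_E (delta (a, b)) = (if Suc b < p then q ^ a *\<^sub>f delta (a, Suc b) else 0)
     - (if 0 < a then raising a (qi ^ (2 * b) * (h / k)) *\<^sub>f delta (a - 1, b) else 0)"
proof -
  show "V_ops k h L_F (delta (a, b)) = (if Suc a < p then delta (Suc a, b) else 0)" if "b < p"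
  proof
    fix x :: "nat \<times> nat" obtain a' b' where x: "x = (a', b')" by (cases x)
    show "V_ops k h L_F (delta (a, b)) x = (if Suc a < p then delta (Suc a, b) else 0) x"
      unfolding x V_ops_apply by (cases a') (auto simp: delta_def zero_fun_apply)
  qed
  show "V_ops k h L_E (delta (a, b)) = (if Suc b < p then q ^ a *\<^sub>f delta (a, Suc b) else 0)
     - (if 0 < a then raising a (qi ^ (2 * b) * (h / k)) *\<^sub>f delta (a - 1, b) else 0)" if "a < p"
  proof
    fix x :: "nat \<times> nat" obtain a' b' where x: "x = (a', b')" by (cases x)
    have 1: "(if 0 < b' \<and> b' < p then q ^ a' * delta (a, b) (a', b' - 1) else 0) =
        (if Suc b < p then q ^ a *\<^sub>f delta (a, Suc b) else 0) (a', b')"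
      by (cases b') (simp_all add: delta_def zero_fun_apply fscale_apply)
    have 2: "(if Suc a' < p then raising (Suc a') (qi ^ (2 * b') * (h / k)) * delta (a, b) (Suc a', b') else 0) =
        (if 0 < a then raising a (qi ^ (2 * b) * (h / k)) *\<^sub>f delta (a - 1, b) else 0) (a', b')"
      using that by (cases a) (simp_all add: delta_def zero_fun_apply fscale_apply)
    show "V_ops k h L_E (delta (a, b)) x = ((if Suc b < p then q ^ a *\<^sub>f delta (a, Suc b) else 0)
     - (if 0 < a then raising a (qi ^ (2 * b) * (h / k)) *\<^sub>f delta (a - 1, b) else 0)) x"
      unfolding x V_ops_apply minus_apply 1 2 ..
  qed
qed

lemma V_delta_pow:
  "b < p \<Longrightarrow> (V_ops k h L_E ^^ b) (delta (0, 0)) = delta (0, b)"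
  "a < p \<Longrightarrow> b < p \<Longrightarrow> (V_ops k h L_F ^^ a) (delta (0, b)) = delta (a, b)"
proof -
  show "b < p \<Longrightarrow> (V_ops k h L_E ^^ b) (delta (0, 0)) = delta (0, b)"
    by (induction b) (auto simp: V_delta n_pos)
  show "a < p \<Longrightarrow> b < p \<Longrightarrow> (V_ops k h L_F ^^ a) (delta (0, b)) = delta (a, b)"
    by (induction a) (auto simp: V_delta)
qed

lemma funpow_commute: "(f ^^ a) ((f ^^ b) x) = (f ^^ b) ((f ^^ a) x)"
proof -
  have "(f ^^ (a + b)) x = (f ^^ (b + a)) x" by (simp add: add.commute)
  then show ?thesis by (simp only: funpow_add o_apply)
qed

lemma V_F_nilpotent: assumes "f \<in> VV" shows "(V_ops k h L_F ^^ p) f = 0"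
proof -
  have "(V_ops k h L_F ^^ m) f (a, b) = (if m \<le> a \<and> a < p then f (a - m, b) else 0)" for m a b
    using funs_onD[OF assms] by (induction m arbitrary: a) (auto simp: V_ops_apply)
  then show ?thesis by (auto simp: fun_eq_iff zero_fun_apply)
qed

text \<open>E^p e = 0 holds by truncation, hence E^p kills all E^b e. On F^a E^b e it follows by
  induction on a: moving F past E^p costs the factor q^(-p) = 1 and a term with coefficient
  \<open>lowering p\<close>, which is 0.\<close>

lemma V_E_nilpotent: assumes k: "k \<noteq> 0" and f: "f \<in> VV" shows "(V_ops k h L_E ^^ p) f = 0"
proof -
  let ?T = "V_ops k h"
  have "(?T L_E ^^ p) (delta (a, b)) = 0" if "a < p" "b < p" for a b
    using that
  proof (induction a)
    case 0
    have z: "(?T L_E ^^ m) 0 = 0" for m by (rule lin_0[OF lin_funpow[OF lin_V_ops]])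
    obtain p' where p': "p = Suc p'" using p_pos by (cases p) auto
    have "(?T L_E ^^ p) (delta (0, 0)) = ?T L_E ((?T L_E ^^ p') (delta (0, 0)))" unfolding p' by simp
    then have "(?T L_E ^^ p) (delta (0, 0)) = 0" using p' n_pos by (simp add: V_delta_pow V_delta)
    then have "(?T L_E ^^ b) ((?T L_E ^^ p) (delta (0, 0))) = 0" by (simp add: z)
    moreover have "(?T L_E ^^ b) ((?T L_E ^^ p) (delta (0, 0))) = (?T L_E ^^ p) ((?T L_E ^^ b) (delta (0, 0)))"
      by (rule funpow_commute)
    ultimately show ?case using 0 by (simp add: V_delta_pow)
  next
    case (Suc a)
    have d: "delta (a, b) \<in> VV" using Suc.prems by simp
    obtain p' where p': "p = Suc p'" using p_pos by (cases p) auto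
    have "?T L_F ((?T L_E ^^ p) (delta (a, b))) = qi ^ p *\<^sub>f (?T L_E ^^ p) (?T L_F (delta (a, b)))"
      using FE_pow[OF qrep_V[OF k] d V_delta_weight, where l = p'] k lowering_p unfolding p'[symmetric] by simp
    moreover have "qi ^ p = 1" by (simp add: qi_pow_eq_1)
    moreover have "(?T L_E ^^ p) (delta (a, b)) = 0" using Suc by simp
    ultimately show ?case using Suc.prems by (simp add: V_delta lin_0[OF lin_V_ops])
  qed
  then have d0: "(?T L_E ^^ p) (delta b) = 0" if "b \<in> V_basis" for b using that by (cases b) auto
  have "(?T L_E ^^ p) f = (\<lambda>_. 0) f"
  proof (rule lin_eqI[of V_basis "?T L_E ^^ p" "\<lambda>_. 0", OF _ _ _ _ f])
    show "lin (?T L_E ^^ p)" by (rule lin_funpow[OF lin_V_ops])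
  qed (simp_all add: lin_def d0)
  then show ?thesis by simp
qed

text \<open>The two conditions on (k, h) express the relations between \<open>kap\<close> and
  \<open>hat\<close>, and they persist along the weights of the basis. As the basis consists of
  weight vectors, every relation can be checked on a weight vector.\<close>

lemma V_kills_ideal:
  assumes k: "k ^ n = 1" and h: "h ^ n * k ^ 2 = 1" and x: "x \<in> Qu_ideal n q" and f: "f \<in> VV"
  shows "frep (V_ops k h) x f = 0"
proof -
  let ?T = "V_ops k h"
  have k0: "k \<noteq> 0" using k n_pos by (metis power_0_left zero_neq_one neq0_conv)
  have m: "monoid_rep (word_act ?T)" by (rule monoid_rep_word_act[OF lin_V_ops])
  have fg: "frep ?T (gen g) = ?T g" for g by (simp add: fun_eq_iff frep_gen)
  note r = rep_mult[OF m] rep_one[OF m] rep_const[OF m] rep_power[OF m] rep_diff rep_add fg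
  have frep_lin: "lin (frep ?T x)" for x using m by (intro lin_rep) (simp add: monoid_rep_def)
  have inV: "frep ?T x f \<in> VV" if "f \<in> VV" for x f by (rule frep_funs_on[OF V_ops_funs_on that])
  have qp: "(q ^ n) ^ n = 1" "(qi ^ n) ^ n = 1"
    using q_order by (simp_all add: power_inverse power2_eq_square flip: power_mult)
  have q2n: "(qi ^ 2) ^ n = (qi ^ n) ^ 2" "(q ^ 2) ^ n = (q ^ n) ^ 2" by (simp_all only: power_mult[symmetric] mult.commute)
  have rel0: "frep ?T x f = 0" if x: "x \<in> Qu_rels n q" and f: "f \<in> VV" and w: "weight ?T k' h' f"
    and k': "k' ^ n = 1" and h': "h' ^ n * k' ^ 2 = 1" for x f k' h'
  proof -
    have k'0: "k' \<noteq> 0" using k' n_pos by (metis power_0_left zero_neq_one neq0_conv)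
    have w': "?T L_kap f = k' *\<^sub>f f" "?T L_hat f = h' *\<^sub>f f" using w by (simp_all add: weight_def)
    have pw: "(?T L_kap ^^ m) f = k' ^ m *\<^sub>f f" "(?T L_hat ^^ m) f = h' ^ m *\<^sub>f f" for m
      by (induction m) (simp_all add: lin_scale[OF lin_V_ops] w' mult.commute)
    have sc: "(?T g ^^ m) (c *\<^sub>f u) = c *\<^sub>f (?T g ^^ m) u" for g m c u by (rule lin_scale[OF lin_funpow[OF lin_V_ops]])
    have wE: "?T L_kap (?T L_E f) = (q ^ n * k') *\<^sub>f ?T L_E f" "?T L_hat (?T L_E f) = (q ^ n * qi ^ 2 * h') *\<^sub>f ?T L_E f"
      "?T L_kap (?T L_F f) = (qi ^ n * k') *\<^sub>f ?T L_F f" "?T L_hat (?T L_F f) = (qi ^ n * q ^ 2 * h') *\<^sub>f ?T L_F f"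
      using qrepD(4,5)[OF qrep_V[OF k0] f w] by (simp_all add: weight_def)
    have kinv: "k' ^ (n - 1) * k' = 1" using k' n_pos by (metis power_minus_mult)
    have kinv': "k' ^ (n - 1) = inverse k'" using kinv k'0 by (simp add: field_simps)
    have hinv: "h' ^ (n - 1) * h' * k' ^ 2 = 1" using h' n_pos by (metis power_minus_mult)
    have h2: "h' ^ n = (k' ^ (n - 1)) ^ 2"
      using h' k'0 unfolding kinv' by (simp add: field_simps)
    have FE: "?T L_F (?T L_E f) = qi *\<^sub>f ?T L_E (?T L_F f) + (1 - h' / k') *\<^sub>f f"
      by (rule qrepD(3)[OF qrep_V[OF k0] f w])
    note s = r lin_scale[OF lin_V_ops] sc w' pw wE kap_inv_def hat_inv_def
    from x consider "x = kap ^ n - 1" | "x = hat ^ n - kap_inv n ^ 2" | "x = kap * hat - hat * kap"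
      | "x = kap * gE * kap_inv n - const (q ^ n) * gE" | "x = kap * gF * kap_inv n - const (inverse (q ^ n)) * gF"
      | "x = hat * gE * hat_inv n - const (q ^ n * inverse (q ^ 2)) * gE"
      | "x = hat * gF * hat_inv n - const (inverse (q ^ n) * q ^ 2) * gF"
      | "x = gE ^ p" | "x = gF ^ p" | "x = gF * gE - const qi * gE * gF - (1 - kap_inv n * hat)"
      unfolding Qu_rels_def by blast
    then show ?thesis
    proof cases
      case 1 then show ?thesis by (simp add: s k')
    next
      case 2
      have "frep ?T (kap_inv n ^ 2) f = (k' ^ (n - 1)) ^ 2 *\<^sub>f f"
        by (simp add: power2_eq_square s)
      then show ?thesis using 2 by (simp add: s h2 del: kap_inv_def)
    next
      case 3 then show ?thesis by (simp add: s mult.commute)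
    next
      case 4
      have "frep ?T (kap * gE * kap_inv n) f = (q ^ n * (k' ^ (n - 1) * k')) *\<^sub>f ?T L_E f" by (simp add: s mult_ac)
      also have "q ^ n * (k' ^ (n - 1) * k') = q ^ n" using kinv by simp
      finally show ?thesis using 4 by (simp add: rep_diff rep_mult[OF m] rep_const[OF m] fg)
    next
      case 5
      have "frep ?T (kap * gF * kap_inv n) f = (qi ^ n * (k' ^ (n - 1) * k')) *\<^sub>f ?T L_F f" by (simp add: s mult_ac)
      also have "qi ^ n * (k' ^ (n - 1) * k') = qi ^ n" using kinv by simp
      finally show ?thesis using 5 by (simp add: rep_diff rep_mult[OF m] rep_const[OF m] fg power_inverse)
    next
      case 6
      have "frep ?T (hat * gE * hat_inv n) f = ((q ^ n * qi ^ 2) * (h' ^ (n - 1) * h' * k' ^ 2)) *\<^sub>f ?T L_E f" by (simp add: s mult_ac)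
      also have "(q ^ n * qi ^ 2) * (h' ^ (n - 1) * h' * k' ^ 2) = q ^ n * qi ^ 2" using hinv by simp
      finally show ?thesis using 6 by (simp add: rep_diff rep_mult[OF m] rep_const[OF m] fg power_inverse)
    next
      case 7
      have "frep ?T (hat * gF * hat_inv n) f = ((qi ^ n * q ^ 2) * (h' ^ (n - 1) * h' * k' ^ 2)) *\<^sub>f ?T L_F f" by (simp add: s mult_ac)
      also have "(qi ^ n * q ^ 2) * (h' ^ (n - 1) * h' * k' ^ 2) = qi ^ n * q ^ 2" using hinv by simp
      finally show ?thesis using 7 by (simp add: rep_diff rep_mult[OF m] rep_const[OF m] fg power_inverse)
    next
      case 8 then show ?thesis using V_E_nilpotent[OF k0 f] by (simp add: s)
    next
      case 9 then show ?thesis using V_F_nilpotent[OF f] by (simp add: s)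
    next
      case 10
      then show ?thesis using FE by (simp add: s kinv'[simplified] fscale_add divide_inverse mult.commute)
    qed
  qed
  show ?thesis
  proof (rule genideal_rep_zero[OF m inV _ x[unfolded Qu_ideal_def] f])
    fix x f assume x: "x \<in> Qu_rels n q" and f: "f \<in> VV"
    have "frep ?T x (delta b) = (\<lambda>_. 0) (delta b)" if b: "b \<in> V_basis" for b
    proof -
      obtain a c where ac: "b = (a, c)" by (cases b)
      let ?k = "(q ^ n) ^ c * (qi ^ n) ^ a * k" and ?h = "(q ^ n * qi ^ 2) ^ c * (qi ^ n * q ^ 2) ^ a * h"
      have pc: "(u ^ c) ^ m = (u ^ m) ^ c" for u :: 'k and c m by (simp only: power_mult[symmetric] mult.commute)
      have u: "(q ^ n * qi ^ 2) ^ n * (q ^ n) ^ 2 = 1" "(qi ^ n * q ^ 2) ^ n * (qi ^ n) ^ 2 = 1"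
        by (simp_all only: power_mult_distrib qp q2n mult_1) (simp_all only: power_mult_distrib[symmetric] q_qi power_one)
      have "?k ^ n = ((q ^ n) ^ c) ^ n * ((qi ^ n) ^ a) ^ n * k ^ n" by (simp only: power_mult_distrib)
      also have "\<dots> = 1" by (simp only: pc[of "q ^ n" c n] pc[of "qi ^ n" a n] qp k power_one mult_1)
      finally have "?k ^ n = 1" .
      moreover have "?h ^ n * ?k ^ 2 = 1"
      proof -
        have "?h ^ n * ?k ^ 2 = (((q ^ n * qi ^ 2) ^ c) ^ n * ((q ^ n) ^ c) ^ 2) *
            (((qi ^ n * q ^ 2) ^ a) ^ n * ((qi ^ n) ^ a) ^ 2) * (h ^ n * k ^ 2)"
          by (simp only: power_mult_distrib mult_ac)
        also have "((q ^ n * qi ^ 2) ^ c) ^ n * ((q ^ n) ^ c) ^ 2 = 1"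
          unfolding pc[of _ c] power_mult_distrib[symmetric] u(1) power_one ..
        also have "((qi ^ n * q ^ 2) ^ a) ^ n * ((qi ^ n) ^ a) ^ 2 = 1"
          unfolding pc[of _ a] power_mult_distrib[symmetric] u(2) power_one ..
        finally show ?thesis using h by simp
      qed
      ultimately show ?thesis using rel0[OF x _ V_delta_weight] b unfolding ac by simp
    qed
    then have d0: "frep ?T x (delta b) = 0" if "b \<in> V_basis" for b using that by simp
    have "frep ?T x f = (\<lambda>_. 0) f"
    proof (rule lin_eqI[of V_basis "frep ?T x" "\<lambda>_. 0", OF _ frep_lin _ _ f])
    qed (simp_all add: lin_def d0)
    then show "frep ?T x f = 0" by simp
  qed
qed

end

context root_order begin

section \<open>The induced module as a left ideal of the algebra\<close>

definition V_elt :: "'k falg \<Rightarrow> (nat \<times> nat \<Rightarrow> 'k) \<Rightarrow> 'k falg" where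
  "V_elt e v = (\<Sum>(a, b)\<in>V_basis. const (v (a, b)) * (gF ^ a * (gE ^ b * e)))"

lemma V_elt_add: "V_elt e (f + g) = V_elt e f + V_elt e g"
  by (simp add: V_elt_def fun_apply const_simps distrib_right sum.distrib case_prod_unfold)

lemma V_elt_scale: "V_elt e (c *\<^sub>f f) = const c * V_elt e f"
  by (simp add: V_elt_def fun_apply const_simps sum_distrib_left case_prod_unfold mult.assoc)

lemma V_elt_0 [simp]: "V_elt e 0 = 0"
  using V_elt_scale[of e 0 0] by (simp add: const_simps)

lemma V_elt_minus: "V_elt e (f - g) = V_elt e f - V_elt e g"
  using V_elt_add[of e "f - g" g] by simp

lemma V_elt_sum: "V_elt e (\<Sum>i\<in>I. F i) = (\<Sum>i\<in>I. V_elt e (F i))"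
  by (induction I rule: infinite_finite_induct) (simp_all add: V_elt_add)

lemma V_elt_delta: "a < p \<Longrightarrow> b < p \<Longrightarrow> V_elt e (delta (a, b)) = gF ^ a * (gE ^ b * e)"
proof -
  assume ab: "a < p" "b < p"
  have "V_elt e (delta (a, b)) = (\<Sum>x\<in>V_basis. if x = (a, b) then gF ^ fst x * (gE ^ snd x * e) else 0)"
    unfolding V_elt_def case_prod_unfold by (intro sum.cong refl) (simp add: delta_def const_simps)
  then show ?thesis using ab by simp
qed

lemma gen_V_elt_delta:
  assumes e: "wvec k h e" and k: "k ^ n = 1" and ab: "a < p" "b < p"
  shows "gen g * V_elt e (delta (a, b)) \<cong>\<^sub>A V_elt e (V_ops k h g (delta (a, b)))"
proof (cases g)
  case L_kap
  have "V_ops k h L_kap (delta (a, b)) = ((qi ^ n) ^ a * ((q ^ n) ^ b * k)) *\<^sub>f delta (a, b)"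
    using V_delta_weight[of k h b a] by (simp add: weight_def mult_ac)
  moreover have "wvec ((qi ^ n) ^ a * ((q ^ n) ^ b * k)) ((qi ^ n * q ^ 2) ^ a * ((q ^ n * qi ^ 2) ^ b * h)) (gF ^ a * (gE ^ b * e))"
    by (intro wvec_EF_pow e)
  ultimately show ?thesis
    by (simp add: L_kap V_elt_scale V_elt_delta ab wvec_def)
next
  case L_hat
  have "V_ops k h L_hat (delta (a, b)) = ((qi ^ n * q ^ 2) ^ a * ((q ^ n * qi ^ 2) ^ b * h)) *\<^sub>f delta (a, b)"
    using V_delta_weight[of k h b a] by (simp add: weight_def mult_ac)
  moreover have "wvec ((qi ^ n) ^ a * ((q ^ n) ^ b * k)) ((qi ^ n * q ^ 2) ^ a * ((q ^ n * qi ^ 2) ^ b * h)) (gF ^ a * (gE ^ b * e))"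
    by (intro wvec_EF_pow e)
  ultimately show ?thesis
    by (simp add: L_hat V_elt_scale V_elt_delta ab wvec_def)
next
  case L_F
  show ?thesis
  proof (cases "Suc a < p")
    case True
    then show ?thesis using ab by (simp add: L_F V_delta V_elt_delta mult.assoc)
  next
    case False
    then have "Suc a = p" using ab by simp
    then have "gF * (gF ^ a * (gE ^ b * e)) = gF ^ p * (gE ^ b * e)" by (metis mult.assoc power_Suc)
    also have "\<dots> \<cong>\<^sub>A 0 * (gE ^ b * e)" by (rule cong_multR[OF relations(9)])
    finally show ?thesis using ab False by (simp add: L_F V_delta V_elt_delta)
  qed
next
  case L_E
  have k0: "k \<noteq> 0" using k n_pos by (metis power_0_left zero_neq_one neq0_conv)
  have qn1: "((q ^ n) ^ b) ^ n = 1"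
  proof -
    have "((q ^ n) ^ b) ^ n = (q ^ p) ^ b" by (simp add: power2_eq_square mult_ac flip: power_mult)
    then show ?thesis by (simp add: q_order)
  qed
  have kb: "((q ^ n) ^ b * k) ^ n = 1" by (simp add: power_mult_distrib qn1 k)
  have r: "((q ^ n * qi ^ 2) ^ b * h) / ((q ^ n) ^ b * k) = qi ^ (2 * b) * (h / k)"
    using k0 by (simp add: power_mult_distrib power_mult)
  have "gE * (gF ^ a * (gE ^ b * e)) \<cong>\<^sub>A const (q ^ a) * (gF ^ a * (gE * (gE ^ b * e))) -
      const (raising a (qi ^ (2 * b) * (h / k))) * (gF ^ (a - 1) * (gE ^ b * e))"
    using E_F_pow_cong[OF wvec_EF_pow(1)[OF e, of b] kb, of a] unfolding r .
  also have "\<dots> \<cong>\<^sub>A V_elt e (if Suc b < p then q ^ a *\<^sub>f delta (a, Suc b) else 0) -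
      V_elt e (if 0 < a then raising a (qi ^ (2 * b) * (h / k)) *\<^sub>f delta (a - 1, b) else 0)"
  proof (rule cong_diff)
    show "const (q ^ a) * (gF ^ a * (gE * (gE ^ b * e))) \<cong>\<^sub>A V_elt e (if Suc b < p then q ^ a *\<^sub>f delta (a, Suc b) else 0)"
    proof (cases "Suc b < p")
      case True
      then show ?thesis using ab by (simp add: V_elt_scale V_elt_delta mult.assoc)
    next
      case False
      then have "Suc b = p" using ab by simp
      then have "gE * (gE ^ b * e) = gE ^ p * e" by (metis mult.assoc power_Suc)
      also have "\<dots> \<cong>\<^sub>A 0 * e" by (rule cong_multR[OF relations(8)])
      finally have "gE * (gE ^ b * e) \<cong>\<^sub>A 0" by simp
      from cong_multL[OF cong_multL[OF this, of "gF ^ a"], of "const (q ^ a)"]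
      show ?thesis using False by simp
    qed
    show "const (raising a (qi ^ (2 * b) * (h / k))) * (gF ^ (a - 1) * (gE ^ b * e)) \<cong>\<^sub>A
        V_elt e (if 0 < a then raising a (qi ^ (2 * b) * (h / k)) *\<^sub>f delta (a - 1, b) else 0)"
      using ab by (cases a) (simp_all add: V_elt_scale V_elt_delta const_simps)
  qed
  finally show ?thesis
    unfolding L_E V_elt_delta[OF ab] V_delta(2)[OF ab(1)] V_elt_minus .
qed

lemma gen_V_elt:
  assumes e: "wvec k h e" and k: "k ^ n = 1" and f: "f \<in> VV"
  shows "gen g * V_elt e f \<cong>\<^sub>A V_elt e (V_ops k h g f)"
proof -
  have fe: "f = (\<Sum>x\<in>V_basis. f x *\<^sub>f delta x)" by (rule delta_expansion[OF _ f]) simp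
  have "gen g * V_elt e f = (\<Sum>x\<in>V_basis. const (f x) * (gen g * V_elt e (delta x)))"
    by (subst fe) (simp add: V_elt_sum V_elt_scale sum_distrib_left const_mult_left[of "gen g"])
  also have "\<dots> \<cong>\<^sub>A (\<Sum>x\<in>V_basis. const (f x) * V_elt e (V_ops k h g (delta x)))"
    by (intro cong_sum cong_multL) (auto intro: gen_V_elt_delta[OF e k])
  also have "\<dots> = V_elt e (V_ops k h g f)"
    by (subst (2) fe) (simp add: V_elt_sum V_elt_scale lin_sum[OF lin_V_ops] lin_scale[OF lin_V_ops])
  finally show ?thesis .
qed

text \<open>This makes V \<rightarrow> A e a homomorphism, so that products in A can be computed
  with the matrices \<open>V_ops\<close>.\<close>

lemma mult_V_elt:
  assumes e: "wvec k h e" and k: "k ^ n = 1" and f: "f \<in> VV"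
  shows "x * V_elt e f \<cong>\<^sub>A V_elt e (frep (V_ops k h) x f)"
proof (induction x rule: poly_mapping_add_induct)
  case (single w c)
  have "Poly_Mapping.single (Word gs) 1 * V_elt e f \<cong>\<^sub>A V_elt e (foldr (V_ops k h) gs f)" for gs
  proof (induction gs)
    case Nil
    have "Poly_Mapping.single (Word []) 1 = (1 :: 'k falg)" by (simp flip: single_one add: zero_word_def)
    then show ?case by simp
  next
    case (Cons g gs)
    have "Poly_Mapping.single (Word (g # gs)) 1 = (gen g * Poly_Mapping.single (Word gs) 1 :: 'k falg)"
      by (simp add: gen_def mult_single plus_word_def)
    then have "Poly_Mapping.single (Word (g # gs)) 1 * V_elt e f = gen g * (Poly_Mapping.single (Word gs) 1 * V_elt e f)"
      by (simp add: mult.assoc)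
    also have "\<dots> \<cong>\<^sub>A gen g * V_elt e (foldr (V_ops k h) gs f)" by (rule cong_multL[OF Cons])
    also have "\<dots> \<cong>\<^sub>A V_elt e (V_ops k h g (foldr (V_ops k h) gs f))"
      by (rule gen_V_elt[OF e k]) (rule foldr_funs_on[OF V_ops_funs_on f])
    finally show ?case by simp
  qed
  from cong_multL[OF this[of "letters w"], of "const c"]
  have "const c * (Poly_Mapping.single w 1 * V_elt e f) \<cong>\<^sub>A const c * V_elt e (word_act (V_ops k h) w f)"
    by (simp add: word_act_def)
  moreover have "Poly_Mapping.single w c = (const c * Poly_Mapping.single w 1 :: 'k falg)"
    by (simp add: const_def mult_single)
  ultimately have "Poly_Mapping.single w c * V_elt e f \<cong>\<^sub>A const c * V_elt e (word_act (V_ops k h) w f)"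
    by (simp only: mult.assoc)
  then show ?case by (simp add: V_elt_scale)
next
  case (add x y)
  then show ?case by (simp add: distrib_right rep_add V_elt_add cong_add)
qed simp

text \<open>Acting on the generator of V recovers the coefficients, a left inverse of
  \<open>V_elt\<close>. Together with \<open>V_kills_ideal\<close> this yields the independence of
  the F^a E^b e in A.\<close>

lemma frep_V_elt:
  assumes e: "frep (V_ops k h) e (delta (0, 0)) = delta (0, 0)" and f: "f \<in> VV"
  shows "frep (V_ops k h) (V_elt e f) (delta (0, 0)) = f"
proof -
  let ?T = "V_ops k h"
  have m: "monoid_rep (word_act ?T)" by (rule monoid_rep_word_act[OF lin_V_ops])
  have fg: "frep ?T (gen g) = ?T g" for g by (simp add: fun_eq_iff frep_gen)
  have d: "f x *\<^sub>f (?T L_F ^^ fst x) ((?T L_E ^^ snd x) (delta (0, 0))) = f x *\<^sub>f delta x" if "x \<in> V_basis" for x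
    using that by (auto simp: V_delta_pow)
  have "frep ?T (V_elt e f) (delta (0, 0)) =
      (\<Sum>x\<in>V_basis. f x *\<^sub>f (?T L_F ^^ fst x) ((?T L_E ^^ snd x) (delta (0, 0))))"
    unfolding V_elt_def rep_sum
    by (intro sum.cong refl)
      (simp add: case_prod_unfold rep_mult[OF m] rep_const[OF m] rep_power[OF m] fg e)
  also have "\<dots> = (\<Sum>x\<in>V_basis. f x *\<^sub>f delta x)" by (rule sum.cong[OF refl d])
  also have "\<dots> = f" by (rule delta_expansion[symmetric, OF _ f]) simp
  finally show ?thesis .
qed

lemma V_elt_inj:
  assumes k: "k ^ n = 1" and h: "h ^ n * k ^ 2 = 1"
    and e: "frep (V_ops k h) e (delta (0, 0)) = delta (0, 0)" and f: "f \<in> VV" and z: "V_elt e f \<cong>\<^sub>A 0"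
  shows "f = 0"
proof -
  have "frep (V_ops k h) (V_elt e f) (delta (0, 0)) = 0"
    by (rule V_kills_ideal[OF k h]) (use z n_pos in \<open>simp_all add: cong_iff\<close>)
  then show ?thesis using frep_V_elt[OF e f] by simp
qed

section \<open>The primitive idempotents\<close>

abbreviation "gK \<equiv> (kap_inv n * hat :: 'k falg)"
abbreviation "gX \<equiv> (kap * hat ^ (n div 2) :: 'k falg)"
abbreviation "half_p \<equiv> n div 2 * n"

lemma half_p: "half_p = p div 2" "2 * half_p = p" "half_p > 0" "even (n div 2)" "2 * (n div 2) = n"
proof -
  obtain m where m: "n = 4 * m" using four_dvd by blast
  then show "half_p = p div 2" "2 * half_p = p" "half_p > 0" "even (n div 2)" "2 * (n div 2) = n"
    using n_pos by (simp_all add: power2_eq_square)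
qed

lemma half_range: "{0..half_p - 1} = {..<half_p}"
proof -
  obtain m where "half_p = Suc m" using half_p(3) by (metis gr0_conv_Suc)
  then show ?thesis by (simp add: atLeast0AtMost lessThan_Suc_atMost)
qed

lemma comm_pow:
  assumes "a * b \<cong>\<^sub>A b * a" shows "a ^ l * b \<cong>\<^sub>A b * a ^ l"
proof (induction l)
  case (Suc l)
  have "a ^ Suc l * b = a * (a ^ l * b)" by (simp add: mult.assoc)
  also have "\<dots> \<cong>\<^sub>A a * (b * a ^ l)" by (rule cong_multL[OF Suc])
  also have "\<dots> = (a * b) * a ^ l" by (simp add: mult.assoc)
  also have "\<dots> \<cong>\<^sub>A (b * a) * a ^ l" by (rule cong_multR[OF assms])
  finally show ?case by (simp add: mult.assoc)
qed simp

lemma comm_mult: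
  assumes "a * c \<cong>\<^sub>A c * a" "b * c \<cong>\<^sub>A c * b" shows "(a * b) * c \<cong>\<^sub>A c * (a * b)"
proof -
  have "(a * b) * c = a * (b * c)" by (simp add: mult.assoc)
  also have "\<dots> \<cong>\<^sub>A a * (c * b)" by (rule cong_multL[OF assms(2)])
  also have "\<dots> = (a * c) * b" by (simp add: mult.assoc)
  also have "\<dots> \<cong>\<^sub>A (c * a) * b" by (rule cong_multR[OF assms(1)])
  finally show ?thesis by (simp add: mult.assoc)
qed

lemma mult_pow:
  assumes "a * b \<cong>\<^sub>A b * a" shows "(a * b) ^ l \<cong>\<^sub>A a ^ l * b ^ l"
proof (induction l)
  case (Suc l)
  have "(a * b) ^ Suc l = a * b * (a * b) ^ l" by simp
  also have "\<dots> \<cong>\<^sub>A a * b * (a ^ l * b ^ l)" by (rule cong_multL[OF Suc])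
  also have "\<dots> = a * (b * a ^ l) * b ^ l" by (simp add: mult.assoc)
  also have "\<dots> \<cong>\<^sub>A a * (a ^ l * b) * b ^ l"
    by (intro cong_multR cong_multL cong_sym[OF comm_pow[OF assms]])
  finally show ?case by (simp add: mult.assoc)
qed simp

lemma pow_cong: "x \<cong>\<^sub>A y \<Longrightarrow> x ^ l \<cong>\<^sub>A y ^ l"
  by (induction l) (simp_all add: cong_mult)

lemma group_comm:
  "hat * kap \<cong>\<^sub>A kap * hat" "kap_inv n * hat \<cong>\<^sub>A hat * kap_inv n" "gK * kap \<cong>\<^sub>A kap * gK" "gK * hat \<cong>\<^sub>A hat * gK"
  "gX * gK \<cong>\<^sub>A gK * gX"
proof -
  show 1: "hat * kap \<cong>\<^sub>A kap * hat" by (rule cong_sym[OF relations(3)])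
  show 2: "kap_inv n * hat \<cong>\<^sub>A hat * kap_inv n" unfolding kap_inv_def by (rule comm_pow[OF relations(3)])
  have 3: "kap_inv n * kap \<cong>\<^sub>A kap * kap_inv n" unfolding kap_inv_def by (simp add: power_commutes)
  show 4: "gK * kap \<cong>\<^sub>A kap * gK" by (rule comm_mult[OF 3 1])
  show 5: "gK * hat \<cong>\<^sub>A hat * gK" by (rule comm_mult[OF 2 cong_refl])
  show "gX * gK \<cong>\<^sub>A gK * gX"
    by (rule comm_mult[OF cong_sym[OF 4] comm_pow[OF cong_sym[OF 5]]])
qed

lemma kap_pow_n: "kap ^ (n * l) \<cong>\<^sub>A 1" "kap ^ (m + n * l) \<cong>\<^sub>A kap ^ m" "kap_inv n ^ (n * l) \<cong>\<^sub>A 1"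
proof -
  show 1: "kap ^ (n * l) \<cong>\<^sub>A 1" for l using pow_cong[OF relations(1), of l] by (simp add: power_mult)
  show "kap ^ (m + n * l) \<cong>\<^sub>A kap ^ m" using cong_multL[OF 1[of l], of "kap ^ m"] by (simp add: power_add)
  have 2: "kap_inv n ^ (n * l) = (kap ^ (n * ((n - 1) * l)) :: 'k falg)"
    unfolding kap_inv_def power_mult[symmetric] by (simp add: mult_ac)
  show "kap_inv n ^ (n * l) \<cong>\<^sub>A 1" unfolding 2 by (rule 1)
qed

lemma gK_order: "gK ^ half_p \<cong>\<^sub>A 1"
proof -
  have "gK ^ half_p \<cong>\<^sub>A kap_inv n ^ half_p * hat ^ half_p" by (rule mult_pow[OF group_comm(2)])
  also have "kap_inv n ^ half_p = kap_inv n ^ (n * (n div 2))" by (simp add: mult.commute)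
  also have "hat ^ half_p = (hat ^ n) ^ (n div 2)" by (simp add: mult.commute flip: power_mult)
  also have "kap_inv n ^ (n * (n div 2)) * (hat ^ n) ^ (n div 2) \<cong>\<^sub>A 1 * (kap_inv n ^ 2) ^ (n div 2)"
    by (intro cong_mult kap_pow_n pow_cong relations)
  also have "\<dots> = kap_inv n ^ (n * 1)" using half_p(5) by (simp flip: power_mult)
  also have "\<dots> \<cong>\<^sub>A 1" by (rule kap_pow_n)
  finally show ?thesis .
qed

text \<open>The square is \<open>kap ^ 2 * hat ^ n\<close>, and \<open>hat ^ n\<close> is the
  inverse of \<open>kap ^ 2\<close>.\<close>

lemma gX_order: "gX * gX \<cong>\<^sub>A 1"
proof -
  have "gX * gX = kap * (hat ^ (n div 2) * kap) * hat ^ (n div 2)" by (simp add: mult.assoc)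
  also have "\<dots> \<cong>\<^sub>A kap * (kap * hat ^ (n div 2)) * hat ^ (n div 2)"
    by (intro cong_multR cong_multL comm_pow group_comm)
  also have "\<dots> = kap * (kap * (hat ^ (n div 2) * hat ^ (n div 2)))" by (simp only: mult.assoc)
  also have "hat ^ (n div 2) * hat ^ (n div 2) = (hat ^ n :: 'k falg)"
    using half_p(5) by (simp add: mult_2 flip: power_add)
  also have "kap * (kap * hat ^ n) \<cong>\<^sub>A kap * (kap * kap_inv n ^ 2)"
    by (intro cong_multL relations)
  also have "\<dots> = kap * (kap * kap_inv n) * kap_inv n" by (simp add: power2_eq_square mult.assoc)
  also have "\<dots> \<cong>\<^sub>A kap * 1 * kap_inv n" by (intro cong_multR cong_multL inverses)
  also have "\<dots> = kap * kap_inv n" by simp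
  also have "\<dots> \<cong>\<^sub>A 1" by (rule inverses)
  finally show ?thesis .
qed

definition idem :: "nat \<Rightarrow> nat \<Rightarrow> 'k falg" where "idem s j = phi n q s * bold1 n j"

lemma cong_cancel: "a + x = y + b \<Longrightarrow> b \<cong>\<^sub>A a \<Longrightarrow> x \<cong>\<^sub>A y"
proof -
  assume "a + x = y + b"
  then have "x - y = b - a" by (simp add: algebra_simps)
  then show "b \<cong>\<^sub>A a \<Longrightarrow> x \<cong>\<^sub>A y" by (simp add: cong_iff)
qed

text \<open>Multiplication by K shifts the summation index by one. The term entering at r = p/2
  equals the term lost at r = 0, since K^(p/2) = 1 and q^(s p/2) = 1 for even s.\<close>

lemma phi_eig:
  assumes s: "even s" shows "gK * phi n q s \<cong>\<^sub>A const (q ^ s) * phi n q s"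
proof -
  note range = half_range
  have qs: "inverse (q ^ (s * half_p)) = 1"
  proof -
    obtain t where "s = 2 * t" using s by blast
    then have "s * half_p = p * t" using half_p(2) by (metis mult.assoc mult.commute)
    then show ?thesis by (simp add: power_mult q_order)
  qed
  have 1: "gK * (\<Sum>r<half_p. const (inverse (q ^ (s * r))) * gK ^ r) =
      const (q ^ s) * (\<Sum>r<half_p. const (inverse (q ^ (s * Suc r))) * gK ^ Suc r)"
    unfolding sum_distrib_left
  proof (rule sum.cong[OF refl])
    fix r
    have "q ^ s * inverse (q ^ (s * Suc r)) = inverse (q ^ (s * r))" by (simp add: power_add field_simps)
    then show "gK * (const (inverse (q ^ (s * r))) * gK ^ r) = const (q ^ s) * (const (inverse (q ^ (s * Suc r))) * gK ^ Suc r)"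
      by (simp only: const_mult_const const_mult_left[of gK] power_Suc)
  qed
  let ?t = "\<lambda>r. const (inverse (q ^ (s * r))) * gK ^ r"
  have 3: "?t 0 + (\<Sum>r<half_p. ?t (Suc r)) = (\<Sum>r<half_p. ?t r) + ?t half_p"
    by (rule trans[OF sum.lessThan_Suc_shift[symmetric] sum.lessThan_Suc])
  note 3
  moreover have "?t half_p \<cong>\<^sub>A ?t 0"
    using cong_multL[OF gK_order, of "const 1"] by (simp add: qs)
  ultimately have 2: "(\<Sum>r<half_p. ?t (Suc r)) \<cong>\<^sub>A (\<Sum>r<half_p. ?t r)"
    by (rule cong_cancel)
  have "gK * phi n q s = const (1 / of_nat half_p) * (gK * (\<Sum>r<half_p. ?t r))"
    unfolding phi_def range by (rule const_mult_left)
  also have "\<dots> \<cong>\<^sub>A const (1 / of_nat half_p) * (const (q ^ s) * (\<Sum>r<half_p. ?t r))"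
    unfolding 1 by (intro cong_multL 2)
  also have "\<dots> = const (q ^ s) * phi n q s"
    unfolding phi_def range by (simp only: const_mult_const mult.commute)
  finally show ?thesis .
qed

lemma gX_phi: "gX * phi n q s \<cong>\<^sub>A phi n q s * gX"
proof -
  let ?S = "\<Sum>r = 0..half_p - 1. const (inverse (q ^ (s * r))) * gK ^ r"
  have "gX * ?S = (\<Sum>r = 0..half_p - 1. const (inverse (q ^ (s * r))) * (gX * gK ^ r))"
    by (simp only: sum_distrib_left const_mult_left[of gX])
  also have "\<dots> \<cong>\<^sub>A (\<Sum>r = 0..half_p - 1. const (inverse (q ^ (s * r))) * (gK ^ r * gX))"
    by (intro cong_sum cong_multL cong_sym[OF comm_pow[OF cong_sym[OF group_comm(5)]]])
  also have "\<dots> = ?S * gX" by (simp add: sum_distrib_right mult.assoc)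
  finally have "const (1 / of_nat half_p) * (gX * ?S) \<cong>\<^sub>A const (1 / of_nat half_p) * (?S * gX)" by (rule cong_multL)
  then show ?thesis unfolding phi_def const_mult_left[of gX] by (simp add: mult.assoc)
qed

lemma gX_bold1: "j \<le> 1 \<Longrightarrow> gX * bold1 n j \<cong>\<^sub>A const ((- 1) ^ j) * bold1 n j"
proof -
  have p: "const (1/2) * (gX * (1 + gX)) \<cong>\<^sub>A const (1/2) * (1 + gX)"
  proof (rule cong_multL)
    have "gX * (1 + gX) = gX * gX + gX" by (simp add: distrib_left)
    also have "\<dots> \<cong>\<^sub>A 1 + gX" by (intro cong_add gX_order cong_refl)
    finally show "gX * (1 + gX) \<cong>\<^sub>A 1 + gX" .
  qed
  have m: "const (1/2) * (gX * (1 - gX)) \<cong>\<^sub>A const (1/2) * (const (- 1) * (1 - gX))"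
  proof (rule cong_multL)
    have "gX * (1 - gX) = gX - gX * gX" by (simp add: right_diff_distrib)
    also have "\<dots> \<cong>\<^sub>A gX - 1" by (intro cong_diff gX_order cong_refl)
    finally show "gX * (1 - gX) \<cong>\<^sub>A const (- 1) * (1 - gX)" by (simp add: const_minus const_simps)
  qed
  assume "j \<le> 1"
  then consider "j = 0" | "j = 1" by linarith
  then show ?thesis
  proof cases
    case 1
    have b: "bold1 n 0 = const (1/2) * (1 + gX)" by (simp add: bold1_def)
    show ?thesis using p unfolding 1 b const_mult_left[of gX] power_0 const_simps mult_1 .
  next
    case 2
    have "const ((- 1) ^ j) * (const (1/2) * (1 - gX)) = const (1/2) * (const (- 1) * (1 - gX))"
      using 2 by (simp only: const_mult_const) simp
    moreover have b: "bold1 n j = const (1/2) * (1 - gX)" using 2 by (simp add: bold1_def)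
    ultimately show ?thesis using m unfolding b const_mult_left[of gX] by (simp only:)
  qed
qed

text \<open>With \<open>wt_h\<close>, the eigenvalues of \<open>kap\<close> and \<open>hat\<close>
  on the idempotent e of index (2i, j). They are determined by the eigenvalue q^(2i) of K and the
  eigenvalue (-1)^j of \<open>kap * hat ^ (n div 2)\<close>; the sign (-1)^i comes from q^(p/2) =
  -1.\<close>

definition wt_k :: "nat \<Rightarrow> nat \<Rightarrow> 'k" where "wt_k i j = (- 1) ^ (i + j) * qi ^ (n * i)"
definition wt_h :: "nat \<Rightarrow> nat \<Rightarrow> 'k" where "wt_h i j = q ^ (2 * i) * wt_k i j"

lemma wt_k_nz [simp]: "wt_k i j \<noteq> 0" by (simp add: wt_k_def)

lemma wt_kn: "wt_k i j ^ n = 1" "wt_h i j ^ n * wt_k i j ^ 2 = 1"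
proof -
  have ev: "even n" using four_dvd by (auto dest: dvd_trans[of 2 4])
  have a: "((- 1) ^ (i + j) :: 'k) ^ n = 1" using ev by (simp add: power_mult[symmetric] mult.commute[of "i + j"] power_mult)
  have b: "(qi ^ (n * i)) ^ n = 1"
  proof -
    have "(qi ^ (n * i)) ^ n = qi ^ (p * i)" by (simp add: power2_eq_square mult_ac flip: power_mult)
    then show ?thesis by (simp add: qi_pow_eq_1)
  qed
  show 1: "wt_k i j ^ n = 1" unfolding wt_k_def power_mult_distrib a b by simp
  have c: "wt_k i j ^ 2 = qi ^ (2 * (n * i))"
  proof -
    have "((- 1 :: 'k) ^ (i + j)) ^ 2 = 1" by (simp flip: power_mult)
    then show ?thesis unfolding wt_k_def power_mult_distrib by (simp add: mult.commute flip: power_mult)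
  qed
  have "wt_h i j ^ n = q ^ (2 * (n * i))" unfolding wt_h_def power_mult_distrib 1 by (simp add: mult_ac flip: power_mult)
  then show "wt_h i j ^ n * wt_k i j ^ 2 = 1" unfolding c by simp
qed

lemma wt_h_X: "wt_k i j * wt_h i j ^ (n div 2) = (- 1) ^ j"
  and wt_k_root: "((- 1) ^ j * qi ^ (n * i)) ^ Suc (n div 2) = wt_k i j"
proof -
  have h: "(qi ^ (n * i)) ^ (n div 2) = (- 1) ^ i"
  proof -
    have "(qi ^ (n * i)) ^ (n div 2) = (qi ^ half_p) ^ i" by (simp add: mult_ac flip: power_mult)
    moreover have "qi ^ half_p = - 1" unfolding power_inverse half_p(1) q_pow_half by simp
    ultimately show ?thesis by simp
  qed
  have e: "((- 1) ^ l :: 'k) ^ (n div 2) = 1" for l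
    using half_p(4) by (simp add: power_mult[symmetric] mult.commute[of l] power_mult)
  show r: "((- 1) ^ j * qi ^ (n * i)) ^ Suc (n div 2) = wt_k i j"
    unfolding power_Suc power_mult_distrib h e wt_k_def by (simp add: power_add)
  have "wt_k i j * wt_h i j ^ (n div 2) = wt_k i j * ((q ^ (2 * i)) ^ (n div 2) * wt_k i j ^ (n div 2))"
    unfolding wt_h_def power_mult_distrib ..
  also have "(q ^ (2 * i)) ^ (n div 2) = q ^ (n * i)"
    by (metis half_p(5) mult.assoc mult.commute power_mult)
  also have "wt_k i j ^ (n div 2) = (- 1) ^ i" unfolding wt_k_def power_mult_distrib e h by simp
  finally show "wt_k i j * wt_h i j ^ (n div 2) = (- 1) ^ j"
    by (simp add: wt_k_def power_add mult_ac)
qed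

text \<open>On e the element \<open>hat\<close> acts as q^(2i) \<open>kap\<close>, so the known
  eigenvalue of \<open>kap * hat ^ (n div 2)\<close> becomes one of \<kappa>^(1 + n/2). Raising to
  the power 1 + n/2 once more returns \<kappa> itself.\<close>

lemma idem_wvec:
  assumes j: "j \<le> 1" shows "wvec (wt_k i j) (wt_h i j) (idem (2 * i) j)"
proof -
  let ?e = "idem (2 * i) j"
  have K: "gK * ?e \<cong>\<^sub>A const (q ^ (2 * i)) * ?e"
    using cong_multR[OF phi_eig[of "2 * i"], of "bold1 n j"] by (simp add: idem_def mult.assoc)
  have X: "gX * ?e \<cong>\<^sub>A const ((- 1) ^ j) * ?e"
  proof -
    have "gX * ?e = (gX * phi n q (2 * i)) * bold1 n j" by (simp add: idem_def mult.assoc)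
    also have "\<dots> \<cong>\<^sub>A (phi n q (2 * i) * gX) * bold1 n j" by (rule cong_multR[OF gX_phi])
    also have "\<dots> = phi n q (2 * i) * (gX * bold1 n j)" by (simp add: mult.assoc)
    also have "\<dots> \<cong>\<^sub>A phi n q (2 * i) * (const ((- 1) ^ j) * bold1 n j)" by (intro cong_multL gX_bold1 j)
    also have "\<dots> = const ((- 1) ^ j) * ?e" unfolding idem_def by (rule const_mult_left)
    finally show ?thesis .
  qed
  have hz: "hat * z \<cong>\<^sub>A kap * (gK * z)" for z
  proof -
    have "kap * (gK * z) = (kap * kap_inv n) * (hat * z)" by (simp add: mult.assoc)
    also have "\<dots> \<cong>\<^sub>A 1 * (hat * z)" by (rule cong_multR[OF inverses(1)])
    finally show ?thesis by (simp add: cong_sym)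
  qed
  have Kk: "gK * (kap ^ m * ?e) \<cong>\<^sub>A const (q ^ (2 * i)) * (kap ^ m * ?e)" for m
  proof -
    have "gK * (kap ^ m * ?e) = (gK * kap ^ m) * ?e" by (simp add: mult.assoc)
    also have "\<dots> \<cong>\<^sub>A (kap ^ m * gK) * ?e"
      by (intro cong_multR cong_sym[OF comm_pow[OF cong_sym[OF group_comm(3)]]])
    also have "\<dots> = kap ^ m * (gK * ?e)" by (simp add: mult.assoc)
    also have "\<dots> \<cong>\<^sub>A kap ^ m * (const (q ^ (2 * i)) * ?e)" by (rule cong_multL[OF K])
    also have "\<dots> = const (q ^ (2 * i)) * (kap ^ m * ?e)" by (rule const_mult_left)
    finally show ?thesis .
  qed
  have hk: "hat * (kap ^ m * ?e) \<cong>\<^sub>A const (q ^ (2 * i)) * (kap ^ Suc m * ?e)" for m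
  proof -
    have "hat * (kap ^ m * ?e) \<cong>\<^sub>A kap * (gK * (kap ^ m * ?e))" by (rule hz)
    also have "\<dots> \<cong>\<^sub>A kap * (const (q ^ (2 * i)) * (kap ^ m * ?e))" by (rule cong_multL[OF Kk])
    also have "\<dots> = const (q ^ (2 * i)) * (kap * (kap ^ m * ?e))" by (rule const_mult_left)
    finally show ?thesis by (simp add: mult.assoc)
  qed
  have hm: "hat ^ m * ?e \<cong>\<^sub>A const ((q ^ (2 * i)) ^ m) * (kap ^ m * ?e)" for m
  proof (induction m)
    case (Suc m)
    have "hat ^ Suc m * ?e = hat * (hat ^ m * ?e)" by (simp add: mult.assoc)
    also have "\<dots> \<cong>\<^sub>A hat * (const ((q ^ (2 * i)) ^ m) * (kap ^ m * ?e))" by (rule cong_multL[OF Suc])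
    also have "\<dots> = const ((q ^ (2 * i)) ^ m) * (hat * (kap ^ m * ?e))" by (rule const_mult_left)
    also have "\<dots> \<cong>\<^sub>A const ((q ^ (2 * i)) ^ m) * (const (q ^ (2 * i)) * (kap ^ Suc m * ?e))" by (rule cong_multL[OF hk])
    finally show ?case by (simp add: const_mult_const mult.commute)
  qed (simp add: const_simps)
  let ?m = "Suc (n div 2)"
  have qn: "(q ^ (2 * i)) ^ (n div 2) = q ^ (n * i)"
    by (metis half_p(5) mult.assoc mult.commute power_mult)
  have "const (q ^ (n * i)) * (kap ^ ?m * ?e) = kap * (const ((q ^ (2 * i)) ^ (n div 2)) * (kap ^ (n div 2) * ?e))"
    by (simp add: qn const_mult_left[of kap] mult.assoc)
  also have "\<dots> \<cong>\<^sub>A kap * (hat ^ (n div 2) * ?e)" by (intro cong_multL cong_sym[OF hm])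
  also have "\<dots> = gX * ?e" by (simp add: mult.assoc)
  also have "\<dots> \<cong>\<^sub>A const ((- 1) ^ j) * ?e" by (rule X)
  finally have "const (qi ^ (n * i)) * (const (q ^ (n * i)) * (kap ^ ?m * ?e)) \<cong>\<^sub>A
      const (qi ^ (n * i)) * (const ((- 1) ^ j) * ?e)" by (rule cong_multL)
  then have "kap ^ ?m * ?e \<cong>\<^sub>A const ((- 1) ^ j * qi ^ (n * i)) * ?e"
    by (simp only: const_mult_const q_qi const_simps mult_1_left mult.commute)
  from eig_power[OF this, of ?m]
  have 1: "(kap ^ ?m) ^ ?m * ?e \<cong>\<^sub>A const (wt_k i j) * ?e" unfolding wt_k_root .
  \<comment> \<open>(1 + n/2)^2 = 1 + n + n^2/4 = 1 + n (1 + n/4), an exponent congruent to 1 modulo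
    n thanks to 4 dvd n.\<close>
  have 2: "(kap ^ ?m) ^ ?m = (kap ^ (1 + n * (1 + n div 4)) :: 'k falg)"
  proof -
    obtain m where "n = 4 * m" using four_dvd by blast
    then have "?m * ?m = 1 + n * (1 + n div 4)" by (simp add: algebra_simps)
    then show ?thesis by (simp only: power_mult[symmetric])
  qed
  have "kap ^ 1 * ?e \<cong>\<^sub>A kap ^ (1 + n * (1 + n div 4)) * ?e"
    by (rule cong_multR[OF cong_sym[OF kap_pow_n(2)]])
  also have "\<dots> = (kap ^ ?m) ^ ?m * ?e" by (simp only: 2)
  also note 1
  finally have kap: "kap * ?e \<cong>\<^sub>A const (wt_k i j) * ?e" by simp
  have "hat * ?e \<cong>\<^sub>A const (q ^ (2 * i)) * (kap * ?e)" using hk[of 0] by simp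
  also have "\<dots> \<cong>\<^sub>A const (q ^ (2 * i)) * (const (wt_k i j) * ?e)" by (rule cong_multL[OF kap])
  finally show ?thesis using kap by (simp add: wvec_def const_mult_const wt_h_def)
qed

text \<open>The idempotent is a polynomial in \<open>kap\<close> and \<open>hat\<close> and fixes
  every vector of its own weight. It is applied to the generator of V, which takes the place of
  e.\<close>

lemma frep_idem:
  assumes j: "j \<le> 1" and T: "\<And>g. lin (T g)" and w: "weight T (wt_k i j) (wt_h i j) f"
  shows "frep T (idem (2 * i) j) f = f"
proof -
  have m: "monoid_rep (word_act T)" by (rule monoid_rep_word_act[OF T])
  have fg: "frep T (gen g) = T g" for g by (simp add: fun_eq_iff frep_gen)
  have w': "T L_kap f = wt_k i j *\<^sub>f f" "T L_hat f = wt_h i j *\<^sub>f f" using w by (simp_all add: weight_def)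
  have pw: "(T L_kap ^^ m) f = wt_k i j ^ m *\<^sub>f f" "(T L_hat ^^ m) f = wt_h i j ^ m *\<^sub>f f" for m
    by (induction m) (simp_all add: lin_scale[OF T] w' mult.commute)
  have X: "frep T gX f = (- 1) ^ j *\<^sub>f f"
    by (simp add: rep_mult[OF m] rep_power[OF m] fg pw lin_scale[OF T] w' wt_h_X mult.commute[of "wt_h i j ^ (n div 2)"])
  have kinv: "wt_k i j ^ (n - 1) = inverse (wt_k i j)"
  proof -
    have "wt_k i j ^ (n - 1) * wt_k i j = 1" using wt_kn(1) n_pos by (metis power_minus_mult)
    then show ?thesis by (simp add: field_simps)
  qed
  have K: "frep T gK f = q ^ (2 * i) *\<^sub>f f"
    by (simp add: rep_mult[OF m] kap_inv_def rep_power[OF m] fg w' pw lin_scale[OF lin_funpow[OF T]] kinv[simplified] wt_h_def mult.assoc)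
  have lr: "lin (frep T x)" for x using m by (intro lin_rep) (simp add: monoid_rep_def)
  have Kr: "frep T (gK ^ r) f = (q ^ (2 * i)) ^ r *\<^sub>f f" for r
  proof (induction r)
    case (Suc r)
    have "frep T (gK ^ Suc r) f = frep T gK (frep T (gK ^ r) f)" by (simp only: power_Suc rep_mult[OF m])
    then show ?case unfolding Suc lin_scale[OF lr] K by (simp add: mult.commute)
  qed (simp add: rep_one[OF m])
  have B: "frep T (bold1 n j) f = f"
  proof -
    consider "j = 0" | "j = 1" using j by linarith
    then show ?thesis
    proof cases
      case 1
      then have "frep T (bold1 n j) f = (1/2) *\<^sub>f (f + frep T gX f)"
        unfolding bold1_def by (simp only: refl if_True rep_mult[OF m, of "const _"] rep_const[OF m] rep_add rep_one[OF m])
      then show ?thesis unfolding X 1 by (simp add: fun_eq_iff fun_apply)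
    next
      case 2
      then have "frep T (bold1 n j) f = (1/2) *\<^sub>f (f - frep T gX f)"
        unfolding bold1_def
        by (simp only: one_neq_zero if_False rep_mult[OF m, of "const _"] rep_const[OF m] rep_diff rep_one[OF m])
      then show ?thesis unfolding X 2 by (simp add: fun_eq_iff fun_apply)
    qed
  qed
  have "frep T (phi n q (2 * i)) f = (1 / of_nat half_p) *\<^sub>f (\<Sum>r = 0..half_p - 1. f)"
    unfolding phi_def rep_mult[OF m, of "const _"] rep_const[OF m] rep_sum Kr
    by (simp add: power_mult flip: power_mult_distrib)
  also have "\<dots> = f"
  proof
    fix b
    have "Suc (half_p - 1) = half_p" using half_p(3) by simp
    then have "(\<Sum>r = 0..half_p - 1. f b) = of_nat half_p * f b" by simp
    moreover have "(of_nat half_p :: 'k) \<noteq> 0" using half_p(3) by (metis neq0_conv of_nat_eq_0_iff)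
    ultimately show "((1 / of_nat half_p) *\<^sub>f (\<Sum>r = 0..half_p - 1. f)) b = f b"
      unfolding fscale_apply sum_fun_apply by simp
  qed
  finally show ?thesis by (simp add: idem_def rep_mult[OF m] B)
qed

text \<open>Orthogonality of characters: summed over i, the coefficient of K^r in the
  \<open>phi\<close> is a geometric sum over a root of unity, zero unless r = 0. Completeness
  reduces questions about u0 to the weights of the e.\<close>

lemma idem_sum: "(\<Sum>i = 1..half_p. \<Sum>j\<le>1. idem (2 * i) j) = 1"
proof -
  have b: "(\<Sum>j\<le>1. bold1 n j) = (1 :: 'k falg)"
  proof -
    have "(\<Sum>j\<le>1. bold1 n j) = const (1/2) * (1 + gX) + const (1/2) * (1 - gX)"
      by (simp add: bold1_def atMost_Suc)
    also have "\<dots> = const (1/2 + 1/2)" unfolding const_simps(4) by (simp add: algebra_simps)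
    finally show ?thesis by (simp add: const_simps)
  qed
  have geom: "(\<Sum>i = 1..half_p. inverse (q ^ (2 * i * r))) = (if r = 0 then of_nat half_p else 0)" if "r < half_p" for r
  proof (cases "r = 0")
    case False
    let ?x = "qi ^ (2 * r)"
    have "2 * r < p" "0 < 2 * r" using that half_p(2) False by simp_all
    then have x1: "?x \<noteq> 1" by (auto simp: qi_pow_eq_1 dest: dvd_imp_le)
    have xp: "?x ^ half_p = 1"
    proof -
      have "?x ^ half_p = qi ^ (p * r)" unfolding power_mult[symmetric] half_p(2)[symmetric] by (simp only: mult_ac)
      then show ?thesis by (simp add: qi_pow_eq_1)
    qed
    have "(\<Sum>i = 1..half_p. inverse (q ^ (2 * i * r))) = (\<Sum>i = 1..half_p. ?x ^ i)"
      by (simp add: power_inverse mult_ac flip: power_mult)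
    also have "\<dots> = (\<Sum>i<half_p. ?x ^ Suc i)"
      by (rule sum.reindex_bij_witness[of _ Suc "\<lambda>i. i - 1"]) auto
    also have "\<dots> = ?x * (\<Sum>i<half_p. ?x ^ i)" by (simp add: sum_distrib_left)
    also have "(1 - ?x) * (\<Sum>i<half_p. ?x ^ i) = 0"
      using one_diff_power_eq[of ?x half_p] xp by simp
    then have "(\<Sum>i<half_p. ?x ^ i) = 0" using x1 by simp
    finally show ?thesis using False by simp
  qed simp
  note range = half_range
  have "(\<Sum>i = 1..half_p. phi n q (2 * i)) = const (1 / of_nat half_p) *
      (\<Sum>r<half_p. const (\<Sum>i = 1..half_p. inverse (q ^ (2 * i * r))) * gK ^ r)"
    unfolding phi_def range sum_distrib_left[symmetric]
    by (subst sum.swap) (simp add: const_sum sum_distrib_right)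
  also have "(\<Sum>r<half_p. const (\<Sum>i = 1..half_p. inverse (q ^ (2 * i * r))) * gK ^ r) =
      (\<Sum>r<half_p. if r = 0 then const (of_nat half_p) else 0)"
    by (intro sum.cong refl) (simp add: geom[unfolded One_nat_def] const_simps)
  also have "\<dots> = const (of_nat half_p)" using half_p(3) by simp
  also have "const (1 / of_nat half_p) * const (of_nat half_p) = (1 :: 'k falg)"
  proof -
    have "(of_nat half_p :: 'k) \<noteq> 0" using half_p(3) by (metis neq0_conv of_nat_eq_0_iff)
    then show ?thesis by (simp flip: const_simps(1)) (simp add: const_simps)
  qed
  finally have "(\<Sum>i = 1..half_p. phi n q (2 * i)) = 1" .
  then show ?thesis
    unfolding idem_def sum_distrib_left[symmetric] b sum_distrib_right[symmetric] by simp
qed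

end

section \<open>The modules P and S\<close>

text \<open>Representatives in the free algebra of the elements of u0, built up inductively so that
  statements about u0 can be proved generator by generator.\<close>

inductive_set cartan :: "'k::field falg set" where
  "const c \<in> cartan" | "kap \<in> cartan" | "hat \<in> cartan"
| "x \<in> cartan \<Longrightarrow> y \<in> cartan \<Longrightarrow> x + y \<in> cartan"
| "x \<in> cartan \<Longrightarrow> y \<in> cartan \<Longrightarrow> x * y \<in> cartan"

lemma cartan_closed:
  fixes x y :: "'a::field falg"
  shows "(1 :: 'a falg) \<in> cartan" "(0 :: 'a falg) \<in> cartan" "x \<in> cartan \<Longrightarrow> - x \<in> cartan" "x \<in> cartan \<Longrightarrow> y \<in> cartan \<Longrightarrow> x - y \<in> cartan"
  "x \<in> cartan \<Longrightarrow> x ^ l \<in> cartan" "(\<And>i. i \<in> I \<Longrightarrow> f i \<in> cartan) \<Longrightarrow> (\<Sum>i\<in>I. f i :: 'a falg) \<in> cartan"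
proof -
  show 1: "(1 :: 'a falg) \<in> cartan" using cartan.intros(1)[of 1] by (simp add: const_simps)
  show 0: "(0 :: 'a falg) \<in> cartan" using cartan.intros(1)[of 0] by (simp add: const_simps)
  have c: "const (- 1) * x = - x" for x :: "'a falg"
    by (simp add: const_def single_uminus)
  show neg: "x \<in> cartan \<Longrightarrow> - x \<in> cartan" for x :: "'a falg"
    using cartan.intros(5)[OF cartan.intros(1)[of "- 1"], of x] by (simp add: c)
  show "x \<in> cartan \<Longrightarrow> y \<in> cartan \<Longrightarrow> x - y \<in> cartan"
    using cartan.intros(4)[OF _ neg, of x y] by simp
  show "x \<in> cartan \<Longrightarrow> x ^ l \<in> cartan" by (induction l) (auto intro: 1 cartan.intros)
  show "(\<And>i. i \<in> I \<Longrightarrow> f i \<in> cartan) \<Longrightarrow> (\<Sum>i\<in>I. f i :: 'a falg) \<in> cartan"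
    by (induction I rule: infinite_finite_induct) (auto intro: 0 cartan.intros)
qed

context root_order begin

lemma cls_ring:
  "cls x \<oplus>\<^bsub>Qu n q\<^esub> cls y = cls (x + y)" "cls x \<otimes>\<^bsub>Qu n q\<^esub> cls y = cls (x * y)" "cls x \<in> carrier (Qu n q)"
  "\<ominus>\<^bsub>Qu n q\<^esub> cls x = cls (- x)"
proof -
  show 1: "cls x \<oplus>\<^bsub>Qu n q\<^esub> cls y = cls (x + y)" for x y by (rule Qu_add)
  show "cls x \<otimes>\<^bsub>Qu n q\<^esub> cls y = cls (x * y)" by (rule Qu_cls_hom[symmetric])
  show 2: "cls x \<in> carrier (Qu n q)" for x by (simp add: carrier_Qu)
  interpret ring "Qu n q" by (rule ring_Qu)
  show "\<ominus>\<^bsub>Qu n q\<^esub> cls x = cls (- x)"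
    by (rule minus_equality) (simp_all add: 1 2 Qu_zero)
qed

lemma cls_finsum: "finite A \<Longrightarrow> (\<Oplus>\<^bsub>Qu n q\<^esub>a\<in>A. cls (f a)) = cls (\<Sum>a\<in>A. f a)"
proof (induction A rule: finite_induct)
  interpret ring "Qu n q" by (rule ring_Qu)
  case empty
  show ?case by (simp add: Qu_zero)
next
  interpret ring "Qu n q" by (rule ring_Qu)
  case (insert a A)
  have "(\<lambda>a. cls (f a)) \<in> A \<rightarrow> carrier (Qu n q)" by (simp add: cls_ring)
  from finsum_insert[OF insert.hyps this] show ?case
    using insert by (simp add: cls_ring)
qed

lemma cartan_u0: "U \<in> cartan \<Longrightarrow> cls U \<in> Qu_u0 n q"
  unfolding Qu_u0_def
proof (induction rule: cartan.induct)
  case (4 x y)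
  from generate_ring.eng_add[OF 4(3,4)] show ?case by (simp add: cls_ring)
next
  case (5 x y)
  from generate_ring.eng_mult[OF 5(3,4)] show ?case by (simp add: cls_ring)
qed (auto intro: generate_ring.incl)

lemma u0_cartan: "u \<in> Qu_u0 n q \<Longrightarrow> \<exists>U\<in>cartan. u = cls U"
  unfolding Qu_u0_def
proof (induction rule: generate_ring.induct)
  case one
  show ?case by (rule bexI[of _ 1]) (simp_all add: Qu_cls_1 cartan_closed)
next
  case (incl h)
  then show ?case by (auto intro: cartan.intros)
next
  case (a_inv h)
  then obtain U where "U \<in> cartan" "h = cls U" by blast
  then show ?case by (intro bexI[of _ "- U"]) (simp_all add: cls_ring cartan_closed)
next
  case (eng_add h1 h2)
  then obtain U V where "U \<in> cartan" "h1 = cls U" "V \<in> cartan" "h2 = cls V" by blast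
  then show ?case by (intro bexI[of _ "U + V"]) (simp_all add: cls_ring cartan.intros)
next
  case (eng_mult h1 h2)
  then obtain U V where "U \<in> cartan" "h1 = cls U" "V \<in> cartan" "h2 = cls V" by blast
  then show ?case by (intro bexI[of _ "U * V"]) (simp_all add: cls_ring cartan.intros)
qed

lemma swap_inv:
  assumes "a * g \<cong>\<^sub>A const c * (g * a)" "d * c = 1" shows "g * a \<cong>\<^sub>A const d * a * g"
proof -
  have "g * a = const d * (const c * (g * a))" using assms(2) by (simp add: const_mult_const const_simps)
  also have "\<dots> \<cong>\<^sub>A const d * (a * g)" by (intro cong_multL cong_sym[OF assms(1)])
  finally show ?thesis by (simp add: mult.assoc)
qed

lemma E_cartan: "U \<in> cartan \<Longrightarrow> \<exists>U'\<in>cartan. gE * U \<cong>\<^sub>A U' * gE"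
proof (induction rule: cartan.induct)
  case (1 c)
  show ?case by (rule bexI[of _ "const c"]) (simp_all add: const_comm cartan.intros)
next
  case 2
  have "gE * kap \<cong>\<^sub>A const (qi ^ n) * kap * gE" by (rule swap_inv[OF kap_E]) simp
  then show ?case by (intro bexI[of _ "const (qi ^ n) * kap"]) (auto intro: cartan.intros)
next
  case 3
  have "gE * hat \<cong>\<^sub>A const (inverse (q ^ n * qi ^ 2)) * hat * gE"
    by (rule swap_inv[OF hat_E], rule left_inverse) simp
  then show ?case by (intro bexI[of _ "const (inverse (q ^ n * qi ^ 2)) * hat"]) (auto intro: cartan.intros)
next
  case (4 x y)
  then obtain x' y' where "x' \<in> cartan" "y' \<in> cartan" "gE * x \<cong>\<^sub>A x' * gE" "gE * y \<cong>\<^sub>A y' * gE" by blast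
  then show ?case
    by (intro bexI[of _ "x' + y'"]) (auto intro: cartan.intros cong_add simp: distrib_left distrib_right)
next
  case (5 x y)
  then obtain x' y' where xy: "x' \<in> cartan" "y' \<in> cartan" "gE * x \<cong>\<^sub>A x' * gE" "gE * y \<cong>\<^sub>A y' * gE" by blast
  have "gE * (x * y) \<cong>\<^sub>A x' * gE * y" using cong_multR[OF xy(3), of y] by (simp add: mult.assoc)
  also have "x' * gE * y = x' * (gE * y)" by (simp add: mult.assoc)
  also have "\<dots> \<cong>\<^sub>A x' * (y' * gE)" by (rule cong_multL[OF xy(4)])
  finally have "gE * (x * y) \<cong>\<^sub>A x' * y' * gE" by (simp add: mult.assoc)
  then show ?case using xy by (intro bexI[of _ "x' * y'"]) (auto intro: cartan.intros)
qed

lemma E_pow_cartan: "U \<in> cartan \<Longrightarrow> \<exists>U'\<in>cartan. gE ^ b * U \<cong>\<^sub>A U' * gE ^ b"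
proof (induction b)
  case (Suc b)
  then obtain U' where U': "U' \<in> cartan" "gE ^ b * U \<cong>\<^sub>A U' * gE ^ b" by blast
  obtain U'' where U'': "U'' \<in> cartan" "gE * U' \<cong>\<^sub>A U'' * gE" using E_cartan[OF U'(1)] by blast
  have "gE ^ Suc b * U = gE * (gE ^ b * U)" by (simp add: mult.assoc)
  also have "\<dots> \<cong>\<^sub>A gE * (U' * gE ^ b)" by (rule cong_multL[OF U'(2)])
  also have "\<dots> = gE * U' * gE ^ b" by (simp add: mult.assoc)
  also have "\<dots> \<cong>\<^sub>A U'' * gE * gE ^ b" by (rule cong_multR[OF U''(2)])
  finally show ?case using U'' by (intro bexI[of _ U'']) (simp_all add: mult.assoc)
qed (auto intro!: bexI[of _ U])

lemma idem_cartan: "idem s j \<in> cartan"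
proof -
  have X: "gX \<in> cartan" by (intro cartan.intros cartan_closed)
  have "bold1 n j \<in> (cartan :: 'k falg set)"
    unfolding bold1_def using X by (auto intro: cartan.intros(1,4,5) cartan_closed)
  moreover have "phi n q s \<in> cartan"
    unfolding phi_def kap_inv_def by (intro cartan.intros(1,5) cartan_closed(6) cartan_closed(5) cartan.intros(2,3))
  ultimately show ?thesis unfolding idem_def by (rule cartan.intros(5)[rotated])
qed

text \<open>One scalar function \<chi> for two situations: left multiplication on weight vectors of
  A, and the action on weight vectors in coordinates indexed by pairs. Vanishing of \<chi> seen in
  an induced module is thereby carried back to A.\<close>

definition acts_by :: "'k falg \<Rightarrow> ('k \<Rightarrow> 'k \<Rightarrow> 'k) \<Rightarrow> bool" where
  "acts_by U \<chi> \<longleftrightarrow> (\<forall>k h z. wvec k h z \<longrightarrow> U * z \<cong>\<^sub>A const (\<chi> k h) * z) \<and>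
     (\<forall>k h T (f :: nat \<times> nat \<Rightarrow> 'k). (\<forall>g. lin (T g)) \<longrightarrow> weight T k h f \<longrightarrow> frep T U f = \<chi> k h *\<^sub>f f)"

lemma acts_byD:
  fixes f :: "nat \<times> nat \<Rightarrow> 'k"
  assumes "acts_by U \<chi>"
  shows "wvec k h z \<Longrightarrow> U * z \<cong>\<^sub>A const (\<chi> k h) * z"
    "(\<And>g. lin (T g)) \<Longrightarrow> weight T k h f \<Longrightarrow> frep T U f = \<chi> k h *\<^sub>f f"
  using assms by (simp_all add: acts_by_def)

lemma cartan_scalar: "U \<in> cartan \<Longrightarrow> \<exists>\<chi>. acts_by U \<chi>"
proof (induction rule: cartan.induct)
  case (1 c)
  show ?case by (rule exI[of _ "\<lambda>_ _. c"]) (auto simp: acts_by_def intro: rep_const monoid_rep_word_act)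
next
  case 2
  show ?case by (rule exI[of _ "\<lambda>k h. k"]) (auto simp: acts_by_def wvec_def weight_def frep_gen)
next
  case 3
  show ?case by (rule exI[of _ "\<lambda>k h. h"]) (auto simp: acts_by_def wvec_def weight_def frep_gen)
next
  case (4 x y)
  then obtain \<chi> \<xi> where c: "acts_by x \<chi>" "acts_by y \<xi>" by blast
  have "acts_by (x + y) (\<lambda>k h. \<chi> k h + \<xi> k h)"
    unfolding acts_by_def distrib_right const_simps rep_add fscale_add
    using acts_byD[OF c(1)] acts_byD[OF c(2)] by (auto intro!: cong_add)
  then show ?case by blast
next
  case (5 x y)
  then obtain \<chi> \<xi> where c: "acts_by x \<chi>" "acts_by y \<xi>" by blast
  have "frep T (x * y) f = (\<chi> k h * \<xi> k h) *\<^sub>f f"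
    if T: "\<And>g. lin (T g)" and w: "weight T k h f" for k h T and f :: "nat \<times> nat \<Rightarrow> 'k"
  proof -
    have m: "monoid_rep (word_act T)" by (rule monoid_rep_word_act[OF T])
    have l: "lin (frep T x)" using m by (intro lin_rep) (simp add: monoid_rep_def)
    show ?thesis
      by (simp add: rep_mult[OF m] acts_byD(2)[OF c(1) T w] acts_byD(2)[OF c(2) T w] lin_scale[OF l] mult.commute)
  qed
  moreover have "x * y * z \<cong>\<^sub>A const (\<chi> k h * \<xi> k h) * z" if "wvec k h z" for k h z
    by (rule eig_mult[OF acts_byD(1)[OF c(1) that] acts_byD(1)[OF c(2) that]])
  ultimately have "acts_by (x * y) (\<lambda>k h. \<chi> k h * \<xi> k h)" by (simp add: acts_by_def)
  then show ?case by blast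
qed

section \<open>Normal forms and the uniqueness of \<gamma>\<close>

definition pbw_sum :: "(nat \<Rightarrow> nat \<Rightarrow> 'k falg) \<Rightarrow> 'k falg" where
  "pbw_sum U = (\<Sum>a\<in>{0..p - 2}. \<Sum>b\<in>{0..p - 1}. gF ^ a * U a b * gE ^ b)"

lemma gamma_space_eq: "gamma_space n q = {cls (pbw_sum U) | U. \<forall>a b. U a b \<in> cartan}"
proof -
  have *: "(\<Oplus>\<^bsub>Qu n q\<^esub>a \<in> {0..p - 2}. \<Oplus>\<^bsub>Qu n q\<^esub>b \<in> {0..p - 1}.
         cls (gF ^ a) \<otimes>\<^bsub>Qu n q\<^esub> cls (U a b) \<otimes>\<^bsub>Qu n q\<^esub> cls (gE ^ b)) = cls (pbw_sum U)" for U
    by (simp add: cls_ring cls_finsum pbw_sum_def)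
  show ?thesis
  proof (intro equalityI subsetI)
    fix x assume "x \<in> gamma_space n q"
    then obtain u where u: "\<And>a b. u a b \<in> Qu_u0 n q" and x: "x = (\<Oplus>\<^bsub>Qu n q\<^esub>a \<in> {0..p - 2}. \<Oplus>\<^bsub>Qu n q\<^esub>b \<in> {0..p - 1}.
         cls (gF ^ a) \<otimes>\<^bsub>Qu n q\<^esub> u a b \<otimes>\<^bsub>Qu n q\<^esub> cls (gE ^ b))"
      unfolding gamma_space_def by blast
    have "\<forall>a b. \<exists>U. U \<in> cartan \<and> u a b = cls U" using u0_cartan[OF u] by blast
    then obtain U where U: "\<And>a b. U a b \<in> cartan" "\<And>a b. u a b = cls (U a b)" by metis
    show "x \<in> {cls (pbw_sum U) | U. \<forall>a b. U a b \<in> cartan}"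
      unfolding x U(2) * using U(1) by blast
  next
    fix x assume "x \<in> {cls (pbw_sum U) | U. \<forall>a b. U a b \<in> cartan}"
    then obtain U where U: "\<forall>a b. U a b \<in> cartan" "x = cls (pbw_sum U)" by blast
    show "x \<in> gamma_space n q"
      unfolding gamma_space_def mem_Collect_eq U(2) *[symmetric]
      by (rule exI[of _ "\<lambda>a b. cls (U a b)"]) (use U(1) cartan_u0 in blast)
  qed
qed

text \<open>Expand 1 into the idempotents: each U e is \<chi> at the weight of e times e, so U is a
  sum of zeros.\<close>

lemma cartan_zero:
  assumes U: "U \<in> cartan"
    and \<chi>: "\<And>k h z. wvec k h z \<Longrightarrow> U * z \<cong>\<^sub>A const (\<chi> k h) * z" and z: "\<And>i j. \<chi> (wt_k i j) (wt_h i j) = 0"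
  shows "U \<cong>\<^sub>A 0"
proof -
  have "U = U * (\<Sum>i = 1..half_p. \<Sum>j\<le>1. idem (2 * i) j)" unfolding idem_sum by simp
  also have "\<dots> = (\<Sum>i = 1..half_p. \<Sum>j\<le>1. U * idem (2 * i) j)" by (simp only: sum_distrib_left)
  also have "\<dots> \<cong>\<^sub>A (\<Sum>i = 1..half_p. \<Sum>j\<le>1. const (\<chi> (wt_k i j) (wt_h i j)) * idem (2 * i) j)"
    by (intro cong_sum \<chi> idem_wvec) auto
  also have "\<dots> = 0" by (simp only: z const_simps mult_zero_left sum.neutral_const)
  finally show ?thesis .
qed

text \<open>Applied to the generator of an induced module, F times the sum has \<chi>(a, b) as
  coefficient of F^(a+1) E^b, and a \<le> p - 2 keeps a + 1 below p. So each \<chi>(a, b) vanishes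
  at the weights of all idempotents, and each U(a, b) is 0 in A.\<close>

lemma F_pbw_inj:
  assumes U: "\<And>a b. U a b \<in> cartan" and z: "gF * pbw_sum U \<cong>\<^sub>A 0"
  shows "pbw_sum U \<cong>\<^sub>A 0"
proof -
  have "\<forall>a b. \<exists>\<chi>. acts_by (U a b) \<chi>" using cartan_scalar[OF U] by blast
  then obtain \<chi> where "\<And>a b. acts_by (U a b) (\<chi> a b)" by metis
  note c = acts_byD[OF this]
  have "U a0 b0 \<cong>\<^sub>A 0" if a0: "a0 \<le> p - 2" and b0: "b0 \<le> p - 1" for a0 b0
  proof (rule cartan_zero[OF U c(1)])
    fix i j
    \<comment> \<open>The weight is chosen so that E^(b0) applied to the generator has the weight of
      the idempotent of index (2i, j), where \<open>cartan_zero\<close> wants \<chi>(a0, b0) to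
      vanish.\<close>
    define k h where "k = (qi ^ n) ^ b0 * wt_k i j" and "h = (inverse (q ^ n * qi ^ 2)) ^ b0 * wt_h i j"
    have qp: "(qi ^ n) ^ n = 1" using qi_pow_eq_1[of p] by (simp add: power2_eq_square flip: power_mult)
    have pc: "(u ^ b0) ^ m = (u ^ m) ^ b0" for u :: 'k and m by (simp only: power_mult[symmetric] mult.commute)
    have k: "k ^ n = 1"
    proof -
      have "((qi ^ n) ^ b0) ^ n = ((qi ^ n) ^ n) ^ b0" by (rule pc)
      then show ?thesis unfolding k_def power_mult_distrib wt_kn qp by simp
    qed
    have h: "h ^ n * k ^ 2 = 1"
    proof -
      have qn: "(q ^ n) ^ n = 1" using q_order by (simp add: power2_eq_square flip: power_mult)
      have 2: "(qi ^ 2) ^ n = (qi ^ n) ^ 2" by (simp only: power_mult[symmetric] mult.commute)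
      have "(inverse (q ^ n * qi ^ 2)) ^ n = inverse ((q ^ n * qi ^ 2) ^ n)" by (rule power_inverse)
      also have "(q ^ n * qi ^ 2) ^ n = (qi ^ n) ^ 2" unfolding power_mult_distrib qn 2 by simp
      finally have "(inverse (q ^ n * qi ^ 2)) ^ n = inverse ((qi ^ n) ^ 2)" .
      then have 1: "(inverse (q ^ n * qi ^ 2)) ^ n * (qi ^ n) ^ 2 = 1" by simp
      have "h ^ n * k ^ 2 = ((inverse (q ^ n * qi ^ 2)) ^ b0) ^ n * ((qi ^ n) ^ b0) ^ 2 * (wt_h i j ^ n * wt_k i j ^ 2)"
        unfolding k_def h_def power_mult_distrib by (simp only: mult_ac)
      also have "((inverse (q ^ n * qi ^ 2)) ^ b0) ^ n * ((qi ^ n) ^ b0) ^ 2 = ((inverse (q ^ n * qi ^ 2)) ^ n * (qi ^ n) ^ 2) ^ b0"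
        by (simp only: pc power_mult_distrib)
      finally show ?thesis unfolding 1 wt_kn by simp
    qed
    have k0: "k \<noteq> 0" by (simp add: k_def)
    let ?T = "V_ops k h"
    have m: "monoid_rep (word_act ?T)" by (rule monoid_rep_word_act[OF lin_V_ops])
    have fg: "frep ?T (gen g) = ?T g" for g by (simp add: fun_eq_iff frep_gen)
    have p2: "p - 1 < p" "p - 2 < p - 1" using p_ge by simp_all
    have "frep ?T (gF * pbw_sum U) (delta (0, 0)) = 0"
      by (rule V_kills_ideal[OF k h]) (use z n_pos in \<open>simp_all add: cong_iff\<close>)
    moreover have "frep ?T (gF * pbw_sum U) (delta (0, 0)) =
        (\<Sum>a\<in>{0..p - 2}. \<Sum>b\<in>{0..p - 1}. \<chi> a b ((q ^ n) ^ b * k) ((q ^ n * qi ^ 2) ^ b * h) *\<^sub>f delta (Suc a, b))"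
    proof -
      have t: "frep ?T (gF ^ a * U a b * gE ^ b) (delta (0, 0)) =
          \<chi> a b ((q ^ n) ^ b * k) ((q ^ n * qi ^ 2) ^ b * h) *\<^sub>f delta (a, b)"
        if "a < p" "b < p" for a b
        using c(2)[OF lin_V_ops V_delta_weight[of k h b 0], of a b] that
        by (simp add: rep_mult[OF m] rep_power[OF m] fg V_delta_pow lin_scale[OF lin_funpow[OF lin_V_ops]])
      have 1: "frep ?T (gF * pbw_sum U) (delta (0, 0)) = ?T L_F (frep ?T (pbw_sum U) (delta (0, 0)))"
        by (simp only: rep_mult[OF m] fg)
      have 2: "frep ?T (pbw_sum U) (delta (0, 0)) =
          (\<Sum>a\<in>{0..p - 2}. \<Sum>b\<in>{0..p - 1}. frep ?T (gF ^ a * U a b * gE ^ b) (delta (0, 0)))"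
        by (simp only: pbw_sum_def rep_sum)
      show ?thesis
        unfolding 1 2 lin_sum[OF lin_V_ops]
      proof (intro sum.cong refl)
        fix a b assume ab: "a \<in> {0..p - 2}" "b \<in> {0..p - 1}"
        then have l: "a < p" "b < p" "Suc a < p" using p2 by auto
        show "?T L_F (frep ?T (gF ^ a * U a b * gE ^ b) (delta (0, 0))) =
            \<chi> a b ((q ^ n) ^ b * k) ((q ^ n * qi ^ 2) ^ b * h) *\<^sub>f delta (Suc a, b)"
          unfolding t[OF l(1,2)] lin_scale[OF lin_V_ops] V_delta(1)[OF l(2)] using l by simp
      qed
    qed
    ultimately have z0: "(\<Sum>a\<in>{0..p - 2}. \<Sum>b\<in>{0..p - 1}. \<chi> a b ((q ^ n) ^ b * k) ((q ^ n * qi ^ 2) ^ b * h) *\<^sub>f delta (Suc a, b)) (Suc a0, b0) = 0"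
      by (simp add: zero_fun_apply)
    have "(\<Sum>a\<in>{0..p - 2}. \<Sum>b\<in>{0..p - 1}. \<chi> a b ((q ^ n) ^ b * k) ((q ^ n * qi ^ 2) ^ b * h) *\<^sub>f delta (Suc a, b)) (Suc a0, b0)
        = (\<Sum>a\<in>{0..p - 2}. if a = a0 then \<Sum>b\<in>{0..p - 1}. if b = b0 then \<chi> a b ((q ^ n) ^ b * k) ((q ^ n * qi ^ 2) ^ b * h) else 0 else 0)"
    proof -
      have "c * delta (Suc a, b) (Suc a0, b0) = (if a = a0 then if b = b0 then c else 0 else 0)" for a b and c :: 'k
        by (auto simp: delta_def)
      moreover have "(\<Sum>b\<in>{0..p - 1}. if a = a0 then f b else 0) = (if a = a0 then \<Sum>b\<in>{0..p - 1}. f b else 0)"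
        for a and f :: "nat \<Rightarrow> 'k" by simp
      ultimately show ?thesis unfolding sum_fun_apply fscale_apply by (simp only:)
    qed
    also have "\<dots> = \<chi> a0 b0 ((q ^ n) ^ b0 * k) ((q ^ n * qi ^ 2) ^ b0 * h)"
      using a0 b0 by (simp only: sum.delta finite_atLeastAtMost) simp
    finally have "\<chi> a0 b0 ((q ^ n) ^ b0 * k) ((q ^ n * qi ^ 2) ^ b0 * h) = 0" unfolding z0 by simp
    moreover have "(q ^ n) ^ b0 * k = wt_k i j" "(q ^ n * qi ^ 2) ^ b0 * h = wt_h i j"
    proof -
      have "(q ^ n * qi ^ 2) * inverse (q ^ n * qi ^ 2) = 1" by (rule right_inverse) simp
      then have "(q ^ n * qi ^ 2) ^ b0 * inverse (q ^ n * qi ^ 2) ^ b0 = 1"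
        by (simp only: power_mult_distrib[symmetric] power_one)
      then show "(q ^ n * qi ^ 2) ^ b0 * h = wt_h i j" unfolding h_def mult.assoc[symmetric] by (simp only: mult_1)
      have "(q ^ n) ^ b0 * (qi ^ n) ^ b0 = 1" by (simp only: power_mult_distrib[symmetric] q_qi power_one)
      then show "(q ^ n) ^ b0 * k = wt_k i j" unfolding k_def mult.assoc[symmetric] by (simp only: mult_1)
    qed
    ultimately show "\<chi> a0 b0 (wt_k i j) (wt_h i j) = 0" by simp
  qed
  then have "pbw_sum U \<cong>\<^sub>A (\<Sum>a\<in>{0..p - 2}. \<Sum>b\<in>{0..p - 1}. gF ^ a * 0 * gE ^ b)"
    unfolding pbw_sum_def by (intro cong_sum cong_multL cong_multR) auto
  then show ?thesis by simp
qed

text \<open>With \<open>wtP_h\<close>, the weight of \<gamma>, which is that of E^(2i-1) \<alpha>.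
  Passing from e to \<alpha> = F^(p-1) e multiplies the eigenvalue of \<kappa> by q^n, as q^(np) =
  1; and q^(-ni), q^n, q^(n(2i-1)) multiply to q^(ni).\<close>

definition wtP_k :: "nat \<Rightarrow> nat \<Rightarrow> 'k" where "wtP_k i j = (- 1) ^ (i + j) * q ^ (n * i)"
definition wtP_h :: "nat \<Rightarrow> nat \<Rightarrow> 'k" where "wtP_h i j = qi ^ (2 * i) * wtP_k i j"

lemma wtP_k_nz [simp]: "wtP_k i j \<noteq> 0" by (simp add: wtP_k_def)

text \<open>K acts on \<gamma> as q^(-2i) = q^(p-2i), which is q^(d-1) for d = p - (2i - 1), the
  dimension of S.\<close>

lemma wtP_quot: "1 \<le> i \<Longrightarrow> 2 * i \<le> p \<Longrightarrow> wtP_h i j / wtP_k i j = q ^ (p - (2 * i - 1) - 1)"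
proof -
  assume i: "1 \<le> i" "2 * i \<le> p"
  have "q ^ (p - 2 * i) * q ^ (2 * i) = 1" using i q_order by (simp flip: power_add)
  then have "q ^ (p - 2 * i) = qi ^ (2 * i)" by (simp add: power_inverse field_simps)
  moreover have "p - (2 * i - 1) - 1 = p - 2 * i" using i by simp
  ultimately show ?thesis by (simp add: wtP_h_def)
qed

text \<open>P is computed inside the induced module V at the weight of e, where \<alpha>, \<beta>,
  \<gamma> become explicit vectors \<open>va\<close>, \<open>vb\<close>, \<open>vg\<close>. The
  homomorphism that they define on the model of P is injective by its values on the kernel of F, and
  \<gamma> generates the model, so the image is A \<gamma>.\<close>

lemma coords_P:
  assumes i: "1 \<le> i" "2 * i \<le> p" and j: "j \<le> 1"
  shows "\<exists>\<Phi>. coords n q (Qu_P n q (2 * i) j) P_basis (P_ops (2 * i - 1) (wtP_k i j) (wtP_h i j)) \<Phi>"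
proof -
  define r where "r = 2 * i - 1"
  have r: "0 < r" "r < p" "2 * i - 2 = r - 1" using i by (auto simp: r_def)
  define d where "d = p - r"
  have d: "d + r = p" "0 < d" using r by (auto simp: d_def)
  define k h where "k = wt_k i j" and "h = wt_h i j"
  have k: "k ^ n = 1" "k \<noteq> 0" and h: "h ^ n * k ^ 2 = 1" by (simp_all add: k_def h_def wt_kn)
  define e where "e = idem (2 * i) j"
  have e: "wvec k h e" unfolding e_def k_def h_def by (rule idem_wvec[OF j])
  let ?T = "V_ops k h"
  have e00: "frep ?T e (delta (0, 0)) = delta (0, 0)"
    unfolding e_def by (rule frep_idem[OF j lin_V_ops]) (use V_delta_weight[of k h 0 0] in \<open>simp add: k_def h_def\<close>)
  note T = qrep_V[OF k(2), of h]
  define va where "va = (delta (p - 1, 0) :: nat \<times> nat \<Rightarrow> 'k)"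
  define vb where "vb = (?T L_E ^^ (r - 1)) va"
  \<comment> \<open>F is the shift of a to a + 1 in V, so \<gamma> is \<beta> shifted back. This
    solves F \<gamma> = \<beta> because \<beta> has no terms with a = 0: each E lowers a by at most
    one, and r - 1 < p - 1 (\<open>supp\<close>).\<close>
  define vg where "vg = (\<lambda>(a, b). if Suc a < p then vb (Suc a, b) else 0)"
  have va: "va \<in> VV" using p_pos by (simp add: va_def n_pos)
  have vb: "vb \<in> VV" unfolding vb_def by (rule funpow_in[OF T va])
  have vg: "vg \<in> VV"
  proof (rule funs_onI)
    fix x assume "x \<notin> V_basis"
    then have "(Suc (fst x), snd x) \<notin> V_basis" by (cases x) auto
    then show "vg x = 0" using funs_onD[OF vb] by (simp add: vg_def case_prod_unfold)
  qed
  have supp: "(?T L_E ^^ l) va (a, b) = 0" if "a + l < p - 1" for l a b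
    using that
  proof (induction l arbitrary: a b)
    case (Suc l)
    then show ?case using Suc.IH[of a "b - 1"] Suc.IH[of "Suc a" b] by (auto simp: V_ops_apply)
  qed (simp add: va_def delta_def)
  \<comment> \<open>In the row of F^(p-1), the vector E^l \<alpha> has its only non-zero entry at b
    = l. This separates \<alpha> from E^r \<alpha> when injectivity is checked.\<close>
  have topE: "(?T L_E ^^ l) va (p - 1, b) = (if b = l then (q ^ (p - 1)) ^ l else 0)" if "l < p" for l b
    using that
  proof (induction l arbitrary: b)
    case (Suc l)
    then show ?case using n_pos by (cases b) (simp_all add: V_ops_apply)
  qed (simp add: va_def delta_def)
  have q1: "(qi ^ n) ^ (p - 1) = q ^ n" "(qi ^ n * q ^ 2) ^ (p - 1) = q ^ n * qi ^ 2"
  proof -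
    have *: "u ^ (p - 1) = v" if "u ^ p = 1" "u * v = 1" for u v :: 'k
    proof -
      have "u ^ (p - 1) * u = 1" using that(1) p_pos by (metis power_minus_mult)
      then show ?thesis using that(2) by (metis mult.assoc mult.commute mult_1)
    qed
    have c: "(x ^ m) ^ p = (x ^ p) ^ m" for x :: 'k and m by (simp only: power_mult[symmetric] mult.commute)
    have qip: "qi ^ p = 1" by (simp add: qi_pow_eq_1)
    show "(qi ^ n) ^ (p - 1) = q ^ n" by (rule *) (simp_all only: c qip power_one q_qi)
    show "(qi ^ n * q ^ 2) ^ (p - 1) = q ^ n * qi ^ 2"
    proof (rule *)
      show "(qi ^ n * q ^ 2) ^ p = 1" unfolding power_mult_distrib c qip q_order by simp
      have "qi ^ n * q ^ 2 * (q ^ n * qi ^ 2) = (q ^ n * qi ^ n) * (q ^ 2 * qi ^ 2)" by (simp only: mult_ac)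
      then show "qi ^ n * q ^ 2 * (q ^ n * qi ^ 2) = 1" by (simp only: q_qi mult_1)
    qed
  qed
  let ?k = "wtP_k i j" and ?h = "wtP_h i j"
  have wk: "(qi ^ n) ^ (p - 1) * k = (qi ^ n) ^ r * ?k" "(qi ^ n * q ^ 2) ^ (p - 1) * h = (qi ^ n * q ^ 2) ^ r * ?h"
  proof -
    obtain i' where i': "i = Suc i'" using i by (cases i) auto
    have r': "r = i' + i" by (simp add: r_def i')
    define u v where "u = q ^ n" and "v = qi ^ n"
    have uv: "u * v = 1" "\<And>m. u ^ m * v ^ m = 1" by (simp_all add: u_def v_def flip: power_mult_distrib)
    have k': "k = (- 1) ^ (i + j) * v ^ i" "?k = (- 1) ^ (i + j) * u ^ i"
      by (simp_all add: k_def wt_k_def wtP_k_def u_def v_def power_mult)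
    have "(qi ^ n) ^ r * ?k = (- 1) ^ (i + j) * v ^ i' * (u ^ i * v ^ i)"
      unfolding v_def[symmetric] r' power_add k' by (simp only: mult_ac)
    also have "\<dots> = (- 1) ^ (i + j) * v ^ i'" by (simp only: uv mult_1_right)
    finally have 1: "(qi ^ n) ^ r * ?k = (- 1) ^ (i + j) * v ^ i'" .
    have "q ^ n * k = (- 1) ^ (i + j) * v ^ i' * (u * v)"
      unfolding u_def[symmetric] k' i' power_Suc by (simp only: mult_ac)
    then have 2: "q ^ n * k = (- 1) ^ (i + j) * v ^ i'" by (simp only: uv mult_1_right)
    show "(qi ^ n) ^ (p - 1) * k = (qi ^ n) ^ r * ?k" unfolding q1 1 2 ..
    have qq: "q ^ 2 * qi ^ 2 = 1" "(q ^ 2) ^ i * (qi ^ 2) ^ i = 1" by (simp_all flip: power_mult_distrib)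
    have hk: "h = q ^ (2 * i) * k" by (simp add: h_def k_def wt_h_def)
    have "(qi ^ n * q ^ 2) ^ (p - 1) * h = (q ^ n * k) * ((q ^ 2) ^ i' * (q ^ 2 * qi ^ 2))"
      unfolding q1 hk power_mult i' power_Suc by (simp only: mult_ac)
    also have "\<dots> = ((qi ^ n) ^ r * ?k) * (q ^ 2) ^ i'" by (simp only: 1 2 qq mult_1_right)
    also have "\<dots> = ((qi ^ n) ^ r * ?k) * ((q ^ 2) ^ i' * ((q ^ 2) ^ i * (qi ^ 2) ^ i))" by (simp only: qq mult_1_right)
    also have "\<dots> = (qi ^ n * q ^ 2) ^ r * ?h"
      unfolding wtP_h_def power_mult_distrib power_mult r' power_add by (simp only: mult_ac)
    finally show "(qi ^ n * q ^ 2) ^ (p - 1) * h = (qi ^ n * q ^ 2) ^ r * ?h" .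
  qed
  have wva: "weight ?T ((qi ^ n) ^ r * ?k) ((qi ^ n * q ^ 2) ^ r * ?h) va"
    using V_delta_weight[of k h 0 "p - 1"] unfolding va_def by (simp only: power_0 mult_1 wk)
  \<comment> \<open>\<gamma> is not produced from \<beta> by generators, so its weight is read off
    entry by entry: the weight of \<beta> determines that of every basis vector which occurs in
    \<gamma>.\<close>
  have wvg: "weight ?T ?k ?h vg"
  proof -
    have cancel: "u ^ (r - 1) * (v ^ r * x) = v * x" if "u * v = 1" for u v x :: 'k
    proof -
      have "u ^ (r - 1) * (v ^ r * x) = (u * v) ^ (r - 1) * (v * x)"
        using r(1) by (cases r) (simp_all add: power_mult_distrib mult_ac)
      then show ?thesis by (simp add: that)
    qed
    have c2: "(q ^ n * qi ^ 2) * (qi ^ n * q ^ 2) = 1"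
    proof -
      have "(q ^ n * qi ^ 2) * (qi ^ n * q ^ 2) = (q ^ n * qi ^ n) * (q ^ 2 * qi ^ 2)" by (simp only: mult_ac)
      then show ?thesis by (simp only: q_qi mult_1)
    qed
    have w: "weight ?T (qi ^ n * ?k) (qi ^ n * q ^ 2 * ?h) vb"
      using weight_E_pow[OF T va wva, of "r - 1"] unfolding vb_def cancel[OF q_qi(3)] cancel[OF c2] .
    have 1: "(q ^ n) ^ b * (qi ^ n) ^ a * k = ?k" "(q ^ n * qi ^ 2) ^ b * (qi ^ n * q ^ 2) ^ a * h = ?h"
      if nz: "vb (Suc a, b) \<noteq> 0" for a b
    proof -
      have "(q ^ n) ^ b * (qi ^ n) ^ Suc a * k * vb (Suc a, b) = qi ^ n * ?k * vb (Suc a, b)"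
        using fun_cong[OF conjunct1[OF w[unfolded weight_def]], of "(Suc a, b)"]
        by (simp only: V_ops_apply fscale_apply)
      then have "qi ^ n * ((q ^ n) ^ b * (qi ^ n) ^ a * k) = qi ^ n * ?k" using nz by (simp add: mult_ac)
      then show "(q ^ n) ^ b * (qi ^ n) ^ a * k = ?k" by simp
      have "(q ^ n * qi ^ 2) ^ b * (qi ^ n * q ^ 2) ^ Suc a * h * vb (Suc a, b) = qi ^ n * q ^ 2 * ?h * vb (Suc a, b)"
        using fun_cong[OF conjunct2[OF w[unfolded weight_def]], of "(Suc a, b)"]
        by (simp only: V_ops_apply fscale_apply)
      then have "(q ^ n * qi ^ 2) ^ b * (qi ^ n * q ^ 2) ^ Suc a * h = qi ^ n * q ^ 2 * ?h" by (rule iffD1[OF mult_right_cancel[OF nz]])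
      then have c3: "qi ^ n * q ^ 2 * ((q ^ n * qi ^ 2) ^ b * (qi ^ n * q ^ 2) ^ a * h) = qi ^ n * q ^ 2 * ?h"
        by (simp only: power_Suc mult_ac)
      have "qi ^ n * q ^ 2 \<noteq> 0" by simp
      from iffD1[OF mult_left_cancel[OF this] c3]
      show "(q ^ n * qi ^ 2) ^ b * (qi ^ n * q ^ 2) ^ a * h = ?h" .
    qed
    show ?thesis
      unfolding weight_def
    proof (intro conjI ext)
      fix x :: "nat \<times> nat" obtain a b where x: "x = (a, b)" by (cases x)
      show "?T L_kap vg x = (?k *\<^sub>f vg) x"
        using 1(1)[of a b] unfolding x V_ops_apply fscale_apply vg_def by (cases "vb (Suc a, b) = 0") simp_all
      show "?T L_hat vg x = (?h *\<^sub>f vg) x"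
        using 1(2)[of a b] unfolding x V_ops_apply fscale_apply vg_def by (cases "vb (Suc a, b) = 0") simp_all
    qed
  qed
  have Fva: "?T L_F va = 0"
    using p_pos n_pos unfolding va_def by (simp add: V_delta)
  have Fvg: "?T L_F vg = vb"
  proof
    fix x :: "nat \<times> nat" obtain a b where x: "x = (a, b)" by (cases x)
    show "?T L_F vg x = vb x"
    proof (cases a)
      case 0
      then show ?thesis using supp[of 0 "r - 1" b] r by (simp add: x V_ops_apply vb_def)
    next
      case (Suc a')
      then show ?thesis using funs_onD[OF vb, of x] by (simp add: x V_ops_apply vg_def)
    qed
  qed
  define \<psi> where "\<psi> = P_hom ?T va vg"
  let ?P = "P_ops r ?k ?h"
  have lin\<psi>: "lin \<psi>" unfolding \<psi>_def by (rule lin_P_hom)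
  have \<psi>V: "\<psi> f \<in> VV" for f unfolding \<psi>_def by (rule P_hom_in[OF T va vg])
  have int: "\<psi> (?P g f) = ?T g (\<psi> f)" for g f
    unfolding \<psi>_def
    by (rule P_hom_intertwine[OF T va wva vg wvg wtP_k_nz r(1) Fva Fvg[unfolded vb_def]
          V_E_nilpotent[OF k(2) va] V_E_nilpotent[OF k(2) vg]])
  have w: "?h / ?k = q ^ (d - 1)" using wtP_quot[OF i, of j] by (simp add: d_def r_def)
  have \<psi>d: "\<psi> (delta (False, l)) = (?T L_E ^^ l) va" "\<psi> (delta (True, l)) = (?T L_E ^^ l) vg" if "l < p" for l
  proof -
    have dsum: "(\<Sum>l'<p. (delta (z, l) (z', l') :: 'k) *\<^sub>f f l') = (if z = z' then f l else 0)"
      for z z' :: bool and f :: "nat \<Rightarrow> nat \<times> nat \<Rightarrow> 'k"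
    proof -
      have "(\<Sum>l'<p. (delta (z, l) (z', l') :: 'k) *\<^sub>f f l') = (\<Sum>l'<p. if l' = l then (if z = z' then f l else 0) else 0)"
        by (intro sum.cong refl) (auto simp: delta_def)
      then show ?thesis using that by simp
    qed
    show "\<psi> (delta (False, l)) = (?T L_E ^^ l) va" "\<psi> (delta (True, l)) = (?T L_E ^^ l) vg"
      unfolding \<psi>_def P_hom_def by (simp_all add: dsum)
  qed
  have inj: "f = 0" if f: "f \<in> funs_on P_basis" "\<psi> f = 0" for f
  proof (rule inj_on_ker_imp_inj[OF lin\<psi> lin_V_ops[of k h L_F], of "funs_on P_basis" "?P L_F" "2 * p"])
    fix g :: "bool \<times> nat \<Rightarrow> 'k" assume g: "g \<in> funs_on P_basis"
    show "?P L_F g \<in> funs_on P_basis" by (rule P_ops_funs_on[OF g])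
    show "\<psi> (?P L_F g) = ?T L_F (\<psi> g)" by (rule int)
    show "(?P L_F ^^ (2 * p)) g = 0" by (rule P_nilpotent[OF g r(2)])
    assume Fg: "?P L_F g = 0" and z: "\<psi> g = 0"
    define a b where "a = g (False, 0)" and "b = g (False, r)"
    have gab: "g = a *\<^sub>f delta (False, 0) + b *\<^sub>f delta (False, r)"
      unfolding a_def b_def by (rule P_kerF[OF g w d r(1) Fg])
    have z': "a *\<^sub>f va + b *\<^sub>f (?T L_E ^^ r) va = 0"
      using z \<psi>d(1)[of 0] \<psi>d(1)[of r] r n_pos unfolding gab lin_add[OF lin\<psi>] lin_scale[OF lin\<psi>] by simp
    have "a = 0"
      using fun_cong[OF z', of "(p - 1, 0)"] topE[of r 0] topE[of 0 0] r n_pos by (simp add: fun_apply)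
    moreover have "b = 0"
      using fun_cong[OF z', of "(p - 1, r)"] topE[of r r] topE[of 0 r] r n_pos by (simp add: fun_apply)
    ultimately show "g = 0" using gab by simp
  qed (use f in auto)
  have E0: "alpha n q (2 * i) j = V_elt e va"
    unfolding va_def alpha_def using p_pos n_pos by (simp add: V_elt_delta e_def idem_def)
  have beta: "beta n q (2 * i) j \<cong>\<^sub>A V_elt e vb"
    using mult_V_elt[OF e k(1) va, of "gE ^ (r - 1)"]
    unfolding beta_def r(3) E0 vb_def
    by (simp add: rep_power[OF monoid_rep_word_act[OF lin_V_ops]] frep_gen[abs_def])
  have Fg: "gF * V_elt e vg \<cong>\<^sub>A V_elt e vb"
    using gen_V_elt[OF e k(1) vg, of L_F] unfolding Fvg .
  have in_space: "cls (V_elt e vg) \<in> gamma_space n q"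
  proof -
    have "\<forall>b. \<exists>U. U \<in> cartan \<and> gE ^ b * e \<cong>\<^sub>A U * gE ^ b"
      using E_pow_cartan[OF idem_cartan] unfolding e_def by blast
    then obtain U where U: "\<And>b. U b \<in> cartan" "\<And>b. gE ^ b * e \<cong>\<^sub>A U b * gE ^ b" by metis
    have rng: "{0..p - 2} \<subseteq> {..<p}" "{..<p} = {0..p - 1}" using p_ge by auto
    have "V_elt e vg = (\<Sum>a\<in>{..<p}. \<Sum>b\<in>{..<p}. const (vg (a, b)) * (gF ^ a * (gE ^ b * e)))"
      unfolding V_elt_def by (simp add: sum.cartesian_product)
    also have "\<dots> = (\<Sum>a\<in>{0..p - 2}. \<Sum>b\<in>{..<p}. const (vg (a, b)) * (gF ^ a * (gE ^ b * e)))"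
    proof (rule sum.mono_neutral_right[OF finite_lessThan rng(1)], intro ballI)
      fix a assume "a \<in> {..<p} - {0..p - 2}"
      then have "\<not> Suc a < p" by auto
      then show "(\<Sum>b\<in>{..<p}. const (vg (a, b)) * (gF ^ a * (gE ^ b * e))) = 0"
        by (simp add: vg_def const_simps)
    qed
    also have "\<dots> = (\<Sum>a\<in>{0..p - 2}. \<Sum>b\<in>{0..p - 1}. const (vg (a, b)) * (gF ^ a * (gE ^ b * e)))"
      unfolding rng(2) ..
    also have "\<dots> \<cong>\<^sub>A (\<Sum>a\<in>{0..p - 2}. \<Sum>b\<in>{0..p - 1}. const (vg (a, b)) * (gF ^ a * (U b * gE ^ b)))"
      by (intro cong_sum cong_multL U)
    also have "\<dots> = pbw_sum (\<lambda>a b. const (vg (a, b)) * U b)"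
      unfolding pbw_sum_def by (intro sum.cong refl) (simp add: const_mult_left[of "gF ^ _"] mult.assoc)
    finally have "cls (V_elt e vg) = cls (pbw_sum (\<lambda>a b. const (vg (a, b)) * U b))" by (simp add: cong_def)
    then show ?thesis
      unfolding gamma_space_eq using U(1) by (auto intro!: cartan.intros)
  qed
  have gamma: "gamma n q (2 * i) j = cls (V_elt e vg)"
    unfolding gamma_def
  proof (rule the_equality)
    show "cls (V_elt e vg) \<in> gamma_space n q \<and>
        cls gF \<otimes>\<^bsub>Qu n q\<^esub> cls (V_elt e vg) = cls (beta n q (2 * i) j)"
      using in_space cong_trans[OF Fg cong_sym[OF beta]] by (simp add: cls_ring cong_def)
    fix x assume x: "x \<in> gamma_space n q \<and> cls gF \<otimes>\<^bsub>Qu n q\<^esub> x = cls (beta n q (2 * i) j)"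
    obtain U where U: "\<And>a b. U a b \<in> cartan" "x = cls (pbw_sum U)" using x unfolding gamma_space_eq by blast
    obtain U' where U': "\<And>a b. U' a b \<in> cartan" "cls (V_elt e vg) = cls (pbw_sum U')"
      using in_space unfolding gamma_space_eq by blast
    \<comment> \<open>The difference of two solutions is again a normal form and is annihilated by
      F, hence 0 by \<open>F_pbw_inj\<close>.\<close>
    define D where "D = (\<lambda>a b. U a b - U' a b)"
    have D: "pbw_sum D = pbw_sum U - pbw_sum U'"
      by (simp add: pbw_sum_def D_def right_diff_distrib left_diff_distrib sum_subtractf)
    have "gF * pbw_sum U \<cong>\<^sub>A beta n q (2 * i) j" using x U by (simp add: cls_ring cong_def)
    moreover have "gF * pbw_sum U' \<cong>\<^sub>A beta n q (2 * i) j"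
      using cong_trans[OF Fg cong_sym[OF beta]] cong_multL[of "pbw_sum U'" "V_elt e vg" gF] U'(2)
      by (simp add: cong_def)
    ultimately have "gF * pbw_sum U \<cong>\<^sub>A gF * pbw_sum U'" using cong_trans cong_sym by blast
    then have "gF * pbw_sum D \<cong>\<^sub>A 0" unfolding D right_diff_distrib by (simp add: cong_iff)
    then have "pbw_sum D \<cong>\<^sub>A 0"
      by (intro F_pbw_inj) (auto simp: D_def intro: cartan_closed U(1) U'(1))
    then have "cls (pbw_sum U) = cls (pbw_sum U')" by (simp add: D cong_iff Qu_cls_eq_iff)
    then show "x = cls (V_elt e vg)" using U(2) U'(2) by (simp only:)
  qed
  define \<Phi> where "\<Phi> = (\<lambda>f. cls (V_elt e (\<psi> f)))"
  have \<Phi>rep: "\<Phi> (frep ?P x f) = cls x \<otimes>\<^bsub>Qu n q\<^esub> \<Phi> f" for x f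
  proof -
    have "\<psi> (frep ?P x f) = frep ?T x (\<psi> f)"
      by (rule frep_intertwine[OF lin\<psi>, of UNIV]) (simp_all add: int)
    then show ?thesis
      using mult_V_elt[OF e k(1) \<psi>V, of x f] by (simp add: \<Phi>_def cls_ring cong_def)
  qed
  have \<psi>g: "\<psi> (delta (True, 0)) = vg" using \<psi>d(2)[of 0] p_pos n_pos by simp
  \<comment> \<open>From \<gamma> one reaches E^(r-1) \<alpha> by F, then \<alpha> by r - 1 further
    steps, with non-zero coefficients as they stay below E^r \<alpha>; powers of E give both
    strings.\<close>
  have cyc: "\<exists>x. frep ?P x (delta (True, 0)) = f" if f: "f \<in> funs_on P_basis" for f
  proof -
    have mP: "monoid_rep (word_act ?P)" by (rule monoid_rep_word_act[OF lin_P_ops])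
    define U where "U = range (\<lambda>x. frep ?P x (delta (True, 0)))"
    have U: "invariant_space ?P U"
      unfolding invariant_space_def U_def
    proof (intro conjI ballI allI)
      show "0 \<in> range (\<lambda>x. frep ?P x (delta (True, 0)))" by (rule image_eqI[of _ _ 0]) simp_all
      fix f assume "f \<in> range (\<lambda>x. frep ?P x (delta (True, 0)))"
      then obtain x where x: "f = frep ?P x (delta (True, 0))" by blast
      show "c *\<^sub>f f \<in> range (\<lambda>x. frep ?P x (delta (True, 0)))" for c
        by (rule image_eqI[of _ _ "const c * x"]) (simp_all add: x rep_mult[OF mP] rep_const[OF mP])
      show "?P g f \<in> range (\<lambda>x. frep ?P x (delta (True, 0)))" for g
        by (rule image_eqI[of _ _ "gen g * x"]) (simp_all add: x rep_mult[OF mP] frep_gen)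
      fix f' assume "f' \<in> range (\<lambda>x. frep ?P x (delta (True, 0)))"
      then obtain x' where x': "f' = frep ?P x' (delta (True, 0))" by blast
      show "f + f' \<in> range (\<lambda>x. frep ?P x (delta (True, 0)))"
        by (rule image_eqI[of _ _ "x + x'"]) (simp_all add: x x' rep_add)
    qed
    have g0: "delta (True, 0) \<in> U" unfolding U_def by (rule image_eqI[of _ _ 1]) (simp_all add: rep_one[OF mP])
    have "?P L_F (delta (True, 0)) = delta (False, r - 1)"
    proof
      fix x :: "bool \<times> nat" obtain z l where "x = (z, l)" by (cases x)
      then show "?P L_F (delta (True, 0)) x = delta (False, r - 1) x"
        using r by (auto simp: P_ops_apply delta_def)
    qed
    then have "delta (False, r - 1) \<in> U" using invariant_spaceD(4)[OF U g0, of L_F] by simp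
    moreover have "\<exists>c. c \<noteq> 0 \<and> (?P L_F ^^ (r - 1)) (delta (False, r - 1)) = c *\<^sub>f delta (False, r - 1 - (r - 1))"
      by (rule F_pow_delta[OF w d r(1)]) (use r in auto)
    then obtain c where c: "c \<noteq> 0" "(?P L_F ^^ (r - 1)) (delta (False, r - 1)) = c *\<^sub>f delta (False, 0)" by auto
    ultimately have "c *\<^sub>f delta (False, 0) \<in> U"
      using invariant_spaceD(5)[OF U, where g' = L_F and m = "r - 1"] by metis
    then have a0: "delta (False, 0) \<in> U" by (rule invariant_spaceD(6)[OF U c(1)])
    have "delta (z, l) \<in> U" if "l < p" for z l
      using invariant_spaceD(5)[OF U a0, where g' = L_E and m = l] invariant_spaceD(5)[OF U g0, where g' = L_E and m = l] that
      by (cases z) (simp_all add: funpow_E_P_ops)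
    then have "(\<Sum>b\<in>P_basis. f b *\<^sub>f delta b) \<in> U"
      by (intro invariant_spaceD(7)[OF U] invariant_spaceD(3)[OF U]) auto
    moreover have "f = (\<Sum>b\<in>P_basis. f b *\<^sub>f delta b)" by (rule delta_expansion[OF _ f]) simp
    ultimately have "f \<in> U" by simp
    then show ?thesis unfolding U_def by auto
  qed
  have g_in: "delta (True, 0) \<in> funs_on P_basis" using n_pos by simp
  have car: "carrier (Qu_P n q (2 * i) j) = \<Phi> ` funs_on P_basis"
  proof -
    have "carrier (Qu_P n q (2 * i) j) = {a \<otimes>\<^bsub>Qu n q\<^esub> gamma n q (2 * i) j | a. a \<in> carrier (Qu n q)}"
      by (simp add: Qu_P_def)
    also have "\<dots> = range (\<lambda>x. cls x \<otimes>\<^bsub>Qu n q\<^esub> \<Phi> (delta (True, 0)))"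
      unfolding gamma \<Phi>_def \<psi>g carrier_Qu by blast
    also have "\<dots> = range (\<lambda>x. \<Phi> (frep ?P x (delta (True, 0))))" unfolding \<Phi>rep ..
    also have "\<dots> = \<Phi> ` range (\<lambda>x. frep ?P x (delta (True, 0)))" by blast
    also have "range (\<lambda>x. frep ?P x (delta (True, 0))) = funs_on P_basis"
    proof (intro equalityI subsetI)
      fix f assume "f \<in> range (\<lambda>x. frep ?P x (delta (True, 0)))"
      then obtain x where "f = frep ?P x (delta (True, 0))" by blast
      moreover have "frep ?P x (delta (True, 0)) \<in> funs_on P_basis"
        by (rule frep_funs_on[OF _ g_in]) (rule P_ops_funs_on)
      ultimately show "f \<in> funs_on P_basis" by simp
    next
      fix f :: "bool \<times> nat \<Rightarrow> 'k" assume "f \<in> funs_on P_basis"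
      from cyc[OF this] show "f \<in> range (\<lambda>x. frep ?P x (delta (True, 0)))" by blast
    qed
    finally show ?thesis .
  qed
  have "inj_on \<Phi> (funs_on P_basis)"
  proof (rule inj_onI)
    fix f g assume fg: "f \<in> funs_on P_basis" "g \<in> funs_on P_basis" "\<Phi> f = \<Phi> g"
    have "V_elt e (\<psi> (f - g)) \<cong>\<^sub>A 0"
      using fg(3) unfolding \<Phi>_def lin_diff[OF lin\<psi>] V_elt_minus by (simp add: cong_iff Qu_cls_eq_iff)
    then have "\<psi> (f - g) = 0" by (rule V_elt_inj[OF k(1) h e00 \<psi>V])
    then show "f = g" using inj[of "f - g"] fg by simp
  qed
  then have "coords n q (Qu_P n q (2 * i) j) P_basis ?P \<Phi>"
    unfolding coords_def bij_betw_def car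
    using \<Phi>rep lin_P_ops P_ops_funs_on
    by (auto simp: Qu_P_def left_regular_def \<Phi>_def lin_0[OF lin\<psi>] Qu_zero lin_add[OF lin\<psi>] V_elt_add cls_ring)
  then show ?thesis unfolding r_def by blast
qed

lemma coords_S:
  assumes i: "1 \<le> i" "2 * i \<le> p" and j: "j \<le> 1"
  shows "\<exists>\<Phi>. coords n q (Qu_S n q (2 * i) j) {..<p - (2 * i - 1)} (S_ops (p - (2 * i - 1)) (wtP_k i j) (wtP_h i j)) \<Phi>"
proof -
  obtain \<Phi> where P: "coords n q (Qu_P n q (2 * i) j) P_basis (P_ops (2 * i - 1) (wtP_k i j) (wtP_h i j)) \<Phi>"
    using coords_P[OF assms] by blast
  have "p - (2 * i - 1) + (2 * i - 1) = p" "0 < p - (2 * i - 1)" "0 < 2 * i - 1" using i by auto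
  from coords_socle[OF P wtP_quot[OF i] this] show ?thesis unfolding Qu_S_def by blast
qed

end

section \<open>The tensor product of two simple modules\<close>

context root_order begin

text \<open>-1 = q^(p/2) is the power (q^n)^(n/2), so \<kappa> acts on a simple module by powers of
  q^n alone. In this form the idempotents \<open>idem1\<close>, hence \<open>flat\<close>, can be
  evaluated.\<close>

lemma wtP_k_pow: "wtP_k i j = (q ^ n) ^ (i + n div 2 * (i + j))"
proof -
  have "(q ^ n) ^ (n div 2 * (i + j)) = (q ^ half_p) ^ (i + j)" by (simp add: mult_ac flip: power_mult)
  also have "q ^ half_p = - 1" unfolding half_p(1) by (rule q_pow_half)
  finally have H: "(q ^ n) ^ (n div 2 * (i + j)) = (- 1) ^ (i + j)" .
  show ?thesis unfolding wtP_k_def power_add[of "q ^ n" i] H unfolding power_mult by (rule mult.commute)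
qed

lemma frep_diag:
  assumes "\<And>f b. T L_kap f b = c b * f b" "\<And>g. lin (T g)"
  shows "frep T (kap ^ r) f b = c b ^ r * f b"
proof -
  have "(T L_kap ^^ r) f b = c b ^ r * f b" by (induction r arbitrary: b) (simp_all add: assms(1))
  moreover have "frep T kap = T L_kap" by (simp add: fun_eq_iff frep_gen)
  ultimately show ?thesis by (simp add: rep_power[OF monoid_rep_word_act[of T, OF assms(2)]])
qed

text \<open>\<open>idem1 n q c\<close> projects onto the eigenspace of \<kappa> for (q^n)^c: the sum
  over r is geometric with ratio q^(n(e - c)), an n-th root of unity.\<close>

lemma frep_idem1:
  assumes T: "\<And>f b. T L_kap f b = (q ^ n) ^ e b * f b" "\<And>g. lin (T g)" and c: "c < n"
  shows "frep T (idem1 n q c) f b = (if e b mod n = c then f b else 0)"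
proof -
  note m = monoid_rep_word_act[of T, OF T(2)]
  have range: "{0..n - 1} = {..<n}" using n_pos by auto
  let ?x = "(q ^ n) ^ (n - c + e b)"
  have "frep T (idem1 n q c) f b = 1 / of_nat n * (\<Sum>r<n. ?x ^ r) * f b"
    unfolding idem1_def range
    by (simp add: rep_mult[OF m] rep_const[OF m] rep_sum fun_apply frep_diag[of T "\<lambda>b. (q ^ n) ^ e b", OF T]
        sum_distrib_right power_add power_mult_distrib mult.assoc)
  also have "(\<Sum>r<n. ?x ^ r) = (if e b mod n = c then of_nat n else 0)"
  proof -
    have "?x = 1 \<longleftrightarrow> p dvd n * (n - c + e b)" by (simp only: power_mult[symmetric] q_pow_eq_1)
    also have "\<dots> \<longleftrightarrow> n dvd (n - c + e b)" using n_pos by (simp add: power2_eq_square)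
    also have "\<dots> \<longleftrightarrow> e b mod n = c"
    proof -
      have "n dvd (n - c + e b) \<longleftrightarrow> (int n dvd int (e b) - int c)"
      proof -
        have "int (n - c + e b) = (int (e b) - int c) + int n" using c by simp
        then show ?thesis by (metis dvd_add_right_iff dvd_refl int_dvd_int_iff add.commute)
      qed
      also have "\<dots> \<longleftrightarrow> int (e b) mod int n = int c mod int n" by (simp add: mod_eq_dvd_iff)
      also have "\<dots> \<longleftrightarrow> e b mod n = c mod n" by (metis of_nat_eq_iff zmod_int)
      finally show ?thesis using c by simp
    qed
    finally have x1: "?x = 1 \<longleftrightarrow> e b mod n = c" .
    have "?x ^ n = (q ^ p) ^ (n - c + e b)" unfolding power_mult[symmetric] by (simp add: power2_eq_square mult_ac)
    then have "?x ^ n = 1" by (simp add: q_order)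
    then have "(1 - ?x) * (\<Sum>r<n. ?x ^ r) = 0" by (simp add: one_diff_power_eq[symmetric] del: power_add)
    then show ?thesis using x1 by (cases "?x = 1") auto
  qed
  also have "1 / of_nat n * (if e b mod n = c then of_nat n else 0) * f b = (if e b mod n = c then f b else 0)"
    using n_pos by simp
  finally show ?thesis .
qed

lemma frep_flat:
  assumes T: "\<And>f b. T L_kap f b = (q ^ n) ^ e b * f b" "\<And>g. lin (T g)"
  shows "frep T (flat n q) f b = qi ^ (e b mod n) * f b" "frep T (flat_inv n q) f b = q ^ (e b mod n) * f b"
proof -
  note m = monoid_rep_word_act[of T, OF T(2)]
  have *: "frep T (\<Sum>i = 0..n - 1. const (u i) * idem1 n q i) f b = u (e b mod n) * f b" for u
  proof -
    have "frep T (\<Sum>i = 0..n - 1. const (u i) * idem1 n q i) f b =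
        (\<Sum>i = 0..n - 1. u i * (if e b mod n = i then f b else 0))"
      unfolding rep_sum sum_fun_apply
      by (intro sum.cong refl) (use n_pos in \<open>auto simp: rep_mult[OF m] rep_const[OF m] fun_apply frep_idem1[of T e, OF T]\<close>)
    also have "\<dots> = (\<Sum>i = 0..n - 1. if e b mod n = i then u i * f b else 0)" by (intro sum.cong) auto
    also have "\<dots> = u (e b mod n) * f b"
    proof -
      have "e b mod n \<le> n - 1" using mod_less_divisor[OF n_pos, of "e b"] by linarith
      then show ?thesis by simp
    qed
    finally show ?thesis .
  qed
  show "frep T (flat n q) f b = qi ^ (e b mod n) * f b" unfolding flat_def * by (simp add: power_inverse)
  show "frep T (flat_inv n q) f b = q ^ (e b mod n) * f b" unfolding flat_inv_def * ..
qed

lemma S_ops_commute: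
  "act_fst (S_ops d1 k1 h1 g) (act_snd (S_ops d2 k2 h2 g') f) = act_snd (S_ops d2 k2 h2 g') (act_fst (S_ops d1 k1 h1 g) f)"
  by (cases g; cases g') (auto simp: act_fst_def act_snd_def S_ops_def fun_eq_iff mult_ac)

definition level :: "nat \<Rightarrow> (nat \<times> nat \<Rightarrow> 'k) \<Rightarrow> bool" where
  "level u f \<longleftrightarrow> (\<forall>a b. a + b \<noteq> u \<longrightarrow> f (a, b) = 0)"

end

locale simple_tensor = root_order n q for n and q :: "'k::field_char_0" +
  fixes i1 j1 i2 j2 :: nat
  assumes i1: "1 \<le> i1" "2 * i1 \<le> n ^ 2" and i2: "1 \<le> i2" "2 * i2 \<le> n ^ 2" and j1: "j1 \<le> 1" and j2: "j2 \<le> 1"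
begin

definition "d1 = p - (2 * i1 - 1)"
definition "d2 = p - (2 * i2 - 1)"
abbreviation "k1 \<equiv> wtP_k i1 j1"
abbreviation "k2 \<equiv> wtP_k i2 j2"
abbreviation "h1 \<equiv> wtP_h i1 j1"
abbreviation "h2 \<equiv> wtP_h i2 j2"
abbreviation "T1 \<equiv> S_ops d1 k1 h1"
abbreviation "T2 \<equiv> S_ops d2 k2 h2"
abbreviation "T \<equiv> tensor_ops n q T1 T2"
abbreviation "B \<equiv> {..<d1} \<times> {..<d2}"
abbreviation "VW \<equiv> funs_on B :: (nat \<times> nat \<Rightarrow> 'k) set"

lemma d_bounds: "0 < d1" "d1 < p" "0 < d2" "d2 < p"
  using i1 i2 p_ge by (auto simp: d1_def d2_def)

text \<open>On the \<open>b\<close>-th vector of the second factor the idempotent \<open>1\<^sub>c\<close> is \<open>1\<close> for \<open>c = kb b\<close> and \<open>0\<close> otherwise.\<close>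

definition kb :: "nat \<Rightarrow> nat" where "kb b = (b + (i2 + n div 2 * (i2 + j2))) mod n"
definition ka :: "nat \<Rightarrow> 'k" where "ka a = (q ^ n) ^ a * k1"
definition ha :: "nat \<Rightarrow> 'k" where "ha a = (q ^ n * qi ^ 2) ^ a * h1"
definition lo1 :: "nat \<Rightarrow> 'k" where "lo1 a = lowering a (h1 / k1)"
definition lo2 :: "nat \<Rightarrow> 'k" where "lo2 a = lowering a (h2 / k2)"

lemma ka_nz [simp]: "ka a \<noteq> 0" by (simp add: ka_def)

lemma ka_n: "ka a ^ n = 1"
proof -
  have "ka a = (q ^ n) ^ (a + (i1 + n div 2 * (i1 + j1)))" unfolding ka_def wtP_k_pow power_add ..
  then have "ka a ^ n = (q ^ p) ^ (a + (i1 + n div 2 * (i1 + j1)))"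
    by (simp only: power_mult[symmetric] power2_eq_square mult_ac)
  then show ?thesis by (simp add: q_order)
qed

lemma ka_inv: "ka a ^ (n - 1) = inverse (ka a)"
proof -
  have "ka a ^ (n - 1) * ka a = 1" using ka_n n_pos by (metis power_minus_mult)
  then show ?thesis by (simp add: field_simps)
qed

lemma kb_Suc: "kb (Suc b) = (if kb b = n - 1 then 0 else Suc (kb b))"
proof -
  have "Suc x = n \<longleftrightarrow> x = n - 1" for x using n_pos by auto
  then show ?thesis by (simp only: kb_def add_Suc mod_Suc)
qed

lemma kb_less: "kb b < n" unfolding kb_def using n_pos by simp

lemma T2_kap: "T2 L_kap f b = (q ^ n) ^ (b + (i2 + n div 2 * (i2 + j2))) * f b"
  unfolding S_ops_apply wtP_k_pow power_add by (simp only: mult_ac)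

lemmas T2_idem1 = frep_idem1[of T2 "\<lambda>b. b + (i2 + n div 2 * (i2 + j2))", OF T2_kap lin_S_ops, folded kb_def]
  and T2_flat = frep_flat[of T2 "\<lambda>b. b + (i2 + n div 2 * (i2 + j2))", OF T2_kap lin_S_ops, folded kb_def]

lemma mon: "monoid_rep (word_act T1)" "monoid_rep (word_act T2)"
  by (rule monoid_rep_word_act[OF lin_S_ops])+

lemma tensor_S: "\<exists>\<Phi>1 \<Phi>2. tensor_coords n q (Qu_S n q (2 * i1) j1) (Qu_S n q (2 * i2) j2) {..<d1} {..<d2} T1 T2 \<Phi>1 \<Phi>2"
proof -
  obtain \<Phi>1 \<Phi>2 where "coords n q (Qu_S n q (2 * i1) j1) {..<d1} T1 \<Phi>1" "coords n q (Qu_S n q (2 * i2) j2) {..<d2} T2 \<Phi>2"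
    unfolding d1_def d2_def using coords_S[OF i1 j1] coords_S[OF i2 j2] by blast
  then have "tensor_coords n q (Qu_S n q (2 * i1) j1) (Qu_S n q (2 * i2) j2) {..<d1} {..<d2} T1 T2 \<Phi>1 \<Phi>2"
    by unfold_locales (simp_all add: S_ops_commute)
  then show ?thesis by blast
qed

lemma rep_tens: "rep (pair_act T1 T2) (x \<otimes>\<^sub>k y) f = act_fst (frep T1 x) (act_snd (frep T2 y) f)"
  using tensor_S tensor_coords.rep2_tens by blast

lemma T_V: "f \<in> VW \<Longrightarrow> T g f \<in> VW"
  unfolding tensor_ops_def using tensor_S tensor_coords.rep2_V by blast

lemma lin_T: "lin (T g)"
proof -
  have "monoid_rep (pair_act T1 T2)" using tensor_S tensor_coords.monoid_rep_pair_act by blast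
  then show ?thesis unfolding tensor_ops_def by (intro lin_rep) (unfold monoid_rep_def, blast)
qed

lemma frep1: "frep T1 (gen g) = T1 g" "frep T2 (gen g) = T2 g" "frep T1 1 f = f"
  "frep T1 (kap_inv n) f a = inverse (ka a) * f a"
  using frep_diag[of T1 "\<lambda>a. ka a", OF _ lin_S_ops, of "n - 1"]
  by (simp_all add: fun_eq_iff frep_gen rep_one[OF mon(1)] S_ops_apply ka_def kap_inv_def ka_inv[unfolded ka_def, simplified])

text \<open>\<Delta> in coordinates, with the idempotents evaluated in the second factor.
  \<open>flat\<close> and its inverse give powers of q with exponents \<open>kb b\<close> up to
  sign, and the exceptional coefficients appear where the residue \<open>kb\<close> wraps around
  between n - 1 and 0.\<close>

lemma T_apply:
  "T L_kap f (a, b) = (ka a * ((q ^ n) ^ b * k2)) * f (a, b)"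
  "T L_hat f (a, b) = (ha a * ((q ^ n * qi ^ 2) ^ b * h2)) * f (a, b)"
  "T L_E f (a, b) = (if 0 < a \<and> a < d1 then q ^ kb b * f (a - 1, b) else 0)
     + (if 0 < b \<and> b < d2 then (if kb b = 0 then inverse (ka a) else 1) * f (a, b - 1) else 0)"
  "T L_F f (a, b) = (if Suc a < d1 then lo1 (Suc a) * (qi ^ kb b * f (Suc a, b)) else 0)
     + (if Suc b < d2 then (if kb (Suc b) = 0 then ha a else ha a / ka a) * (lo2 (Suc b) * f (a, Suc b)) else 0)"
proof -
  show "T L_kap f (a, b) = (ka a * ((q ^ n) ^ b * k2)) * f (a, b)"
    by (simp add: tensor_ops_def rep_tens frep1 act_fst_def act_snd_def S_ops_apply ka_def)
  show "T L_hat f (a, b) = (ha a * ((q ^ n * qi ^ 2) ^ b * h2)) * f (a, b)"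
    by (simp add: tensor_ops_def rep_tens frep1 act_fst_def act_snd_def S_ops_apply ha_def)
  \<comment> \<open>The idempotent stands to the left of E but to the right of F, so it is evaluated
    at the target index b for E and at the source index Suc b for F.\<close>
  have E0: "frep T2 (idem1 n q c * gE) g b = (if kb b = c then T2 L_E g b else 0)" if "c < n" for c g b
    by (simp add: rep_mult[OF mon(2)] frep1 T2_idem1[OF that])
  have F0: "frep T2 (gF * idem1 n q c) g b = (if kb (Suc b) = c then T2 L_F g b else 0)" if "c < n" for c g b
    by (simp add: rep_mult[OF mon(2)] frep1 S_ops_apply T2_idem1[OF that])
  have sum1: "(\<Sum>i = 1..n - 1. if kb b = i then x else 0) = (if kb b = 0 then 0 else x)" for b and x :: 'k
    using kb_less[of b] by simp
  have E1: "frep T2 (\<Sum>i = 1..n - 1. idem1 n q i * gE) g b = (if kb b = 0 then 0 else T2 L_E g b)" for g b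
  proof -
    have "frep T2 (\<Sum>i = 1..n - 1. idem1 n q i * gE) g b = (\<Sum>i = 1..n - 1. if kb b = i then T2 L_E g b else 0)"
      unfolding rep_sum sum_fun_apply by (intro sum.cong refl E0) (use n_pos in auto)
    then show ?thesis unfolding sum1 .
  qed
  have F1: "frep T2 (gF * (\<Sum>i = 1..n - 1. idem1 n q i)) g b = (if kb (Suc b) = 0 then 0 else T2 L_F g b)" for g b
  proof -
    have "frep T2 (gF * (\<Sum>i = 1..n - 1. idem1 n q i)) g b = (\<Sum>i = 1..n - 1. if kb (Suc b) = i then T2 L_F g b else 0)"
      unfolding sum_distrib_left rep_sum sum_fun_apply by (intro sum.cong refl F0) (use n_pos in auto)
    then show ?thesis unfolding sum1 .
  qed
  show "T L_E f (a, b) = (if 0 < a \<and> a < d1 then q ^ kb b * f (a - 1, b) else 0)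
     + (if 0 < b \<and> b < d2 then (if kb b = 0 then inverse (ka a) else 1) * f (a, b - 1) else 0)"
    unfolding tensor_ops_def comult_gen.simps rep_add rep_tens plus_fun_apply act_fst_def act_snd_def prod.case
    by (simp only: frep1 T2_flat E1 E0[OF n_pos]) (simp add: S_ops_apply)
  have KH: "frep T1 (kap_inv n * hat) g a = (ha a / ka a) * g a" for g a
    by (simp add: rep_mult[OF mon(1)] frep1 S_ops_apply ha_def divide_inverse mult_ac)
  show "T L_F f (a, b) = (if Suc a < d1 then lo1 (Suc a) * (qi ^ kb b * f (Suc a, b)) else 0)
     + (if Suc b < d2 then (if kb (Suc b) = 0 then ha a else ha a / ka a) * (lo2 (Suc b) * f (a, Suc b)) else 0)"
    unfolding tensor_ops_def comult_gen.simps rep_add rep_tens plus_fun_apply act_fst_def act_snd_def prod.case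
    by (simp only: frep1 T2_flat KH F1 F0[OF n_pos]) (simp add: S_ops_apply ha_def lo1_def lo2_def)
qed

lemma ka_Suc: "ka (Suc a) = q ^ n * ka a" "ha (Suc a) = q ^ n * qi ^ 2 * ha a"
  by (simp_all add: ka_def ha_def mult.assoc)

lemma ka_quot: "ha a / ka a = qi ^ (2 * a) * (h1 / k1)"
  by (simp add: ka_def ha_def power_mult_distrib power_mult)

lemma lo_ends: "lo1 0 = 0" "lo1 d1 = 0" "lo2 0 = 0" "lo2 d2 = 0"
  using lowering_zero[OF d_bounds(1)] lowering_zero[OF d_bounds(3)]
  by (simp_all add: lo1_def lo2_def wtP_quot[OF i1] wtP_quot[OF i2] d1_def d2_def)

lemma lo_nz: "0 < a \<Longrightarrow> a < d1 \<Longrightarrow> lo1 a \<noteq> 0" "0 < a \<Longrightarrow> a < d2 \<Longrightarrow> lo2 a \<noteq> 0"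
  using lowering_nz[of a d1] lowering_nz[of a d2] d_bounds
  by (simp_all add: lo1_def lo2_def wtP_quot[OF i1] wtP_quot[OF i2] d1_def d2_def)

lemma lo_Suc: "lo1 (Suc a) = qi * lo1 a + (1 - ha a / ka a)"
  "lo2 (Suc b) = qi * lo2 b + (1 - qi ^ (2 * b) * (h2 / k2))"
  unfolding lo1_def lo2_def lowering_Suc ka_quot by (simp_all only: mult.commute)

text \<open>Cross terms, with E and F acting on different factors, agree after multiplication by
  q^(-1). The diagonal terms differ by (1 - K1) + K1 (1 - K2) = 1 - K1 K2, where K1 and K2 are the
  values of K on the two factors.\<close>

lemma FE_T:
  assumes f: "f \<in> VW"
  shows "T L_F (T L_E f) (a, b) = qi * T L_E (T L_F f) (a, b) + (1 - (ha a / ka a) * (qi ^ (2 * b) * (h2 / k2))) * f (a, b)"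
proof (cases "a < d1 \<and> b < d2")
  case False
  then have "(a, b) \<notin> B" by auto
  then have "f (a, b) = 0" "T L_F (T L_E f) (a, b) = 0" "T L_E (T L_F f) (a, b) = 0"
    using f by (auto intro!: funs_onD[of _ B] T_V)
  then show ?thesis by simp
next
  case True
  define eps where "eps = (\<lambda>a b. if kb b = 0 then inverse (ka a) else 1)"
  define phi where "phi = (\<lambda>a b. if kb b = 0 then ha a else ha a / ka a)"
  define K where "K = ha a / ka a"
  have Tef: "T L_E f (a, b) = (if 0 < a \<and> a < d1 then q ^ kb b * f (a - 1, b) else 0)
     + (if 0 < b \<and> b < d2 then eps a b * f (a, b - 1) else 0)"
    "T L_F f (a, b) = (if Suc a < d1 then lo1 (Suc a) * (qi ^ kb b * f (Suc a, b)) else 0)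
     + (if Suc b < d2 then phi a (Suc b) * (lo2 (Suc b) * f (a, Suc b)) else 0)" for f a b
    unfolding T_apply eps_def phi_def by simp_all
  have ep: "phi a b * eps a b = K" for b by (simp add: eps_def phi_def K_def divide_inverse)
  have AA: "q ^ m * qi ^ m = 1" "qi ^ m * q ^ m = 1" for m by simp_all
  define XX where "XX = (if Suc a < d1 \<and> 0 < b then lo1 (Suc a) * (qi ^ kb b * eps (Suc a) b) * f (Suc a, b - 1) else 0)"
  define YY where "YY = (if Suc b < d2 \<and> 0 < a then lo2 (Suc b) * (phi a (Suc b) * q ^ kb (Suc b)) * f (a - 1, Suc b) else 0)"
  \<comment> \<open>Where \<open>kb b\<close> = 0, the exponent of q^(-1) drops from n - 1 at b - 1
    to 0 at b; the factor q^(-n) by which the inverse of \<open>ka\<close> changes from a to a + 1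
    makes up for it.\<close>
  have XX': "XX = (if Suc a < d1 \<and> 0 < b then qi * (lo1 (Suc a) * (eps a b * qi ^ kb (b - 1)) * f (Suc a, b - 1)) else 0)"
  proof (cases "Suc a < d1 \<and> 0 < b")
    case True
    then obtain b' where b': "b = Suc b'" by (cases b) auto
    obtain n' where n': "n = Suc n'" using n_pos by (cases n) auto
    have "qi ^ kb b * eps (Suc a) b = qi * (eps a b * qi ^ kb (b - 1))"
      unfolding b' eps_def kb_Suc ka_Suc using n' by (simp add: power_inverse mult_ac)
    then have "lo1 (Suc a) * (qi ^ kb b * eps (Suc a) b) * f (Suc a, b - 1) =
        qi * (lo1 (Suc a) * (eps a b * qi ^ kb (b - 1)) * f (Suc a, b - 1))" by (simp only: mult_ac)
    then show ?thesis unfolding XX_def using True by simp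
  qed (auto simp: XX_def)
  have YY': "YY = (if Suc b < d2 \<and> 0 < a then qi * (lo2 (Suc b) * (q ^ kb b * phi (a - 1) (Suc b)) * f (a - 1, Suc b)) else 0)"
  proof (cases "Suc b < d2 \<and> 0 < a")
    case True
    then obtain a' where a': "a = Suc a'" by (cases a) auto
    obtain n' where n': "n = Suc n'" using n_pos by (cases n) auto
    have "phi a (Suc b) * q ^ kb (Suc b) = qi * (q ^ kb b * phi (a - 1) (Suc b))"
    proof (cases "kb b = n - 1")
      case True
      have "q ^ n * qi ^ 2 = qi * q ^ (n - 1)" unfolding n' by (simp add: power2_eq_square)
      then show ?thesis unfolding a' phi_def kb_Suc ka_Suc using True by simp
    next
      case False
      have "phi a (Suc b) = qi ^ 2 * (ha a' / ka a')" "phi (a - 1) (Suc b) = ha a' / ka a'" "q ^ kb (Suc b) = q * q ^ kb b"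
        unfolding a' phi_def kb_Suc ka_Suc using False by simp_all
      moreover have "qi ^ 2 * x * (q * y) = qi * (y * x)" for x y :: 'k
      proof -
        have "qi ^ 2 * x * (q * y) = q * qi * (qi * (y * x))" by (simp only: power2_eq_square mult_ac)
        then show ?thesis by (simp only: q_qi mult_1)
      qed
      ultimately show ?thesis by (simp only:)
    qed
    then have "lo2 (Suc b) * (phi a (Suc b) * q ^ kb (Suc b)) * f (a - 1, Suc b) =
        qi * (lo2 (Suc b) * (q ^ kb b * phi (a - 1) (Suc b)) * f (a - 1, Suc b))" by (simp only: mult_ac)
    then show ?thesis unfolding YY_def using True by simp
  qed (auto simp: YY_def)
  \<comment> \<open>At the border Suc a = d1 the truncation of the model is invisible, because
    \<open>lo1 d1\<close> is 0.\<close>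
  have l1: "(if Suc a < d1 then lo1 (Suc a) * f (a, b) else 0) = lo1 (Suc a) * f (a, b)"
  proof (cases "Suc a < d1")
    case False
    then have "Suc a = d1" using True by simp
    then show ?thesis using lo_ends by simp
  qed simp
  have l2: "(if Suc b < d2 then K * lo2 (Suc b) * f (a, b) else 0) = K * lo2 (Suc b) * f (a, b)"
  proof (cases "Suc b < d2")
    case False
    then have "Suc b = d2" using True by simp
    then show ?thesis using lo_ends by simp
  qed simp
  have "T L_F (T L_E f) (a, b) = (if Suc a < d1 then lo1 (Suc a) * f (a, b) else 0) + XX + YY
      + (if Suc b < d2 then K * lo2 (Suc b) * f (a, b) else 0)"
    unfolding Tef XX_def YY_def ep[of "Suc b", symmetric] using True AA(2)[of "kb b"]
    by (simp add: distrib_left distrib_right mult_ac)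
  moreover have "qi * T L_E (T L_F f) (a, b) = qi * lo1 a * f (a, b) + XX + YY + qi * (K * lo2 b) * f (a, b)"
  proof -
    have e: "eps a b * phi a b = K" using ep[of b] by (simp add: mult.commute)
    have "T L_E (T L_F f) (a, b) = (if 0 < a then lo1 a * f (a, b) else 0) +
        (if Suc a < d1 \<and> 0 < b then lo1 (Suc a) * (eps a b * qi ^ kb (b - 1)) * f (Suc a, b - 1) else 0) +
        (if Suc b < d2 \<and> 0 < a then lo2 (Suc b) * (q ^ kb b * phi (a - 1) (Suc b)) * f (a - 1, Suc b) else 0) +
        (if 0 < b then K * lo2 b * f (a, b) else 0)"
      unfolding Tef e[symmetric] using True AA(1)[of "kb b"]
      by (cases a; cases b) (simp_all add: distrib_left distrib_right mult_ac)
    then show ?thesis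
      unfolding XX' YY' using lo_ends by (simp add: distrib_left mult_ac)
  qed
  ultimately show ?thesis
    unfolding l1 l2 unfolding lo_Suc(1)[of a] lo_Suc(2)[of b] K_def[symmetric] by (simp add: algebra_simps)
qed

section \<open>Levels, and where E and F are injective or surjective\<close>

lemma level_E: "level u f \<Longrightarrow> level (Suc u) (T L_E f)"
  unfolding level_def by (auto simp: T_apply)

lemma level_E_pow: "level u f \<Longrightarrow> level (u + l) ((T L_E ^^ l) f)"
  by (induction l) (auto intro: level_E)

lemma T_weight_ops:
  "T L_kap (T L_E f) = q ^ n *\<^sub>f T L_E (T L_kap f)" "T L_hat (T L_E f) = (q ^ n * qi ^ 2) *\<^sub>f T L_E (T L_hat f)"
  "T L_kap (T L_F f) = qi ^ n *\<^sub>f T L_F (T L_kap f)" "T L_hat (T L_F f) = (qi ^ n * q ^ 2) *\<^sub>f T L_F (T L_hat f)"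
proof -
  define K H where "K = (\<lambda>a b. ka a * ((q ^ n) ^ b * k2))" and "H = (\<lambda>a b. ha a * ((q ^ n * qi ^ 2) ^ b * h2))"
  define u v where "u = q ^ n" and "v = q ^ n * qi ^ 2"
  define u' v' where "u' = qi ^ n" and "v' = qi ^ n * q ^ 2"
  have KH: "K (Suc a) b = u * K a b" "K a (Suc b) = u * K a b" "H (Suc a) b = v * H a b" "H a (Suc b) = v * H a b" for a b
    by (simp_all add: K_def H_def ka_Suc u_def v_def mult_ac)
  have uu: "u' * (u * x) = x" "v' * (v * x) = x" for x
  proof -
    have "v' * v = (q ^ n * qi ^ n) * (q ^ 2 * qi ^ 2)" unfolding v_def v'_def by (simp only: mult_ac)
    then have "v' * v = 1" by (simp only: q_qi mult_1)
    then show "v' * (v * x) = x" by (simp flip: mult.assoc)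
    show "u' * (u * x) = x" by (simp add: u_def u'_def flip: mult.assoc)
  qed
  define Ea Eb Fa Fb where "Ea = (\<lambda>a b. if 0 < a \<and> a < d1 then q ^ kb b else 0)"
    and "Eb = (\<lambda>a b. if 0 < b \<and> b < d2 then (if kb b = 0 then inverse (ka a) else 1) else 0)"
    and "Fa = (\<lambda>a b. if Suc a < d1 then lo1 (Suc a) * qi ^ kb b else 0)"
    and "Fb = (\<lambda>a b. if Suc b < d2 then (if kb (Suc b) = 0 then ha a else ha a / ka a) * lo2 (Suc b) else 0)"
  have TK: "T L_kap f (a, b) = K a b * f (a, b)" "T L_hat f (a, b) = H a b * f (a, b)"
    "T L_E f (a, b) = Ea a b * f (a - 1, b) + Eb a b * f (a, b - 1)"
    "T L_F f (a, b) = Fa a b * f (Suc a, b) + Fb a b * f (a, Suc b)" for f a b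
    unfolding T_apply K_def H_def Ea_def Eb_def Fa_def Fb_def by simp_all
  have Es: "Ea a b * K a b = u * (Ea a b * K (a - 1) b)" "Eb a b * K a b = u * (Eb a b * K a (b - 1))"
    "Ea a b * H a b = v * (Ea a b * H (a - 1) b)" "Eb a b * H a b = v * (Eb a b * H a (b - 1))" for a b
    by (cases a; cases b; simp add: Ea_def Eb_def KH)+
  show "T L_kap (T L_E f) = q ^ n *\<^sub>f T L_E (T L_kap f)"
  proof
    fix x :: "nat \<times> nat" obtain a b where x: "x = (a, b)" by (cases x)
    have "K a b * (Ea a b * f (a - 1, b) + Eb a b * f (a, b - 1)) = (Ea a b * K a b) * f (a - 1, b) + (Eb a b * K a b) * f (a, b - 1)"
      by (simp only: distrib_left mult_ac)
    then show "T L_kap (T L_E f) x = (q ^ n *\<^sub>f T L_E (T L_kap f)) x"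
      unfolding x fscale_apply TK u_def[symmetric] Es by (simp only: distrib_left mult_ac)
  qed
  show "T L_hat (T L_E f) = (q ^ n * qi ^ 2) *\<^sub>f T L_E (T L_hat f)"
  proof
    fix x :: "nat \<times> nat" obtain a b where x: "x = (a, b)" by (cases x)
    have "H a b * (Ea a b * f (a - 1, b) + Eb a b * f (a, b - 1)) = (Ea a b * H a b) * f (a - 1, b) + (Eb a b * H a b) * f (a, b - 1)"
      by (simp only: distrib_left mult_ac)
    then show "T L_hat (T L_E f) x = ((q ^ n * qi ^ 2) *\<^sub>f T L_E (T L_hat f)) x"
      unfolding x fscale_apply TK v_def[symmetric] Es by (simp only: distrib_left mult_ac)
  qed
  show "T L_kap (T L_F f) = qi ^ n *\<^sub>f T L_F (T L_kap f)"
  proof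
    fix x :: "nat \<times> nat" obtain a b where x: "x = (a, b)" by (cases x)
    have "Fa a b * (u * K a b * f (Suc a, b)) + Fb a b * (u * K a b * f (a, Suc b)) =
        u * (K a b * (Fa a b * f (Suc a, b) + Fb a b * f (a, Suc b)))" by (simp only: distrib_left mult_ac)
    then show "T L_kap (T L_F f) x = (qi ^ n *\<^sub>f T L_F (T L_kap f)) x"
      unfolding x fscale_apply TK u'_def[symmetric] KH by (simp only: uu)
  qed
  show "T L_hat (T L_F f) = (qi ^ n * q ^ 2) *\<^sub>f T L_F (T L_hat f)"
  proof
    fix x :: "nat \<times> nat" obtain a b where x: "x = (a, b)" by (cases x)
    have "Fa a b * (v * H a b * f (Suc a, b)) + Fb a b * (v * H a b * f (a, Suc b)) =
        v * (H a b * (Fa a b * f (Suc a, b) + Fb a b * f (a, Suc b)))" by (simp only: distrib_left mult_ac)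
    then show "T L_hat (T L_F f) x = ((qi ^ n * q ^ 2) *\<^sub>f T L_F (T L_hat f)) x"
      unfolding x fscale_apply TK v'_def[symmetric] KH by (simp only: uu)
  qed
qed

lemma qrep_T: "qrep VW T"
  unfolding qrep_def
proof (intro conjI allI ballI impI lin_T)
  fix f assume f: "f \<in> VW"
  show "T g f \<in> VW" for g by (rule T_V[OF f])
  fix k' h' assume w: "weight T k' h' f"
  then show "weight T (q ^ n * k') (q ^ n * qi ^ 2 * h') (T L_E f)"
    by (simp add: weight_def T_weight_ops lin_scale[OF lin_T])
  from w show "weight T (qi ^ n * k') (qi ^ n * q ^ 2 * h') (T L_F f)"
    by (simp add: weight_def T_weight_ops lin_scale[OF lin_T])
  show "T L_F (T L_E f) = qi *\<^sub>f T L_E (T L_F f) + (1 - h' / k') *\<^sub>f f"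
  proof
    fix x :: "nat \<times> nat" obtain a b where x: "x = (a, b)" by (cases x)
    have "(1 - (ha a / ka a) * (qi ^ (2 * b) * (h2 / k2))) * f (a, b) = (1 - h' / k') * f (a, b)"
    proof (cases "f (a, b) = 0")
      case False
      have "ka a * ((q ^ n) ^ b * k2) = k'" "ha a * ((q ^ n * qi ^ 2) ^ b * h2) = h'"
        using False fun_cong[OF conjunct1[OF w[unfolded weight_def]], of "(a, b)"]
          fun_cong[OF conjunct2[OF w[unfolded weight_def]], of "(a, b)"]
        by (simp_all add: T_apply fscale_apply)
      then have "h' / k' = (ha a * ((q ^ n * qi ^ 2) ^ b * h2)) / (ka a * ((q ^ n) ^ b * k2))" by simp
      also have "\<dots> = (ha a / ka a) * (qi ^ (2 * b) * (h2 / k2))"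
        by (simp add: power_mult_distrib power_mult)
      finally show ?thesis by simp
    qed simp
    then show "T L_F (T L_E f) x = (qi *\<^sub>f T L_E (T L_F f) + (1 - h' / k') *\<^sub>f f) x"
      unfolding x FE_T[OF f] by (simp add: fun_apply)
  qed
qed

lemma level_weight:
  assumes "level u f"
  shows "weight T ((q ^ n) ^ u * (k1 * k2)) ((q ^ n * qi ^ 2) ^ u * (h1 * h2)) f"
  unfolding weight_def
proof (intro conjI ext)
  fix x :: "nat \<times> nat" obtain a b where x: "x = (a, b)" by (cases x)
  show "T L_kap f x = (((q ^ n) ^ u * (k1 * k2)) *\<^sub>f f) x" "T L_hat f x = (((q ^ n * qi ^ 2) ^ u * (h1 * h2)) *\<^sub>f f) x"
    using assms unfolding x T_apply fscale_apply ka_def ha_def level_def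
    by (cases "a + b = u"; force simp: power_add mult_ac)+
qed

text \<open>On level u + 1 the equation F f = g is a two-term recursion along the antidiagonal. The
  bounds keep the antidiagonal inside the rectangle and the leading coefficients non-zero. The free
  starting value \<open>s\<close> is 1 for a non-zero vector in the kernel of F and 0 for the choice
  of y in P.\<close>

lemma F_solve:
  assumes u: "Suc u < d1" "Suc u < d2" and g: "level u g"
  shows "\<exists>f\<in>VW. level (Suc u) f \<and> T L_F f = g \<and> f (0, Suc u) = s"
proof -
  define c where "c = (\<lambda>a b. (if kb (Suc b) = 0 then ha a else ha a / ka a) * lo2 (Suc b))"
  define x where "x = rec_nat s (\<lambda>a xa. (g (a, u - a) - c a (u - a) * xa) / (lo1 (Suc a) * qi ^ kb (u - a)))"
  have x: "x 0 = s" "x (Suc a) = (g (a, u - a) - c a (u - a) * x a) / (lo1 (Suc a) * qi ^ kb (u - a))" for a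
    by (simp_all add: x_def)
  define f where "f = (\<lambda>(a, b). if a + b = Suc u then x a else 0)"
  have "f \<in> VW"
  proof (rule funs_onI)
    fix ab assume "ab \<notin> B"
    then have "fst ab + snd ab \<noteq> Suc u" using u by (cases ab) auto
    then show "f ab = 0" by (cases ab) (simp add: f_def)
  qed
  moreover have "level (Suc u) f" by (simp add: level_def f_def)
  moreover have "T L_F f = g"
  proof
    fix ab :: "nat \<times> nat" obtain a b where ab: "ab = (a, b)" by (cases ab)
    show "T L_F f ab = g ab"
    proof (cases "a + b = u")
      case True
      then have b: "b = u - a" "Suc a < d1" "Suc b < d2" using u by auto
      have "lo1 (Suc a) * qi ^ kb b \<noteq> 0" using lo_nz(1)[of "Suc a"] b by simp
      then have "lo1 (Suc a) * qi ^ kb b * x (Suc a) = g (a, b) - c a b * x a" unfolding x b(1)[symmetric] by simp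
      moreover have "T L_F f ab = lo1 (Suc a) * qi ^ kb b * x (Suc a) + c a b * x a"
        unfolding ab T_apply using b(2,3) True by (simp add: f_def c_def mult.assoc)
      ultimately show ?thesis by (simp add: ab)
    next
      case False
      then show ?thesis using g unfolding ab T_apply level_def by (simp add: f_def)
    qed
  qed
  moreover have "f (0, Suc u) = s" by (simp add: f_def x)
  ultimately show ?thesis by blast
qed

lemma singular_vector:
  assumes "t < d1" "t < d2"
  shows "\<exists>x\<in>VW. level t x \<and> T L_F x = 0 \<and> x \<noteq> 0"
proof (cases t)
  case 0
  have "T L_F (delta (0, 0)) = 0"
    by (auto simp: fun_eq_iff T_apply delta_def zero_fun_apply)
  moreover have "(delta (0, 0) :: nat \<times> nat \<Rightarrow> 'k) \<noteq> 0"
    by (metis delta_def zero_fun_apply zero_neq_one)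
  moreover have "(delta (0, 0) :: nat \<times> nat \<Rightarrow> 'k) \<in> VW"
    by (rule funs_onI) (use d_bounds in \<open>auto simp: delta_def\<close>)
  moreover have "level t (delta (0, 0))" using 0 by (auto simp: level_def delta_def)
  ultimately show ?thesis by blast
next
  case (Suc u)
  have "level u 0" by (simp add: level_def zero_fun_apply)
  from F_solve[OF _ _ this, of 1] assms obtain x where "x \<in> VW" "level t x" "T L_F x = 0" "x (0, t) = 1"
    using Suc by auto
  moreover from this have "x \<noteq> 0" by (metis zero_fun_apply zero_neq_one)
  ultimately show ?thesis by blast
qed

text \<open>On a level u \<ge> d1 the antidiagonal does not reach b = 0. Descending in a from d1,
  where f is 0, each entry inside the rectangle is determined by the previous one through
  \<open>lo2 (u - a)\<close>, which is not 0.\<close>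

lemma F_inj:
  assumes f: "f \<in> VW" "level u f" "T L_F f = 0" and u: "d1 \<le> u"
  shows "f = 0"
proof -
  have F: "T L_F f (a, b) = 0" for a b using f(3) by (simp add: zero_fun_apply)
  have "a \<le> u \<Longrightarrow> f (a, u - a) = 0" if "d1 - a = m" for m a
    using that
  proof (induction m arbitrary: a)
    case 0
    then show ?case using funs_onD[OF f(1), of "(a, u - a)"] by simp
  next
    case (Suc m)
    then have a: "a < d1" "a < u" using u by auto
    have "Suc a < d1 \<Longrightarrow> f (Suc a, u - Suc a) = 0" using Suc a by auto
    then have "(if Suc a < d1 then lo1 (Suc a) * (qi ^ kb (u - Suc a) * f (Suc a, u - Suc a)) else 0) = 0" by simp
    then have z: "(if Suc (u - Suc a) < d2 then (if kb (Suc (u - Suc a)) = 0 then ha a else ha a / ka a) *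
        (lo2 (Suc (u - Suc a)) * f (a, Suc (u - Suc a))) else 0) = 0"
      using F[of a "u - Suc a"] unfolding T_apply by simp
    have s: "Suc (u - Suc a) = u - a" using a by simp
    show ?case
    proof (cases "u - a < d2")
      case True
      have "lo2 (u - a) \<noteq> 0" using lo_nz(2)[of "u - a"] True a by simp
      moreover have "ha a \<noteq> 0" by (simp add: ha_def wtP_h_def)
      ultimately show ?thesis using z True unfolding s by (auto split: if_splits)
    qed (use funs_onD[OF f(1), of "(a, u - a)"] in simp)
  qed
  then have *: "a \<le> u \<Longrightarrow> f (a, u - a) = 0" for a by blast
  show ?thesis
  proof
    fix x :: "nat \<times> nat" obtain a b where x: "x = (a, b)" by (cases x)
    show "f x = 0 x" using *[of a] f(2) unfolding x level_def zero_fun_apply by (cases "a + b = u") auto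
  qed
qed

text \<open>The entry of E f at (u + 1 - b, b) is a power of q times f (u - b, b) plus a multiple of
  the entry of f treated before. The recursion in b starts at (u + 1, 0), which lies in the
  rectangle as u + 1 < d1.\<close>

lemma E_inj:
  assumes f: "f \<in> VW" "level u f" "T L_E f = 0" and u: "Suc u < d1"
  shows "f = 0"
proof -
  have E: "T L_E f (a, b) = 0" for a b using f(3) by (simp add: zero_fun_apply)
  have *: "b \<le> u \<Longrightarrow> f (u - b, b) = 0" for b
  proof (induction b)
    case 0
    then show ?case using E[of "Suc u" 0] u unfolding T_apply by simp
  next
    case (Suc b)
    define c where "c = u - Suc b"
    have c: "u - b = Suc c" "u - Suc b = c" using Suc.prems by (auto simp: c_def)
    have "f (Suc c, b) = 0" using Suc c by simp
    moreover have "Suc c < d1" using u c by simp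
    ultimately have "f (c, Suc b) = 0" using E[of "Suc c" "Suc b"] unfolding T_apply by (simp split: if_splits)
    then show ?case unfolding c .
  qed
  show ?thesis
  proof
    fix x :: "nat \<times> nat" obtain a b where x: "x = (a, b)" by (cases x)
    show "f x = 0 x" using *[of b] f(2) unfolding x level_def zero_fun_apply by (cases "a + b = u") auto
  qed
qed

lemma E_pow_nz:
  assumes "f \<in> VW" "level u f" "f \<noteq> 0" "u + l < d1"
  shows "(T L_E ^^ l) f \<noteq> 0"
  using assms(4)
proof (induction l)
  case (Suc l)
  have "T L_E ((T L_E ^^ l) f) = 0 \<Longrightarrow> (T L_E ^^ l) f = 0"
    by (rule E_inj[OF funpow_in[OF qrep_T assms(1)] level_E_pow[OF assms(2)]]) (use Suc.prems in simp_all)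
  with Suc show ?case by (auto simp only: funpow.simps comp_apply)
qed (simp add: assms)

end

section \<open>Decomposition of the tensor product\<close>

lemma lin_slice: "lin (\<lambda>f b. f (l, b))" "lin (\<lambda>f a. f (Inl a))" "lin (\<lambda>f a. f (Inr a))"
  by (intro linI; simp add: fun_eq_iff fun_apply)+

lemma lin_sum_fun: "(\<And>l. l \<in> I \<Longrightarrow> lin (A l)) \<Longrightarrow> lin (\<lambda>f. \<Sum>l\<in>I. A l f)"
  by (intro linI) (simp_all add: lin_add lin_scale sum.distrib fscale_sum)

lemma dir_sum_ops_slice: "l \<in> I \<Longrightarrow> (\<lambda>b. dir_sum_ops I T g f (l, b)) = T l g (\<lambda>b. f (l, b))"
  by (simp add: dir_sum_ops_def)

lemma dir_sum2_ops_slice: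
  "(\<lambda>a. dir_sum2_ops T T' g f (Inl a)) = T g (\<lambda>a. f (Inl a))"
  "(\<lambda>a. dir_sum2_ops T T' g f (Inr a)) = T' g (\<lambda>a. f (Inr a))"
  by (simp_all add: dir_sum2_ops_def)

lemma dir_sum_ops_funpow:
  "l \<in> I \<Longrightarrow> (\<lambda>b. ((dir_sum_ops I T g ^^ N) f) (l, b)) = (T l g ^^ N) (\<lambda>b. f (l, b))"
  by (induction N) (simp_all add: dir_sum_ops_slice)

lemma dir_sum2_ops_funpow:
  "(\<lambda>a. ((dir_sum2_ops T T' g ^^ N) f) (Inl a)) = (T g ^^ N) (\<lambda>a. f (Inl a))"
  "(\<lambda>a. ((dir_sum2_ops T T' g ^^ N) f) (Inr a)) = (T' g ^^ N) (\<lambda>a. f (Inr a))"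
  by (induction N) (simp_all add: dir_sum2_ops_slice)

context simple_tensor begin

text \<open>Here \<Delta> is seen to respect the relations: \<open>\<psi>\<close> is onto by
  dimension, so each vector of the tensor product comes from a space on which the ideal is known to
  act as zero.\<close>

lemma iso_by_hom:
  assumes c: "coords n q N D TD \<Phi>" and D: "finite D" "card D = d1 * d2"
    and \<psi>: "lin \<psi>" "\<And>f. f \<in> funs_on D \<Longrightarrow> \<psi> f \<in> VW"
    and I: "\<And>g f. f \<in> funs_on D \<Longrightarrow> \<psi> (TD g f) = T g (\<psi> f)"
    and inj: "\<And>f. f \<in> funs_on D \<Longrightarrow> \<psi> f = 0 \<Longrightarrow> f = 0"
  shows "lmod_iso (Qu n q) (Qu_tensor n q (Qu_S n q (2 * i1) j1) (Qu_S n q (2 * i2) j2)) N"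
proof -
  have b: "bij_betw \<psi> (funs_on D) VW"
    by (rule inj_imp_bij_funs_on[OF D(1) _ _ \<psi> inj]) (simp_all add: D(2))
  have K: "frep T x f = 0" if x: "x \<in> Qu_ideal n q" and f: "f \<in> VW" for x f
  proof -
    obtain g where g: "g \<in> funs_on D" "f = \<psi> g" using b f unfolding bij_betw_def by blast
    have "\<psi> (frep TD x g) = frep T x (\<psi> g)"
      by (rule frep_intertwine[where F = "funs_on D" and T = TD and T' = T, OF \<psi>(1) coordsD(2)[OF c] I g(1)])
    then show ?thesis by (simp add: coords_kills_ideal[OF c x g(1)] lin_0[OF \<psi>(1)] g(2))
  qed
  obtain \<Phi>1 \<Phi>2 where tc: "tensor_coords n q (Qu_S n q (2 * i1) j1) (Qu_S n q (2 * i2) j2) {..<d1} {..<d2} T1 T2 \<Phi>1 \<Phi>2"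
    using tensor_S by blast
  show ?thesis
    by (rule lmod_iso_by_coords[where \<psi> = \<psi> and T' = T, OF c tensor_coords.coords_tensor[OF tc K] \<psi>(1) b I])
qed

lemma level_independent:
  assumes A: "finite A" "inj_on t A" and v: "\<And>a. a \<in> A \<Longrightarrow> level (t a) (v a)" "\<And>a. a \<in> A \<Longrightarrow> v a \<noteq> 0"
    and s: "(\<Sum>a\<in>A. c a *\<^sub>f v a) = 0" and a: "a \<in> A"
  shows "c a = 0"
proof -
  obtain x y where xy: "v a (x, y) \<noteq> 0" using v(2)[OF a] by (auto simp: fun_eq_iff fun_apply)
  have "x + y = t a" using v(1)[OF a] xy unfolding level_def by blast
  then have "v a' (x, y) = 0" if "a' \<in> A" "a' \<noteq> a" for a'
    using v(1)[OF that(1)] inj_onD[OF A(2) _ that(1) a] that(2) unfolding level_def by metis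
  then have "(\<Sum>a'\<in>A. c a' * v a' (x, y)) = (\<Sum>a'\<in>A. if a' = a then c a * v a (x, y) else 0)"
    by (intro sum.cong refl) auto
  also have "\<dots> = c a * v a (x, y)" using A(1) a by simp
  finally show ?thesis using fun_cong[OF s, of "(x, y)"] xy by (simp add: fun_apply)
qed

lemma half_even: "p = 2 * (n ^ 2 div 2)" "even (n ^ 2 div 2)"
proof -
  obtain c where "p = 4 * c" using p_even by blast
  then show "p = 2 * (n ^ 2 div 2)" "even (n ^ 2 div 2)" by auto
qed

text \<open>Raising i by p/2 does not change the weight of index (i, j): q^(np/2) = (-1)^n = 1,
  q^(-p) = 1, and p/2 is even. So a vector of level t has the weight of index i1 + i2 + t - p/2,
  with j congruent to j1 + j2 + t modulo 2.\<close>

lemma weight_match: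
  assumes i: "i + n ^ 2 div 2 = i1 + i2 + t" and j: "even (j + j1 + j2 + t)"
  shows "(q ^ n) ^ t * (k1 * k2) = wtP_k i j" "(q ^ n * qi ^ 2) ^ t * (h1 * h2) = wtP_h i j"
proof -
  have par: "even (i1 + j1 + (i2 + j2)) = even (i + j)" using arg_cong[OF i, of even] j half_even(2) by auto
  have "(q ^ n) ^ (n ^ 2 div 2) = (q ^ (n ^ 2 div 2)) ^ n" by (simp only: power_mult[symmetric] mult.commute)
  also have "\<dots> = 1" unfolding q_pow_half using four_dvd by (auto simp: power_minus_even dvd_def)
  finally have h1: "(q ^ n) ^ (n ^ 2 div 2) = 1" .
  have "(q ^ n) ^ t * (k1 * k2) = (- 1) ^ (i1 + j1 + (i2 + j2)) * (q ^ n) ^ (i1 + i2 + t)"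
    unfolding wtP_k_def power_add power_mult by (simp only: mult_ac)
  also have "(q ^ n) ^ (i1 + i2 + t) = q ^ (n * i)" unfolding i[symmetric] power_add h1 power_mult by simp
  also have "(- 1 :: 'k) ^ (i1 + j1 + (i2 + j2)) = (- 1) ^ (i + j)" using par by (metis neg_one_even_power neg_one_odd_power)
  finally show k: "(q ^ n) ^ t * (k1 * k2) = wtP_k i j" unfolding wtP_k_def .
  have "(qi ^ 2) ^ (n ^ 2 div 2) = qi ^ p" unfolding power_mult[symmetric] half_even(1)[symmetric] ..
  then have h2: "(qi ^ 2) ^ (n ^ 2 div 2) = 1" by (simp add: power_inverse q_order)
  have "(q ^ n * qi ^ 2) ^ t * (h1 * h2) = (qi ^ 2) ^ (i1 + i2 + t) * ((q ^ n) ^ t * (k1 * k2))"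
    unfolding wtP_h_def power_add power_mult power_mult_distrib by (simp only: mult_ac)
  also have "(qi ^ 2) ^ (i1 + i2 + t) = qi ^ (2 * i)" unfolding i[symmetric] power_add h2 power_mult by simp
  finally show "(q ^ n * qi ^ 2) ^ t * (h1 * h2) = wtP_h i j" unfolding k wtP_h_def .
qed

end

locale tensor_decomposition = simple_tensor n q i1 j1 i2 j2
  for n and q :: "'k::field_char_0" and i1 j1 i2 j2 +
  fixes I J :: "nat set" and iS jS tS iP jP tP :: "nat \<Rightarrow> nat"
  assumes fin: "finite I" "finite J"
    and S: "\<And>l. l \<in> I \<Longrightarrow> 1 \<le> iS l" "\<And>l. l \<in> I \<Longrightarrow> 2 * iS l \<le> n ^ 2" "\<And>l. l \<in> I \<Longrightarrow> jS l \<le> 1"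
      "\<And>l. l \<in> I \<Longrightarrow> iS l + n ^ 2 div 2 = i1 + i2 + tS l" "\<And>l. l \<in> I \<Longrightarrow> even (jS l + j1 + j2 + tS l)"
      "\<And>l. l \<in> I \<Longrightarrow> tS l < d1" "\<And>l. l \<in> I \<Longrightarrow> tS l < d2"
    and P: "\<And>l. l \<in> J \<Longrightarrow> 1 \<le> iP l" "\<And>l. l \<in> J \<Longrightarrow> 2 * iP l \<le> n ^ 2" "\<And>l. l \<in> J \<Longrightarrow> jP l \<le> 1"
      "\<And>l. l \<in> J \<Longrightarrow> iP l + n ^ 2 div 2 = i1 + i2 + tP l" "\<And>l. l \<in> J \<Longrightarrow> even (jP l + j1 + j2 + tP l)"
      "\<And>l. l \<in> J \<Longrightarrow> tP l < d1" "\<And>l. l \<in> J \<Longrightarrow> tP l < d2" "\<And>l. l \<in> J \<Longrightarrow> 2 * iP l - 1 \<le> tP l"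
    \<comment> \<open>The kernel of \<open>F\<close> on the \<open>l\<close>-th copy of \<open>P\<close> is spanned by \<open>x\<close> and \<open>E\<^sup>rx\<close> with \<open>r = 2 * iP l - 1\<close>, of level
      \<open>tP l - r\<close> and \<open>tP l\<close>.\<close>
    and levels: "inj_on (case_sum tS (case_sum (\<lambda>l. tP l - (2 * iP l - 1)) tP)) (I <+> (J <+> J))"
    and count: "(\<Sum>l\<in>I. n ^ 2 - (2 * iS l - 1)) + card J * (2 * n ^ 2) = d1 * d2"
begin

definition "dS l = n ^ 2 - (2 * iS l - 1)"
definition "rP l = 2 * iP l - 1"
abbreviation "OS \<equiv> dir_sum_ops I (\<lambda>l. S_ops (dS l) (wtP_k (iS l) (jS l)) (wtP_h (iS l) (jS l)))"
abbreviation "OP \<equiv> dir_sum_ops J (\<lambda>l. P_ops (rP l) (wtP_k (iP l) (jP l)) (wtP_h (iP l) (jP l)))"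
abbreviation "BS \<equiv> Sigma I (\<lambda>l. {..<dS l})"
abbreviation "BP \<equiv> Sigma J (\<lambda>l. P_basis)"

lemma dS: "l \<in> I \<Longrightarrow> 0 < dS l" "l \<in> I \<Longrightarrow> dS l \<le> p"
  using S(1,2)[of l] p_ge by (auto simp: dS_def)

lemma rP: "l \<in> J \<Longrightarrow> 0 < rP l" "l \<in> J \<Longrightarrow> rP l < p" "l \<in> J \<Longrightarrow> rP l \<le> tP l"
  using P(1,2,8)[of l] p_ge by (auto simp: rP_def)

text \<open>F E^d x = 0 since \<open>lowering d\<close> vanishes for the weight of x, and the level
  of E^d x is at least d1, where F is injective. Hence the string ends at the length of S.\<close>

lemma S_vec: "l \<in> I \<Longrightarrow> \<exists>x\<in>VW. level (tS l) x \<and> T L_F x = 0 \<and> x \<noteq> 0 \<and> (T L_E ^^ dS l) x = 0"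
proof -
  assume l: "l \<in> I"
  obtain x where x: "x \<in> VW" "level (tS l) x" "T L_F x = 0" "x \<noteq> 0"
    using singular_vector[OF S(6,7)[OF l]] by blast
  have w: "weight T (wtP_k (iS l) (jS l)) (wtP_h (iS l) (jS l)) x"
    using level_weight[OF x(2)] unfolding weight_match[OF S(4,5)[OF l]] .
  obtain e where e: "dS l = Suc e" using dS(1)[OF l] by (cases "dS l") auto
  note quot = wtP_quot[OF S(1,2)[OF l], of "jS l", folded dS_def]
  have "T L_F ((T L_E ^^ dS l) x) = lowering (dS l) (q ^ (dS l - 1)) *\<^sub>f (T L_E ^^ e) x"
    using FE_pow_ker[OF qrep_T x(1) w wtP_k_nz x(3), of e, folded e] unfolding quot .
  then have "T L_F ((T L_E ^^ dS l) x) = 0" using lowering_zero[of "dS l"] e by (simp del: funpow.simps)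
  moreover have "d1 \<le> tS l + dS l"
    using S(1,2,4,7)[OF l] half_even(1) i1 i2 unfolding d1_def d2_def dS_def by linarith
  ultimately have "(T L_E ^^ dS l) x = 0"
    by (intro F_inj[OF funpow_in[OF qrep_T x(1)] level_E_pow[OF x(2)]])
  with x show ?thesis by blast
qed

text \<open>x sits r levels below y, so that E^(r-1) x lies on the level of F y and
  \<open>F_solve\<close> gives y. F commutes with E^p here, so E^p x and then E^p y are killed by F;
  their levels are at least d1, hence both are 0.\<close>

lemma P_vec: "l \<in> J \<Longrightarrow> \<exists>x\<in>VW. \<exists>y\<in>VW. level (tP l - rP l) x \<and> level (tP l) y \<and> T L_F x = 0 \<and> x \<noteq> 0 \<and>
    T L_F y = (T L_E ^^ (rP l - 1)) x \<and> (T L_E ^^ n ^ 2) x = 0 \<and> (T L_E ^^ n ^ 2) y = 0"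
proof -
  assume l: "l \<in> J"
  obtain x where x: "x \<in> VW" "level (tP l - rP l) x" "T L_F x = 0" "x \<noteq> 0"
    using singular_vector[OF less_imp_diff_less[OF P(6)[OF l]] less_imp_diff_less[OF P(7)[OF l]]] by blast
  obtain u where u: "tP l = Suc u" "tP l - rP l + (rP l - 1) = u" using rP(1,3)[OF l] by (cases "tP l") auto
  have "level u ((T L_E ^^ (rP l - 1)) x)" using level_E_pow[OF x(2), of "rP l - 1"] unfolding u(2) .
  then obtain y where y: "y \<in> VW" "level (tP l) y" "T L_F y = (T L_E ^^ (rP l - 1)) x"
    using F_solve[of u "(T L_E ^^ (rP l - 1)) x" 0] P(6,7)[OF l] unfolding u(1) by blast
  obtain e where e: "n ^ 2 = Suc e" using p_ge by (cases "n ^ 2") auto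
  have lv: "d1 \<le> tP l - rP l + p"
    using P(1,2,4,7,8)[OF l] half_even(1) i1 i2 unfolding d1_def d2_def rP_def by linarith
  note F = FE_pow[OF qrep_T _ level_weight, where l = e, folded e]
  have Ex: "(T L_E ^^ n ^ 2) x = 0"
  proof (rule F_inj[OF funpow_in[OF qrep_T x(1)] level_E_pow[OF x(2)] _ lv])
    show "T L_F ((T L_E ^^ n ^ 2) x) = 0"
      using F[OF x(1,2)] q_nz by (simp add: lowering_p x(3) lin_0[OF lin_funpow[OF lin_T]] del: funpow.simps)
  qed
  have "(T L_E ^^ n ^ 2) y = 0"
  proof (rule F_inj[OF funpow_in[OF qrep_T y(1)] level_E_pow[OF y(2)]])
    have "(T L_E ^^ n ^ 2) ((T L_E ^^ (rP l - 1)) x) = (T L_E ^^ (rP l - 1)) ((T L_E ^^ n ^ 2) x)"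
      by (simp only: funpow_add[symmetric, THEN fun_cong, simplified] add.commute)
    then have "(T L_E ^^ n ^ 2) (T L_F y) = 0" unfolding y(3) Ex lin_0[OF lin_funpow[OF lin_T]] .
    then show "T L_F ((T L_E ^^ n ^ 2) y) = 0"
      using F[OF y(1,2)] q_nz by (simp add: lowering_p del: funpow.simps)
    show "d1 \<le> tP l + p" using lv by linarith
  qed
  with x y Ex show ?thesis by blast
qed

definition "xS = (\<lambda>l. SOME x. x \<in> VW \<and> level (tS l) x \<and> T L_F x = 0 \<and> x \<noteq> 0 \<and> (T L_E ^^ dS l) x = 0)"

definition "xyP = (\<lambda>l. SOME xy. fst xy \<in> VW \<and> snd xy \<in> VW \<and> level (tP l - rP l) (fst xy) \<and> level (tP l) (snd xy) \<and>
    T L_F (fst xy) = 0 \<and> fst xy \<noteq> 0 \<and>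
    T L_F (snd xy) = (T L_E ^^ (rP l - 1)) (fst xy) \<and> (T L_E ^^ n ^ 2) (fst xy) = 0 \<and> (T L_E ^^ n ^ 2) (snd xy) = 0)"

abbreviation "xP l \<equiv> fst (xyP l)"
abbreviation "yP l \<equiv> snd (xyP l)"

lemma xS: assumes l: "l \<in> I"
  shows "xS l \<in> VW" "level (tS l) (xS l)" "T L_F (xS l) = 0" "xS l \<noteq> 0" "(T L_E ^^ dS l) (xS l) = 0"
proof -
  have "\<exists>x. x \<in> VW \<and> level (tS l) x \<and> T L_F x = 0 \<and> x \<noteq> 0 \<and> (T L_E ^^ dS l) x = 0" using S_vec[OF l] by blast
  from someI_ex[OF this] show "xS l \<in> VW" "level (tS l) (xS l)" "T L_F (xS l) = 0" "xS l \<noteq> 0" "(T L_E ^^ dS l) (xS l) = 0"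
    unfolding xS_def by blast+
qed

lemma xyP: assumes l: "l \<in> J"
  shows "xP l \<in> VW" "yP l \<in> VW" "level (tP l - rP l) (xP l)" "level (tP l) (yP l)"
    "T L_F (xP l) = 0" "xP l \<noteq> 0" "T L_F (yP l) = (T L_E ^^ (rP l - 1)) (xP l)"
    "(T L_E ^^ n ^ 2) (xP l) = 0" "(T L_E ^^ n ^ 2) (yP l) = 0"
proof -
  have "\<exists>xy. fst xy \<in> VW \<and> snd xy \<in> VW \<and> level (tP l - rP l) (fst xy) \<and> level (tP l) (snd xy) \<and>
    T L_F (fst xy) = 0 \<and> fst xy \<noteq> 0 \<and>
    T L_F (snd xy) = (T L_E ^^ (rP l - 1)) (fst xy) \<and> (T L_E ^^ n ^ 2) (fst xy) = 0 \<and> (T L_E ^^ n ^ 2) (snd xy) = 0"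
    using P_vec[OF l] unfolding Bex_def split_paired_Ex fst_conv snd_conv by blast
  note e = someI_ex[OF this, folded xyP_def]
  show "xP l \<in> VW" "yP l \<in> VW" "level (tP l - rP l) (xP l)" "level (tP l) (yP l)"
    "T L_F (xP l) = 0" "xP l \<noteq> 0" "T L_F (yP l) = (T L_E ^^ (rP l - 1)) (xP l)"
    "(T L_E ^^ n ^ 2) (xP l) = 0" "(T L_E ^^ n ^ 2) (yP l) = 0"
    using someI_ex[OF \<open>\<exists>xy. _ xy\<close>] unfolding xyP_def by blast+
qed

definition "\<psi>S f = (\<Sum>l\<in>I. S_hom (dS l) T (xS l) (\<lambda>b. f (l, b)))"
definition "\<psi>P f = (\<Sum>l\<in>J. P_hom T (xP l) (yP l) (\<lambda>b. f (l, b)))"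
definition "\<psi> f = \<psi>S (\<lambda>a. f (Inl a)) + \<psi>P (\<lambda>a. f (Inr a))"

lemma lin_\<psi>S: "lin \<psi>S" and lin_\<psi>P: "lin \<psi>P"
  unfolding \<psi>S_def[abs_def] \<psi>P_def[abs_def]
  by (intro lin_sum_fun lin_comp[OF lin_S_hom lin_slice(1), unfolded comp_def]
      lin_comp[OF lin_P_hom lin_slice(1), unfolded comp_def])+

lemma lin_\<psi>: "lin \<psi>"
  using lin_\<psi>S lin_\<psi>P unfolding lin_def \<psi>_def case_sum_fun_simps
  by (simp add: case_sum_fun_simps fscale_add algebra_simps)

lemma \<psi>S_in: "\<psi>S f \<in> VW" unfolding \<psi>S_def by (intro funs_on_sum S_hom_in[OF qrep_T] xS)

lemma \<psi>P_in: "\<psi>P f \<in> VW" unfolding \<psi>P_def by (intro funs_on_sum P_hom_in[OF qrep_T] xyP)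

lemma \<psi>S_intertwine: "\<psi>S (OS g f) = T g (\<psi>S f)"
  unfolding \<psi>S_def lin_sum[OF lin_T]
proof (rule sum.cong[OF refl])
  fix l assume l: "l \<in> I"
  have "weight T (wtP_k (iS l) (jS l)) (wtP_h (iS l) (jS l)) (xS l)"
    using level_weight[OF xS(2)[OF l]] unfolding weight_match[OF S(4,5)[OF l]] .
  from S_hom_intertwine[OF qrep_T xS(1)[OF l] this wtP_k_nz xS(3)[OF l] dS(1)[OF l] xS(5)[OF l]] show "S_hom (dS l) T (xS l) (\<lambda>b. OS g f (l, b)) = T g (S_hom (dS l) T (xS l) (\<lambda>b. f (l, b)))"
    unfolding dir_sum_ops_slice[OF l] .
qed

lemma \<psi>P_intertwine: "\<psi>P (OP g f) = T g (\<psi>P f)"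
  unfolding \<psi>P_def lin_sum[OF lin_T]
proof (rule sum.cong[OF refl])
  fix l assume l: "l \<in> J"
  define t where "t = tP l - rP l"
  have t: "tP l = rP l + t" using rP(3)[OF l] by (simp add: t_def)
  note wm = weight_match[OF P(4,5)[OF l]]
  have wy: "weight T (wtP_k (iP l) (jP l)) (wtP_h (iP l) (jP l)) (yP l)"
    using level_weight[OF xyP(4)[OF l]] unfolding wm .
  have c: "a ^ r * (b ^ (r + t) * x) = b ^ t * x" if "a * b = 1" for a b x :: 'k and r
  proof -
    have "a ^ r * (b ^ (r + t) * x) = (a * b) ^ r * (b ^ t * x)" by (simp only: power_add power_mult_distrib mult_ac)
    then show ?thesis using that by simp
  qed
  have "(qi ^ n * q ^ 2) * (q ^ n * qi ^ 2) = (q ^ n * qi ^ n) * (q ^ 2 * qi ^ 2)" by (simp only: mult_ac)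
  then have one: "qi ^ n * q ^ n = 1" "(qi ^ n * q ^ 2) * (q ^ n * qi ^ 2) = 1" by (simp_all only: q_qi mult_1)
  \<comment> \<open>The index of the weight is attached to y; x lies r levels lower and so has that
    weight divided r times by the weight of E, as in the model of P.\<close>
  have wx: "weight T ((qi ^ n) ^ rP l * wtP_k (iP l) (jP l)) ((qi ^ n * q ^ 2) ^ rP l * wtP_h (iP l) (jP l)) (xP l)"
    using level_weight[OF xyP(3)[OF l]] unfolding wm[symmetric] t c[OF one(1)] c[OF one(2)] by simp
  show "P_hom T (xP l) (yP l) (\<lambda>b. OP g f (l, b)) = T g (P_hom T (xP l) (yP l) (\<lambda>b. f (l, b)))"
    unfolding dir_sum_ops_slice[OF l] by (rule P_hom_intertwine[OF qrep_T xyP(1)[OF l] wx xyP(2)[OF l] wy wtP_k_nz rP(1)[OF l] xyP(5,7,8,9)[OF l]])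
qed

lemma \<psi>_intertwine: "\<psi> (dir_sum2_ops OS OP g f) = T g (\<psi> f)"
  unfolding \<psi>_def dir_sum2_ops_slice \<psi>S_intertwine \<psi>P_intertwine lin_add[OF lin_T] ..

lemma coords_OS: "\<exists>\<Phi>. coords n q (dir_sum I (\<lambda>l. Qu_S n q (2 * iS l) (jS l))) BS OS \<Phi>"
proof -
  have "\<forall>l\<in>I. \<exists>\<Phi>. coords n q (Qu_S n q (2 * iS l) (jS l)) {..<dS l} (S_ops (dS l) (wtP_k (iS l) (jS l)) (wtP_h (iS l) (jS l))) \<Phi>"
    unfolding dS_def using coords_S S(1,2,3) by blast
  then obtain \<Phi> where "\<And>l. l \<in> I \<Longrightarrow> coords n q (Qu_S n q (2 * iS l) (jS l)) {..<dS l} (S_ops (dS l) (wtP_k (iS l) (jS l)) (wtP_h (iS l) (jS l))) (\<Phi> l)"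
    unfolding bchoice_iff by blast
  note H = this
  show ?thesis by (rule exI, rule coords_dir_sum[OF fin(1)], rule H)
qed

lemma coords_OP: "\<exists>\<Phi>. coords n q (dir_sum J (\<lambda>l. Qu_P n q (2 * iP l) (jP l))) BP OP \<Phi>"
proof -
  have "\<forall>l\<in>J. \<exists>\<Phi>. coords n q (Qu_P n q (2 * iP l) (jP l)) P_basis (P_ops (rP l) (wtP_k (iP l) (jP l)) (wtP_h (iP l) (jP l))) \<Phi>"
    unfolding rP_def using coords_P P(1,2,3) by blast
  then obtain \<Phi> where "\<And>l. l \<in> J \<Longrightarrow> coords n q (Qu_P n q (2 * iP l) (jP l)) P_basis (P_ops (rP l) (wtP_k (iP l) (jP l)) (wtP_h (iP l) (jP l))) (\<Phi> l)"
    unfolding bchoice_iff by blast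
  note H = this
  show ?thesis by (rule exI, rule coords_dir_sum[OF fin(2)], rule H)
qed

lemma coords_O: "\<exists>\<Phi>. coords n q (dir_sum2 (dir_sum I (\<lambda>l. Qu_S n q (2 * iS l) (jS l))) (dir_sum J (\<lambda>l. Qu_P n q (2 * iP l) (jP l))))
    (BS <+> BP) (dir_sum2_ops OS OP) \<Phi>"
proof -
  obtain \<Phi> \<Phi>' where "coords n q (dir_sum I (\<lambda>l. Qu_S n q (2 * iS l) (jS l))) BS OS \<Phi>"
    "coords n q (dir_sum J (\<lambda>l. Qu_P n q (2 * iP l) (jP l))) BP OP \<Phi>'"
    using coords_OS coords_OP by (elim exE)
  note H = this
  show ?thesis by (rule exI, rule coords_dir_sum2[OF H])
qed

lemma slice_in:
  assumes f: "f \<in> funs_on (BS <+> BP)"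
  shows "l \<in> I \<Longrightarrow> (\<lambda>b. f (Inl (l, b))) \<in> funs_on {..<dS l}" "l \<in> J \<Longrightarrow> (\<lambda>b. f (Inr (l, b))) \<in> funs_on P_basis"
  by (intro funs_onI funs_onD[OF f]; auto)+

lemma funs_on_eqI:
  fixes f :: "(nat \<times> nat) + (nat \<times> bool \<times> nat) \<Rightarrow> 'k"
  assumes "f \<in> funs_on (BS <+> BP)" "\<And>l. l \<in> I \<Longrightarrow> (\<lambda>b. f (Inl (l, b))) = 0" "\<And>l. l \<in> J \<Longrightarrow> (\<lambda>b. f (Inr (l, b))) = 0"
  shows "f = 0"
proof
  fix a show "f a = 0 a"
  proof (cases "a \<in> BS <+> BP")
    case True
    then consider l b where "a = Inl (l, b)" "l \<in> I" | l b where "a = Inr (l, b)" "l \<in> J" by auto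
    then show ?thesis
    proof cases
      case (1 l b)
      show ?thesis using fun_cong[OF assms(2)[OF 1(2)], of b] by (simp add: 1(1) zero_fun_apply)
    next
      case (2 l b)
      show ?thesis using fun_cong[OF assms(3)[OF 2(2)], of b] by (simp add: 2(1) zero_fun_apply)
    qed
  qed (simp add: funs_onD[OF assms(1)] zero_fun_apply)
qed

text \<open>The kernel of F in the direct sum is spanned by the lowest vector of each S and by
  \<alpha> and E^r \<alpha> of each P. Their images are non-zero and live on pairwise distinct
  levels, hence are independent.\<close>

lemma \<psi>_ker:
  assumes f: "f \<in> funs_on (BS <+> BP)" and F: "dir_sum2_ops OS OP L_F f = 0" and z: "\<psi> f = 0"
  shows "f = 0"
proof -
  define fS where "fS = (\<lambda>l b. f (Inl (l, b)))"
  define fP where "fP = (\<lambda>l b. f (Inr (l, b)))"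
  have fS: "(\<lambda>b. f (Inl (l, b))) = fS l" and fP: "(\<lambda>b. f (Inr (l, b))) = fP l" for l
    by (simp_all add: fS_def fP_def)
  have S0: "fS l = fS l 0 *\<^sub>f delta 0" if l: "l \<in> I" for l
  proof (rule S_kerF[OF slice_in(1)[OF f l, unfolded fS] wtP_quot[OF S(1,2)[OF l], folded dS_def] dS[OF l]])
    have "OS L_F (\<lambda>a. f (Inl a)) = 0" using arg_cong[OF F, of "\<lambda>h a. h (Inl a)"] unfolding dir_sum2_ops_slice case_sum_fun_simps .
    then have "(\<lambda>b. OS L_F (\<lambda>a. f (Inl a)) (l, b)) = 0" by (simp add: fun_eq_iff fun_apply)
    then show "S_ops (dS l) (wtP_k (iS l) (jS l)) (wtP_h (iS l) (jS l)) L_F (fS l) = 0"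
      unfolding dir_sum_ops_slice[OF l] fS_def .
  qed
  have P0: "fP l = fP l (False, 0) *\<^sub>f delta (False, 0) + fP l (False, rP l) *\<^sub>f delta (False, rP l)" if l: "l \<in> J" for l
  proof (rule P_kerF[OF slice_in(2)[OF f l, unfolded fP] wtP_quot[OF P(1,2)[OF l], folded rP_def]])
    show "p - rP l + rP l = p" "0 < p - rP l" "0 < rP l" using rP[OF l] by auto
    have "OP L_F (\<lambda>a. f (Inr a)) = 0" using arg_cong[OF F, of "\<lambda>h a. h (Inr a)"] unfolding dir_sum2_ops_slice case_sum_fun_simps .
    then have "(\<lambda>b. OP L_F (\<lambda>a. f (Inr a)) (l, b)) = 0" by (simp add: fun_eq_iff fun_apply)
    then show "P_ops (rP l) (wtP_k (iP l) (jP l)) (wtP_h (iP l) (jP l)) L_F (fP l) = 0"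
      unfolding dir_sum_ops_slice[OF l] fP_def .
  qed
  have S1: "S_hom (dS l) T (xS l) (fS l) = fS l 0 *\<^sub>f xS l" if l: "l \<in> I" for l
  proof -
    have "S_hom (dS l) T (xS l) (delta 0) = xS l"
      unfolding S_hom_def using dS(1)[OF l] by (simp add: delta_def fun_eq_iff fun_apply if_distrib[of "\<lambda>x. x * _"] cong: if_cong)
    then show ?thesis by (subst S0[OF l]) (simp only: lin_scale[OF lin_S_hom])
  qed
  have P1: "P_hom T (xP l) (yP l) (fP l) = fP l (False, 0) *\<^sub>f xP l + fP l (False, rP l) *\<^sub>f (T L_E ^^ rP l) (xP l)" if l: "l \<in> J" for l
  proof -
    have "P_hom T (xP l) (yP l) (delta (False, e)) = (T L_E ^^ e) (xP l)" if "e < p" for e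
      using that unfolding P_hom_def
      by (simp add: delta_def fun_eq_iff fun_apply if_distrib[of "\<lambda>x. x * _"] cong: if_cong)
    moreover have "0 < p" "rP l < p" using rP[OF l] by (simp_all add: n_pos)
    ultimately have d: "P_hom T (xP l) (yP l) (delta (False, 0)) = xP l"
      "P_hom T (xP l) (yP l) (delta (False, rP l)) = (T L_E ^^ rP l) (xP l)" by simp_all
    show ?thesis by (subst P0[OF l]) (simp only: lin_add[OF lin_P_hom] lin_scale[OF lin_P_hom] d)
  qed
  define A where "A = I <+> (J <+> J)"
  define c where "c = case_sum (\<lambda>l. fS l 0) (case_sum (\<lambda>l. fP l (False, 0)) (\<lambda>l. fP l (False, rP l)))"
  define v where "v = case_sum xS (case_sum xP (\<lambda>l. (T L_E ^^ rP l) (xP l)))"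
  have "(\<Sum>a\<in>A. c a *\<^sub>f v a) = (\<Sum>l\<in>I. fS l 0 *\<^sub>f xS l) +
      ((\<Sum>l\<in>J. fP l (False, 0) *\<^sub>f xP l) + (\<Sum>l\<in>J. fP l (False, rP l) *\<^sub>f (T L_E ^^ rP l) (xP l)))"
    unfolding A_def c_def v_def using fin by (simp add: sum.Plus)
  also have "\<dots> = \<psi> f" unfolding \<psi>_def \<psi>S_def \<psi>P_def
    unfolding fS fP sum.distrib[symmetric]
    using S1 P1 by (intro arg_cong2[where f = "(+)"] sum.cong) simp_all
  finally have "(\<Sum>a\<in>A. c a *\<^sub>f v a) = 0" using z by simp
  moreover have "finite A" unfolding A_def using fin by simp
  moreover have "level (case_sum tS (case_sum (\<lambda>l. tP l - rP l) tP) a) (v a)" "v a \<noteq> 0" if "a \<in> A" for a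
  proof -
    consider l where "a = Inl l" "l \<in> I" | l where "a = Inr (Inl l)" "l \<in> J" | l where "a = Inr (Inr l)" "l \<in> J"
      using \<open>a \<in> A\<close> unfolding A_def by auto
    then have "level (case_sum tS (case_sum (\<lambda>l. tP l - rP l) tP) a) (v a) \<and> v a \<noteq> 0"
    proof cases
      \<comment> \<open>E^r x is not 0 because its level \<open>tP l\<close> is below d1, the range
        in which E is injective.\<close>
      case (3 l)
      have "tP l - rP l + rP l = tP l" using rP(3)[OF 3(2)] by simp
      then have "level (tP l) ((T L_E ^^ rP l) (xP l))" "(T L_E ^^ rP l) (xP l) \<noteq> 0"
        using level_E_pow[OF xyP(3)[OF 3(2)], of "rP l"] E_pow_nz[OF xyP(1,3,6)[OF 3(2)], of "rP l"] P(6)[OF 3(2)] by simp_all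
      then show ?thesis by (simp add: 3 v_def)
    qed (simp_all add: v_def xS xyP)
    then show "level (case_sum tS (case_sum (\<lambda>l. tP l - rP l) tP) a) (v a)" "v a \<noteq> 0" by blast+
  qed
  ultimately have c0: "c a = 0" if "a \<in> A" for a
    using level_independent[OF _ levels[folded A_def rP_def]] that by blast
  show ?thesis
  proof (rule funs_on_eqI[OF f])
    fix l assume l: "l \<in> I"
    have "Inl l \<in> A" unfolding A_def using l by blast
    from c0[OF this] have "fS l 0 = 0" by (simp add: c_def)
    then show "(\<lambda>b. f (Inl (l, b))) = 0" using S0[OF l] by (simp add: fS_def fun_eq_iff fun_apply)
  next
    fix l assume l: "l \<in> J"
    have "Inr (Inl l) \<in> A" "Inr (Inr l) \<in> A" unfolding A_def using l by blast+
    from c0[OF this(1)] c0[OF this(2)] have "fP l (False, 0) = 0" "fP l (False, rP l) = 0" by (simp_all add: c_def)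
    then show "(\<lambda>b. f (Inr (l, b))) = 0" using P0[OF l] by (simp add: fP_def fun_eq_iff fun_apply)
  qed
qed

lemma O_nilpotent:
  assumes f: "f \<in> funs_on (BS <+> BP)"
  shows "(dir_sum2_ops OS OP L_F ^^ (2 * p)) f = 0"
proof (rule funs_on_eqI)
  obtain \<Phi> where c: "coords n q (dir_sum2 (dir_sum I (\<lambda>l. Qu_S n q (2 * iS l) (jS l))) (dir_sum J (\<lambda>l. Qu_P n q (2 * iP l) (jP l))))
    (BS <+> BP) (dir_sum2_ops OS OP) \<Phi>" using coords_O by (elim exE)
  show "(dir_sum2_ops OS OP L_F ^^ (2 * p)) f \<in> funs_on (BS <+> BP)"
  proof -
    have "(dir_sum2_ops OS OP L_F ^^ N) f \<in> funs_on (BS <+> BP)" for N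
    proof (induction N)
      case (Suc N)
      then show ?case unfolding funpow.simps comp_apply by (rule coordsD(2)[OF c])
    qed (simp only: funpow.simps id_apply f)
    then show ?thesis .
  qed
  fix l
  show "(\<lambda>b. (dir_sum2_ops OS OP L_F ^^ (2 * p)) f (Inl (l, b))) = 0" if l: "l \<in> I"
  proof -
    have "(\<lambda>b. (dir_sum2_ops OS OP L_F ^^ (2 * p)) f (Inl (l, b))) =
        (S_ops (dS l) (wtP_k (iS l) (jS l)) (wtP_h (iS l) (jS l)) L_F ^^ (2 * p)) (\<lambda>b. f (Inl (l, b)))"
    proof -
      have "(\<lambda>b. (dir_sum2_ops OS OP L_F ^^ (2 * p)) f (Inl (l, b))) = (\<lambda>b. (OS L_F ^^ (2 * p)) (\<lambda>a. f (Inl a)) (l, b))"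
        using fun_cong[OF dir_sum2_ops_funpow(1)[where T = OS and T' = OP and g = L_F and N = "2 * p" and f = f]]
        by (intro ext)
      then show ?thesis unfolding dir_sum_ops_funpow[OF l] .
    qed
    also have "\<dots> = 0" by (rule S_nilpotent[OF slice_in(1)[OF f l]]) (use dS(2)[OF l] in linarith)
    finally show ?thesis .
  qed
  show "(\<lambda>b. (dir_sum2_ops OS OP L_F ^^ (2 * p)) f (Inr (l, b))) = 0" if l: "l \<in> J"
  proof -
    have "(\<lambda>b. (dir_sum2_ops OS OP L_F ^^ (2 * p)) f (Inr (l, b))) =
        (P_ops (rP l) (wtP_k (iP l) (jP l)) (wtP_h (iP l) (jP l)) L_F ^^ (2 * p)) (\<lambda>b. f (Inr (l, b)))"
    proof -
      have "(\<lambda>b. (dir_sum2_ops OS OP L_F ^^ (2 * p)) f (Inr (l, b))) = (\<lambda>b. (OP L_F ^^ (2 * p)) (\<lambda>a. f (Inr a)) (l, b))"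
        using fun_cong[OF dir_sum2_ops_funpow(2)[where T = OS and T' = OP and g = L_F and N = "2 * p" and f = f]]
        by (intro ext)
      then show ?thesis unfolding dir_sum_ops_funpow[OF l] .
    qed
    also have "\<dots> = 0" by (rule P_nilpotent[OF slice_in(2)[OF f l] rP(2)[OF l]])
    finally show ?thesis .
  qed
qed

lemma \<psi>_inj:
  assumes f: "f \<in> funs_on (BS <+> BP)" "\<psi> f = 0"
  shows "f = 0"
proof -
  obtain \<Phi> where c: "coords n q (dir_sum2 (dir_sum I (\<lambda>l. Qu_S n q (2 * iS l) (jS l))) (dir_sum J (\<lambda>l. Qu_P n q (2 * iP l) (jP l))))
    (BS <+> BP) (dir_sum2_ops OS OP) \<Phi>" using coords_O by (elim exE)
  show ?thesis
  proof (rule inj_on_ker_imp_inj[where V = "funs_on (BS <+> BP)" and F = "dir_sum2_ops OS OP L_F" and F' = "T L_F"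
        and N = "2 * p", OF lin_\<psi> lin_T _ _ _ _ f])
    fix f :: "(nat \<times> nat) + (nat \<times> bool \<times> nat) \<Rightarrow> 'k" assume f: "f \<in> funs_on (BS <+> BP)"
    show "dir_sum2_ops OS OP L_F f \<in> funs_on (BS <+> BP)" by (rule coordsD(2)[OF c f])
    show "\<psi> (dir_sum2_ops OS OP L_F f) = T L_F (\<psi> f)" by (rule \<psi>_intertwine)
    show "(dir_sum2_ops OS OP L_F ^^ (2 * p)) f = 0" by (rule O_nilpotent[OF f])
    show "dir_sum2_ops OS OP L_F f = 0 \<Longrightarrow> \<psi> f = 0 \<Longrightarrow> f = 0" by (rule \<psi>_ker[OF f])
  qed
qed

lemma card_BS_BP: "finite BS" "finite BP" "card BS + card BP = d1 * d2"
proof -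
  show "finite BS" "finite BP" using fin by simp_all
  have "card BP = card J * (2 * p)" using fin by (simp add: card_cartesian_product)
  moreover have "card BS = (\<Sum>l\<in>I. dS l)" using fin by (simp add: card_SigmaI)
  ultimately show "card BS + card BP = d1 * d2" using count by (simp only: dS_def)
qed

theorem tensor_iso:
  "lmod_iso (Qu n q) (Qu_tensor n q (Qu_S n q (2 * i1) j1) (Qu_S n q (2 * i2) j2))
     (dir_sum2 (dir_sum I (\<lambda>l. Qu_S n q (2 * iS l) (jS l))) (dir_sum J (\<lambda>l. Qu_P n q (2 * iP l) (jP l))))"
proof -
  obtain \<Phi> where c: "coords n q (dir_sum2 (dir_sum I (\<lambda>l. Qu_S n q (2 * iS l) (jS l))) (dir_sum J (\<lambda>l. Qu_P n q (2 * iP l) (jP l))))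
    (BS <+> BP) (dir_sum2_ops OS OP) \<Phi>" using coords_O by (elim exE)
  show ?thesis
  proof (rule iso_by_hom[OF c _ _ lin_\<psi> _ \<psi>_intertwine \<psi>_inj])
    show "finite (BS <+> BP)" "card (BS <+> BP) = d1 * d2" using card_BS_BP by (simp_all add: card_Plus)
    show "\<psi> f \<in> VW" for f unfolding \<psi>_def by (intro funs_on_simps \<psi>S_in \<psi>P_in)
  qed
qed

text \<open>A sum over S alone, not paired with an empty sum; functions on its basis are extended by
  zero so that the injectivity of the full map applies.\<close>

theorem tensor_iso_semisimple:
  assumes J: "J = {}"
  shows "lmod_iso (Qu n q) (Qu_tensor n q (Qu_S n q (2 * i1) j1) (Qu_S n q (2 * i2) j2))
     (dir_sum I (\<lambda>l. Qu_S n q (2 * iS l) (jS l)))"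
proof -
  obtain \<Phi> where c: "coords n q (dir_sum I (\<lambda>l. Qu_S n q (2 * iS l) (jS l))) BS OS \<Phi>" using coords_OS by (elim exE)
  show ?thesis
  proof (rule iso_by_hom[OF c _ _ lin_\<psi>S \<psi>S_in \<psi>S_intertwine])
    show "finite BS" "card BS = d1 * d2" using card_BS_BP J by simp_all
    fix f assume f: "f \<in> funs_on BS" "\<psi>S f = 0"
    have "case_sum f 0 = (0 :: (nat \<times> nat) + (nat \<times> bool \<times> nat) \<Rightarrow> 'k)"
    proof (rule \<psi>_inj)
      show "case_sum f 0 \<in> funs_on (BS <+> BP)"
      proof (rule funs_onI)
        fix a assume a: "a \<notin> BS <+> BP"
        show "case_sum f 0 a = 0"
        proof (cases a)
          case (Inl b)
          with a have "b \<notin> BS" by blast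
          then show ?thesis unfolding Inl sum.case by (rule funs_onD[OF f(1)])
        qed (simp add: zero_fun_apply)
      qed
      show "\<psi> (case_sum f 0) = 0" by (simp add: \<psi>_def f(2) lin_0[OF lin_\<psi>P])
    qed
    then show "f = 0" by (auto simp: fun_eq_iff zero_fun_apply dest: spec[of _ "Inl _"])
  qed
qed

end

section \<open>Arithmetic of the summation ranges\<close>

lemma res2_le: "res2 r \<le> 1"
  unfolding res2_def by linarith

lemma even_res2: "even (res2 r) \<longleftrightarrow> even r"
  unfolding res2_def by (simp add: even_nat_iff)

lemma sum_arith:
  fixes x N :: nat
  shows "(\<Sum>l = 0..N. x + 2 * l) = (N + 1) * (x + N)"
  by (induction N) (simp_all add: algebra_simps)

text \<open>At index c - l the dimensions P + 1 - 2(c - l) form an arithmetic progression of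
  difference 2 starting at P + 1 - 2c.\<close>

lemma sum_dims:
  fixes c N P :: nat
  assumes "N < c" "2 * c \<le> P"
  shows "(\<Sum>l = 0..N. P - (2 * (c - l) - 1)) = (N + 1) * (P + 1 - 2 * c + N)"
  unfolding sum_arith[symmetric] by (intro sum.cong refl) (use assms in auto)

context simple_tensor begin

abbreviation "half \<equiv> n ^ 2 div 2"

text \<open>The hypotheses of \<open>tensor_decomposition\<close> are symmetric in the two factors.
  With a the smaller and b the larger of i1 and i2, the cases of the theorem merge in pairs although
  the factors are never interchanged.\<close>

lemma swap_cases:
  assumes "a = i1 \<and> b = i2 \<or> a = i2 \<and> b = i1"
  shows "a + b = i1 + i2" "(p + 1 - 2 * a) * (p + 1 - 2 * b) = d1 * d2" "1 \<le> a" "1 \<le> b" "a \<le> half" "b \<le> half"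
    "p + 1 - 2 * b \<le> p + 1 - 2 * a \<Longrightarrow> t < p + 1 - 2 * b \<Longrightarrow> t < d1 \<and> t < d2"
proof -
  have d: "d1 = p + 1 - 2 * i1" "d2 = p + 1 - 2 * i2" using i1 i2 by (auto simp: d1_def d2_def)
  show "(p + 1 - 2 * a) * (p + 1 - 2 * b) = d1 * d2" using assms unfolding d by (elim disjE conjE) (simp_all only: mult.commute)
  show "a + b = i1 + i2" "1 \<le> a" "1 \<le> b" "a \<le> half" "b \<le> half" using assms i1 i2 half_even(1) by linarith+
  show "p + 1 - 2 * b \<le> p + 1 - 2 * a \<Longrightarrow> t < p + 1 - 2 * b \<Longrightarrow> t < d1 \<and> t < d2" using assms unfolding d by auto
qed

lemma parity:
  "t + l = 2 * c \<Longrightarrow> even (res2 (int j1 + int j2 + int l) + j1 + j2 + t)"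
  "t + l = 2 * c + 1 \<Longrightarrow> even (res2 (int j1 + int j2 + int l - 1) + j1 + j2 + t)"
  unfolding even_add even_res2 by (simp; presburger)+

text \<open>There is one S for each level t below the smaller dimension p + 1 - 2b, listed from the
  top: t = p - 2b - l. \<open>weight_match\<close> gives it the index a + b + t - p/2 = p/2 + a - b
  - l, and a + b > p/2 keeps this at least 1 down to level 0.\<close>

lemma tensor_semisimple:
  assumes ab: "a = i1 \<and> b = i2 \<or> a = i2 \<and> b = i1" "a \<le> b" and s: "half < a + b"
  shows "lmod_iso (Qu n q) (Qu_tensor n q (Qu_S n q (2 * i1) j1) (Qu_S n q (2 * i2) j2))
    (dir_sum {0..n ^ 2 - 2 * b} (\<lambda>l. Qu_S n q (2 * (half + a - b - l)) (res2 (int j1 + int j2 + int l))))"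
proof -
  note sw = swap_cases[OF ab(1)]
  note hp = half_even(1)
  interpret tensor_decomposition n q i1 j1 i2 j2 "{0..n ^ 2 - 2 * b}" "{}" "\<lambda>l. half + a - b - l"
    "\<lambda>l. res2 (int j1 + int j2 + int l)" "\<lambda>l. n ^ 2 - 2 * b - l" "\<lambda>l. 0" "\<lambda>l. 0" "\<lambda>l. 0"
  proof unfold_locales
    fix l assume l: "l \<in> {0..n ^ 2 - 2 * b}"
    then have l: "l \<le> p - 2 * b" by simp
    show "1 \<le> half + a - b - l" "2 * (half + a - b - l) \<le> p" "half + a - b - l + half = i1 + i2 + (p - 2 * b - l)"
      using l ab(2) s sw(1,3,4,5,6) hp by linarith+
    have "p - 2 * b - l < p + 1 - 2 * b" "p + 1 - 2 * b \<le> p + 1 - 2 * a" using sw(6) hp ab(2) by linarith+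
    then show "p - 2 * b - l < d1" "p - 2 * b - l < d2" using sw(7) by blast+
    have "p - 2 * b - l + l = 2 * (half - b)" using l sw(6) hp by linarith
    then show "even (res2 (int j1 + int j2 + int l) + j1 + j2 + (p - 2 * b - l))" by (rule parity(1))
    show "res2 (int j1 + int j2 + int l) \<le> 1" by (rule res2_le)
  next
    show "inj_on (case_sum (\<lambda>l. p - 2 * b - l) (case_sum (\<lambda>l. 0 - (2 * 0 - 1)) (\<lambda>l. 0))) ({0..p - 2 * b} <+> {} <+> {})"
      by (auto simp: inj_on_def)
    have "(\<Sum>l = 0..p - 2 * b. p - (2 * (half + a - b - l) - 1)) = (p - 2 * b + 1) * (p + 1 - 2 * (half + a - b) + (p - 2 * b))"
      by (rule sum_dims) (use ab(2) s sw(3-6) hp in linarith)+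
    moreover have "p - 2 * b + 1 = p + 1 - 2 * b" "p + 1 - 2 * (half + a - b) + (p - 2 * b) = p + 1 - 2 * a"
      using ab(2) s sw(3-6) hp by linarith+
    ultimately show "(\<Sum>l = 0..p - 2 * b. p - (2 * (half + a - b - l) - 1)) + card ({} :: nat set) * (2 * p) = d1 * d2"
      using sw(2) by (simp only: card.empty mult_0 add_0_right mult.commute)
  qed simp_all
  show ?thesis by (rule tensor_iso_semisimple[OF refl])
qed

text \<open>Put m = p/2 - a - b; level t then has index t - m, which is positive only for t > m. The
  top levels 2m + 2, ..., 2m + 2a give the S. The levels l and 2m + 1 - l with l \<le> m are paired:
  they carry \<alpha> and E^r \<alpha> of the P of index m + 1 - l, as r = 2(m + 1 - l) - 1 is their
  difference.\<close>

lemma tensor_mixed: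
  assumes ab: "a = i1 \<and> b = i2 \<or> a = i2 \<and> b = i1" "a \<le> b" and s: "a + b \<le> half"
  shows "lmod_iso (Qu n q) (Qu_tensor n q (Qu_S n q (2 * i1) j1) (Qu_S n q (2 * i2) j2))
    (dir_sum2 (dir_sum {0..2 * a - 2} (\<lambda>l. Qu_S n q (2 * (half + a - b - l)) (res2 (int j1 + int j2 + int l))))
      (dir_sum {0..half - i1 - i2} (\<lambda>l. Qu_P n q (2 * (half - i1 - i2 + 1 - l)) (res2 (int j1 + int j2 + int l - 1)))))"
proof -
  note sw = swap_cases[OF ab(1)]
  note hp = half_even(1)
  define m where "m = half - i1 - i2"
  have half: "half = m + a + b" using sw(1) s by (simp add: m_def)
  then have p2: "p = 2 * m + 2 * a + 2 * b" using hp by linarith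
  interpret tensor_decomposition n q i1 j1 i2 j2 "{0..2 * a - 2}" "{0..m}" "\<lambda>l. half + a - b - l"
    "\<lambda>l. res2 (int j1 + int j2 + int l)" "\<lambda>l. n ^ 2 - 2 * b - l"
    "\<lambda>l. m + 1 - l" "\<lambda>l. res2 (int j1 + int j2 + int l - 1)" "\<lambda>l. 2 * m + 1 - l"
  proof unfold_locales
    fix l assume "l \<in> {0..2 * a - 2}"
    then have l: "l \<le> 2 * a - 2" by simp
    show "1 \<le> half + a - b - l" "2 * (half + a - b - l) \<le> p" "half + a - b - l + half = i1 + i2 + (p - 2 * b - l)"
      using l ab(2) half sw(1,3,4) p2 by linarith+
    have "p - 2 * b - l < p + 1 - 2 * b" "p + 1 - 2 * b \<le> p + 1 - 2 * a" using p2 ab(2) by linarith+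
    then show "p - 2 * b - l < d1" "p - 2 * b - l < d2" using sw(7) by blast+
    have "p - 2 * b - l + l = 2 * (half - b)" using l p2 half by linarith
    then show "even (res2 (int j1 + int j2 + int l) + j1 + j2 + (p - 2 * b - l))" by (rule parity(1))
    show "res2 (int j1 + int j2 + int l) \<le> 1" by (rule res2_le)
  next
    fix l assume "l \<in> {0..m}"
    then have l: "l \<le> m" by simp
    show "1 \<le> m + 1 - l" "2 * (m + 1 - l) \<le> p" "m + 1 - l + half = i1 + i2 + (2 * m + 1 - l)"
      "2 * (m + 1 - l) - 1 \<le> 2 * m + 1 - l"
      using l half sw(1,3,4) p2 by linarith+
    have "2 * m + 1 - l < p + 1 - 2 * b" "p + 1 - 2 * b \<le> p + 1 - 2 * a" using p2 ab(2) sw(3) by linarith+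
    then show "2 * m + 1 - l < d1" "2 * m + 1 - l < d2" using sw(7) by blast+
    have "2 * m + 1 - l + l = 2 * m + 1" using l by linarith
    then show "even (res2 (int j1 + int j2 + int l - 1) + j1 + j2 + (2 * m + 1 - l))" by (rule parity(2))
    show "res2 (int j1 + int j2 + int l - 1) \<le> 1" by (rule res2_le)
  next
    have p: "p - 2 * b = 2 * m + 2 * a" using p2 by linarith
    show "inj_on (case_sum (\<lambda>l. p - 2 * b - l) (case_sum (\<lambda>l. 2 * m + 1 - l - (2 * (m + 1 - l) - 1)) (\<lambda>l. 2 * m + 1 - l)))
       ({0..2 * a - 2} <+> {0..m} <+> {0..m})"
      unfolding p using sw(3) by (auto simp: inj_on_def)
    have "(\<Sum>l = 0..2 * a - 2. p - (2 * (half + a - b - l) - 1)) = (2 * a - 2 + 1) * (p + 1 - 2 * (half + a - b) + (2 * a - 2))"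
      by (rule sum_dims) (use ab(2) half p2 sw(3,4) in linarith)+
    moreover have "p + 1 - 2 * (half + a - b) + (2 * a - 2) = 2 * b - 1" "2 * a - 2 + 1 = 2 * a - 1"
      using ab(2) half p2 sw(3,4) by linarith+
    \<comment> \<open>With A = 2a - 1 and B = 2b - 1 one has p = A + B + 2m + 2, so the right side
      is (B + 2m + 2)(A + 2m + 2) = A B + (2m + 2) p.\<close>
    moreover have "(2 * a - 1) * (2 * b - 1) + Suc m * (2 * p) = (p + 1 - 2 * a) * (p + 1 - 2 * b)"
    proof -
      obtain a' b' where "a = Suc a'" "b = Suc b'" using sw(3,4) by (cases a; cases b) auto
      then have *: "2 * a - 1 = 2 * a' + 1" "2 * b - 1 = 2 * b' + 1" "p = 2 * m + 2 * a' + 2 * b' + 4"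
        "p + 1 - 2 * a = 2 * m + 2 * b' + 3" "p + 1 - 2 * b = 2 * m + 2 * a' + 3" using p2 by simp_all
      show ?thesis unfolding *(4,5) unfolding *(1,2,3) by (simp add: algebra_simps)
    qed
    ultimately show "(\<Sum>l = 0..2 * a - 2. p - (2 * (half + a - b - l) - 1)) + card {0..m} * (2 * p) = d1 * d2"
      using sw(2) by (simp only: card_atLeastAtMost diff_zero)
  qed simp_all
  show ?thesis using tensor_iso unfolding m_def .
qed

end

theorem theorem4p8:
  fixes q :: "'k :: {alg_closed_field, field_char_0}"
    and n i1 i2 j1 j2 :: nat
  assumes "n > 0" and "4 dvd n"
    and "q ^ (n ^ 2) = 1" and "\<And>d. 0 < d \<Longrightarrow> d < n ^ 2 \<Longrightarrow> q ^ d \<noteq> 1"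
    and "1 \<le> i1" and "i1 \<le> n ^ 2 div 2" and "1 \<le> i2" and "i2 \<le> n ^ 2 div 2"
    and "j1 \<le> 1" and "j2 \<le> 1"
  shows
    "(2 * i1 - 1 \<ge> n ^ 2 - 2 * i2 + 1 \<and> i1 \<le> i2 \<longrightarrow>
        lmod_iso (Qu n q)
          (Qu_tensor n q (Qu_S n q (2 * i1) j1) (Qu_S n q (2 * i2) j2))
          (dir_sum {0..n ^ 2 - 2 * i2}
            (\<lambda>l. Qu_S n q (n ^ 2 + 2 * i1 - 2 * i2 - 2 * l) (res2 (int j1 + int j2 + int l)))))
   \<and> (2 * i1 - 1 \<ge> n ^ 2 - 2 * i2 + 1 \<and> i1 > i2 \<longrightarrow>
        lmod_iso (Qu n q)
          (Qu_tensor n q (Qu_S n q (2 * i1) j1) (Qu_S n q (2 * i2) j2))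
          (dir_sum {0..n ^ 2 - 2 * i1}
            (\<lambda>l. Qu_S n q (n ^ 2 - 2 * i1 + 2 * i2 - 2 * l) (res2 (int j1 + int j2 + int l)))))
   \<and> (2 * i1 - 1 < n ^ 2 - 2 * i2 + 1 \<and> i1 \<le> i2 \<longrightarrow>
        lmod_iso (Qu n q)
          (Qu_tensor n q (Qu_S n q (2 * i1) j1) (Qu_S n q (2 * i2) j2))
          (dir_sum2
            (dir_sum {0..2 * i1 - 2}
              (\<lambda>l. Qu_S n q (n ^ 2 + 2 * i1 - 2 * i2 - 2 * l) (res2 (int j1 + int j2 + int l))))
            (dir_sum {0..n ^ 2 div 2 - i1 - i2}
              (\<lambda>l. Qu_P n q (n ^ 2 - 2 * i1 - 2 * i2 + 2 - 2 * l)
                     (res2 (int j1 + int j2 + int l - 1))))))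
   \<and> (2 * i1 - 1 < n ^ 2 - 2 * i2 + 1 \<and> i1 > i2 \<longrightarrow>
        lmod_iso (Qu n q)
          (Qu_tensor n q (Qu_S n q (2 * i1) j1) (Qu_S n q (2 * i2) j2))
          (dir_sum2
            (dir_sum {0..2 * i2 - 2}
              (\<lambda>l. Qu_S n q (n ^ 2 - 2 * i1 + 2 * i2 - 2 * l) (res2 (int j1 + int j2 + int l))))
            (dir_sum {0..n ^ 2 div 2 - i1 - i2}
              (\<lambda>l. Qu_P n q (n ^ 2 - 2 * i1 - 2 * i2 + 2 - 2 * l)
                     (res2 (int j1 + int j2 + int l - 1))))))"
proof -
  interpret simple_tensor n q i1 j1 i2 j2
    by unfold_locales (use assms in auto)
  note hp = half_even(1)
  have half: "i1 \<le> half" "i2 \<le> half" "1 \<le> i1" "1 \<le> i2" using assms by auto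
  have idx: "n ^ 2 + 2 * i1 - 2 * i2 - 2 * l = 2 * (half + i1 - i2 - l)"
    "n ^ 2 - 2 * i1 + 2 * i2 - 2 * l = 2 * (half + i2 - i1 - l)"
    "n ^ 2 - 2 * i1 - 2 * i2 + 2 - 2 * l = 2 * (half - i1 - i2 + 1 - l)" for l
    using hp half by linarith+
  \<comment> \<open>The first condition of each case says i1 + i2 > p/2 or i1 + i2 \<le> p/2, which
    is the distinction between \<open>tensor_semisimple\<close> and
    \<open>tensor_mixed\<close>.\<close>
  show ?thesis
    unfolding idx
  proof (intro conjI impI; elim conjE)
    assume "2 * i1 - 1 \<ge> n ^ 2 - 2 * i2 + 1" "i1 \<le> i2"
    then show "lmod_iso (Qu n q) (Qu_tensor n q (Qu_S n q (2 * i1) j1) (Qu_S n q (2 * i2) j2))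
        (dir_sum {0..n ^ 2 - 2 * i2} (\<lambda>l. Qu_S n q (2 * (half + i1 - i2 - l)) (res2 (int j1 + int j2 + int l))))"
      using hp half by (intro tensor_semisimple) linarith+
  next
    assume "2 * i1 - 1 \<ge> n ^ 2 - 2 * i2 + 1" "i1 > i2"
    then show "lmod_iso (Qu n q) (Qu_tensor n q (Qu_S n q (2 * i1) j1) (Qu_S n q (2 * i2) j2))
        (dir_sum {0..n ^ 2 - 2 * i1} (\<lambda>l. Qu_S n q (2 * (half + i2 - i1 - l)) (res2 (int j1 + int j2 + int l))))"
      using hp half by (intro tensor_semisimple) linarith+
  next
    assume "2 * i1 - 1 < n ^ 2 - 2 * i2 + 1" "i1 \<le> i2"
    then show "lmod_iso (Qu n q) (Qu_tensor n q (Qu_S n q (2 * i1) j1) (Qu_S n q (2 * i2) j2))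
        (dir_sum2 (dir_sum {0..2 * i1 - 2} (\<lambda>l. Qu_S n q (2 * (half + i1 - i2 - l)) (res2 (int j1 + int j2 + int l))))
          (dir_sum {0..half - i1 - i2} (\<lambda>l. Qu_P n q (2 * (half - i1 - i2 + 1 - l)) (res2 (int j1 + int j2 + int l - 1)))))"
      using hp half by (intro tensor_mixed) linarith+
  next
    assume "2 * i1 - 1 < n ^ 2 - 2 * i2 + 1" "i1 > i2"
    then show "lmod_iso (Qu n q) (Qu_tensor n q (Qu_S n q (2 * i1) j1) (Qu_S n q (2 * i2) j2))
        (dir_sum2 (dir_sum {0..2 * i2 - 2} (\<lambda>l. Qu_S n q (2 * (half + i2 - i1 - l)) (res2 (int j1 + int j2 + int l))))
          (dir_sum {0..half - i1 - i2} (\<lambda>l. Qu_P n q (2 * (half - i1 - i2 + 1 - l)) (res2 (int j1 + int j2 + int l - 1)))))"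
      using hp half by (intro tensor_mixed) linarith+
  qed
qed

end
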